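(* Let $G$ be a totally disconnected, locally compact group and let $\mathcal{H}$ be a group of automorphisms of $G$. Assume that there is $O\in\mathcal{B}(G)$ such that $\mathcal{H}.O$ is proper and coarsely connected. Then the following are equivalent: (1) $\mathcal{H}$ is virtually flat of finite rank; (2) $|\mathcal{H}:\mathcal{H}_{FC_d}|$ is finite.
   Context: Automorphisms are continuous with continuous inverse. $\mathcal{B}(G)$ is the set of compact, open subgroups of $G$ with metric $d(V,W)=\log\bigl(|V:V\cap W|\cdot|W:W\cap V|\bigr)$; automorphisms act isometrically by $\varphi.V=\varphi(V)$, and $\mathcal{H}.O$ carries the induced metric. A metric space is proper if closed bounded subsets are compact; coarsely connected if for some $\delta>0$ any two points can be joined by a finite chain with consecutive distances at most $\delta$. A set $B$ of automorphisms is bounded if $B.V$ has bounded diameter for some (equivalently every) $V\in\mathcal{B}(G)$. $\mathcal{H}_{FC_d}=\{\varphi\in\mathcal{H}:\{\psi\varphi\psi^{-1}:\psi\in\mathcal{H}\}\text{ bounded}\}$. The scale is $s_G(\varphi)=\min\{|\varphi(V):\varphi(V)\cap V|:V\in\mathcal{B}(G)\}$; a group $\mathcal{K}$ of automorphisms is flat if there is $O'\in\mathcal{B}(G)$ with $|\varphi(O'):\varphi(O')\cap O'|=s_G(\varphi)$ for all $\varphi\in\mathcal{K}$. For flat $\mathcal{K}$, $\mathcal{K}(1)=\{\varphi:s_G(\varphi)=1=s_G(\varphi^{-1})\}$ is normal with $\mathcal{K}/\mathcal{K}(1)$ free abelian, whose $\mathbb{Z}$-rank is the rank of $\mathcal{K}$.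 Virtually flat of finite rank means having a finite-index subgroup that is flat of finite rank. *)

theory Defs
  imports "HOL-Analysis.Analysis" "HOL-Algebra.Algebra"
begin

definition topological_group :: "('a, 'b) monoid_scheme \<Rightarrow> 'a topology \<Rightarrow> bool" where
  "topological_group G T \<longleftrightarrow> group G \<and> topspace T = carrier G \<and>
     continuous_map (prod_topology T T) T (\<lambda>(x, y). x \<otimes>\<^bsub>G\<^esub> y) \<and>
     continuous_map T T (\<lambda>x. inv\<^bsub>G\<^esub> x)"

definition totally_disconnected_space :: "'a topology \<Rightarrow> bool" where
  "totally_disconnected_space T \<longleftrightarrow>
     (\<forall>S. connectedin T S \<longrightarrow> S = {} \<or> (\<exists>x. S = {x}))"

definition tdlc_group :: "('a, 'b) monoid_scheme \<Rightarrow> 'a topology \<Rightarrow> bool" where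
  "tdlc_group G T \<longleftrightarrow> topological_group G T \<and> locally_compact_space T \<and>
     totally_disconnected_space T"

definition Aut :: "('a, 'b) monoid_scheme \<Rightarrow> 'a topology \<Rightarrow> ('a \<Rightarrow> 'a) set" where
  "Aut G T = {f. f \<in> extensional (carrier G) \<and> f \<in> hom G G \<and>
                 bij_betw f (carrier G) (carrier G) \<and> homeomorphic_map T T f}"

definition aut_group :: "('a, 'b) monoid_scheme \<Rightarrow> 'a topology \<Rightarrow> ('a \<Rightarrow> 'a) monoid" where
  "aut_group G T = \<lparr>carrier = Aut G T, mult = (\<lambda>f g. compose (carrier G) f g),
                    one = restrict id (carrier G)\<rparr>"

definition cpt_open_subgroups :: "('a, 'b) monoid_scheme \<Rightarrow> 'a topology \<Rightarrow> 'a set set" where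
  "cpt_open_subgroups G T = {V. subgroup V G \<and> compactin T V \<and> openin T V}"

text \<open>Index of U in V, i.e. the number of cosets of U inside V (used with U a subgroup of V).\<close>
definition sub_index :: "('a, 'b) monoid_scheme \<Rightarrow> 'a set \<Rightarrow> 'a set \<Rightarrow> nat" where
  "sub_index G V U = card ((\<lambda>v. U #>\<^bsub>G\<^esub> v) ` V)"

definition cos_dist :: "('a, 'b) monoid_scheme \<Rightarrow> 'a set \<Rightarrow> 'a set \<Rightarrow> real" where
  "cos_dist G V W = ln (real (sub_index G V (V \<inter> W) * sub_index G W (W \<inter> V)))"

definition orbit_sp :: "('a \<Rightarrow> 'a) set \<Rightarrow> 'a set \<Rightarrow> 'a set set" where
  "orbit_sp H V = (\<lambda>\<phi>. \<phi> ` V) ` H"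

definition proper_metric :: "'m set \<Rightarrow> ('m \<Rightarrow> 'm \<Rightarrow> real) \<Rightarrow> bool" where
  "proper_metric M dm \<longleftrightarrow>
     (\<forall>A. closedin (Metric_space.mtopology M dm) A \<and> Metric_space.mbounded M dm A
          \<longrightarrow> compactin (Metric_space.mtopology M dm) A)"

definition coarsely_connected :: "'m set \<Rightarrow> ('m \<Rightarrow> 'm \<Rightarrow> real) \<Rightarrow> bool" where
  "coarsely_connected M dm \<longleftrightarrow>
     (\<exists>eps>0. \<forall>x\<in>M. \<forall>y\<in>M. \<exists>xs. xs \<noteq> [] \<and> hd xs = x \<and> last xs = y \<and> set xs \<subseteq> M \<and>
        (\<forall>i. Suc i < length xs \<longrightarrow> dm (xs ! i) (xs ! Suc i) \<le> eps))"

definition bounded_auts :: "('a, 'b) monoid_scheme \<Rightarrow> 'a topology \<Rightarrow> ('a \<Rightarrow> 'a) set \<Rightarrow> bool" where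
  "bounded_auts G T B \<longleftrightarrow>
     (\<exists>V\<in>cpt_open_subgroups G T. \<exists>C. \<forall>\<phi>\<in>B. \<forall>\<psi>\<in>B.
        cos_dist G (\<phi> ` V) (\<psi> ` V) \<le> C)"

definition FCd :: "('a, 'b) monoid_scheme \<Rightarrow> 'a topology \<Rightarrow> ('a \<Rightarrow> 'a) set \<Rightarrow> ('a \<Rightarrow> 'a) set" where
  "FCd G T H = {\<phi>\<in>H. bounded_auts G T
      ((\<lambda>\<psi>. \<psi> \<otimes>\<^bsub>aut_group G T\<^esub> \<phi> \<otimes>\<^bsub>aut_group G T\<^esub> inv\<^bsub>aut_group G T\<^esub> \<psi>) ` H)}"

definition scale :: "('a, 'b) monoid_scheme \<Rightarrow> 'a topology \<Rightarrow> ('a \<Rightarrow> 'a) \<Rightarrow> nat" where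
  "scale G T \<phi> = (LEAST n. \<exists>V\<in>cpt_open_subgroups G T.
       n = sub_index G (\<phi> ` V) (\<phi> ` V \<inter> V))"

definition flat :: "('a, 'b) monoid_scheme \<Rightarrow> 'a topology \<Rightarrow> ('a \<Rightarrow> 'a) set \<Rightarrow> bool" where
  "flat G T K \<longleftrightarrow> subgroup K (aut_group G T) \<and>
     (\<exists>O'\<in>cpt_open_subgroups G T. \<forall>\<phi>\<in>K.
        sub_index G (\<phi> ` O') (\<phi> ` O' \<inter> O') = scale G T \<phi>)"

definition K_one :: "('a, 'b) monoid_scheme \<Rightarrow> 'a topology \<Rightarrow> ('a \<Rightarrow> 'a) set \<Rightarrow> ('a \<Rightarrow> 'a) set" where
  "K_one G T K = {\<phi>\<in>K. scale G T \<phi> = 1 \<and> scale G T (inv\<^bsub>aut_group G T\<^esub> \<phi>) = 1}"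

definition flat_finite_rank :: "('a, 'b) monoid_scheme \<Rightarrow> 'a topology \<Rightarrow> ('a \<Rightarrow> 'a) set \<Rightarrow> bool" where
  "flat_finite_rank G T K \<longleftrightarrow> flat G T K \<and>
     (\<exists>S::nat set. finite S \<and>
        ((aut_group G T)\<lparr>carrier := K\<rparr> Mod K_one G T K) \<cong> free_Abelian_group S)"

definition virtually_flat_finite_rank ::
  "('a, 'b) monoid_scheme \<Rightarrow> 'a topology \<Rightarrow> ('a \<Rightarrow> 'a) set \<Rightarrow> bool" where
  "virtually_flat_finite_rank G T H \<longleftrightarrow>
     (\<exists>K. K \<subseteq> H \<and> subgroup K (aut_group G T) \<and>
          finite (rcosets\<^bsub>(aut_group G T)\<lparr>carrier := H\<rparr>\<^esub> K) \<and> flat_finite_rank G T K)"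

end

theory Submission
  imports Defs "HOL-Library.Function_Algebras"
begin

text \<open>For a flat group the subgroup on which the scale is trivial is the stabiliser of a common minimiser
  \<open>O'\<close>; since the quotient is abelian, conjugating \<open>\<phi>\<close> inside the flat group does not change
  \<open>\<phi>(O')\<close>, and finite index costs only a bounded error.

  Conversely, elements of \<open>\<H>\<^sub>F\<^sub>C\<^sub>d\<close> displace the orbit of \<open>O\<close> by a bounded amount. A collecting process in
  the spirit of Dietzmann's lemma shows that commutators have bounded powers, and then that commutators with finitely
  many generators generate a group with finite orbit. So \<open>\<H>\<^sub>F\<^sub>C\<^sub>d\<close> is finitely generated abelian modulo a
  subgroup \<open>R\<close> with finite orbit, and its elements commute on the \<open>R\<close>-invariant compact open subgroups.
  There Willis' tidying procedure can be carried out for finitely many automorphisms simultaneously. The scale is then a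
  function on \<open>\<int>\<^sup>n\<close> that is multiplicative up to positive integer factors; it is a maximum of finitely many
  characters, and Dickson's lemma yields finitely many vectors into which every vector splits multiplicatively. A
  subgroup minimising for these finitely many automorphisms minimises for all.\<close>

section \<open>Indices\<close>

text \<open>Two constraints shape the converse. A subgroup is made minimising for finitely many
  automorphisms at a time, and being minimising for two of them bounds the index of their product
  only by the product of the scales; hence vectors have to split with exact equality of scales.
  Moreover elements of H_FCd commute only modulo R, but exactly in their action on R-invariant
  subgroups, so every construction (intersections of translates, cores, products with nubs) has to
  stay in that family. Tidying for a new automorphism must not spoil the earlier ones. What is added
  to a subgroup in order to suppress returning orbits is therefore chosen independently of the
  subgroup: the nub. It is invariant under all the commuting automorphisms, and nubs normalise one
  another, so that one subgroup can absorb several of them. Minimality is carried along as exact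
  exponential growth of |f^k(V) : f^k(V) \<inter> V| in k, which presupposes no knowledge of the
  scale and passes to intersections and to commuting images. Distinct points of an orbit have
  distance at least ln 2, so properness amounts to finiteness of balls.\<close>

definition idx :: "('a, 'b) monoid_scheme \<Rightarrow> 'a set \<Rightarrow> 'a set \<Rightarrow> nat" where
  "idx G A B = card ((\<lambda>a. B #>\<^bsub>G\<^esub> a) ` A)"

definition finite_index :: "('a, 'b) monoid_scheme \<Rightarrow> 'a set \<Rightarrow> 'a set \<Rightarrow> bool" where
  "finite_index G A B \<longleftrightarrow> finite ((\<lambda>a. B #>\<^bsub>G\<^esub> a) ` A)"

lemma image_cong_ker:
  assumes "\<And>a b. a \<in> A \<Longrightarrow> b \<in> A \<Longrightarrow> f a = f b \<longleftrightarrow> g a = g b"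
  shows "card (f ` A) = card (g ` A)" "finite (f ` A) \<longleftrightarrow> finite (g ` A)"
proof -
  have b: "bij_betw (\<lambda>K. g (SOME a. a \<in> A \<and> f a = K)) (f ` A) (g ` A)"
  proof -
    have e: "g (SOME b. b \<in> A \<and> f b = f a) = g a" if "a \<in> A" for a
    proof -
      have "(SOME b. b \<in> A \<and> f b = f a) \<in> A \<and> f (SOME b. b \<in> A \<and> f b = f a) = f a"
        by (rule someI[of _ a]) (use that in auto)
      then show ?thesis using assms that by metis
    qed
    have e2: "f (SOME b. b \<in> A \<and> g b = g a) = f a" if "a \<in> A" for a
    proof -
      have "(SOME b. b \<in> A \<and> g b = g a) \<in> A \<and> g (SOME b. b \<in> A \<and> g b = g a) = g a"
        by (rule someI[of _ a]) (use that in auto)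
      then show ?thesis using assms that by metis
    qed
    show ?thesis
      by (rule bij_betw_byWitness[where f' = "\<lambda>L. f (SOME a. a \<in> A \<and> g a = L)"])
        (auto simp: e e2)
  qed
  show "card (f ` A) = card (g ` A)" using b by (rule bij_betw_same_card)
  show "finite (f ` A) \<longleftrightarrow> finite (g ` A)" using b by (rule bij_betw_finite)
qed

context group
begin

lemma rcos_eq_iff:
  assumes "subgroup B G" "a \<in> carrier G" "b \<in> carrier G"
  shows "B #> a = B #> b \<longleftrightarrow> a \<otimes> inv b \<in> B"
proof
  assume "B #> a = B #> b"
  then have "a \<in> B #> b" using rcos_self[OF assms(2,1)] by simp
  then show "a \<otimes> inv b \<in> B"
    using assms subgroup.mem_carrier[OF assms(1)] by (auto simp: r_coset_def m_assoc)
next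
  assume "a \<otimes> inv b \<in> B"
  then have "a \<in> B #> b"
    using assms by (auto simp: r_coset_def intro!: bexI[of _ "a \<otimes> inv b"] simp: m_assoc)
  then show "B #> a = B #> b" using repr_independence[OF _ assms(3,1)] by simp
qed

text \<open>Two elements of A lie in one coset of \<open>A \<inter> B\<close> iff they lie in one
  coset of B. Counting the B-cosets met by A removes intersections from all index estimates and lets
  A be any subset.\<close>

lemma sub_index_Int:
  assumes "subgroup A G" "subgroup B G"
  shows "sub_index G A (A \<inter> B) = idx G A B"
proof -
  have AB: "subgroup (A \<inter> B) G" using assms subgroups_Inter_pair by blast
  have c: "a \<in> A \<Longrightarrow> a \<in> carrier G" for a using assms by (meson subgroup.mem_carrier)
  have "(A \<inter> B) #> a = (A \<inter> B) #> b \<longleftrightarrow> B #> a = B #> b" if "a \<in> A" "b \<in> A" for a b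
    using that c assms AB by (simp add: rcos_eq_iff subgroup.m_closed subgroup.m_inv_closed)
  then show ?thesis unfolding sub_index_def idx_def by (rule image_cong_ker(1))
qed

lemma finite_index_mono: "A \<subseteq> A' \<Longrightarrow> finite_index G A' B \<Longrightarrow> finite_index G A B"
  unfolding finite_index_def by (meson finite_subset image_mono)

lemma idx_mono: "A \<subseteq> A' \<Longrightarrow> finite_index G A' B \<Longrightarrow> idx G A B \<le> idx G A' B"
  unfolding finite_index_def idx_def by (meson card_mono image_mono)

lemma idx_pos: "finite_index G A B \<Longrightarrow> A \<noteq> {} \<Longrightarrow> idx G A B > 0"
  unfolding finite_index_def idx_def by (simp add: card_gt_0_iff)

text \<open>A finite count that does not drop from A' to A means that A meets every coset met by A'.
  This is how stabilisation of an index becomes a factorisation of elements.\<close>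

lemma idx_eq_cover:
  assumes "A \<subseteq> A'" "finite_index G A' B" "idx G A' B \<le> idx G A B" "x \<in> A'" "subgroup B G" "A' \<subseteq> carrier G"
  shows "\<exists>a\<in>A. x \<otimes> inv a \<in> B"
proof -
  have "(\<lambda>a. B #> a) ` A = (\<lambda>a. B #> a) ` A'"
    using assms unfolding finite_index_def idx_def by (intro card_seteq) auto
  then obtain a where "a \<in> A" "B #> x = B #> a" using assms(4) by (metis imageE imageI)
  then show ?thesis using assms rcos_eq_iff by (metis subsetD)
qed

text \<open>Choosing representatives r of the B-cosets parametrises the C-cosets met by A by pairs
  of a B-coset and a C-coset met by B. Surjectivity alone gives the triangle inequality; for nested
  subgroups the parametrisation is also injective and the index multiplicative.\<close>

lemma idx_repr:
  assumes "subgroup B G" "subgroup C G" "A \<subseteq> carrier G"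
  obtains r where "\<And>a. a \<in> A \<Longrightarrow> r (B #> a) \<in> A \<and> B #> r (B #> a) = B #> a"
    "(\<lambda>a. C #> a) ` A \<subseteq> (\<lambda>(K, L). L #> r K) ` ((\<lambda>a. B #> a) ` A \<times> (\<lambda>a. C #> a) ` B)"
proof -
  define r where "r K = (SOME a. a \<in> A \<and> B #> a = K)" for K
  have r: "r (B #> a) \<in> A \<and> B #> r (B #> a) = B #> a" if "a \<in> A" for a
    unfolding r_def using that by (rule_tac someI[of _ a]) auto
  have "C #> a \<in> (\<lambda>(K, L). L #> r K) ` ((\<lambda>a. B #> a) ` A \<times> (\<lambda>a. C #> a) ` B)" if "a \<in> A" for a
  proof -
    let ?r = "r (B #> a)"
    have c: "?r \<in> carrier G" "a \<in> carrier G" using r[OF that] that assms by auto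
    have "a \<otimes> inv ?r \<in> B" using r[OF that] rcos_eq_iff assms c by metis
    moreover have "C #> a = (C #> (a \<otimes> inv ?r)) #> ?r"
      using c assms by (simp add: coset_mult_assoc subgroup.subset m_assoc)
    ultimately show ?thesis using that by force
  qed
  then show ?thesis using r by (intro that[of r]) auto
qed

lemma idx_triangle:
  assumes "subgroup B G" "subgroup C G" "A \<subseteq> carrier G" "finite_index G A B" "finite_index G B C"
  shows "idx G A C \<le> idx G A B * idx G B C"
proof -
  obtain r where "(\<lambda>a. C #> a) ` A \<subseteq> (\<lambda>(K, L). L #> r K) ` ((\<lambda>a. B #> a) ` A \<times> (\<lambda>a. C #> a) ` B)"
    using idx_repr[OF assms(1-3)] by metis
  moreover have f: "finite ((\<lambda>a. B #> a) ` A \<times> (\<lambda>a. C #> a) ` B)"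
    using assms(4,5) unfolding finite_index_def by auto
  ultimately have "card ((\<lambda>a. C #> a) ` A) \<le> card ((\<lambda>a. B #> a) ` A \<times> (\<lambda>a. C #> a) ` B)"
    by (meson card_image_le card_mono finite_imageI le_trans)
  then show ?thesis unfolding idx_def by (simp add: card_cartesian_product)
qed

lemma idx_mult:
  assumes "subgroup A G" "subgroup B G" "subgroup C G" "C \<subseteq> B" "B \<subseteq> A"
  shows "idx G A C = idx G A B * idx G B C"
proof -
  have A: "A \<subseteq> carrier G" using assms subgroup.subset by blast
  obtain r where r: "\<And>a. a \<in> A \<Longrightarrow> r (B #> a) \<in> A \<and> B #> r (B #> a) = B #> a"
    and sub: "(\<lambda>a. C #> a) ` A \<subseteq> (\<lambda>(K, L). L #> r K) ` ((\<lambda>a. B #> a) ` A \<times> (\<lambda>a. C #> a) ` B)"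
    using idx_repr[OF assms(2,3) A] by metis
  have "bij_betw (\<lambda>(K, L). L #> r K) ((\<lambda>a. B #> a) ` A \<times> (\<lambda>a. C #> a) ` B) ((\<lambda>a. C #> a) ` A)"
    unfolding bij_betw_def
  proof
    show "inj_on (\<lambda>(K, L). L #> r K) ((\<lambda>a. B #> a) ` A \<times> (\<lambda>a. C #> a) ` B)"
    proof (clarsimp simp: inj_on_def)
      fix a a' b b' assume h: "a \<in> A" "b \<in> B" "a' \<in> A" "b' \<in> B"
        and eq: "C #> b #> r (B #> a) = C #> b' #> r (B #> a')"
      let ?r = "r (B #> a)" and ?r' = "r (B #> a')"
      have c: "a \<in> carrier G" "a' \<in> carrier G" "b \<in> carrier G" "b' \<in> carrier G"
        "?r \<in> carrier G" "?r' \<in> carrier G"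
        using h r A assms subgroup.mem_carrier by blast+
      have "C #> (b \<otimes> ?r) = C #> (b' \<otimes> ?r')"
        using eq c assms by (simp add: coset_mult_assoc subgroup.subset)
      then have m: "(b \<otimes> ?r) \<otimes> inv (b' \<otimes> ?r') \<in> C" using c rcos_eq_iff[OF assms(3)] by simp
      then have mB: "(b \<otimes> ?r) \<otimes> inv (b' \<otimes> ?r') \<in> B" using assms by auto
      then have "B #> (b \<otimes> ?r) = B #> (b' \<otimes> ?r')" using c rcos_eq_iff[OF assms(2)] by simp
      then have "B #> ?r = B #> ?r'"
        using h c assms by (simp add: coset_mult_assoc[symmetric] subgroup.subset subgroup.rcos_const coset_join2)
      then have e: "B #> a = B #> a'" using r h by simp
      then have "(b \<otimes> ?r) \<otimes> inv (b' \<otimes> ?r') = b \<otimes> inv b'"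
        using c by (simp add: inv_mult_group m_assoc) (metis c(6) inv_closed m_assoc r_inv l_one)
      then have "C #> b = C #> b'" using m rcos_eq_iff[OF assms(3)] c by simp
      with e show "B #> a = B #> a' \<and> C #> b = C #> b'" by simp
    qed
    show "(\<lambda>(K, L). L #> r K) ` ((\<lambda>a. B #> a) ` A \<times> (\<lambda>a. C #> a) ` B) = (\<lambda>a. C #> a) ` A"
    proof
      show "(\<lambda>(K, L). L #> r K) ` ((\<lambda>a. B #> a) ` A \<times> (\<lambda>a. C #> a) ` B) \<subseteq> (\<lambda>a. C #> a) ` A"
      proof clarsimp
        fix a b assume h: "a \<in> A" "b \<in> B"
        have "b \<otimes> r (B #> a) \<in> A" using h r assms by (meson subgroup.m_closed subsetD)
        moreover have "C #> b #> r (B #> a) = C #> (b \<otimes> r (B #> a))"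
          using h r[OF h(1)] A assms by (meson coset_mult_assoc subgroup.subset subsetD)
        ultimately show "C #> b #> r (B #> a) \<in> (#>) C ` A" by blast
      qed
    qed (rule sub)
  qed
  then have "card ((\<lambda>a. C #> a) ` A) = card ((\<lambda>a. B #> a) ` A \<times> (\<lambda>a. C #> a) ` B)"
    by (metis bij_betw_same_card)
  then show ?thesis unfolding idx_def by (simp add: card_cartesian_product)
qed

lemma idx_Int:
  assumes "subgroup A G" "subgroup B G"
  shows "idx G A (A \<inter> B) = idx G A B"
proof -
  have "A \<inter> (A \<inter> B) = A \<inter> B" by auto
  then show ?thesis
    using sub_index_Int[OF assms] unfolding sub_index_def idx_def by metis
qed

lemma finite_index_Int:
  assumes "subgroup A G" "subgroup B G"
  shows "finite_index G A (A \<inter> B) \<longleftrightarrow> finite_index G A B"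
proof -
  have AB: "subgroup (A \<inter> B) G" using assms subgroups_Inter_pair by blast
  have c: "a \<in> A \<Longrightarrow> a \<in> carrier G" for a using assms by (meson subgroup.mem_carrier)
  have "(A \<inter> B) #> a = (A \<inter> B) #> b \<longleftrightarrow> B #> a = B #> b" if "a \<in> A" "b \<in> A" for a b
    using that c assms AB by (simp add: rcos_eq_iff subgroup.m_closed subgroup.m_inv_closed)
  then show ?thesis unfolding finite_index_def by (rule image_cong_ker(2))
qed

lemma idx_refl: "subgroup A G \<Longrightarrow> A' \<subseteq> A \<Longrightarrow> A' \<noteq> {} \<Longrightarrow> idx G A' A = 1"
proof -
  assume h: "subgroup A G" "A' \<subseteq> A" "A' \<noteq> {}"
  then have "(\<lambda>a. A #> a) ` A' = {A}"
    by (auto simp: coset_join2 subgroup.mem_carrier subset_iff image_iff)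
  then show ?thesis unfolding idx_def by simp
qed

lemma idx_eq_1:
  assumes "subgroup A G" "subgroup B G" "idx G A B = 1"
  shows "A \<subseteq> B"
proof
  fix x assume x: "x \<in> A"
  have "\<one> \<in> A" using assms subgroup.one_closed by blast
  obtain K where "(\<lambda>a. B #> a) ` A = {K}" using assms(3) unfolding idx_def by (auto simp: card_1_singleton_iff)
  then have "B #> x = B #> \<one>" using x \<open>\<one> \<in> A\<close> by (metis imageI singletonD)
  then show "x \<in> B" using rcos_eq_iff[OF assms(2)] x assms by (metis inv_one one_closed r_one subgroup.mem_carrier)
qed

lemma idx_image:
  assumes "subgroup B G" "A \<subseteq> carrier G" "f \<in> hom G G" "inj_on f (carrier G)"
  shows "idx G (f ` A) (f ` B) = idx G A B" "finite_index G (f ` A) (f ` B) = finite_index G A B"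
proof -
  have B: "B \<subseteq> carrier G" using assms subgroup.subset by blast
  have e: "f ` B #> f a = f ` (B #> a)" if "a \<in> A" for a
    using that assms(2) B assms(3) by (auto simp: r_coset_def hom_mult subset_iff image_iff)
  have "(\<lambda>a. f ` B #> a) ` f ` A = (\<lambda>K. f ` K) ` (\<lambda>a. B #> a) ` A"
    using e by (auto simp: image_image)
  moreover have "inj_on (\<lambda>K. f ` K) ((\<lambda>a. B #> a) ` A)"
  proof (rule inj_onI)
    fix K L assume "K \<in> (\<lambda>a. B #> a) ` A" "L \<in> (\<lambda>a. B #> a) ` A" "f ` K = f ` L"
    moreover then have "K \<subseteq> carrier G" "L \<subseteq> carrier G" using assms(2) B r_coset_subset_G by blast+
    ultimately show "K = L" using assms(4) by (meson inj_on_image_eq_iff)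
  qed
  ultimately show "idx G (f ` A) (f ` B) = idx G A B" "finite_index G (f ` A) (f ` B) = finite_index G A B"
    unfolding idx_def finite_index_def by (auto simp: card_image finite_image_iff)
qed

lemma idx_finite_subset_eq:
  assumes "subgroup A G" "subgroup B G" "subgroup C G" "C \<subseteq> B" "B \<subseteq> A" "finite_index G A C" "idx G A C \<le> idx G A B"
  shows "B = C"
proof -
  have "idx G A C = idx G A B * idx G B C" using idx_mult assms by metis
  moreover have "idx G A C > 0" using assms idx_pos subgroup.one_closed by blast
  ultimately have "idx G B C = 1" using assms(7)
    by (metis One_nat_def le_antisym less_nat_zero_code mult_eq_0_iff mult_le_mono2 nat_mult_1_right nat_neq_iff not_less_eq_eq One_nat_def Suc_leI mult.commute nat_mult_le_cancel1 zero_less_iff_neq_zero)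
  then show ?thesis using idx_eq_1 assms by blast
qed

end

section \<open>Compact open subgroups\<close>

locale topgroup = group G for G (structure) +
  fixes T :: "'a topology"
  assumes tg: "topological_group G T"
begin

abbreviation \<B> :: "'a set set" where "\<B> \<equiv> cpt_open_subgroups G T"

lemma topspace_eq [simp]: "topspace T = carrier G"
  using tg by (simp add: topological_group_def)

lemma closed_carrier [simp]: "closedin T (carrier G)"
  using closedin_topspace[of T] by simp

lemma cont_mult: "continuous_map (prod_topology T T) T (\<lambda>(x, y). x \<otimes> y)"
  and cont_inv: "continuous_map T T (\<lambda>x. inv x)"
  using tg by (auto simp: topological_group_def)

lemma cont_mult2:
  assumes "continuous_map S T f" "continuous_map S T g"
  shows "continuous_map S T (\<lambda>x. f x \<otimes> g x)"
proof -
  have "continuous_map S T ((\<lambda>(x, y). x \<otimes> y) \<circ> (\<lambda>x. (f x, g x)))"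
    by (rule continuous_map_compose[OF _ cont_mult]) (use assms in \<open>auto simp: continuous_map_pairwise o_def\<close>)
  then show ?thesis by (simp add: o_def)
qed

lemma cont_const: "a \<in> carrier G \<Longrightarrow> continuous_map S T (\<lambda>x. a)"
  by (simp add: continuous_map_const)

lemma cont_left: "a \<in> carrier G \<Longrightarrow> continuous_map T T (\<lambda>x. a \<otimes> x)"
  by (rule cont_mult2) (auto intro: cont_const simp: continuous_map_id[unfolded id_def])

lemma cont_right: "a \<in> carrier G \<Longrightarrow> continuous_map T T (\<lambda>x. x \<otimes> a)"
  by (rule cont_mult2) (auto intro: cont_const simp: continuous_map_id[unfolded id_def])

lemma cont_conj: "a \<in> carrier G \<Longrightarrow> continuous_map T T (\<lambda>x. a \<otimes> x \<otimes> inv a)"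
  by (rule cont_mult2) (auto intro: cont_const cont_left)

lemma openin_left: "openin T U \<Longrightarrow> a \<in> carrier G \<Longrightarrow> openin T {x \<in> carrier G. a \<otimes> x \<in> U}"
  using openin_continuous_map_preimage[OF cont_left] by simp

lemma openin_right: "openin T U \<Longrightarrow> a \<in> carrier G \<Longrightarrow> openin T {x \<in> carrier G. x \<otimes> a \<in> U}"
  using openin_continuous_map_preimage[OF cont_right] by simp

lemma B_dest:
  assumes "V \<in> \<B>"
  shows "subgroup V G" "compactin T V" "openin T V" "V \<subseteq> carrier G" "\<one> \<in> V"
  using assms by (auto simp: cpt_open_subgroups_def subgroup.subset subgroup.one_closed dest: subgroup.mem_carrier)

lemma open_subgroup_closed:
  assumes "subgroup V G" "openin T V"
  shows "closedin T V"
proof -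
  have V: "V \<subseteq> carrier G" using assms subgroup.subset by blast
  have 1: "carrier G - V \<subseteq> (\<Union>a\<in>carrier G - V. {x \<in> carrier G. x \<otimes> inv a \<in> V})"
  proof
    fix x assume "x \<in> carrier G - V"
    moreover have "x \<otimes> inv x \<in> V" if "x \<in> carrier G"
      using that subgroup.one_closed[OF assms(1)] by simp
    ultimately show "x \<in> (\<Union>a\<in>carrier G - V. {x \<in> carrier G. x \<otimes> inv a \<in> V})"
      by (intro UN_I[of x]) simp_all
  qed
  have "x \<notin> V" if a: "a \<in> carrier G - V" "x \<in> carrier G" "x \<otimes> inv a \<in> V" for a x
  proof
    assume "x \<in> V"
    then have "inv (x \<otimes> inv a) \<otimes> x \<in> V" using a assms subgroup.m_closed subgroup.m_inv_closed by metis
    moreover have "inv (x \<otimes> inv a) \<otimes> x = a" using a by (simp add: inv_mult_group m_assoc)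
    ultimately show False using a by simp
  qed
  then have "(\<Union>a\<in>carrier G - V. {x \<in> carrier G. x \<otimes> inv a \<in> V}) \<subseteq> carrier G - V"
    by (intro UN_least subsetI) simp
  with 1 have "carrier G - V = (\<Union>a\<in>carrier G - V. {x \<in> carrier G. x \<otimes> inv a \<in> V})"
    by (rule subset_antisym)
  moreover have "openin T (\<Union>a\<in>carrier G - V. {x \<in> carrier G. x \<otimes> inv a \<in> V})"
    using openin_right[OF assms(2)] by blast
  ultimately show ?thesis using V by (simp add: closedin_def)
qed

lemma B_closed: "V \<in> \<B> \<Longrightarrow> closedin T V"
  using open_subgroup_closed B_dest by blast

lemma compact_cover_right:
  assumes "compactin T K" "subgroup V G" "openin T V"
  obtains F where "finite F" "F \<subseteq> K" "\<And>x. x \<in> K \<Longrightarrow> \<exists>a\<in>F. x \<otimes> inv a \<in> V"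
proof -
  have K: "K \<subseteq> carrier G" using compactin_subset_topspace[OF assms(1)] by simp
  let ?U = "(\<lambda>a. {x \<in> carrier G. x \<otimes> inv a \<in> V}) ` K"
  have "\<forall>U\<in>?U. openin T U" using openin_right[OF assms(3)] K by auto
  moreover have "K \<subseteq> \<Union>?U"
  proof
    fix x assume "x \<in> K"
    then have "x \<in> {y \<in> carrier G. y \<otimes> inv x \<in> V}"
      using K subgroup.one_closed[OF assms(2)] by auto
    then show "x \<in> \<Union>?U" using \<open>x \<in> K\<close> by blast
  qed
  ultimately obtain \<F> where "finite \<F>" "\<F> \<subseteq> ?U" "K \<subseteq> \<Union>\<F>"
    using assms(1) unfolding compactin_def by meson
  then obtain F where F: "finite F" "F \<subseteq> K" "\<F> = (\<lambda>a. {x \<in> carrier G. x \<otimes> inv a \<in> V}) ` F"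
    by (meson finite_subset_image)
  show ?thesis
    by (rule that[of F]) (use F \<open>K \<subseteq> \<Union>\<F>\<close> in auto)
qed

lemma compact_finite_index:
  assumes "compactin T K" "subgroup V G" "openin T V"
  shows "finite_index G K V"
proof -
  obtain F where F: "finite F" "F \<subseteq> K" "\<And>x. x \<in> K \<Longrightarrow> \<exists>a\<in>F. x \<otimes> inv a \<in> V"
    using compact_cover_right[OF assms] by metis
  have K: "K \<subseteq> carrier G" using compactin_subset_topspace[OF assms(1)] by simp
  have "(\<lambda>a. V #> a) ` K \<subseteq> (\<lambda>a. V #> a) ` F"
    using F K rcos_eq_iff[OF assms(2)] by (auto simp: image_iff) (meson subsetD)
  then show ?thesis unfolding finite_index_def by (rule finite_subset) (simp add: F)
qed

lemma B_finite_index: "V \<in> \<B> \<Longrightarrow> W \<in> \<B> \<Longrightarrow> finite_index G V W"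
  using compact_finite_index B_dest by blast

lemma compact_inv:
  assumes "compactin T K"
  shows "compactin T ((\<lambda>x. inv x) ` K)"
  using assms cont_inv image_compactin by blast

lemma compact_cover_left:
  assumes "compactin T K" "subgroup V G" "openin T V"
  obtains F where "finite F" "F \<subseteq> K" "\<And>x. x \<in> K \<Longrightarrow> \<exists>a\<in>F. inv a \<otimes> x \<in> V"
proof -
  have K: "K \<subseteq> carrier G" using compactin_subset_topspace[OF assms(1)] by simp
  obtain F where F: "finite F" "F \<subseteq> (\<lambda>x. inv x) ` K" "\<And>x. x \<in> (\<lambda>x. inv x) ` K \<Longrightarrow> \<exists>a\<in>F. x \<otimes> inv a \<in> V"
    using compact_cover_right[OF compact_inv[OF assms(1)] assms(2,3)] by metis
  show ?thesis
  proof (rule that[of "(\<lambda>x. inv x) ` F"])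
    show "(\<lambda>x. inv x) ` F \<subseteq> K" using F(2) K by (force simp: subset_iff)
    fix x assume x: "x \<in> K"
    then obtain a where a: "a \<in> F" "inv x \<otimes> inv a \<in> V" using F(3) by blast
    have c: "a \<in> carrier G" "x \<in> carrier G" using F(2) K a x by auto
    have "inv (inv x \<otimes> inv a) \<in> V" by (rule subgroup.m_inv_closed[OF assms(2) a(2)])
    then have "inv (inv a) \<otimes> x \<in> V" using c by (simp add: inv_mult_group)
    then show "\<exists>a\<in>(\<lambda>x. inv x) ` F. inv a \<otimes> x \<in> V" using a by blast
  qed (use F in auto)
qed

lemma B_Int:
  assumes "V \<in> \<B>" "W \<in> \<B>"
  shows "V \<inter> W \<in> \<B>"
proof -
  have "compactin T (V \<inter> W)" using compact_Int_closedin[OF B_dest(2) B_closed] assms by blast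
  then show ?thesis using B_dest[OF assms(1)] B_dest[OF assms(2)] subgroups_Inter_pair[of V W]
    by (simp add: cpt_open_subgroups_def openin_Int)
qed

lemma compact_nest:
  assumes K: "compactin T K" and C: "\<And>n::nat. closedin T (C n)" "\<And>n. K \<inter> C n \<noteq> {}"
    and d: "\<And>n. C (Suc n) \<subseteq> C n"
  shows "K \<inter> (\<Inter>n. C n) \<noteq> {}"
proof -
  have dec: "m \<le> n \<Longrightarrow> C n \<subseteq> C m" for m n using lift_Suc_antimono_le[of C m n, OF d] by simp
  have "K \<inter> \<Inter>\<F> \<noteq> {}" if "finite \<F>" "\<F> \<subseteq> range C" for \<F>
  proof -
    obtain I where I: "finite I" "\<F> = C ` I" using \<open>finite \<F>\<close> \<open>\<F> \<subseteq> range C\<close> by (meson finite_subset_image)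
    obtain n where n: "\<forall>i\<in>I. i \<le> n" using I finite_nat_set_iff_bounded_le by auto
    have "C n \<subseteq> \<Inter>\<F>" using I n dec by blast
    then show ?thesis using C(2)[of n] by blast
  qed
  then show ?thesis using K C(1) unfolding compactin_fip by (metis (no_types, lifting) image_iff)
qed

lemma compact_directed:
  assumes K: "compactin T K" and C: "\<And>C. C \<in> \<C> \<Longrightarrow> closedin T C" "\<And>C. C \<in> \<C> \<Longrightarrow> K \<inter> C \<noteq> {}"
    and d: "\<And>C D. C \<in> \<C> \<Longrightarrow> D \<in> \<C> \<Longrightarrow> \<exists>E\<in>\<C>. E \<subseteq> C \<inter> D" and ne: "\<C> \<noteq> {}"
  shows "K \<inter> \<Inter>\<C> \<noteq> {}"
proof -
  have "\<exists>E\<in>\<C>. E \<subseteq> \<Inter>\<F>" if "finite \<F>" "\<F> \<subseteq> \<C>" for \<F> using that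
  proof induction
    case empty then show ?case using ne by auto
  next
    case (insert C \<F>)
    then obtain E where "E \<in> \<C>" "E \<subseteq> \<Inter>\<F>" by auto
    moreover then obtain E' where "E' \<in> \<C>" "E' \<subseteq> C \<inter> E" using d insert by (metis insert_subset)
    ultimately show ?case by (metis Inter_insert Int_subset_iff dual_order.trans)
  qed
  then have "K \<inter> \<Inter>\<F> \<noteq> {}" if "finite \<F>" "\<F> \<subseteq> \<C>" for \<F> using that C(2) by fastforce
  then show ?thesis using K C(1) unfolding compactin_fip by metis
qed

lemma closure_subgroup:
  assumes "subgroup S G"
  shows "subgroup (T closure_of S) G"
proof -
  have S: "S \<subseteq> carrier G" using assms subgroup.subset by blast
  have sub: "S \<subseteq> T closure_of S" using S closure_of_subset[of S T] by simp
  have clo: "T closure_of S \<subseteq> carrier G" using closure_of_subset_topspace[of T S] by simp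
  have inv: "(\<lambda>x. inv x) ` (T closure_of S) \<subseteq> T closure_of S"
  proof -
    have "(\<lambda>x. inv x) ` S \<subseteq> S" using subgroup.m_inv_closed[OF assms] by auto
    from subset_trans[OF continuous_map_image_closure_subset[OF cont_inv] closure_of_mono[OF this]]
    show ?thesis .
  qed
  have mul: "(\<lambda>(x, y). x \<otimes> y) ` ((T closure_of S) \<times> (T closure_of S)) \<subseteq> T closure_of S"
  proof -
    have "(\<lambda>(x, y). x \<otimes> y) ` (S \<times> S) \<subseteq> S" using subgroup.m_closed[OF assms] by auto
    from subset_trans[OF continuous_map_image_closure_subset[OF cont_mult] closure_of_mono[OF this]]
    show ?thesis unfolding closure_of_Times .
  qed
  show ?thesis
  proof (rule subgroupI)
    show "T closure_of S \<noteq> {}" using sub subgroup.one_closed[OF assms] by auto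
    show "T closure_of S \<subseteq> carrier G" by (rule clo)
    show "inv a \<in> T closure_of S" if "a \<in> T closure_of S" for a using inv that by (simp add: image_subset_iff)
    show "a \<otimes> b \<in> T closure_of S" if "a \<in> T closure_of S" "b \<in> T closure_of S" for a b
      using mul that by (simp add: image_subset_iff)
  qed
qed

lemma hom_image_subgroup: "subgroup V G \<Longrightarrow> f \<in> hom G G \<Longrightarrow> subgroup (f ` V) G"
  by (rule group_hom.subgroup_img_is_subgroup[of G G])
     (simp_all add: group_hom_def group_hom_axioms_def is_group)

lemma B_image:
  assumes "V \<in> \<B>" "f \<in> hom G G" "homeomorphic_map T T f"
  shows "f ` V \<in> \<B>"
proof -
  have "openin T (f ` V)" using homeomorphic_imp_open_map[OF assms(3)] B_dest(3)[OF assms(1)] by (simp add: open_map_def)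
  moreover have "compactin T (f ` V)"
    by (rule image_compactin[OF B_dest(2)[OF assms(1)] homeomorphic_imp_continuous_map[OF assms(3)]])
  ultimately show ?thesis
    using hom_image_subgroup[OF B_dest(1)[OF assms(1)] assms(2)] by (simp add: cpt_open_subgroups_def)
qed

lemma conj_homeo: 
  assumes "a \<in> carrier G"
  shows "homeomorphic_map T T (\<lambda>x. a \<otimes> x \<otimes> inv a)"
proof -
  have "inv a \<otimes> (a \<otimes> x \<otimes> inv a) \<otimes> a = x" "a \<otimes> (inv a \<otimes> x \<otimes> a) \<otimes> inv a = x"
    if "x \<in> carrier G" for x
  proof -
    have "inv a \<otimes> (a \<otimes> x \<otimes> inv a) \<otimes> a = (inv a \<otimes> a) \<otimes> x \<otimes> (inv a \<otimes> a)"
      using assms that by (simp only: m_assoc m_closed inv_closed)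
    then show "inv a \<otimes> (a \<otimes> x \<otimes> inv a) \<otimes> a = x" using assms that by simp
    have "a \<otimes> (inv a \<otimes> x \<otimes> a) \<otimes> inv a = (a \<otimes> inv a) \<otimes> x \<otimes> (a \<otimes> inv a)"
      using assms that by (simp only: m_assoc m_closed inv_closed)
    then show "a \<otimes> (inv a \<otimes> x \<otimes> a) \<otimes> inv a = x" using assms that by simp
  qed
  then have "homeomorphic_maps T T (\<lambda>x. a \<otimes> x \<otimes> inv a) (\<lambda>x. inv a \<otimes> x \<otimes> inv (inv a))"
    unfolding homeomorphic_maps_def
    using cont_conj[OF assms] cont_conj[of "inv a"] assms by simp
  then show ?thesis using homeomorphic_maps_imp_map by blast
qed

lemma conj_hom:
  assumes "a \<in> carrier G"
  shows "(\<lambda>x. a \<otimes> x \<otimes> inv a) \<in> hom G G"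
proof (rule homI)
  fix x y assume "x \<in> carrier G" "y \<in> carrier G"
  moreover have "(a \<otimes> x \<otimes> inv a) \<otimes> (a \<otimes> y \<otimes> inv a) = a \<otimes> x \<otimes> (inv a \<otimes> a) \<otimes> y \<otimes> inv a"
    using calculation assms by (simp only: m_assoc m_closed inv_closed)
  ultimately show "a \<otimes> (x \<otimes> y) \<otimes> inv a = a \<otimes> x \<otimes> inv a \<otimes> (a \<otimes> y \<otimes> inv a)"
    using assms by (simp add: m_assoc)
qed (use assms in simp)

lemma B_conj: "V \<in> \<B> \<Longrightarrow> a \<in> carrier G \<Longrightarrow> (\<lambda>x. a \<otimes> x \<otimes> inv a) ` V \<in> \<B>"
  using B_image conj_homeo conj_hom by blast

lemma compact_mult:
  assumes "compactin T K" "compactin T L"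
  shows "compactin T (K <#> L)"
proof -
  have "compactin (prod_topology T T) (K \<times> L)" using assms by (simp add: compactin_Times)
  then have "compactin T ((\<lambda>(x, y). x \<otimes> y) ` (K \<times> L))" using image_compactin cont_mult by blast
  moreover have "(\<lambda>(x, y). x \<otimes> y) ` (K \<times> L) = K <#> L" by (auto simp: set_mult_def)
  ultimately show ?thesis by simp
qed

lemma open_mult_right:
  assumes "openin T U" "K \<subseteq> carrier G"
  shows "openin T (K <#> U)"
proof -
  have "U \<subseteq> carrier G" using openin_subset[OF assms(1)] by simp
  have "K <#> U = (\<Union>a\<in>K. {x \<in> carrier G. inv a \<otimes> x \<in> U})"
  proof (intro subset_antisym subsetI)
    fix x assume "x \<in> K <#> U"
    then obtain a u where "a \<in> K" "u \<in> U" "x = a \<otimes> u" by (auto simp: set_mult_def)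
    moreover then have "a \<in> carrier G" "u \<in> carrier G" using assms(2) \<open>U \<subseteq> carrier G\<close> by auto
    ultimately show "x \<in> (\<Union>a\<in>K. {x \<in> carrier G. inv a \<otimes> x \<in> U})"
      by (intro UN_I[of a]) (simp_all add: m_assoc[symmetric])
  next
    fix x assume "x \<in> (\<Union>a\<in>K. {x \<in> carrier G. inv a \<otimes> x \<in> U})"
    then obtain a where a: "a \<in> K" "x \<in> carrier G" "inv a \<otimes> x \<in> U" by (elim UN_E) simp
    then have "x = a \<otimes> (inv a \<otimes> x)" using assms(2) by (simp add: m_assoc[symmetric] subset_iff)
    then show "x \<in> K <#> U" unfolding set_mult_def using a by blast
  qed
  moreover have "openin T (\<Union>a\<in>K. {x \<in> carrier G. inv a \<otimes> x \<in> U})"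
    using openin_left[OF assms(1)] assms(2) by (intro openin_Union) (auto simp: subset_iff)
  ultimately show ?thesis by simp
qed

end

section \<open>Subgroups minimising for one automorphism\<close>

text \<open>\<open>f i\<close> stands for the \<open>i\<close>-th power of a fixed automorphism.\<close>

locale flow = topgroup +
  fixes f :: "int \<Rightarrow> 'a \<Rightarrow> 'a"
  assumes f_hom: "f i \<in> hom G G"
    and f_0 [simp]: "x \<in> carrier G \<Longrightarrow> f 0 x = x"
    and f_add: "x \<in> carrier G \<Longrightarrow> f (i + j) x = f i (f j x)"
    and f_cont: "continuous_map T T (f i)"
begin

lemma f_closed [simp]: "x \<in> carrier G \<Longrightarrow> f i x \<in> carrier G"
  using hom_in_carrier[OF f_hom] .

lemma f_mult: "x \<in> carrier G \<Longrightarrow> y \<in> carrier G \<Longrightarrow> f i (x \<otimes> y) = f i x \<otimes> f i y"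
  using hom_mult[OF f_hom] .

lemma f_inv: "x \<in> carrier G \<Longrightarrow> f i (inv x) = inv (f i x)"
  by (metis f_hom group.is_group group_hom.hom_inv group_hom.intro group_hom_axioms.intro is_group)

lemma f_one [simp]: "f i \<one> = \<one>"
  by (metis f_hom group_hom.hom_one group_hom.intro group_hom_axioms.intro is_group)

lemma f_f: "x \<in> carrier G \<Longrightarrow> f i (f j x) = f (i + j) x"
  by (simp add: f_add)

lemma f_minus [simp]: "x \<in> carrier G \<Longrightarrow> f i (f (- i) x) = x" "x \<in> carrier G \<Longrightarrow> f (- i) (f i x) = x"
  by (simp_all add: f_f)

lemma f_inj: "inj_on (f i) (carrier G)"
  by (rule inj_onI) (metis f_minus(2))

lemma f_homeo: "homeomorphic_map T T (f i)"
proof -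
  have "homeomorphic_maps T T (f i) (f (- i))"
    unfolding homeomorphic_maps_def using f_cont by simp
  then show ?thesis using homeomorphic_maps_imp_map by blast
qed

lemma f_B: "V \<in> \<B> \<Longrightarrow> f i ` V \<in> \<B>"
  using B_image f_hom f_homeo by blast

lemma f_image_iff:
  assumes "V \<subseteq> carrier G" "x \<in> carrier G"
  shows "x \<in> f i ` V \<longleftrightarrow> f (- i) x \<in> V"
proof
  assume "x \<in> f i ` V"
  then obtain v where "v \<in> V" "x = f i v" by auto
  then show "f (- i) x \<in> V" using assms(1) by (simp add: subset_iff)
next
  assume "f (- i) x \<in> V"
  then show "x \<in> f i ` V" using assms(2) by (intro image_eqI[of _ _ "f (- i) x"]) simp_all
qed

text \<open>Time reversal: statements about the past are obtained from those about the
  future.\<close>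

lemma reverse: "flow G T (\<lambda>i. f (- i))"
  by unfold_locales (simp_all add: f_hom f_cont f_f)

text \<open>The intersection of the preimages of V under the \<open>f i\<close>. In Willis' notation
  \<open>stay V {0..}\<close> is V_-, \<open>stay V {..0}\<close> is V_+, and
  \<open>stay V UNIV\<close> is their intersection V_0.\<close>

definition stay :: "'a set \<Rightarrow> int set \<Rightarrow> 'a set" where
  "stay V I = {x \<in> carrier G. \<forall>i\<in>I. f i x \<in> V}"

lemma stay_carrier: "stay V I \<subseteq> carrier G"
  by (auto simp: stay_def)

lemma stay_D: "x \<in> stay V I \<Longrightarrow> i \<in> I \<Longrightarrow> f i x \<in> V"
  by (simp add: stay_def)

lemma stay_0D: "x \<in> stay V I \<Longrightarrow> 0 \<in> I \<Longrightarrow> x \<in> V"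
  by (auto simp: stay_def)

lemma stay_cD: "x \<in> stay V I \<Longrightarrow> x \<in> carrier G"
  by (simp add: stay_def)

lemma stay_subgroup:
  assumes V: "subgroup V G"
  shows "subgroup (stay V I) G"
proof (rule subgroupI)
  show "stay V I \<subseteq> carrier G" by (rule stay_carrier)
  have "\<one> \<in> stay V I" by (simp add: stay_def subgroup.one_closed[OF V])
  then show "stay V I \<noteq> {}" by blast
  show "inv a \<in> stay V I" if "a \<in> stay V I" for a
    using that by (simp add: stay_def f_inv subgroup.m_inv_closed[OF V])
  show "a \<otimes> b \<in> stay V I" if "a \<in> stay V I" "b \<in> stay V I" for a b
    using that by (simp add: stay_def f_mult subgroup.m_closed[OF V])
qed

lemma stay_closed:
  assumes "closedin T V"
  shows "closedin T (stay V I)"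
proof (cases "I = {}")
  case True
  then have "stay V I = carrier G" by (simp add: stay_def)
  then show ?thesis by simp
next
  case False
  then have "stay V I = (\<Inter>i\<in>I. {x \<in> topspace T. f i x \<in> V})"
    by (auto simp: stay_def)
  moreover have "closedin T (\<Inter>i\<in>I. {x \<in> topspace T. f i x \<in> V})"
    using False closedin_continuous_map_preimage[OF f_cont assms] by (intro closedin_Inter) auto
  ultimately show ?thesis by simp
qed

lemma stay_mono: "J \<subseteq> I \<Longrightarrow> stay V I \<subseteq> stay V J"
  by (auto simp: stay_def)

lemma stay_sub: "0 \<in> I \<Longrightarrow> stay V I \<subseteq> V"
  by (auto simp: stay_def)

lemma stay_compact:
  assumes "compactin T V" "closedin T V" "i \<in> I"
  shows "compactin T (stay V I)"
proof -
  have V: "V \<subseteq> carrier G" using compactin_subset_topspace[OF assms(1)] by simp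
  have "stay V I \<subseteq> f (- i) ` V"
  proof
    fix x assume "x \<in> stay V I"
    then have "f i x \<in> V" "x \<in> carrier G" using assms by (auto simp: stay_def)
    then show "x \<in> f (- i) ` V" by (metis f_minus(2) imageI)
  qed
  then show ?thesis
    using closed_compactin[OF image_compactin[OF assms(1) f_cont] _ stay_closed[OF assms(2)]] by blast
qed

lemma f_CsD: "x \<in> stay V I \<Longrightarrow> (\<And>i. i \<in> J \<Longrightarrow> i + j \<in> I) \<Longrightarrow> f j x \<in> stay V J"
  by (auto simp: stay_def f_f)

lemma f_image_stay: "V \<subseteq> carrier G \<Longrightarrow> f i ` V = stay V {- i}"
  by (auto simp: stay_def f_image_iff dest: subsetD)

lemma B_stay: 
  assumes "V \<in> \<B>" "finite I" "I \<noteq> {}"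
  shows "stay V I \<in> \<B>"
  using assms(2,3)
proof (induction rule: finite_ne_induct)
  case (singleton i)
  have "stay V {i} = f (- i) ` V" using f_image_stay[OF B_dest(4)[OF assms(1)], of "- i"] by simp
  then show ?case using f_B assms by simp
next
  case (insert i I)
  have "stay V (insert i I) = f (- i) ` V \<inter> stay V I"
    using f_image_stay[OF B_dest(4)[OF assms(1)], of "- i"] by (auto simp: stay_def)
  then show ?case using f_B assms insert B_Int by simp
qed

text \<open>Willis' tidiness above. The second half of tidiness is expressed by the absence of orbits that leave
  and return, which together with the first characterises the minimising subgroups.\<close>

definition tidy_above :: "'a set \<Rightarrow> bool" where
  "tidy_above V \<longleftrightarrow> (\<forall>x\<in>V. \<exists>a\<in>stay V {0..}. \<exists>b\<in>stay V {..0}. x = a \<otimes> b)"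

definition no_return :: "'a set \<Rightarrow> bool" where
  "no_return V \<longleftrightarrow> (\<forall>x\<in>V. \<forall>d\<ge>0. f d x \<in> V \<longrightarrow> (\<forall>i\<in>{0..d}. f i x \<in> V))"

text \<open>The one-step splitting is applied at time k to \<open>f (int k) a\<close>, allowing a
  past of length m + k. Pulled back to time 0, its second factor stays in V throughout
  \<open>{- m..int k}\<close>: it can be divided out of a and absorbed into b, and what is left of a
  survives one step longer.\<close>

lemma tidy_above_finite:
  assumes V: "subgroup V G"
    and step: "\<And>m x. 0 \<le> m \<Longrightarrow> x \<in> V \<Longrightarrow> \<exists>a\<in>stay V {0, 1}. \<exists>b\<in>stay V {- m..0}. x = a \<otimes> b"
    and "0 \<le> m" "x \<in> V"
  shows "\<exists>a\<in>stay V {0..int k}. \<exists>b\<in>stay V {- m..0}. x = a \<otimes> b"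
proof (induction k)
  case 0
  have "x \<in> carrier G" using V assms subgroup.mem_carrier by metis
  moreover have "\<one> \<in> stay V {- m..0}" using V by (simp add: stay_def subgroup.one_closed)
  ultimately show ?case using assms by (intro bexI[of _ x] bexI[of _ \<one>]) (auto simp: stay_def)
next
  case (Suc k)
  then obtain a b where ab: "a \<in> stay V {0..int k}" "b \<in> stay V {- m..0}" "x = a \<otimes> b" by blast
  have "f (int k) a \<in> V" using ab by (auto simp: stay_def)
  then obtain a' b' where ab': "a' \<in> stay V {0, 1}" "b' \<in> stay V {- (m + int k)..0}" "f (int k) a = a' \<otimes> b'"
    using step[of "m + int k"] assms by fastforce
  have c: "a \<in> carrier G" "b \<in> carrier G" "a' \<in> carrier G" "b' \<in> carrier G"
    using ab ab' by (auto simp: stay_def)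
  define a2 b2 where "a2 = f (- int k) a'" "b2 = f (- int k) b'"
  have a: "a = a2 \<otimes> b2"
    using ab'(3) c unfolding a2_b2_def by (metis f_minus(2) f_mult)
  have cc: "a2 \<in> carrier G" "b2 \<in> carrier G" using c a2_b2_def by auto
  have b2: "b2 \<in> stay V {- m..int k}" unfolding a2_b2_def by (rule f_CsD[OF ab'(2)]) auto
  have "b2 \<in> stay V {0..int k}" using b2 assms stay_mono[of "{0..int k}" "{- m..int k}"] by auto
  then have "a \<otimes> inv b2 \<in> stay V {0..int k}"
    by (intro subgroup.m_closed[OF stay_subgroup[OF V] ab(1)] subgroup.m_inv_closed[OF stay_subgroup[OF V]])
  moreover have "a \<otimes> inv b2 = a2" using a cc by (simp add: m_assoc)
  ultimately have a2: "a2 \<in> stay V {0..int k}" by simp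
  have "f (int (Suc k)) a2 = f 1 a'" unfolding a2_b2_def using c by (simp add: f_f)
  then have "f (int (Suc k)) a2 \<in> V" using ab' by (auto simp: stay_def)
  then have "a2 \<in> stay V {0..int (Suc k)}"
    using a2 by (auto simp: stay_def) (smt (verit) atLeastAtMost_iff)
  moreover have "b2 \<in> stay V {- m..0}" using b2 stay_mono[of "{- m..0}" "{- m..int k}"] by auto
  then have "b2 \<otimes> b \<in> stay V {- m..0}" by (rule subgroup.m_closed[OF stay_subgroup[OF V] _ ab(2)])
  moreover have "x = a2 \<otimes> (b2 \<otimes> b)" using ab a cc c by (simp add: m_assoc)
  ultimately show ?case by blast
qed

text \<open>The hypothesis is one step of the splitting, seen at time 1. Iteration gives splittings
  on every finite window, and compactness of V selects a first factor that serves all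
  windows.\<close>

lemma tidy_above_I:
  assumes V: "subgroup V G" "compactin T V" "closedin T V"
    and step: "\<And>m x. 1 \<le> m \<Longrightarrow> x \<in> stay V {- 1} \<Longrightarrow> \<exists>b\<in>stay V {- m..- 1}. x \<otimes> inv b \<in> V"
  shows "tidy_above V"
  unfolding tidy_above_def
proof
  fix x assume x: "x \<in> V"
  have VG: "V \<subseteq> carrier G" by (rule subgroup.subset[OF V(1)])
  have step': "\<exists>a\<in>stay V {0, 1}. \<exists>b\<in>stay V {- m..0}. y = a \<otimes> b" if my: "0 \<le> m" "y \<in> V" for m y
  proof -
    have y: "y \<in> carrier G" by (rule subsetD[OF VG that(2)])
    have fy: "f 1 y \<in> stay V {- 1}" using that y by (simp add: stay_def f_f)
    \<comment> \<open>Length m + 1, since pulling b back by one step turns the window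
      \<open>{- (m + 1)..- 1}\<close> into \<open>{- m..0}\<close>.\<close>
    obtain b where b: "b \<in> stay V {- (m + 1)..- 1}" "f 1 y \<otimes> inv b \<in> V"
      using step[OF _ fy, of "m + 1"] my by auto
    have bc: "b \<in> carrier G" using b by (simp add: stay_def)
    define b' where "b' = f (- 1) b"
    have b': "b' \<in> stay V {- m..0}" unfolding b'_def by (rule f_CsD[OF b(1)]) auto
    have b'c: "b' \<in> carrier G" using b' by (simp add: stay_def)
    have "b' \<in> V" using stay_0D[OF b'] my by simp
    then have "y \<otimes> inv b' \<in> V"
      by (intro subgroup.m_closed[OF V(1) my(2)] subgroup.m_inv_closed[OF V(1)])
    moreover have "f 1 (y \<otimes> inv b') = f 1 y \<otimes> inv b"
      unfolding b'_def using y bc by (simp add: f_mult f_inv f_f)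
    ultimately have "y \<otimes> inv b' \<in> stay V {0, 1}" using b y b'c by (simp add: stay_def)
    moreover have "y = (y \<otimes> inv b') \<otimes> b'" using y b'c by (simp add: m_assoc)
    ultimately show ?thesis using b' by blast
  qed
  \<comment> \<open>The admissible first factors for the window of length k: closed, decreasing in
    k, and met by V.\<close>
  let ?C = "\<lambda>k::nat. stay V {0..int k} \<inter> {a \<in> carrier G. inv a \<otimes> x \<in> stay V {- int k..0}}"
  have xc: "x \<in> carrier G" by (rule subsetD[OF VG x])
  have "V \<inter> (\<Inter>k. ?C k) \<noteq> {}"
  proof (rule compact_nest[OF V(2)])
    fix k
    have "continuous_map T T (\<lambda>a. inv a \<otimes> x)"
      using cont_mult2[OF cont_inv cont_const[OF xc]] by simp
    then have "closedin T {a \<in> topspace T. inv a \<otimes> x \<in> stay V {- int k..0}}"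
      by (rule closedin_continuous_map_preimage) (rule stay_closed[OF V(3)])
    then show "closedin T (?C k)" using stay_closed[OF V(3)] by (simp add: closedin_Int)
    obtain a b where ab: "a \<in> stay V {0..int k}" "b \<in> stay V {- int k..0}" "x = a \<otimes> b"
      using tidy_above_finite[OF V(1) step', of "int k" x k] x by auto
    have "a \<in> carrier G" "b \<in> carrier G" using ab by (auto simp: stay_def)
    then have "inv a \<otimes> x = b" using ab by (simp add: m_assoc[symmetric])
    moreover have "a \<in> V" using stay_0D[OF ab(1)] by simp
    ultimately show "V \<inter> ?C k \<noteq> {}" using ab \<open>a \<in> carrier G\<close> by blast
    show "?C (Suc k) \<subseteq> ?C k" by (auto simp: stay_def)
  qed
  then obtain a where a: "a \<in> carrier G" "\<And>k::nat. a \<in> stay V {0..int k}" "\<And>k::nat. inv a \<otimes> x \<in> stay V {- int k..0}"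
    by auto
  have "f i a \<in> V" if "0 \<le> i" for i
    using a(2)[of "nat i"] that by (simp add: stay_def)
  then have "a \<in> stay V {0..}" using a(1) by (simp add: stay_def)
  moreover have "f i (inv a \<otimes> x) \<in> V" if "i \<le> 0" for i
    using a(3)[of "nat (- i)"] that by (simp add: stay_def)
  then have "inv a \<otimes> x \<in> stay V {..0}" using a(1) xc by (simp add: stay_def)
  moreover have "x = a \<otimes> (inv a \<otimes> x)" using a xc by (simp add: m_assoc[symmetric])
  ultimately show "\<exists>a\<in>stay V {0..}. \<exists>b\<in>stay V {..0}. x = a \<otimes> b" by blast
qed

end

section \<open>Tidiness above and the growth of indices\<close>

lemma (in topgroup) B_idx_refl: "V \<in> \<B> \<Longrightarrow> idx G V V = 1"
  by (rule idx_refl[OF B_dest(1) subset_refl]) (use B_dest(5) in blast)+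

context flow
begin

lemma f_0_image: "V \<subseteq> carrier G \<Longrightarrow> f 0 ` V = V"
  by (auto simp: subset_iff image_iff)

lemma f_stay_image: "f i ` stay V I = stay V ((\<lambda>j. j - i) ` I)"
proof (intro subset_antisym subsetI)
  fix x assume "x \<in> f i ` stay V I"
  then obtain y where y: "y \<in> stay V I" "x = f i y" by blast
  show "x \<in> stay V ((\<lambda>j. j - i) ` I)" unfolding y(2) by (rule f_CsD[OF y(1)]) auto
next
  fix x assume x: "x \<in> stay V ((\<lambda>j. j - i) ` I)"
  have "f (- i) x \<in> stay V I" by (rule f_CsD[OF x]) auto
  then show "x \<in> f i ` stay V I" using stay_cD[OF x] by (intro image_eqI[of _ _ "f (- i) x"]) simp_all
qed

lemma idx_shift:
  assumes "subgroup V G"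
  shows "idx G (stay V ((\<lambda>j. j - i) ` I)) (stay V ((\<lambda>j. j - i) ` J)) = idx G (stay V I) (stay V J)"
  using idx_image(1)[OF stay_subgroup[OF assms] stay_carrier f_hom f_inj] by (simp add: f_stay_image)

lemma stay_split0: "V \<subseteq> carrier G \<Longrightarrow> stay V (insert 0 I) = stay V I \<inter> V"
  by (auto simp: stay_def)

text \<open>A longer window shrinks \<open>stay V {- int (Suc m)..- 1}\<close>, so the number of
  V-cosets it meets does not increase and attains its minimum at n0. From there on, an element for a
  short window has, modulo V, a representative for any longer one.\<close>

lemma tidy_above_exists:
  assumes V: "subgroup V G" "compactin T V" "closedin T V" "finite_index G (stay V {- 1}) V"
  shows "\<exists>n0. \<forall>n\<ge>n0. tidy_above (stay V {- int n..0})"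
proof -
  define c where "c m = idx G (stay V {- int (Suc m)..- 1}) V" for m
  obtain n0 where n0: "\<And>m. c n0 \<le> c m" using ex_has_least_nat[of "\<lambda>_. True" _ c] by auto
  have "tidy_above (stay V {- int n..0})" if n: "n \<ge> n0" for n
  proof (rule tidy_above_I)
    let ?U = "stay V {- int n..0}"
    show "subgroup ?U G" by (rule stay_subgroup[OF V(1)])
    show "compactin T ?U" by (rule stay_compact[OF V(2,3), of 0]) simp
    show "closedin T ?U" by (rule stay_closed[OF V(3)])
    fix m x assume m: "1 \<le> (m::int)" and x: "x \<in> stay ?U {- 1}"
    let ?A' = "stay V {- int (Suc n)..- 1}" and ?A = "stay V {- int (Suc (n + nat m))..- 1}"
    have "f 0 (f (- 1) x) \<in> ?U" and xc: "x \<in> carrier G" using x by (auto simp: stay_def)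
    then have x': "x \<in> ?A'"
      using f_CsD[of "f (- 1) x" V "{- int n..0}" "{- int (Suc n)..- 1}" 1] by (auto simp: f_f)
    have sub: "?A \<subseteq> ?A'" by (rule stay_mono) auto
    have "idx G ?A' V \<le> idx G (stay V {- int (Suc n0)..- 1}) V"
      by (rule idx_mono) (use n in \<open>auto intro!: stay_mono finite_index_mono[OF _ V(4)]\<close>)
    also have "\<dots> \<le> idx G ?A V" using n0[of "n + nat m"] by (simp add: c_def)
    finally have le: "idx G ?A' V \<le> idx G ?A V" .
    have fin: "finite_index G ?A' V" by (rule finite_index_mono[OF _ V(4)]) (rule stay_mono, auto)
    obtain b where b: "b \<in> ?A" "x \<otimes> inv b \<in> V"
      using idx_eq_cover[OF sub fin le x' V(1) stay_carrier] by blast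
    note sg = stay_subgroup[OF V(1)]
    have "x \<otimes> inv b \<in> ?A'"
      by (intro subgroup.m_closed[OF sg x'] subgroup.m_inv_closed[OF sg] subsetD[OF sub b(1)])
    then have "x \<otimes> inv b \<in> stay V {- int n..- 1}" by (rule subsetD[OF stay_mono, rotated]) auto
    moreover have "{- int n..0} = insert 0 {- int n..- 1}" by auto
    ultimately have "x \<otimes> inv b \<in> ?U"
      using stay_split0[OF subgroup.subset[OF V(1)], of "{- int n..- 1}"] b(2) by simp
    moreover have "b \<in> stay ?U {- m..- 1}"
    proof -
      have "f i b \<in> ?U" if "i \<in> {- m..- 1}" for i
        by (rule f_CsD[OF b(1)]) (use that m in auto)
      then show ?thesis using stay_cD[OF b(1)] by (simp add: stay_def)
    qed
    ultimately show "\<exists>b\<in>stay ?U {- m..- 1}. x \<otimes> inv b \<in> ?U" by blast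
  qed
  then show ?thesis by blast
qed

text \<open>Moeller's criterion for tidiness: equality in the bound \<open>idx_power_le\<close>.
  Unlike minimality it mentions no other subgroup, and it passes to images under commuting
  automorphisms.\<close>

definition straight :: "'a set \<Rightarrow> bool" where
  "straight V \<longleftrightarrow> (\<forall>k::nat. idx G (f (int k) ` V) V = idx G (f 1 ` V) V ^ k)"

text \<open>Index tower through \<open>stay V {- int (Suc k)..- 1}\<close>. The upper index is the
  previous one shifted by \<open>f 1\<close>; the lower one is a count of V-cosets, because
  inserting time 0 means intersecting with V.\<close>

lemma product_step:
  assumes "V \<in> \<B>"
  shows "idx G (stay V {- int (Suc k)}) (stay V {- int (Suc k)..0})
    = idx G (stay V {- int k}) (stay V {- int k..0}) * idx G (stay V {- int (Suc k)..- 1}) V"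
proof -
  let ?A = "stay V {- int (Suc k)}" and ?D = "stay V {- int (Suc k)..- 1}" and ?E = "stay V {- int (Suc k)..0}"
  note V = B_dest[OF assms]
  have sg: "subgroup ?A G" "subgroup ?D G" "subgroup ?E G" using stay_subgroup[OF V(1)] by auto
  have "idx G ?A ?E = idx G ?A ?D * idx G ?D ?E"
    by (rule idx_mult[OF sg]) (auto intro!: stay_mono)
  moreover have "?E = ?D \<inter> V"
  proof -
    have "{- int (Suc k)..0} = insert 0 {- int (Suc k)..- 1}" by auto
    then show ?thesis using stay_split0[OF V(4)] by metis
  qed
  moreover have "idx G ?D (?D \<inter> V) = idx G ?D V" by (rule idx_Int[OF sg(2) V(1)])
  moreover have "idx G ?A ?D = idx G (stay V {- int k}) (stay V {- int k..0})"
  proof -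
    have "(\<lambda>j. j - 1) ` {- int k} = {- int (Suc k)}" by auto
    moreover have "(\<lambda>j. j - 1) ` {- int k..0} = {- int (Suc k)..- 1}"
      by (auto simp: image_iff intro!: bexI[of _ "_ + 1"])
    ultimately show ?thesis using idx_shift[OF V(1), of 1 "{- int k}" "{- int k..0}"] by metis
  qed
  ultimately show ?thesis by simp
qed

text \<open>If \<open>f (- 1) x = a \<otimes> b\<close> with a staying forward and b backward, then
  \<open>f 1 a \<in> V\<close>, so \<open>f 1 b\<close> represents the V-coset of x, and its whole
  past is in V. Lengthening the window thus loses no coset.\<close>

lemma tidy_above_idx:
  assumes V: "V \<in> \<B>" "tidy_above V" and m: "m \<ge> 1"
  shows "idx G (stay V {- m..- 1}) V = idx G (f 1 ` V) V"
proof -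
  note B = B_dest[OF V(1)]
  have eq: "f 1 ` V = stay V {- 1}" using f_image_stay[OF B(4), of 1] by simp
  have "(\<lambda>a. V #> a) ` stay V {- m..- 1} = (\<lambda>a. V #> a) ` stay V {- 1}"
  proof
    show "(#>) V ` stay V {- m..- 1} \<subseteq> (#>) V ` stay V {- 1}"
      by (rule image_mono, rule stay_mono) (use m in auto)
    show "(#>) V ` stay V {- 1} \<subseteq> (#>) V ` stay V {- m..- 1}"
    proof
      fix K assume "K \<in> (#>) V ` stay V {- 1}"
      then obtain x where x: "x \<in> stay V {- 1}" "K = V #> x" by blast
      have xc: "x \<in> carrier G" "f (- 1) x \<in> V" using x by (auto simp: stay_def)
      obtain a b where ab: "a \<in> stay V {0..}" "b \<in> stay V {..0}" "f (- 1) x = a \<otimes> b"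
        using V(2) xc unfolding tidy_above_def by blast
      have c: "a \<in> carrier G" "b \<in> carrier G" using ab by (auto simp: stay_def)
      have "x = f 1 (a \<otimes> b)" using ab(3) xc(1) by (metis f_minus(1))
      then have e: "x = f 1 a \<otimes> f 1 b" using c by (simp add: f_mult)
      have "f 1 a \<in> V" using stay_D[OF ab(1), of 1] by simp
      then have "x \<otimes> inv (f 1 b) \<in> V" using c e by (simp add: m_assoc)
      then have "V #> x = V #> f 1 b" using rcos_eq_iff[OF B(1)] xc c by simp
      moreover have "f 1 b \<in> stay V {- m..- 1}" by (rule f_CsD[OF ab(2)]) auto
      ultimately show "K \<in> (#>) V ` stay V {- m..- 1}" using x(2) by blast
    qed
  qed
  then show ?thesis unfolding idx_def eq by simp
qed

lemma no_return_D: "no_return V \<Longrightarrow> x \<in> V \<Longrightarrow> 0 \<le> d \<Longrightarrow> f d x \<in> V \<Longrightarrow> 0 \<le> i \<Longrightarrow> i \<le> d \<Longrightarrow> f i x \<in> V"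
  unfolding no_return_def by (drule bspec, assumption, drule spec, drule (1) mp, drule (1) mp, drule bspec) auto

lemma no_return_stay:
  assumes "V \<in> \<B>" "no_return V"
  shows "stay V {- int k} \<inter> V = stay V {- int k..0}"
proof (intro subset_antisym subsetI)
  fix x assume x: "x \<in> stay V {- int k} \<inter> V"
  then have xc: "x \<in> carrier G" "f (- int k) x \<in> V" by (auto simp: stay_def)
  have "f i x \<in> V" if "i \<in> {- int k..0}" for i
  proof -
    have "f (i + int k) (f (- int k) x) \<in> V"
      by (rule no_return_D[OF assms(2) xc(2), of "int k"]) (use x xc that in \<open>simp_all add: f_f\<close>)
    then show ?thesis using xc by (simp add: f_f)
  qed
  then show "x \<in> stay V {- int k..0}" using xc by (simp add: stay_def)
next
  fix x assume x: "x \<in> stay V {- int k..0}"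
  then show "x \<in> stay V {- int k} \<inter> V" using stay_0D[OF x] stay_cD[OF x] stay_D[OF x, of "- int k"] by (simp add: stay_def)
qed

text \<open>Without returns, being in V at the times -k and 0 means staying in V in between; the
  index for \<open>f (int k)\<close> is then a product of k equal factors supplied by
  \<open>product_step\<close>.\<close>

lemma straight_I:
  assumes V: "V \<in> \<B>" "tidy_above V" "no_return V"
  shows "straight V"
  unfolding straight_def
proof
  note B = B_dest[OF V(1)]
  have e: "idx G (f (int k) ` V) V = idx G (stay V {- int k}) (stay V {- int k..0})" for k
    using f_image_stay[OF B(4), of "int k"] no_return_stay[OF V(1,3), of k] idx_Int[OF stay_subgroup[OF B(1)] B(1), of "{- int k}"]
    by simp
  fix k show "idx G (f (int k) ` V) V = idx G (f 1 ` V) V ^ k"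
  proof (induction k)
    case 0
    show ?case using B_idx_refl[OF V(1)] f_0_image[OF B(4)] by simp
  next
    case (Suc k)
    have "idx G (f (int (Suc k)) ` V) V = idx G (f (int k) ` V) V * idx G (stay V {- int (Suc k)..- 1}) V"
      unfolding e by (rule product_step[OF V(1)])
    also have "idx G (stay V {- int (Suc k)..- 1}) V = idx G (f 1 ` V) V" by (rule tidy_above_idx[OF V(1,2)]) simp
    finally show ?case using Suc by simp
  qed
qed

text \<open>\<open>P k\<close> is at most the k-th power of \<open>?s\<close>, as every factor
  \<open>c m\<close> is at most \<open>?s\<close>, and at least that power, as it intersects with
  the intermediate translates as well. Equality of the factors gives the splitting; equality of the
  two intersections excludes returns.\<close>

lemma straight_D:
  assumes V: "V \<in> \<B>" "straight V"
  shows "tidy_above V" "no_return V"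
proof -
  note B = B_dest[OF V(1)]
  let ?s = "idx G (f 1 ` V) V"
  define c where "c m = idx G (stay V {- int m..- 1}) V" for m
  define P where "P k = idx G (stay V {- int k}) (stay V {- int k..0})" for k
  have eq: "f (int k) ` V = stay V {- int k}" for k using f_image_stay[OF B(4), of "int k"] by simp
  have eq1: "f 1 ` V = stay V {- 1}" using eq[of 1] by simp
  have Bk: "f (int k) ` V \<in> \<B>" for k by (rule f_B[OF V(1)])
  have fin1: "finite_index G (stay V {- 1}) V" using B_finite_index[OF Bk[of 1] V(1)] eq1 by simp
  have s: "?s > 0" using idx_pos[OF fin1] eq1 subgroup.one_closed[OF stay_subgroup[OF B(1)]] by auto
  have cs: "c m \<le> ?s" if "m \<ge> 1" for m
    unfolding c_def eq1 by (rule idx_mono[OF _ fin1], rule stay_mono) (use that in auto)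
  have P0: "P 0 = 1" unfolding P_def using idx_refl[OF stay_subgroup[OF B(1)], of "stay V {0}" "{0}"]
      subgroup.one_closed[OF stay_subgroup[OF B(1)], of "{0}"] by auto
  have PS: "P (Suc k) = P k * c (Suc k)" for k
    unfolding P_def c_def by (rule product_step[OF V(1)])
  have Pk: "P k \<le> ?s ^ k" for k
  proof (induction k)
    case (Suc k)
    then show ?case using mult_le_mono[OF Suc cs[of "Suc k"]] PS[of k] by (simp add: mult.commute)
  qed (simp add: P0)
  have sub: "stay V {- int k..0} \<subseteq> stay V {- int k} \<inter> V" for k
    using stay_mono[of "{- int k}" "{- int k..0}"] stay_sub[of "{- int k..0}"] by auto
  have sI: "subgroup (stay V {- int k} \<inter> V) G" for k
    using subgroups_Inter_pair[OF stay_subgroup[OF B(1)] B(1)] .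
  have mul: "P k = idx G (stay V {- int k}) (stay V {- int k} \<inter> V) * idx G (stay V {- int k} \<inter> V) (stay V {- int k..0})" for k
    unfolding P_def by (rule idx_mult[OF stay_subgroup[OF B(1)] sI stay_subgroup[OF B(1)] sub]) simp
  have sk: "idx G (stay V {- int k}) (stay V {- int k} \<inter> V) = ?s ^ k" for k
    using V(2) idx_Int[OF stay_subgroup[OF B(1)] B(1), of "{- int k}"] eq unfolding straight_def by simp
  have BI: "stay V {- int k..0} \<in> \<B>" "stay V {- int k} \<in> \<B>" "stay V {- int k} \<inter> V \<in> \<B>" for k
    using B_stay[OF V(1)] B_Int[OF _ V(1)] by auto
  have "idx G (stay V {- int k} \<inter> V) (stay V {- int k..0}) > 0" for k
    using idx_pos[OF B_finite_index[OF BI(3,1)]] B_dest(5)[OF BI(3)] by blast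
  then have "?s ^ k \<le> P k" for k unfolding mul sk by (simp add: Suc_leI)
  then have Peq: "P k = ?s ^ k" for k by (intro le_antisym Pk)
  have ceq: "c m = ?s" if "m \<ge> 1" for m
  proof -
    from that obtain k where "m = Suc k" by (cases m) auto
    then show ?thesis using PS[of k] Peq[of k] Peq[of m] s by simp
  qed
  show "tidy_above V"
  proof (rule tidy_above_I[OF B(1,2) B_closed[OF V(1)]])
    fix m x assume m: "1 \<le> (m::int)" and x: "x \<in> stay V {- 1}"
    have "idx G (stay V {- 1}) V \<le> idx G (stay V {- m..- 1}) V"
      using ceq[of "nat m"] m by (simp add: c_def eq1)
    from idx_eq_cover[OF stay_mono fin1 this x B(1) stay_carrier]
    show "\<exists>b\<in>stay V {- m..- 1}. x \<otimes> inv b \<in> V" using m by simp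
  qed
  have eqI: "stay V {- int k} \<inter> V = stay V {- int k..0}" for k
    by (rule idx_finite_subset_eq[OF stay_subgroup[OF B(1)] sI stay_subgroup[OF B(1)] sub _ B_finite_index[OF BI(2,1)]])
       (use Peq sk P_def in auto)
  show "no_return V"
    unfolding no_return_def
  proof (intro ballI allI impI)
    fix x d i assume h: "x \<in> V" "(0::int) \<le> d" "f d x \<in> V" "i \<in> {0..d}"
    have xc: "x \<in> carrier G" using h B(4) by auto
    have "f d x \<in> stay V {- int (nat d)} \<inter> V" using h xc by (simp add: stay_def)
    then have "f d x \<in> stay V {- int (nat d)..0}" unfolding eqI .
    then have "f (i - d) (f d x) \<in> V" by (rule stay_D) (use h in auto)
    then show "f i x \<in> V" using xc by (simp add: f_f)
  qed
qed

lemma idx_power_le: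
  assumes "V \<in> \<B>"
  shows "idx G (f (int k) ` V) V \<le> idx G (f 1 ` V) V ^ k"
proof (induction k)
  note B = B_dest[OF assms]
  case 0
  show ?case using B_idx_refl[OF assms] f_0_image[OF B(4)] by simp
next
  note B = B_dest[OF assms]
  case (Suc k)
  have e: "f (int (Suc k)) ` V = f (int k) ` (f 1 ` V)"
    unfolding image_image using B(4) by (intro image_cong) (auto simp: f_f add.commute subset_iff)
  have "idx G (f (int (Suc k)) ` V) V \<le> idx G (f (int (Suc k)) ` V) (f (int k) ` V) * idx G (f (int k) ` V) V"
    by (rule idx_triangle) (use assms f_B B_dest B_finite_index in auto)
  also have "idx G (f (int (Suc k)) ` V) (f (int k) ` V) = idx G (f 1 ` V) V"
    unfolding e by (rule idx_image(1)[OF B(1) _ f_hom f_inj]) (rule B_dest(4)[OF f_B[OF assms]])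
  also have "idx G (f 1 ` V) V * idx G (f (int k) ` V) V \<le> idx G (f 1 ` V) V * idx G (f 1 ` V) V ^ k"
    by (rule mult_le_mono2[OF Suc])
  finally show ?case by simp
qed

text \<open>Exchanging W for V at both ends costs a factor \<open>?C\<close> independent of k, while
  the index grows exactly like \<open>?a ^ k\<close> for W and at most like \<open>?b ^ k\<close>
  for V. So \<open>?a\<close> cannot exceed \<open>?b\<close>.\<close>

lemma straight_min:
  assumes W: "W \<in> \<B>" "straight W" and V: "V \<in> \<B>"
  shows "idx G (f 1 ` W) W \<le> idx G (f 1 ` V) V"
proof (rule ccontr)
  let ?a = "idx G (f 1 ` W) W" and ?b = "idx G (f 1 ` V) V"
  assume "\<not> ?a \<le> ?b"
  then have ab: "?b < ?a" by simp
  have b: "?b > 0" by (rule idx_pos[OF B_finite_index[OF f_B[OF V] V]]) (use B_dest(5)[OF V] in auto)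
  let ?C = "idx G W V * idx G V W"
  have "?a ^ k \<le> ?C * ?b ^ k" for k
  proof -
    have "?a ^ k = idx G (f (int k) ` W) W" using W(2) by (simp add: straight_def)
    also have "\<dots> \<le> idx G (f (int k) ` W) (f (int k) ` V) * idx G (f (int k) ` V) W"
      by (rule idx_triangle) (use W V f_B B_dest B_finite_index in auto)
    also have "idx G (f (int k) ` W) (f (int k) ` V) = idx G W V"
      by (rule idx_image(1)[OF B_dest(1)[OF V] B_dest(4)[OF W(1)] f_hom f_inj])
    also have "idx G (f (int k) ` V) W \<le> idx G (f (int k) ` V) V * idx G V W"
      by (rule idx_triangle) (use W V f_B B_dest B_finite_index in auto)
    also have "idx G (f (int k) ` V) V \<le> ?b ^ k" by (rule idx_power_le[OF V])
    finally show ?thesis by (simp add: mult.commute mult.left_commute mult_le_mono)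
  qed
  then have "real (?a ^ k) \<le> real (?C * ?b ^ k)" for k unfolding of_nat_le_iff .
  then have "real ?a ^ k \<le> real ?C * real ?b ^ k" for k by (simp only: of_nat_mult of_nat_power)
  then have le: "(real ?a / real ?b) ^ k \<le> real ?C" for k
    using b by (simp add: power_divide divide_le_eq)
  have "real ?a / real ?b > 1" using ab b by simp
  then obtain k where "real ?C < (real ?a / real ?b) ^ k" using real_arch_pow by blast
  with le[of k] show False by simp
qed

end

section \<open>Cosets and product sets\<close>

context topgroup
begin

lemma left_coset_quotient:
  assumes V: "subgroup V G" and "inv a \<otimes> y \<in> V" "inv a \<otimes> x \<in> V" "a \<in> carrier G" "x \<in> carrier G" "y \<in> carrier G"
  shows "inv y \<otimes> x \<in> V"
proof -
  have "inv (inv a \<otimes> y) \<otimes> (inv a \<otimes> x) = inv y \<otimes> (a \<otimes> inv a) \<otimes> x"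
    using assms(4-) by (simp only: inv_mult_group inv_inv inv_closed m_assoc m_closed)
  then have "inv (inv a \<otimes> y) \<otimes> (inv a \<otimes> x) = inv y \<otimes> x" using assms(4-) by simp
  then show ?thesis
    using subgroup.m_closed[OF V subgroup.m_inv_closed[OF V assms(2)] assms(3)] by simp
qed

lemma mem_setmult: "a \<in> A \<Longrightarrow> b \<in> B \<Longrightarrow> a \<otimes> b \<in> A <#> B"
  unfolding set_mult_def by blast

lemma setmultE:
  assumes "x \<in> A <#> B"
  obtains a b where "a \<in> A" "b \<in> B" "x = a \<otimes> b"
  using assms unfolding set_mult_def by blast

lemma closed_mult_right:
  assumes "subgroup U G" "openin T U" "K \<subseteq> carrier G"
  shows "closedin T (K <#> U)"
proof -
  have U: "U \<subseteq> carrier G" by (rule subgroup.subset[OF assms(1)])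
  have KU: "K <#> U \<subseteq> carrier G" by (rule setmult_subset_G[OF assms(3) U])
  have "carrier G - (K <#> U) = (carrier G - (K <#> U)) <#> U"
  proof (intro subset_antisym subsetI)
    fix x assume x: "x \<in> carrier G - (K <#> U)"
    have "x \<otimes> \<one> \<in> (carrier G - (K <#> U)) <#> U" by (rule mem_setmult[OF x subgroup.one_closed[OF assms(1)]])
    then show "x \<in> (carrier G - (K <#> U)) <#> U" using x by simp
  next
    fix x assume "x \<in> (carrier G - (K <#> U)) <#> U"
    then obtain a u where au: "a \<in> carrier G" "a \<notin> K <#> U" "u \<in> U" "x = a \<otimes> u"
      by (elim setmultE) blast
    have uc: "u \<in> carrier G" using au U by auto
    have "x \<notin> K <#> U"
    proof
      assume "x \<in> K <#> U"
      then obtain k v where kv: "k \<in> K" "v \<in> U" "x = k \<otimes> v" by (elim setmultE)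
      have c: "k \<in> carrier G" "v \<in> carrier G" using kv U assms(3) by auto
      have "a = x \<otimes> inv u" using au uc by (simp add: m_assoc)
      also have "\<dots> = k \<otimes> (v \<otimes> inv u)" using kv c uc by (simp add: m_assoc)
      finally have "a = k \<otimes> (v \<otimes> inv u)" .
      moreover have "v \<otimes> inv u \<in> U"
        by (intro subgroup.m_closed[OF assms(1)] subgroup.m_inv_closed[OF assms(1)] kv au)
      ultimately have "a \<in> K <#> U" using mem_setmult[OF kv(1)] by simp
      with au show False by simp
    qed
    then show "x \<in> carrier G - (K <#> U)" using au uc by simp
  qed
  moreover have "openin T ((carrier G - (K <#> U)) <#> U)"
    by (rule open_mult_right[OF assms(2)]) blast
  ultimately show ?thesis using KU by (simp add: closedin_def)
qed

lemma mult_subgroup: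
  assumes A: "subgroup A G" and B: "subgroup B G"
    and n: "\<And>a b. a \<in> A \<Longrightarrow> b \<in> B \<Longrightarrow> b \<otimes> a \<otimes> inv b \<in> A"
  shows "subgroup (A <#> B) G"
proof (rule subgroupI)
  note cA = subgroup.mem_carrier[OF A] and cB = subgroup.mem_carrier[OF B]
  show "A <#> B \<subseteq> carrier G" by (rule setmult_subset_G[OF subgroup.subset[OF A] subgroup.subset[OF B]])
  have "\<one> \<otimes> \<one> \<in> A <#> B" unfolding set_mult_def using subgroup.one_closed[OF A] subgroup.one_closed[OF B] by blast
  then show "A <#> B \<noteq> {}" by blast
  fix x assume "x \<in> A <#> B"
  then obtain a b where ab: "a \<in> A" "b \<in> B" "x = a \<otimes> b" by (elim setmultE)
  have ib: "inv b \<in> B" "inv a \<in> A" using ab subgroup.m_inv_closed[OF A] subgroup.m_inv_closed[OF B] by auto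
  have "inv x = (inv b \<otimes> inv a \<otimes> inv (inv b)) \<otimes> inv b"
    using ab cA cB by (simp add: inv_mult_group m_assoc)
  then show "inv x \<in> A <#> B" unfolding set_mult_def using n[OF ib(2,1)] ib by blast
  fix y assume "y \<in> A <#> B"
  then obtain a' b' where ab': "a' \<in> A" "b' \<in> B" "y = a' \<otimes> b'" by (elim setmultE)
  have "x \<otimes> y = (a \<otimes> (b \<otimes> a' \<otimes> inv b)) \<otimes> (b \<otimes> b')"
  proof -
    have c: "a \<in> carrier G" "b \<in> carrier G" "a' \<in> carrier G" "b' \<in> carrier G" using ab ab' cA cB by auto
    have "(a \<otimes> (b \<otimes> a' \<otimes> inv b)) \<otimes> (b \<otimes> b') = a \<otimes> b \<otimes> a' \<otimes> (inv b \<otimes> b) \<otimes> b'"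
      using c by (simp only: m_assoc m_closed inv_closed)
    then show ?thesis using c ab ab' by (simp add: m_assoc)
  qed
  moreover have "a \<otimes> (b \<otimes> a' \<otimes> inv b) \<in> A" by (rule subgroup.m_closed[OF A ab(1) n[OF ab'(1) ab(2)]])
  moreover have "b \<otimes> b' \<in> B" by (rule subgroup.m_closed[OF B ab(2) ab'(2)])
  ultimately show "x \<otimes> y \<in> A <#> B" unfolding set_mult_def by blast
qed

lemma subset_setmult:
  assumes "subgroup A G" "subgroup B G"
  shows "A \<subseteq> A <#> B" "B \<subseteq> A <#> B"
proof -
  show "A \<subseteq> A <#> B"
  proof
    fix x assume "x \<in> A"
    then have "x \<otimes> \<one> \<in> A <#> B" by (rule mem_setmult) (rule subgroup.one_closed[OF assms(2)])
    then show "x \<in> A <#> B" using subgroup.mem_carrier[OF assms(1) \<open>x \<in> A\<close>] by simp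
  qed
  show "B \<subseteq> A <#> B"
  proof
    fix x assume "x \<in> B"
    with subgroup.one_closed[OF assms(1)] have "\<one> \<otimes> x \<in> A <#> B" by (rule mem_setmult)
    then show "x \<in> A <#> B" using subgroup.mem_carrier[OF assms(2) \<open>x \<in> B\<close>] by simp
  qed
qed

end

section \<open>Homoclinic elements, returns and intersections of tidy subgroups\<close>

context flow
begin

text \<open>The closure of this group, intersected over all admissible \<open>V\<close>, is the nub of the automorphism.\<close>

definition homoclinic :: "'a set \<Rightarrow> 'a set" where
  "homoclinic V = {x \<in> carrier G. \<exists>n. \<forall>i. n \<le> \<bar>i\<bar> \<longrightarrow> f i x \<in> V}"

lemma homoclinic_carrier: "homoclinic V \<subseteq> carrier G"
  by (auto simp: homoclinic_def)

lemma homoclinic_I0: "x \<in> carrier G \<Longrightarrow> (\<And>i. n \<le> \<bar>i\<bar> \<Longrightarrow> f i x \<in> V) \<Longrightarrow> x \<in> homoclinic V"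
  unfolding homoclinic_def by auto

lemma homoclinic_E:
  assumes "x \<in> homoclinic V"
  obtains n where "x \<in> carrier G" "\<And>i. n \<le> \<bar>i\<bar> \<Longrightarrow> f i x \<in> V"
  using assms unfolding homoclinic_def by auto

lemma homoclinic_subgroup:
  assumes V: "subgroup V G"
  shows "subgroup (homoclinic V) G"
proof (rule subgroupI)
  show "homoclinic V \<subseteq> carrier G" by (rule homoclinic_carrier)
  have "\<one> \<in> homoclinic V" by (rule homoclinic_I0) (simp_all add: subgroup.one_closed[OF V])
  then show "homoclinic V \<noteq> {}" by blast
  show "inv a \<in> homoclinic V" if a: "a \<in> homoclinic V" for a
  proof -
    obtain n where ac: "a \<in> carrier G" and n: "\<And>i. n \<le> \<bar>i\<bar> \<Longrightarrow> f i a \<in> V" by (rule homoclinic_E[OF a]) blast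
    show ?thesis
    proof (rule homoclinic_I0)
      fix i assume "n \<le> \<bar>i\<bar>"
      from subgroup.m_inv_closed[OF V n[OF this]] show "f i (inv a) \<in> V" unfolding f_inv[OF ac] .
    qed (simp add: ac)
  qed
  show "a \<otimes> b \<in> homoclinic V" if a: "a \<in> homoclinic V" and b: "b \<in> homoclinic V" for a b
  proof -
    obtain n where ac: "a \<in> carrier G" and n: "\<And>i. n \<le> \<bar>i\<bar> \<Longrightarrow> f i a \<in> V" by (rule homoclinic_E[OF a]) blast
    obtain m where bc: "b \<in> carrier G" and m: "\<And>i. m \<le> \<bar>i\<bar> \<Longrightarrow> f i b \<in> V" by (rule homoclinic_E[OF b]) blast
    show ?thesis
    proof (rule homoclinic_I0)
      fix i assume i: "max m n \<le> \<bar>i\<bar>"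
      have "f i a \<in> V" by (rule n) (use i in simp)
      moreover have "f i b \<in> V" by (rule m) (use i in simp)
      ultimately show "f i (a \<otimes> b) \<in> V" unfolding f_mult[OF ac bc] by (rule subgroup.m_closed[OF V])
    qed (simp add: ac bc)
  qed
qed

lemma homoclinic_f:
  assumes "x \<in> homoclinic V"
  shows "f j x \<in> homoclinic V"
proof -
  obtain n where xc: "x \<in> carrier G" and n: "\<And>i. n \<le> \<bar>i\<bar> \<Longrightarrow> f i x \<in> V" by (rule homoclinic_E[OF assms]) blast
  show ?thesis
  proof (rule homoclinic_I0)
    fix i assume i: "n + \<bar>j\<bar> \<le> \<bar>i\<bar>"
    show "f i (f j x) \<in> V" unfolding f_f[OF xc] by (rule n) (use i in linarith)
  qed (simp add: xc)
qed

lemma homoclinic_mono: "V \<subseteq> W \<Longrightarrow> homoclinic V \<subseteq> homoclinic W"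
  unfolding homoclinic_def by blast

lemma homoclinic_I:
  assumes "x \<in> carrier G" "\<And>i. a \<le> i \<Longrightarrow> f i x \<in> V" "\<And>i. i \<le> b \<Longrightarrow> f i x \<in> V"
  shows "x \<in> homoclinic V"
proof (rule homoclinic_I0[OF assms(1)])
  fix i assume "\<bar>a\<bar> + \<bar>b\<bar> \<le> \<bar>i\<bar>"
  then have "a \<le> i \<or> i \<le> b" by linarith
  then show "f i x \<in> V" using assms(2,3) by blast
qed

text \<open>A homoclinic x has been in V up to some negative time. Just after it, x agrees modulo V
  with one of finitely many homoclinic elements q whose past is in V. Dividing by
  \<open>f k q\<close> moves the departure from V one step closer to 0, and as long as k is at least
  the common time m this only changes x on the left by an element of V.\<close>

lemma homoclinic_bounded:
  assumes V: "V \<in> \<B>"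
  shows "\<exists>m. homoclinic V \<subseteq> V <#> f m ` V"
proof -
  note B = B_dest[OF V]
  obtain F where F: "finite F" "F \<subseteq> f 1 ` V" "\<And>x. x \<in> f 1 ` V \<Longrightarrow> \<exists>a\<in>F. inv a \<otimes> x \<in> V"
    using compact_cover_left[OF B_dest(2)[OF f_B[OF V]] B(1,3)] by metis
  have Fc: "F \<subseteq> carrier G" using F(2) B_dest(4)[OF f_B[OF V]] by (rule subset_trans)
  define D where "D = homoclinic V \<inter> stay V {..- 1}"
  have sD: "subgroup D G" unfolding D_def by (rule subgroups_Inter_pair[OF homoclinic_subgroup[OF B(1)] stay_subgroup[OF B(1)]])
  have D1: "D \<subseteq> f 1 ` V" unfolding D_def f_image_stay[OF B(4)] using stay_mono[of "{- 1}" "{..- 1}"] by auto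
  define r where "r a = (SOME x. x \<in> D \<and> inv a \<otimes> x \<in> V)" for a
  define R where "R = r ` {a \<in> F. \<exists>x. x \<in> D \<and> inv a \<otimes> x \<in> V}"
  have R: "finite R" "R \<subseteq> D"
    unfolding R_def r_def using F(1) by (auto intro: someI2_ex)
  have RD: "\<exists>q\<in>R. inv q \<otimes> x \<in> V" if x: "x \<in> D" for x
  proof -
    obtain a where a: "a \<in> F" "inv a \<otimes> x \<in> V" using F(3) D1 x by blast
    have ra: "r a \<in> D \<and> inv a \<otimes> r a \<in> V" unfolding r_def by (rule someI[of _ x]) (use a x in auto)
    have c: "a \<in> carrier G" "x \<in> carrier G" "r a \<in> carrier G"
      using a Fc x ra subgroup.mem_carrier[OF sD] by auto
    have "inv (r a) \<otimes> x \<in> V"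
      by (rule left_coset_quotient[OF B(1) _ a(2) c]) (use ra in blast)
    moreover have "r a \<in> R" unfolding R_def using a x by blast
    ultimately show ?thesis by blast
  qed
  have "\<exists>n. \<forall>i. n \<le> \<bar>i\<bar> \<longrightarrow> f i q \<in> V" if "q \<in> R" for q
    using R(2) that unfolding D_def homoclinic_def by blast
  then obtain N where N: "\<And>q i. q \<in> R \<Longrightarrow> N q \<le> \<bar>i\<bar> \<Longrightarrow> f i q \<in> V" by metis
  \<comment> \<open>From time m on, all the chosen representatives are back in V for good; 0 is
    included to make m nonnegative.\<close>
  define m where "m = Max (insert 0 (N ` R))"
  have m: "f k q \<in> V" if "q \<in> R" "m \<le> k" for q k
  proof -
    have "N q \<le> m" unfolding m_def using R(1) that by auto
    moreover have "0 \<le> m" unfolding m_def using R(1) by auto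
    ultimately show ?thesis using N that by simp
  qed
  have step: "x \<in> V <#> f m ` V" if "m \<le> k" "x \<in> homoclinic V \<inter> stay V {..- k}" for k x
    using that
  proof (induction arbitrary: x rule: int_ge_induct)
    case base
    have "x \<in> carrier G" "f (- m) x \<in> V" using base by (auto simp: stay_def)
    then have "x \<in> f m ` V" using f_image_iff[OF B(4)] by simp
    then have "\<one> \<otimes> x \<in> V <#> f m ` V" by (rule mem_setmult[OF B(5)])
    then show ?case using \<open>x \<in> carrier G\<close> by simp
  next
    case (step k)
    have xc: "x \<in> carrier G" using step by (auto simp: stay_def)
    let ?y = "f (- k) x"
    have "?y \<in> stay V {..- 1}" by (rule f_CsD[of x V "{..- (k + 1)}"]) (use step in auto)
    then have y: "?y \<in> D" using step homoclinic_f by (simp add: D_def)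
    then obtain q where q: "q \<in> R" "inv q \<otimes> ?y \<in> V" using RD by blast
    have qD: "q \<in> D" using q R by auto
    have qc: "q \<in> carrier G" by (rule subgroup.mem_carrier[OF sD qD])
    have w: "inv q \<otimes> ?y \<in> D"
      by (intro subgroup.m_closed[OF sD] subgroup.m_inv_closed[OF sD] qD y)
    have "inv q \<otimes> ?y \<in> stay V {..0}"
    proof -
      have "f i (inv q \<otimes> ?y) \<in> V" if "i \<le> 0" for i
        by (cases "i = 0") (use w q that xc qc in \<open>auto simp: D_def stay_def\<close>)
      then show ?thesis using xc qc by (simp add: stay_def)
    qed
    then have "f k (inv q \<otimes> ?y) \<in> stay V {..- k}" by (rule f_CsD) auto
    moreover have "f k (inv q \<otimes> ?y) \<in> homoclinic V" using w homoclinic_f by (simp add: D_def)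
    ultimately have "f k (inv q \<otimes> ?y) \<in> V <#> f m ` V" using step.IH by simp
    then obtain v w where vw: "v \<in> V" "w \<in> f m ` V" "f k (inv q \<otimes> ?y) = v \<otimes> w" by (elim setmultE)
    have c: "v \<in> carrier G" "w \<in> carrier G" using vw B(4) B_dest(4)[OF f_B[OF V]] by auto
    have "f k (inv q \<otimes> ?y) = inv (f k q) \<otimes> x" using qc xc by (simp add: f_mult f_inv)
    then have "f k q \<otimes> (inv (f k q) \<otimes> x) = f k q \<otimes> (v \<otimes> w)" using vw(3) by simp
    then have "x = (f k q \<otimes> v) \<otimes> w" using qc xc c by (simp add: m_assoc[symmetric])
    moreover have "f k q \<otimes> v \<in> V" by (rule subgroup.m_closed[OF B(1) m[OF q(1) step(1)] vw(1)])
    ultimately show ?case using mem_setmult[OF _ vw(2)] by simp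
  qed
  have "homoclinic V \<subseteq> V <#> f m ` V"
  proof
    fix x assume x: "x \<in> homoclinic V"
    then obtain n where xc: "x \<in> carrier G" and n: "\<And>i. n \<le> \<bar>i\<bar> \<Longrightarrow> f i x \<in> V" by (rule homoclinic_E) blast
    have "x \<in> stay V {..- max m \<bar>n\<bar>}" unfolding stay_def using n xc by auto
    then show "x \<in> V <#> f m ` V" using step[of "max m \<bar>n\<bar>" x] x by simp
  qed
  then show ?thesis by blast
qed

lemma homoclinic_closure_compact:
  assumes V: "V \<in> \<B>"
  shows "compactin T (T closure_of homoclinic V)"
proof -
  note B = B_dest[OF V]
  obtain m where m: "homoclinic V \<subseteq> V <#> f m ` V" using homoclinic_bounded[OF V] by blast
  have "closedin T (V <#> f m ` V)"
    by (rule closed_mult_right) (use B_dest[OF f_B[OF V]] B in auto)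
  moreover have "compactin T (V <#> f m ` V)" by (rule compact_mult) (use B_dest[OF f_B[OF V]] B in auto)
  ultimately show ?thesis
    using closed_compactin closure_of_minimal[OF m] closedin_closure_of by blast
qed

text \<open>Split x as a b and then \<open>f d b\<close> as a' b'. The factor a' stays in W in the
  future and, as a quotient of elements whose orbits are in W there, also before time -d; so it is
  homoclinic and never leaves W. Going back from time d, b can then leave W at no intermediate
  time.\<close>

lemma no_return_I:
  assumes W: "subgroup W G" "tidy_above W" "homoclinic W \<subseteq> W"
  shows "no_return W"
  unfolding no_return_def
proof (intro ballI allI impI)
  note mc = subgroup.m_closed[OF W(1)] and ic = subgroup.m_inv_closed[OF W(1)]
  fix x d j assume h: "x \<in> W" "(0::int) \<le> d" "f d x \<in> W" "j \<in> {0..d}"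
  obtain a b where ab: "a \<in> stay W {0..}" "b \<in> stay W {..0}" "x = a \<otimes> b"
    using W(2) h unfolding tidy_above_def by blast
  have c: "a \<in> carrier G" "b \<in> carrier G" using ab by (auto simp: stay_def)
  have fb: "f d b = inv (f d a) \<otimes> f d x" using ab c by (simp add: f_mult m_assoc[symmetric])
  have "f d a \<in> W" using stay_D[OF ab(1), of d] h by simp
  then have "f d b \<in> W" unfolding fb by (intro mc ic h)
  then obtain a' b' where ab': "a' \<in> stay W {0..}" "b' \<in> stay W {..0}" "f d b = a' \<otimes> b'"
    using W(2) unfolding tidy_above_def by blast
  have c': "a' \<in> carrier G" "b' \<in> carrier G" using ab' by (auto simp: stay_def)
  have a': "a' = f d b \<otimes> inv b'" using ab' c' by (simp add: m_assoc)
  have "a' \<in> homoclinic W"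
  proof (rule homoclinic_I[of _ 0 _ "- d"])
    show "f i a' \<in> W" if "0 \<le> i" for i using stay_D[OF ab'(1), of i] that by simp
    show "f i a' \<in> W" if "i \<le> - d" for i
    proof -
      have "f i a' = f (i + d) b \<otimes> inv (f i b')" unfolding a' using c c' by (simp add: f_mult f_inv f_f)
      moreover have "f (i + d) b \<in> W" "f i b' \<in> W"
        using stay_D[OF ab(2), of "i + d"] stay_D[OF ab'(2), of i] that h by auto
      ultimately show ?thesis using mc ic by simp
    qed
  qed (rule c'(1))
  then have all: "f i a' \<in> W" for i using W(3) homoclinic_f by blast
  have "f j b = f (j - d) (f d b)" using c by (simp add: f_f)
  also have "\<dots> = f (j - d) a' \<otimes> f (j - d) b'" using ab' c' by (simp add: f_mult)
  finally have "f j b \<in> W" using mc[OF all] stay_D[OF ab'(2), of "j - d"] h by simp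
  moreover have "f j a \<in> W" using stay_D[OF ab(1), of j] h by simp
  ultimately show "f j x \<in> W" unfolding ab(3) f_mult[OF c] by (intro mc)
qed

text \<open>Pigeonhole on the cosets covering K gives i < j with \<open>f i v\<close> and
  \<open>f j v\<close> in one left coset of V. Their quotient, pulled back by j, lies in V at time
  0, because v has its past in V, and at time j; so it does at time j - i, where it is
  \<open>inv v \<otimes> f (j - i) v\<close>. Hence v is in V at a time beyond t and cannot be
  outside V at time t.\<close>

lemma forward_bounded:
  assumes V: "V \<in> \<B>" "no_return V" and v: "v \<in> stay V {..0}"
    and K: "compactin T K" "\<And>i. 0 \<le> i \<Longrightarrow> f i v \<in> K" and t: "0 \<le> t"
  shows "f t v \<in> V"
proof -
  note B = B_dest[OF V(1)]
  note mc = subgroup.m_closed[OF B(1)] and ic = subgroup.m_inv_closed[OF B(1)]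
  have vc: "v \<in> carrier G" using v by (simp add: stay_def)
  have vV: "f i v \<in> V" if "i \<le> 0" for i using stay_D[OF v] that by simp
  obtain F where F: "finite F" "F \<subseteq> K" "\<And>x. x \<in> K \<Longrightarrow> \<exists>a\<in>F. inv a \<otimes> x \<in> V"
    using compact_cover_left[OF K(1) B(1,3)] by metis
  have Fc: "F \<subseteq> carrier G" using F(2) compactin_subset_topspace[OF K(1)] by simp
  have "\<exists>a\<in>F. inv a \<otimes> f (int n) v \<in> V" for n using F(3) K(2) by simp
  then obtain g where g: "\<And>n. g n \<in> F" "\<And>n. inv (g n) \<otimes> f (int n) v \<in> V" by metis
  have "finite (range g)" using g(1) F(1) by (meson finite_subset image_subsetI)
  then obtain i0 where i0: "infinite {n. g n = g i0}"
    using pigeonhole_infinite[of UNIV g] by auto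
  obtain j where j: "j > i0 + nat t" "g j = g i0"
    using i0 unfolding infinite_nat_iff_unbounded by blast
  define i where "i = i0"
  have gc: "g i0 \<in> carrier G" using g Fc by blast
  let ?h = "inv (f (int i) v) \<otimes> f (int j) v"
  have "inv (g i0) \<otimes> f (int i) v \<in> V" using g(2)[of i0] by (simp add: i_def)
  moreover have "inv (g i0) \<otimes> f (int j) v \<in> V" using g(2)[of j] j(2) by simp
  ultimately have h: "?h \<in> V" by (rule left_coset_quotient[OF B(1)]) (use gc vc in simp_all)
  have hc: "?h \<in> carrier G" using vc by simp
  let ?z = "f (- int j) ?h"
  have "?z = inv (f (int i - int j) v) \<otimes> v" using vc by (simp add: f_mult f_inv f_f)
  then have z: "?z \<in> V" using vV[of "int i - int j"] vV[of 0] j i_def vc mc ic by simp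
  have "f (int j - int i) ?z \<in> V"
    by (rule no_return_D[OF V(2) z, of "int j"]) (use h hc j i_def in \<open>auto simp: f_f\<close>)
  moreover have "f (int j - int i) ?z = inv v \<otimes> f (int j - int i) v"
    using vc by (simp add: f_mult f_inv f_f)
  ultimately have "v \<otimes> (inv v \<otimes> f (int j - int i) v) \<in> V" using mc[OF vV[of 0]] vc by simp
  then have fv: "f (int j - int i) v \<in> V" using vc by (simp add: m_assoc[symmetric])
  have "v \<in> V" using vV[of 0] vc by simp
  from no_return_D[OF V(2) this _ fv t] show ?thesis using j i_def t by simp
qed

lemma forward_bounded':
  assumes V: "V \<in> \<B>" "no_return V" "tidy_above V" and x: "x \<in> V"
    and K: "compactin T K" "\<And>i. 0 \<le> i \<Longrightarrow> f i x \<in> K" and t: "0 \<le> t"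
  shows "f t x \<in> V"
proof -
  note B = B_dest[OF V(1)]
  obtain a b where ab: "a \<in> stay V {0..}" "b \<in> stay V {..0}" "x = a \<otimes> b"
    using V(3) x unfolding tidy_above_def by blast
  have c: "a \<in> carrier G" "b \<in> carrier G" using ab by (auto simp: stay_def)
  have fa: "f i a \<in> V" if "0 \<le> i" for i using stay_D[OF ab(1)] that by simp
  have "f i b \<in> V <#> K" if "0 \<le> i" for i
  proof -
    have "f i b = inv (f i a) \<otimes> f i x" using c ab by (simp add: f_mult m_assoc[symmetric])
    then show ?thesis using mem_setmult[OF subgroup.m_inv_closed[OF B(1) fa[OF that]] K(2)[OF that]] by simp
  qed
  then have "f t b \<in> V" by (rule forward_bounded[OF V(1,2) ab(2) compact_mult[OF B(2) K(1)] _ t])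
  then show ?thesis unfolding ab(3) f_mult[OF c] by (rule subgroup.m_closed[OF B(1) fa[OF t]])
qed

lemma reverse_stay: "flow.stay G (\<lambda>i. f (- i)) V I = stay V (uminus ` I)"
  unfolding flow.stay_def[OF reverse] stay_def by simp

lemma reverse_no_return:
  assumes "V \<subseteq> carrier G" "no_return V"
  shows "flow.no_return (\<lambda>i. f (- i)) V"
  unfolding flow.no_return_def[OF reverse]
proof (intro ballI allI impI)
  fix x d i assume h: "x \<in> V" "(0::int) \<le> d" "f (- d) x \<in> V" "i \<in> {0..d}"
  have xc: "x \<in> carrier G" using assms(1) h(1) by (rule subsetD)
  have "f (d - i) (f (- d) x) \<in> V"
    by (rule no_return_D[OF assms(2) h(3), of d]) (use h xc in auto)
  then show "f (- i) x \<in> V" using xc by (simp add: f_f)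
qed

text \<open>Reversal exchanges the roles of the two factors, and splitting \<open>inv x\<close>
  instead of x restores their order.\<close>

lemma reverse_tidy_above:
  assumes V: "subgroup V G" "tidy_above V"
  shows "flow.tidy_above G (\<lambda>i. f (- i)) V"
  unfolding flow.tidy_above_def[OF reverse] reverse_stay
proof
  fix x assume x: "x \<in> V"
  have xc: "x \<in> carrier G" by (rule subgroup.mem_carrier[OF V(1) x])
  obtain a b where ab: "a \<in> stay V {0..}" "b \<in> stay V {..0}" "inv x = a \<otimes> b"
    using V(2) subgroup.m_inv_closed[OF V(1) x] unfolding tidy_above_def by blast
  have c: "a \<in> carrier G" "b \<in> carrier G" using ab by (auto simp: stay_def)
  have "inv (inv x) = inv b \<otimes> inv a" using ab c by (simp add: inv_mult_group)
  then have "x = inv b \<otimes> inv a" using xc by simp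
  moreover have "inv a \<in> stay V {0..}" "inv b \<in> stay V {..0}"
    using ab subgroup.m_inv_closed[OF stay_subgroup[OF V(1)]] by auto
  ultimately show "\<exists>a\<in>stay V (uminus ` {0..}). \<exists>b\<in>stay V (uminus ` {..0}). x = a \<otimes> b" by auto
qed

lemma bounded_orbit:
  assumes V: "V \<in> \<B>" "tidy_above V" "no_return V" and x: "x \<in> V" and K: "compactin T K" "\<And>i. f i x \<in> K"
  shows "x \<in> stay V UNIV"
proof -
  note B = B_dest[OF V(1)]
  have "f i x \<in> V" for i
  proof (cases "0 \<le> i")
    case True
    then show ?thesis using forward_bounded'[OF V(1,3,2) x K] by simp
  next
    case False
    then show ?thesis
      using flow.forward_bounded'[OF reverse V(1) reverse_no_return[OF B(4) V(3)] reverse_tidy_above[OF B(1) V(2)] x K(1), of "- i"] K(2) by simp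
  qed
  then show ?thesis using x B(4) by (auto simp: stay_def)
qed

text \<open>The compact sets \<open>stay V {- int j..}\<close> decrease to
  \<open>stay V UNIV\<close> and so end up in any open neighbourhood of it.\<close>

lemma tail_near_core:
  assumes V: "V \<in> \<B>" and U: "subgroup U G" "openin T U"
  shows "\<exists>j::nat. stay V {- int j..} \<subseteq> stay V UNIV <#> U"
proof (rule ccontr)
  note B = B_dest[OF V]
  let ?D = "carrier G - (stay V UNIV <#> U)"
  assume "\<not> ?thesis"
  then have ne: "\<not> stay V {- int j..} \<subseteq> stay V UNIV <#> U" for j :: nat by blast
  have op: "openin T (stay V UNIV <#> U)" by (rule open_mult_right[OF U(2) stay_carrier])
  then have cl: "closedin T ?D" using closedin_diff[OF closed_carrier op] by simp
  have "V \<inter> (\<Inter>j::nat. stay V {- int j..} \<inter> ?D) \<noteq> {}"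
  proof (rule compact_nest[OF B(2)])
    fix j :: nat
    show "closedin T (stay V {- int j..} \<inter> ?D)" using cl stay_closed[OF B_closed[OF V]] by (simp add: closedin_Int)
    show "V \<inter> (stay V {- int j..} \<inter> ?D) \<noteq> {}"
      using ne[of j] stay_sub[of "{- int j..}" V] stay_carrier[of V "{- int j..}"] by auto
    show "stay V {- int (Suc j)..} \<inter> ?D \<subseteq> stay V {- int j..} \<inter> ?D"
      using stay_mono[of "{- int j..}" "{- int (Suc j)..}" V] by auto
  qed
  then obtain x where x: "\<And>j::nat. x \<in> stay V {- int j..}" "x \<in> ?D" by auto
  have "f i x \<in> V" for i using stay_D[OF x(1)[of "nat \<bar>i\<bar>"], of i] by simp
  then have "x \<in> stay V UNIV" using x(2) by (simp add: stay_def)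
  then have "x \<in> stay V UNIV <#> U" using subset_setmult(1)[OF stay_subgroup[OF B(1)] U(1)] by blast
  with x show False by simp
qed

text \<open>The splittings of x in V and in W differ by g, whose orbit is bounded: the first factors
  control its future, the second factors its past. Once g = z y with z in \<open>stay W UNIV\<close>
  and y in \<open>stay V UNIV\<close>, the element
  \<open>w1 \<otimes> z = v1 \<otimes> inv y\<close> is a first factor for both.\<close>

lemma tidy_above_Int:
  assumes V: "V \<in> \<B>" "tidy_above V" "no_return V" and W: "W \<in> \<B>" "tidy_above W" "no_return W"
  shows "tidy_above (V \<inter> W)"
  unfolding tidy_above_def
proof
  note BV = B_dest[OF V(1)] and BW = B_dest[OF W(1)]
  note BI = B_dest[OF B_Int[OF V(1) W(1)]]
  fix x assume x: "x \<in> V \<inter> W"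
  obtain v1 v2 where v: "v1 \<in> stay V {0..}" "v2 \<in> stay V {..0}" "x = v1 \<otimes> v2" using V(2) x unfolding tidy_above_def by blast
  obtain w1 w2 where w: "w1 \<in> stay W {0..}" "w2 \<in> stay W {..0}" "x = w1 \<otimes> w2" using W(2) x unfolding tidy_above_def by blast
  have c: "v1 \<in> carrier G" "v2 \<in> carrier G" "w1 \<in> carrier G" "w2 \<in> carrier G"
    using v w by (auto simp: stay_def)
  define g where "g = inv w1 \<otimes> v1"
  have gc: "g \<in> carrier G" using c g_def by simp
  have "w1 \<otimes> w2 = v1 \<otimes> v2" using v w by simp
  then have "v1 = w1 \<otimes> w2 \<otimes> inv v2" using c by (simp add: m_assoc)
  then have "v1 = w1 \<otimes> (w2 \<otimes> inv v2)" using c by (simp add: m_assoc)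
  then have g2: "g = w2 \<otimes> inv v2" unfolding g_def using inv_solve_left[of "w2 \<otimes> inv v2" w1 v1] c by simp
  have gK: "f i g \<in> W <#> V" for i :: int
  proof (cases "0 \<le> i")
    case True
    have "inv (f i w1) \<in> W" using subgroup.m_inv_closed[OF BW(1) stay_D[OF w(1)]] True by simp
    moreover have "f i v1 \<in> V" using stay_D[OF v(1)] True by simp
    ultimately show ?thesis using mem_setmult c by (simp add: g_def f_mult f_inv)
  next
    case False
    have "f i w2 \<in> W" using stay_D[OF w(2)] False by simp
    moreover have "inv (f i v2) \<in> V" using subgroup.m_inv_closed[OF BV(1) stay_D[OF v(2)]] False by simp
    ultimately show ?thesis using mem_setmult c by (simp add: g2 f_mult f_inv)
  qed
  obtain j1 :: nat where j1: "stay V {- int j1..} \<subseteq> stay V UNIV <#> (V \<inter> W)" using tail_near_core[OF V(1) BI(1,3)] by blast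
  obtain j2 :: nat where j2: "stay W {- int j2..} \<subseteq> stay W UNIV <#> (V \<inter> W)" using tail_near_core[OF W(1) BI(1,3)] by blast
  \<comment> \<open>Far in the future the inverses of both first factors are close to the cores,
    which makes \<open>f j g\<close> a core element of W times some
    \<open>p \<in> V \<inter> W\<close> times a core element of V.\<close>
  define j where "j = int (max j1 j2)"
  have "f j (inv v1) \<in> stay V {- int j1..}"
    by (rule f_CsD[OF subgroup.m_inv_closed[OF stay_subgroup[OF BV(1)] v(1)]]) (auto simp: j_def)
  then obtain v0 o1 where v0: "v0 \<in> stay V UNIV" "o1 \<in> V \<inter> W" "f j (inv v1) = v0 \<otimes> o1"
    using j1 unfolding set_mult_def by blast
  have "f j (inv w1) \<in> stay W {- int j2..}"
    by (rule f_CsD[OF subgroup.m_inv_closed[OF stay_subgroup[OF BW(1)] w(1)]]) (auto simp: j_def)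
  then obtain w0 o2 where w0: "w0 \<in> stay W UNIV" "o2 \<in> V \<inter> W" "f j (inv w1) = w0 \<otimes> o2"
    using j2 unfolding set_mult_def by blast
  have c0: "v0 \<in> carrier G" "w0 \<in> carrier G" "o1 \<in> carrier G" "o2 \<in> carrier G"
    using v0 w0 BV(4) by (auto simp: stay_def)
  define p where "p = o2 \<otimes> inv o1"
  have p: "p \<in> V \<inter> W" unfolding p_def by (intro subgroup.m_closed[OF BI(1)] subgroup.m_inv_closed[OF BI(1)] v0 w0)
  have pc: "p \<in> carrier G" using p BV(4) by auto
  have "f j v1 = inv (f j (inv v1))" using c by (simp add: f_inv)
  then have "f j g = (w0 \<otimes> o2) \<otimes> inv (v0 \<otimes> o1)"
    using c v0(3) w0(3) by (simp add: g_def f_mult)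
  then have fjg: "f j g = w0 \<otimes> p \<otimes> inv v0" using c0 by (simp add: p_def inv_mult_group m_assoc)
  have pe: "p = inv w0 \<otimes> f j g \<otimes> v0" using c0 pc unfolding fjg by (simp add: m_assoc) (simp add: m_assoc[symmetric])
  \<comment> \<open>p inherits a bounded orbit from g and lies in V, so it never leaves V and can be
    absorbed into the core element of V.\<close>
  have "p \<in> stay V UNIV"
  proof (rule bounded_orbit[OF V])
    show "p \<in> V" using p by simp
    show "compactin T (W <#> (W <#> V) <#> V)" by (intro compact_mult BV(2) BW(2))
    fix i
    have "f i p = inv (f i w0) \<otimes> f (i + j) g \<otimes> f i v0" unfolding pe using c0 gc by (simp add: f_mult f_inv f_f)
    moreover have "inv (f i w0) \<in> W" using subgroup.m_inv_closed[OF BW(1) stay_D[OF w0(1)]] by simp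
    moreover have "f i v0 \<in> V" using stay_D[OF v0(1)] by simp
    ultimately show "f i p \<in> W <#> (W <#> V) <#> V" by (auto intro!: mem_setmult gK)
  qed
  then have "p \<otimes> inv v0 \<in> stay V UNIV"
    by (rule subgroup.m_closed[OF stay_subgroup[OF BV(1)] _ subgroup.m_inv_closed[OF stay_subgroup[OF BV(1)] v0(1)]])
  then have y: "f (- j) (p \<otimes> inv v0) \<in> stay V UNIV" by (rule f_CsD) simp
  have z: "f (- j) w0 \<in> stay W UNIV" by (rule f_CsD[OF w0(1)]) simp
  define y z where "y = f (- j) (p \<otimes> inv v0)" and "z = f (- j) w0"
  have yc: "y \<in> carrier G" "z \<in> carrier G" using pc c0 by (auto simp: y_def z_def)
  have "g = f (- j) (f j g)" using gc by simp
  also have "\<dots> = z \<otimes> y" unfolding fjg y_def z_def using pc c0 by (simp add: f_mult m_assoc)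
  finally have g3: "g = z \<otimes> y" .
  define u where "u = w1 \<otimes> z"
  have uc: "u \<in> carrier G" using c yc u_def by simp
  have "u \<otimes> y = w1 \<otimes> g" using g3 c yc by (simp add: u_def m_assoc)
  also have "\<dots> = v1" using c by (simp add: g_def m_assoc[symmetric])
  finally have uv: "u = v1 \<otimes> inv y" using inv_solve_right[of u v1 y] uc yc c by simp
  have ya: "y \<in> stay V I" "z \<in> stay W I" for I using y z stay_mono[of I UNIV] by (auto simp: y_def z_def)
  have "u \<in> stay W {0..}" unfolding u_def by (rule subgroup.m_closed[OF stay_subgroup[OF BW(1)] w(1) ya(2)])
  moreover have "u \<in> stay V {0..}" unfolding uv
    by (rule subgroup.m_closed[OF stay_subgroup[OF BV(1)] v(1) subgroup.m_inv_closed[OF stay_subgroup[OF BV(1)] ya(1)]])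
  ultimately have u: "u \<in> stay (V \<inter> W) {0..}" by (simp add: stay_def)
  have e1: "inv u \<otimes> x = inv z \<otimes> w2" using w(3) c yc by (simp add: u_def inv_mult_group m_assoc) (simp add: m_assoc[symmetric])
  have e2: "inv u \<otimes> x = y \<otimes> v2" using v(3) c yc by (simp add: uv inv_mult_group m_assoc) (simp add: m_assoc[symmetric])
  have "inv u \<otimes> x \<in> stay W {..0}" unfolding e1
    by (rule subgroup.m_closed[OF stay_subgroup[OF BW(1)] subgroup.m_inv_closed[OF stay_subgroup[OF BW(1)] ya(2)] w(2)])
  moreover have "inv u \<otimes> x \<in> stay V {..0}" unfolding e2
    by (rule subgroup.m_closed[OF stay_subgroup[OF BV(1)] ya(1) v(2)])
  ultimately have "inv u \<otimes> x \<in> stay (V \<inter> W) {..0}" by (simp add: stay_def)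
  moreover have "x = u \<otimes> (inv u \<otimes> x)" using uc x BV(4) by (auto simp: m_assoc[symmetric])
  ultimately show "\<exists>a\<in>stay (V \<inter> W) {0..}. \<exists>b\<in>stay (V \<inter> W) {..0}. x = a \<otimes> b" using u by blast
qed

lemma no_return_Int: "no_return V \<Longrightarrow> no_return W \<Longrightarrow> no_return (V \<inter> W)"
  unfolding no_return_def by blast

lemma straight_Int:
  assumes "V \<in> \<B>" "W \<in> \<B>" "straight V" "straight W"
  shows "straight (V \<inter> W)"
  using straight_I[OF B_Int[OF assms(1,2)] tidy_above_Int no_return_Int] straight_D assms by blast

end

lemma finite_image_factor:
  assumes "\<And>a b. a \<in> A \<Longrightarrow> b \<in> A \<Longrightarrow> g a = g b \<Longrightarrow> h a = h b" "finite (g ` A)"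
  shows "finite (h ` A)"
proof (rule finite_subset)
  show "h ` A \<subseteq> (\<lambda>K. h (SOME a. a \<in> A \<and> g a = K)) ` g ` A"
  proof
    fix y assume "y \<in> h ` A"
    then obtain a where a: "a \<in> A" "y = h a" by blast
    let ?b = "SOME b. b \<in> A \<and> g b = g a"
    have "?b \<in> A \<and> g ?b = g a" by (rule someI[of _ a]) (use a in simp)
    then have "h a = h ?b" using assms(1)[of a ?b] a(1) by simp
    then show "y \<in> (\<lambda>K. h (SOME a. a \<in> A \<and> g a = K)) ` g ` A" using a by blast
  qed
qed (use assms(2) in simp)

context group
begin

lemma finite_index_anti:
  assumes "subgroup B G" "subgroup B' G" "B \<subseteq> B'" "A \<subseteq> carrier G" "finite_index G A B"
  shows "finite_index G A B'"
  unfolding finite_index_def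
proof (rule finite_image_factor)
  show "finite ((#>) B ` A)" using assms(5) by (simp add: finite_index_def)
  fix a b assume "a \<in> A" "b \<in> A" "B #> a = B #> b"
  then show "B' #> a = B' #> b"
    using rcos_eq_iff[OF assms(1), of a b] rcos_eq_iff[OF assms(2), of a b] assms(3,4) by blast
qed

end

section \<open>Cores under conjugation by a compact subgroup\<close>

context topgroup
begin

lemma B_INT:
  assumes "finite F" "F \<noteq> {}" "\<And>a. a \<in> F \<Longrightarrow> V a \<in> \<B>"
  shows "(\<Inter>a\<in>F. V a) \<in> \<B>"
  using assms
proof (induction rule: finite_ne_induct)
  case (insert a F)
  then show ?case using B_Int[of "V a" "\<Inter>a\<in>F. V a"] by simp
qed simp

definition conj_core :: "'a set \<Rightarrow> 'a set \<Rightarrow> 'a set" where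
  "conj_core K U = {x \<in> carrier G. \<forall>k\<in>K. k \<otimes> x \<otimes> inv k \<in> U}"

lemma conj_inv_image:
  assumes "U \<subseteq> carrier G" "a \<in> carrier G"
  shows "(\<lambda>x. inv a \<otimes> x \<otimes> inv (inv a)) ` U = {x \<in> carrier G. a \<otimes> x \<otimes> inv a \<in> U}"
proof (intro subset_antisym subsetI)
  have e: "a \<otimes> (inv a \<otimes> u \<otimes> a) \<otimes> inv a = u" if "u \<in> carrier G" for u
  proof -
    have "a \<otimes> (inv a \<otimes> u \<otimes> a) \<otimes> inv a = (a \<otimes> inv a) \<otimes> u \<otimes> (a \<otimes> inv a)"
      using assms that by (simp only: m_assoc m_closed inv_closed)
    then show ?thesis using assms that by simp
  qed
  have e': "inv a \<otimes> (a \<otimes> u \<otimes> inv a) \<otimes> a = u" if "u \<in> carrier G" for u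
  proof -
    have "inv a \<otimes> (a \<otimes> u \<otimes> inv a) \<otimes> a = (inv a \<otimes> a) \<otimes> u \<otimes> (inv a \<otimes> a)"
      using assms that by (simp only: m_assoc m_closed inv_closed)
    then show ?thesis using assms that by simp
  qed
  fix x
  { assume "x \<in> (\<lambda>x. inv a \<otimes> x \<otimes> inv (inv a)) ` U"
    then obtain u where u: "u \<in> U" "x = inv a \<otimes> u \<otimes> a" using assms by auto
    then have "u \<in> carrier G" using assms by blast
    then show "x \<in> {x \<in> carrier G. a \<otimes> x \<otimes> inv a \<in> U}" using u assms e by simp }
  { assume x: "x \<in> {x \<in> carrier G. a \<otimes> x \<otimes> inv a \<in> U}"
    then show "x \<in> (\<lambda>x. inv a \<otimes> x \<otimes> inv (inv a)) ` U"
      using e'[of x] assms by (intro image_eqI[of _ _ "a \<otimes> x \<otimes> inv a"]) simp_all }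
qed

text \<open>Whether conjugation by k lands in U depends only on the coset \<open>U #> k\<close>, so
  a compact K imposes finitely many conditions. This keeps the core open.\<close>

lemma conj_core_cover:
  assumes U: "subgroup U G" and K: "subgroup K G" and F: "F \<subseteq> K" "\<And>x. x \<in> K \<Longrightarrow> \<exists>a\<in>F. x \<otimes> inv a \<in> U"
  shows "conj_core K U = (\<Inter>a\<in>F. {x \<in> carrier G. a \<otimes> x \<otimes> inv a \<in> U})"
proof (intro subset_antisym subsetI)
  fix x assume "x \<in> conj_core K U"
  then show "x \<in> (\<Inter>a\<in>F. {x \<in> carrier G. a \<otimes> x \<otimes> inv a \<in> U})" using F(1) by (auto simp: conj_core_def)
next
  fix x assume x: "x \<in> (\<Inter>a\<in>F. {x \<in> carrier G. a \<otimes> x \<otimes> inv a \<in> U})"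
  note cK = subgroup.mem_carrier[OF K]
  have "F \<noteq> {}" using F(2)[OF subgroup.one_closed[OF K]] by auto
  then have xc: "x \<in> carrier G" using x by auto
  have "k \<otimes> x \<otimes> inv k \<in> U" if k: "k \<in> K" for k
  proof -
    obtain a where a: "a \<in> F" "k \<otimes> inv a \<in> U" using F(2)[OF k] by blast
    have c: "a \<in> carrier G" "k \<in> carrier G" using a(1) F(1) cK k by auto
    have ax: "a \<otimes> x \<otimes> inv a \<in> U" using x a by blast
    have "(k \<otimes> inv a) \<otimes> (a \<otimes> x \<otimes> inv a) \<otimes> inv (k \<otimes> inv a) \<in> U"
      by (intro subgroup.m_closed[OF U] subgroup.m_inv_closed[OF U] a ax)
    moreover have "(k \<otimes> inv a) \<otimes> (a \<otimes> x \<otimes> inv a) \<otimes> inv (k \<otimes> inv a)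
      = k \<otimes> (inv a \<otimes> a) \<otimes> x \<otimes> (inv a \<otimes> a) \<otimes> inv k"
      using c xc by (simp only: m_assoc m_closed inv_closed inv_mult_group inv_inv)
    ultimately show ?thesis using c xc by simp
  qed
  then show "x \<in> conj_core K U" using xc by (simp add: conj_core_def)
qed

lemma B_conj_core:
  assumes U: "U \<in> \<B>" and K: "subgroup K G" "compactin T K"
  shows "conj_core K U \<in> \<B>" "conj_core K U \<subseteq> U" "\<And>k x. k \<in> K \<Longrightarrow> x \<in> conj_core K U \<Longrightarrow> k \<otimes> x \<otimes> inv k \<in> conj_core K U"
proof -
  note B = B_dest[OF U]
  note cK = subgroup.mem_carrier[OF K(1)]
  obtain F where F: "finite F" "F \<subseteq> K" "\<And>x. x \<in> K \<Longrightarrow> \<exists>a\<in>F. x \<otimes> inv a \<in> U"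
    using compact_cover_right[OF K(2) B(1,3)] by metis
  have "F \<noteq> {}" using F(3)[OF subgroup.one_closed[OF K(1)]] by auto
  have "(\<Inter>a\<in>F. {x \<in> carrier G. a \<otimes> x \<otimes> inv a \<in> U}) \<in> \<B>"
  proof (rule B_INT[OF F(1) \<open>F \<noteq> {}\<close>])
    fix a assume "a \<in> F"
    then have a: "a \<in> carrier G" using F(2) cK by blast
    then show "{x \<in> carrier G. a \<otimes> x \<otimes> inv a \<in> U} \<in> \<B>"
      using B_conj[OF U, of "inv a"] conj_inv_image[OF B(4) a] by simp
  qed
  then show "conj_core K U \<in> \<B>" using conj_core_cover[OF B(1) K(1) F(2,3)] by simp
  show "conj_core K U \<subseteq> U"
    using subgroup.one_closed[OF K(1)] by (auto simp: conj_core_def dest: bspec[of _ _ \<one>])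
  fix k x assume k: "k \<in> K" and x: "x \<in> conj_core K U"
  have kc: "k \<in> carrier G" "x \<in> carrier G" using cK k x by (auto simp: conj_core_def)
  have "l \<otimes> (k \<otimes> x \<otimes> inv k) \<otimes> inv l \<in> U" if l: "l \<in> K" for l
  proof -
    have lc: "l \<in> carrier G" by (rule cK[OF l])
    have "l \<otimes> k \<in> K" by (rule subgroup.m_closed[OF K(1) l k])
    then have "(l \<otimes> k) \<otimes> x \<otimes> inv (l \<otimes> k) \<in> U" using x by (simp add: conj_core_def)
    then show ?thesis using kc lc by (simp add: inv_mult_group m_assoc)
  qed
  then show "k \<otimes> x \<otimes> inv k \<in> conj_core K U" using kc by (simp add: conj_core_def)
qed

end

section \<open>Comparing the homoclinic groups of two subgroups\<close>

context flow
begin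

text \<open>The preimage of H under \<open>f e\<close> contains H and has the same finite index in
  the invariant group C, hence equals H.\<close>

lemma shift_inj:
  assumes C: "subgroup C G" "\<And>i x. x \<in> C \<Longrightarrow> f i x \<in> C"
    and H: "subgroup H G" "H \<subseteq> C" "finite_index G C H" and e: "\<And>h. h \<in> H \<Longrightarrow> f e h \<in> H"
    and x: "x \<in> C" "f e x \<in> H"
  shows "x \<in> H"
proof -
  let ?H1 = "f (- e) ` H"
  have Cc: "C \<subseteq> carrier G" and Hc: "H \<subseteq> carrier G" using C(1) H(1) subgroup.subset by auto
  have fC: "f (- e) ` C = C"
  proof (intro subset_antisym subsetI)
    fix c assume "c \<in> C"
    then show "c \<in> f (- e) ` C" using C(2)[of c e] Cc by (intro image_eqI[of _ _ "f e c"]) auto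
  qed (use C(2) in blast)
  have H1: "subgroup ?H1 G" by (rule hom_image_subgroup[OF H(1) f_hom])
  have sub: "H \<subseteq> ?H1"
  proof
    fix h assume h: "h \<in> H"
    then show "h \<in> ?H1" using e[OF h] Hc by (intro image_eqI[of _ _ "f e h"]) auto
  qed
  have sub2: "?H1 \<subseteq> C" using H(2) fC by blast
  have "idx G C H = idx G (f (- e) ` C) ?H1" using idx_image(1)[OF H(1) Cc f_hom f_inj] by simp
  then have "idx G C H \<le> idx G C ?H1" using fC by simp
  then have "?H1 = H" using idx_finite_subset_eq[OF C(1) H1 H(1) sub sub2 H(3)] by blast
  moreover have "x \<in> ?H1" using x Cc by (intro image_eqI[of _ _ "f e x"]) auto
  ultimately show ?thesis by simp
qed

text \<open>This makes the nub large enough: modulo V, no homoclinic element is lost when the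
  subgroup shrinks. The closure C of the homoclinic group is compact and invariant, so inside C both
  V and W can be replaced by a normal subgroup Y of finite index, contained in both, and the orbit
  of z can be sorted into finitely many cosets.\<close>

lemma homoclinic_mult:
  assumes V: "V \<in> \<B>" and W: "W \<in> \<B>"
  shows "\<forall>z\<in>homoclinic V. \<exists>l\<in>homoclinic W. inv l \<otimes> z \<in> V"
proof
  note BV = B_dest[OF V] and BW = B_dest[OF W]
  have VW: "V \<inter> W \<in> \<B>" by (rule B_Int[OF V W])
  fix z assume z: "z \<in> homoclinic V"
  define C where "C = T closure_of homoclinic V"
  have C: "subgroup C G" unfolding C_def by (rule closure_subgroup[OF homoclinic_subgroup[OF BV(1)]])
  have Ck: "compactin T C" unfolding C_def by (rule homoclinic_closure_compact[OF V])
  have Ccl: "closedin T C" unfolding C_def by (rule closedin_closure_of)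
  note cC = subgroup.mem_carrier[OF C]
  have LC: "homoclinic V \<subseteq> C" unfolding C_def using closure_of_subset[of "homoclinic V" T] homoclinic_carrier by simp
  have fC: "f i x \<in> C" if "x \<in> C" for i x
  proof -
    have "f i ` homoclinic V \<subseteq> homoclinic V" using homoclinic_f by blast
    then have "T closure_of (f i ` homoclinic V) \<subseteq> C" unfolding C_def by (rule closure_of_mono)
    then have "f i ` C \<subseteq> C" using continuous_map_image_closure_subset[OF f_cont, of i "homoclinic V"] unfolding C_def by blast
    then show ?thesis using that by blast
  qed
  \<comment> \<open>Normalised by C, so that what is built from it by intersecting translates inside
    C stays normal in C.\<close>
  define Q where "Q = conj_core C (V \<inter> W)"
  have Q: "Q \<in> \<B>" "Q \<subseteq> V \<inter> W" "\<And>k x. k \<in> C \<Longrightarrow> x \<in> Q \<Longrightarrow> k \<otimes> x \<otimes> inv k \<in> Q"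
    unfolding Q_def using B_conj_core[OF VW C Ck] by auto
  define Y1 where "Y1 = C \<inter> Q"
  have Y1: "subgroup Y1 G" unfolding Y1_def by (rule subgroups_Inter_pair[OF C B_dest(1)[OF Q(1)]])
  have Y1cl: "closedin T Y1" unfolding Y1_def by (rule closedin_Int[OF Ccl B_closed[OF Q(1)]])
  have Y1k: "compactin T Y1" unfolding Y1_def by (rule compact_Int_closedin[OF Ck B_closed[OF Q(1)]])
  have CsC: "stay Y1 I \<subseteq> C" if "i \<in> I" for I i
  proof
    fix x assume x: "x \<in> stay Y1 I"
    have "f i x \<in> C" using stay_D[OF x that] by (simp add: Y1_def)
    from fC[OF this, of "- i"] show "x \<in> C" using stay_cD[OF x] by simp
  qed
  have fin1: "finite_index G (stay Y1 {- 1}) Y1"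
  proof (rule finite_index_mono[OF CsC])
    show "finite_index G C Y1" unfolding Y1_def finite_index_Int[OF C B_dest(1)[OF Q(1)]]
      by (rule compact_finite_index[OF Ck B_dest(1,3)[OF Q(1)]])
  qed simp
  obtain n where "tidy_above (stay Y1 {- int n..0})" using tidy_above_exists[OF Y1 Y1k Y1cl fin1] by blast
  define Y where "Y = stay Y1 {- int n..0}"
  have TAY: "tidy_above Y" unfolding Y_def by fact
  have Y: "subgroup Y G" unfolding Y_def by (rule stay_subgroup[OF Y1])
  have YY1: "Y \<subseteq> Y1" unfolding Y_def by (rule stay_sub) simp
  have YC: "Y \<subseteq> C" using YY1 Y1_def by blast
  have YV: "Y \<subseteq> V" "Y \<subseteq> W" using YY1 Y1_def Q(2) by auto
  note mY = subgroup.m_closed[OF Y] and iY = subgroup.m_inv_closed[OF Y]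
  have Yn: "c \<otimes> y \<otimes> inv c \<in> Y" if c: "c \<in> C" and y: "y \<in> Y" for c y
  proof -
    have cc: "c \<in> carrier G" "y \<in> carrier G" using cC c y YC by auto
    have "f i (c \<otimes> y \<otimes> inv c) \<in> Y1" if i: "i \<in> {- int n..0}" for i
    proof -
      have "f i y \<in> Y1" using stay_D[OF y[unfolded Y_def] i] .
      then have "f i c \<otimes> f i y \<otimes> inv (f i c) \<in> Y1"
        using Q(3) fC[OF c] subgroup.m_closed[OF C] subgroup.m_inv_closed[OF C] by (simp add: Y1_def)
      then show ?thesis using cc by (simp add: f_mult f_inv)
    qed
    then show ?thesis unfolding Y_def using cc by (simp add: stay_def)
  qed
  have finY: "finite_index G C Y"
  proof -
    have "Y = C \<inter> stay Q {- int n..0}"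
    proof (intro subset_antisym subsetI)
      fix x assume "x \<in> Y"
      then show "x \<in> C \<inter> stay Q {- int n..0}" using YC by (auto simp: Y_def stay_def Y1_def)
    next
      fix x assume "x \<in> C \<inter> stay Q {- int n..0}"
      then show "x \<in> Y" using fC by (auto simp: Y_def stay_def Y1_def)
    qed
    moreover have "stay Q {- int n..0} \<in> \<B>" by (rule B_stay[OF Q(1)]) auto
    ultimately show ?thesis
      using finite_index_Int[OF C B_dest(1)] compact_finite_index[OF Ck B_dest(1,3)] by simp
  qed
  \<comment> \<open>The forward half of being homoclinic for Y. It contains the forward-staying
    factors in the splitting of Y, so that in \<open>Ym <#> Y\<close> the second factor may be taken
    backward-staying.\<close>
  define Ym where "Ym = {x \<in> C. \<exists>n. \<forall>i\<ge>n. f i x \<in> Y}"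
  have Ym: "subgroup Ym G"
  proof (rule subgroupI)
    show "Ym \<subseteq> carrier G" using cC by (auto simp: Ym_def)
    have "\<one> \<in> Ym" unfolding Ym_def by (simp add: subgroup.one_closed[OF C] subgroup.one_closed[OF Y])
    then show "Ym \<noteq> {}" by blast
    show "inv a \<in> Ym" if "a \<in> Ym" for a
    proof -
      obtain m where m: "\<forall>i\<ge>m. f i a \<in> Y" "a \<in> C" using \<open>a \<in> Ym\<close> by (auto simp: Ym_def)
      have "\<forall>i\<ge>m. f i (inv a) \<in> Y"
      proof (intro allI impI)
        fix i assume "m \<le> i"
        with m have "inv (f i a) \<in> Y" by (intro iY) blast
        then show "f i (inv a) \<in> Y" using cC[OF m(2)] by (simp add: f_inv)
      qed
      then show ?thesis using subgroup.m_inv_closed[OF C m(2)] unfolding Ym_def by blast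
    qed
    show "a \<otimes> b \<in> Ym" if "a \<in> Ym" "b \<in> Ym" for a b
    proof -
      obtain m where m: "\<forall>i\<ge>m. f i a \<in> Y" "a \<in> C" using \<open>a \<in> Ym\<close> by (auto simp: Ym_def)
      obtain k where k: "\<forall>i\<ge>k. f i b \<in> Y" "b \<in> C" using \<open>b \<in> Ym\<close> by (auto simp: Ym_def)
      have "\<forall>i\<ge>max m k. f i (a \<otimes> b) \<in> Y"
      proof (intro allI impI)
        fix i assume "max m k \<le> i"
        then have "f i a \<otimes> f i b \<in> Y" using m k by (intro mY) simp_all
        then show "f i (a \<otimes> b) \<in> Y" using cC[OF m(2)] cC[OF k(2)] by (simp add: f_mult)
      qed
      then show ?thesis using subgroup.m_closed[OF C m(2) k(2)] unfolding Ym_def by blast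
    qed
  qed
  have Ymn: "c \<otimes> y \<otimes> inv c \<in> Ym" if c: "c \<in> C" and y: "y \<in> Ym" for c y
  proof -
    obtain m where m: "\<forall>i\<ge>m. f i y \<in> Y" "y \<in> C" using y by (auto simp: Ym_def)
    have "\<forall>i\<ge>m. f i (c \<otimes> y \<otimes> inv c) \<in> Y"
    proof (intro allI impI)
      fix i assume "m \<le> i"
      with m have "f i c \<otimes> f i y \<otimes> inv (f i c) \<in> Y" by (intro Yn fC c) blast
      then show "f i (c \<otimes> y \<otimes> inv c) \<in> Y" using cC[OF m(2)] cC[OF c] by (simp add: f_mult f_inv)
    qed
    moreover have "c \<otimes> y \<otimes> inv c \<in> C"
      by (intro subgroup.m_closed[OF C] subgroup.m_inv_closed[OF C] c m)
    ultimately show ?thesis unfolding Ym_def by blast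
  qed
  have fYm: "f i x \<in> Ym" if x: "x \<in> Ym" for i x
  proof -
    obtain m where m: "\<forall>i\<ge>m. f i x \<in> Y" "x \<in> C" using x by (auto simp: Ym_def)
    have "\<forall>j\<ge>m - i. f j (f i x) \<in> Y" using m(1) cC[OF m(2)] by (simp add: f_f)
    then show ?thesis using fC[OF m(2)] unfolding Ym_def by blast
  qed
  \<comment> \<open>P is mapped into itself by \<open>f (- 1)\<close>; having finite index in C, it
    is preserved by \<open>f 1\<close> as well.\<close>
  define P where "P = Ym <#> Y"
  have P: "subgroup P G" unfolding P_def
    by (rule mult_subgroup[OF Ym Y]) (use Ymn YC in blast)
  have YP: "Y \<subseteq> P" unfolding P_def by (rule subset_setmult[OF Ym Y])
  have PC: "P \<subseteq> C" unfolding P_def using subgroup.m_closed[OF C] YC by (auto simp: Ym_def elim!: setmultE)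
  have finP: "finite_index G C P" by (rule finite_index_anti[OF Y P YP subgroup.subset[OF C] finY])
  have CsYm: "stay Y {0..} \<subseteq> Ym"
  proof
    fix x assume x: "x \<in> stay Y {0..}"
    have "x \<in> C" using stay_0D[OF x] YC by auto
    moreover have "\<forall>i\<ge>0. f i x \<in> Y" using stay_D[OF x] by simp
    ultimately show "x \<in> Ym" unfolding Ym_def by blast
  qed
  have P_split: "\<exists>a\<in>Ym. \<exists>b\<in>stay Y {..0}. x = a \<otimes> b" if x: "x \<in> P" for x
  proof -
    obtain a y where ay: "a \<in> Ym" "y \<in> Y" "x = a \<otimes> y" using x unfolding P_def by (rule setmultE)
    obtain y1 y2 where y: "y1 \<in> stay Y {0..}" "y2 \<in> stay Y {..0}" "y = y1 \<otimes> y2" using TAY ay unfolding tidy_above_def by blast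
    have "a \<otimes> y1 \<in> Ym" by (rule subgroup.m_closed[OF Ym ay(1)]) (use y CsYm in blast)
    moreover have "x = (a \<otimes> y1) \<otimes> y2"
      using ay y subgroup.mem_carrier[OF Ym ay(1)] stay_cD[OF y(1)] stay_cD[OF y(2)] by (simp add: m_assoc)
    ultimately show ?thesis using y by blast
  qed
  have Pback: "f (- 1) x \<in> P" if x: "x \<in> P" for x
  proof -
    obtain a b where ab: "a \<in> Ym" "b \<in> stay Y {..0}" "x = a \<otimes> b" using P_split[OF x] by blast
    have "f (- 1) x = f (- 1) a \<otimes> f (- 1) b"
      using ab subgroup.mem_carrier[OF Ym ab(1)] stay_cD[OF ab(2)] by (simp add: f_mult)
    moreover have "f (- 1) b \<in> Y" using stay_D[OF ab(2), of "- 1"] by simp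
    ultimately show ?thesis unfolding P_def using mem_setmult[OF fYm[OF ab(1)]] by simp
  qed
  \<comment> \<open>Moved one step forward, y still lies in P. Its first factor there is eventually
    in Y and, as a quotient of elements with past in Y, was in Y before time 0: it is
    homoclinic.\<close>
  have key: "\<exists>a\<in>homoclinic Y. \<exists>b\<in>Y. f 1 y = a \<otimes> b" if y: "y \<in> stay Y {..0}" for y
  proof -
    have yc: "y \<in> carrier G" "y \<in> Y" using stay_cD[OF y] stay_0D[OF y] by auto
    have "f 1 y \<in> P"
      by (rule shift_inj[OF C fC P PC finP Pback, of "f 1 y"]) (use yc YC YP fC in auto)
    then obtain a b where ab: "a \<in> Ym" "b \<in> stay Y {..0}" "f 1 y = a \<otimes> b" using P_split by blast
    have c: "a \<in> carrier G" "b \<in> carrier G" using subgroup.mem_carrier[OF Ym ab(1)] stay_cD[OF ab(2)] by auto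
    obtain m where m: "\<forall>i\<ge>m. f i a \<in> Y" using ab(1) by (auto simp: Ym_def)
    have ae: "a = f 1 y \<otimes> inv b" using ab(3) c by (simp add: m_assoc)
    have "a \<in> homoclinic Y"
    proof (rule homoclinic_I[OF c(1), of m _ "- 1"])
      show "f i a \<in> Y" if "m \<le> i" for i using m that by blast
      show "f i a \<in> Y" if "i \<le> - 1" for i
      proof -
        have "f i a = f (i + 1) y \<otimes> inv (f i b)" unfolding ae using c yc by (simp add: f_mult f_inv f_f)
        moreover have "f (i + 1) y \<in> Y" "f i b \<in> Y" using stay_D[OF y, of "i + 1"] stay_D[OF ab(2), of i] that by auto
        ultimately show ?thesis using mY iY by simp
      qed
    qed
    then show ?thesis using ab stay_0D[OF ab(2)] by auto
  qed
  have LY: "subgroup (homoclinic Y) G" by (rule homoclinic_subgroup[OF Y])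
  have LYC: "homoclinic Y \<subseteq> C" using homoclinic_mono[OF YV(1)] LC by blast
  have LYn: "c \<otimes> l \<otimes> inv c \<in> homoclinic Y" if c: "c \<in> C" and l: "l \<in> homoclinic Y" for c l
  proof -
    obtain n where lc: "l \<in> carrier G" and n: "\<And>i. n \<le> \<bar>i\<bar> \<Longrightarrow> f i l \<in> Y" by (rule homoclinic_E[OF l]) blast
    show ?thesis
    proof (rule homoclinic_I0)
      show "c \<otimes> l \<otimes> inv c \<in> carrier G" using cC[OF c] lc by simp
      fix i assume i: "n \<le> \<bar>i\<bar>"
      have "f i c \<otimes> f i l \<otimes> inv (f i c) \<in> Y" by (rule Yn[OF fC[OF c] n[OF i]])
      then show "f i (c \<otimes> l \<otimes> inv c) \<in> Y" using cC[OF c] lc by (simp add: f_mult f_inv)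
    qed
  qed
  \<comment> \<open>By \<open>key\<close>, S is mapped into itself by \<open>f 1\<close>; being of
    finite index in C, it can also be pulled back along the flow.\<close>
  define S where "S = homoclinic Y <#> Y"
  have S: "subgroup S G" unfolding S_def
    by (rule mult_subgroup[OF LY Y]) (use LYn YC in blast)
  have YS: "Y \<subseteq> S" unfolding S_def by (rule subset_setmult[OF LY Y])
  have SC: "S \<subseteq> C" unfolding S_def using subgroup.m_closed[OF C] YC LYC by (auto elim!: setmultE)
  have finS: "finite_index G C S" by (rule finite_index_anti[OF Y S YS subgroup.subset[OF C] finY])
  have LS: "homoclinic Y \<subseteq> S" unfolding S_def by (rule subset_setmult[OF LY Y])
  have Sforw: "f 1 x \<in> S" if x: "x \<in> S" for x
  proof -
    note mS = subgroup.m_closed[OF S]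
    obtain l y where ly: "l \<in> homoclinic Y" "y \<in> Y" "x = l \<otimes> y" using x unfolding S_def by (rule setmultE)
    obtain y1 y2 where y: "y1 \<in> stay Y {0..}" "y2 \<in> stay Y {..0}" "y = y1 \<otimes> y2" using TAY ly unfolding tidy_above_def by blast
    obtain a b where ab: "a \<in> homoclinic Y" "b \<in> Y" "f 1 y2 = a \<otimes> b" using key[OF y(2)] by blast
    have c: "l \<in> carrier G" "y1 \<in> carrier G" "y2 \<in> carrier G"
      using homoclinic_carrier ly(1) stay_cD[OF y(1)] stay_cD[OF y(2)] by auto
    have "f 1 x = f 1 l \<otimes> f 1 y1 \<otimes> f 1 y2" using ly y c by (simp add: f_mult m_assoc)
    moreover have "f 1 l \<in> S" using homoclinic_f[OF ly(1)] LS by blast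
    moreover have "f 1 y1 \<in> S" using stay_D[OF y(1), of 1] YS by auto
    moreover have "f 1 y2 \<in> S" unfolding ab(3) using mS ab(1,2) LS YS by blast
    ultimately show ?thesis using mS by simp
  qed
  have Sback: "x \<in> S" if "x \<in> C" "f (int k) x \<in> S" for x k
    using that
  proof (induction k arbitrary: x)
    case 0 then show ?case using cC by simp
  next
    case (Suc k)
    have "f 1 x \<in> S"
    proof (rule Suc.IH)
      show "f 1 x \<in> C" by (rule fC[OF Suc.prems(1)])
      show "f (int k) (f 1 x) \<in> S" using Suc.prems cC by (simp add: f_f add.commute)
    qed
    from shift_inj[OF C fC S SC finS Sforw Suc.prems(1) this] show ?case .
  qed
  have zC: "z \<in> C" by (rule subsetD[OF LC z])
  have zc: "z \<in> carrier G" by (rule cC[OF zC])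
  obtain n' where "z \<in> carrier G" and n': "\<And>i. n' \<le> \<bar>i\<bar> \<Longrightarrow> f i z \<in> V" by (rule homoclinic_E[OF z]) blast
  \<comment> \<open>Pigeonhole on the S-cosets along the orbit of z. The difference d of the two
    times is at least n', so \<open>f d z\<close> is back in V.\<close>
  have "finite (range (\<lambda>i::nat. S #> f (int i) z))"
    by (rule finite_subset[OF _ finS[unfolded finite_index_def]]) (auto intro: fC[OF zC])
  then obtain i0 where i0: "infinite {n::nat. S #> f (int n) z = S #> f (int i0) z}"
    using pigeonhole_infinite[of UNIV "\<lambda>i::nat. S #> f (int i) z"] by auto
  obtain j where j: "j > i0 + nat \<bar>n'\<bar>" "S #> f (int j) z = S #> f (int i0) z"
    using i0 unfolding infinite_nat_iff_unbounded by blast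
  define d where "d = int j - int i0"
  have d: "d \<ge> n'" "0 \<le> d" using j d_def by auto
  have "f (int j) z \<otimes> inv (f (int i0) z) \<in> S" using j(2) rcos_eq_iff[OF S] zc by simp
  moreover have "f (int j) z \<otimes> inv (f (int i0) z) = f (int i0) (f d z \<otimes> inv z)"
    using zc by (simp add: f_mult f_inv f_f d_def)
  moreover have "f d z \<otimes> inv z \<in> C" by (intro subgroup.m_closed[OF C] subgroup.m_inv_closed[OF C] fC zC)
  ultimately have "f d z \<otimes> inv z \<in> S" using Sback by simp
  then obtain l y where ly: "l \<in> homoclinic Y" "y \<in> Y" "f d z \<otimes> inv z = l \<otimes> y" unfolding S_def by (rule setmultE)
  have c: "l \<in> carrier G" "y \<in> carrier G" using LYC YC ly cC by auto
  have v: "f d z \<in> V" using n'[of d] d by simp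
  \<comment> \<open>The conjugate of \<open>inv l\<close> by \<open>inv y\<close>, chosen so that
    \<open>inv q \<otimes> z\<close> collapses to \<open>inv y \<otimes> f d z\<close>.\<close>
  define q where "q = inv y \<otimes> inv l \<otimes> inv (inv y)"
  have q: "q \<in> homoclinic Y" unfolding q_def
    by (rule LYn) (use ly YC iY subgroup.m_inv_closed[OF LY] in auto)
  have "f d z = l \<otimes> y \<otimes> z" using inv_solve_right[of "l \<otimes> y" "f d z" z] ly(3) c zc by simp
  then have "z = inv (l \<otimes> y) \<otimes> f d z" using c zc by (simp add: inv_mult_group m_assoc) (simp add: m_assoc[symmetric])
  moreover have "inv q = inv y \<otimes> (l \<otimes> y)" using c by (simp add: q_def inv_mult_group m_assoc)
  ultimately have "inv q \<otimes> z = inv y \<otimes> (l \<otimes> y) \<otimes> (inv (l \<otimes> y) \<otimes> f d z)" by simp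
  also have "\<dots> = inv y \<otimes> ((l \<otimes> y) \<otimes> inv (l \<otimes> y)) \<otimes> f d z" using c zc by (simp only: m_assoc m_closed inv_closed f_closed)
  finally have "inv q \<otimes> z = inv y \<otimes> f d z" using c zc by simp
  moreover have "inv y \<otimes> f d z \<in> V"
    by (rule subgroup.m_closed[OF BV(1) _ v]) (use iY[OF ly(2)] YV in blast)
  ultimately have "inv q \<otimes> z \<in> V" by simp
  moreover have "q \<in> homoclinic W" using q homoclinic_mono[OF YV(2)] by (rule subsetD[rotated])
  ultimately show "\<exists>l\<in>homoclinic W. inv l \<otimes> z \<in> V" by blast
qed

end

section \<open>The automorphism group and its action on compact open subgroups\<close>

context topgroup
begin

abbreviation \<A> :: "('a \<Rightarrow> 'a) monoid" where "\<A> \<equiv> aut_group G T"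

lemma aut_carrier: "carrier \<A> = Aut G T"
  and aut_mult_compose: "\<phi> \<otimes>\<^bsub>\<A>\<^esub> \<psi> = compose (carrier G) \<phi> \<psi>"
  and aut_one_def: "\<one>\<^bsub>\<A>\<^esub> = restrict id (carrier G)"
  by (simp_all add: aut_group_def)

lemma AutD:
  assumes "\<phi> \<in> Aut G T"
  shows "\<phi> \<in> extensional (carrier G)" "\<phi> \<in> hom G G" "bij_betw \<phi> (carrier G) (carrier G)"
    "homeomorphic_map T T \<phi>" "inj_on \<phi> (carrier G)" "continuous_map T T \<phi>"
    "\<And>x. x \<in> carrier G \<Longrightarrow> \<phi> x \<in> carrier G"
  using assms unfolding Aut_def
  by (auto simp: bij_betw_def homeomorphic_imp_continuous_map)

lemma aut_mult: "x \<in> carrier G \<Longrightarrow> (\<phi> \<otimes>\<^bsub>\<A>\<^esub> \<psi>) x = \<phi> (\<psi> x)"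
  by (simp add: aut_mult_compose compose_eq)

lemma aut_one: "x \<in> carrier G \<Longrightarrow> \<one>\<^bsub>\<A>\<^esub> x = x"
  by (simp add: aut_one_def)

lemma Aut_compose:
  assumes "\<phi> \<in> Aut G T" "\<psi> \<in> Aut G T"
  shows "compose (carrier G) \<phi> \<psi> \<in> Aut G T"
proof -
  note p = AutD[OF assms(1)] and q = AutD[OF assms(2)]
  have "compose (carrier G) \<phi> \<psi> \<in> hom G G"
    by (rule homI) (use p(7) q(7) hom_mult[OF p(2)] hom_mult[OF q(2)] in \<open>simp_all add: compose_eq\<close>)
  moreover have "bij_betw (compose (carrier G) \<phi> \<psi>) (carrier G) (carrier G)"
    by (rule bij_betw_compose[OF q(3) p(3)])
  moreover have "homeomorphic_map T T (compose (carrier G) \<phi> \<psi>)"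
    by (rule homeomorphic_map_eq[OF homeomorphic_map_compose[OF q(4) p(4)]]) (simp add: compose_eq)
  ultimately show ?thesis by (simp add: Aut_def)
qed

lemma Aut_inv:
  assumes "\<phi> \<in> Aut G T"
  shows "restrict (inv_into (carrier G) \<phi>) (carrier G) \<in> Aut G T"
    "compose (carrier G) (restrict (inv_into (carrier G) \<phi>) (carrier G)) \<phi> = restrict id (carrier G)"
proof -
  note p = AutD[OF assms]
  let ?g = "restrict (inv_into (carrier G) \<phi>) (carrier G)"
  have g1: "?g (\<phi> x) = x" if "x \<in> carrier G" for x using inv_into_f_f[OF p(5) that] p(7)[OF that] by simp
  have im: "\<phi> ` carrier G = carrier G" using p(3) by (simp add: bij_betw_def)
  have g2: "\<phi> (?g x) = x" "?g x \<in> carrier G" if "x \<in> carrier G" for x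
    using f_inv_into_f[of x \<phi> "carrier G"] inv_into_into[of x \<phi> "carrier G"] that im by auto
  have "?g \<in> hom G G"
  proof (rule homI)
    fix x y assume xy: "x \<in> carrier G" "y \<in> carrier G"
    have "\<phi> (?g x \<otimes> ?g y) = x \<otimes> y" using hom_mult[OF p(2)] g2 xy by simp
    then have "?g (x \<otimes> y) = ?g (\<phi> (?g x \<otimes> ?g y))" by simp
    also have "\<dots> = ?g x \<otimes> ?g y" by (rule g1) (use g2 xy in simp)
    finally show "?g (x \<otimes> y) = ?g x \<otimes> ?g y" .
  qed (use g2 in blast)
  moreover have "bij_betw ?g (carrier G) (carrier G)"
    by (rule bij_betw_byWitness[where f' = \<phi>]) (use g1 g2 p(7) in auto)
  moreover have "homeomorphic_map T T ?g"
  proof -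
    obtain h where h: "homeomorphic_maps T T \<phi> h" using p(4) homeomorphic_map_maps by blast
    have "h y = ?g y" if "y \<in> carrier G" for y
    proof -
      have "h (\<phi> (?g y)) = ?g y" using h g2(2)[OF that] by (simp add: homeomorphic_maps_def)
      then show ?thesis using g2(1)[OF that] by simp
    qed
    moreover have "homeomorphic_map T T h" using h homeomorphic_maps_sym homeomorphic_maps_imp_map by blast
    ultimately show ?thesis using homeomorphic_map_eq[of T T h ?g] by simp
  qed
  ultimately show "?g \<in> Aut G T" by (simp add: Aut_def)
  show "compose (carrier G) ?g \<phi> = restrict id (carrier G)"
    using g1 by (auto simp: compose_def restrict_def)
qed

lemma Aut_id: "restrict id (carrier G) \<in> Aut G T"
proof -
  have "homeomorphic_map T T (restrict id (carrier G))"
    by (rule homeomorphic_map_eq[of T T id]) simp_all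
  moreover have "restrict id (carrier G) \<in> hom G G" by (rule homI) simp_all
  moreover have "bij_betw (restrict id (carrier G)) (carrier G) (carrier G)"
    by (simp add: bij_betw_def inj_on_def)
  ultimately show ?thesis by (simp add: Aut_def)
qed

lemma aut_group: "group \<A>"
proof (rule groupI)
  fix \<phi> \<psi> \<eta> assume h: "\<phi> \<in> carrier \<A>" "\<psi> \<in> carrier \<A>"
  show "\<phi> \<otimes>\<^bsub>\<A>\<^esub> \<psi> \<in> carrier \<A>" using Aut_compose h by (simp add: aut_carrier aut_mult_compose)
  { assume "\<eta> \<in> carrier \<A>"
    then show "\<phi> \<otimes>\<^bsub>\<A>\<^esub> \<psi> \<otimes>\<^bsub>\<A>\<^esub> \<eta> = \<phi> \<otimes>\<^bsub>\<A>\<^esub> (\<psi> \<otimes>\<^bsub>\<A>\<^esub> \<eta>)"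
      using AutD(7)[of \<eta>] by (simp add: aut_carrier aut_mult_compose compose_def fun_eq_iff restrict_def) }
next
  fix \<phi> assume h: "\<phi> \<in> carrier \<A>"
  show "\<one>\<^bsub>\<A>\<^esub> \<otimes>\<^bsub>\<A>\<^esub> \<phi> = \<phi>"
    using AutD(1,7)[of \<phi>] h by (simp add: aut_carrier aut_mult_compose aut_one_def compose_def restrict_def extensional_def fun_eq_iff)
  show "\<exists>\<psi>\<in>carrier \<A>. \<psi> \<otimes>\<^bsub>\<A>\<^esub> \<phi> = \<one>\<^bsub>\<A>\<^esub>"
    using Aut_inv[of \<phi>] h unfolding aut_carrier aut_mult_compose aut_one_def by blast
qed (simp add: aut_carrier aut_one_def Aut_id)

sublocale A: group \<A> by (rule aut_group)

lemma aut_hom: "\<phi> \<in> carrier \<A> \<Longrightarrow> \<phi> \<in> hom G G"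
  and aut_cont: "\<phi> \<in> carrier \<A> \<Longrightarrow> continuous_map T T \<phi>"
  and aut_inj: "\<phi> \<in> carrier \<A> \<Longrightarrow> inj_on \<phi> (carrier G)"
  and aut_closed: "\<phi> \<in> carrier \<A> \<Longrightarrow> x \<in> carrier G \<Longrightarrow> \<phi> x \<in> carrier G"
  and aut_homeo: "\<phi> \<in> carrier \<A> \<Longrightarrow> homeomorphic_map T T \<phi>"
  using AutD by (simp_all add: aut_carrier)

lemma aut_image_mult: "V \<subseteq> carrier G \<Longrightarrow> (\<phi> \<otimes>\<^bsub>\<A>\<^esub> \<psi>) ` V = \<phi> ` \<psi> ` V"
  unfolding image_image by (rule image_cong) (auto simp: aut_mult)

lemma aut_image_one: "V \<subseteq> carrier G \<Longrightarrow> \<one>\<^bsub>\<A>\<^esub> ` V = V"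
  by (auto simp: aut_one subset_iff image_iff)

lemma aut_inv_right: "\<phi> \<in> carrier \<A> \<Longrightarrow> x \<in> carrier G \<Longrightarrow> \<phi> ((inv\<^bsub>\<A>\<^esub> \<phi>) x) = x"
  using aut_mult[of x \<phi> "inv\<^bsub>\<A>\<^esub> \<phi>"] aut_one by simp

lemma aut_image_subset: "\<phi> \<in> carrier \<A> \<Longrightarrow> V \<subseteq> carrier G \<Longrightarrow> \<phi> ` V \<subseteq> carrier G"
  using aut_closed by auto

lemma aut_image_inv_left: "\<phi> \<in> carrier \<A> \<Longrightarrow> V \<subseteq> carrier G \<Longrightarrow> (inv\<^bsub>\<A>\<^esub> \<phi>) ` \<phi> ` V = V"
  using aut_image_mult[of V "inv\<^bsub>\<A>\<^esub> \<phi>" \<phi>] aut_image_one[of V] by simp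

lemma aut_image_inv_right: "\<phi> \<in> carrier \<A> \<Longrightarrow> V \<subseteq> carrier G \<Longrightarrow> \<phi> ` (inv\<^bsub>\<A>\<^esub> \<phi>) ` V = V"
  using aut_image_mult[of V \<phi> "inv\<^bsub>\<A>\<^esub> \<phi>"] aut_image_one[of V] by simp

lemma aut_image_mem: "\<phi> \<in> carrier \<A> \<Longrightarrow> V \<subseteq> carrier G \<Longrightarrow> x \<in> carrier G \<Longrightarrow> \<phi> x \<in> \<phi> ` V \<longleftrightarrow> x \<in> V"
  using inj_on_image_mem_iff[OF aut_inj] by blast

lemma aut_B: "\<phi> \<in> carrier \<A> \<Longrightarrow> V \<in> \<B> \<Longrightarrow> \<phi> ` V \<in> \<B>"
  by (rule B_image[OF _ aut_hom aut_homeo])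

lemma aut_idx: "\<phi> \<in> carrier \<A> \<Longrightarrow> V \<in> \<B> \<Longrightarrow> W \<in> \<B> \<Longrightarrow> idx G (\<phi> ` V) (\<phi> ` W) = idx G V W"
  by (rule idx_image(1)[OF B_dest(1) B_dest(4) aut_hom aut_inj])

lemma aut_mult_elt: "\<phi> \<in> carrier \<A> \<Longrightarrow> x \<in> carrier G \<Longrightarrow> y \<in> carrier G \<Longrightarrow> \<phi> (x \<otimes> y) = \<phi> x \<otimes> \<phi> y"
  using hom_mult[OF aut_hom] .

lemma aut_inv_elt: "\<phi> \<in> carrier \<A> \<Longrightarrow> x \<in> carrier G \<Longrightarrow> \<phi> (inv x) = inv (\<phi> x)"
  using group_hom.hom_inv[of G G \<phi> x] aut_hom by (simp add: group_hom_def group_hom_axioms_def is_group)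

lemma pow_flow:
  assumes "\<phi> \<in> carrier \<A>"
  shows "flow G T (\<lambda>i. \<phi> [^]\<^bsub>\<A>\<^esub> (i::int))"
proof
  have c: "\<phi> [^]\<^bsub>\<A>\<^esub> (i::int) \<in> carrier \<A>" for i using assms by simp
  fix i j :: int and x
  show "\<phi> [^]\<^bsub>\<A>\<^esub> i \<in> hom G G" by (rule aut_hom[OF c])
  show "continuous_map T T (\<phi> [^]\<^bsub>\<A>\<^esub> i)" by (rule aut_cont[OF c])
  assume "x \<in> carrier G"
  then show "(\<phi> [^]\<^bsub>\<A>\<^esub> (0::int)) x = x" "(\<phi> [^]\<^bsub>\<A>\<^esub> (i + j)) x = (\<phi> [^]\<^bsub>\<A>\<^esub> i) ((\<phi> [^]\<^bsub>\<A>\<^esub> j) x)"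
    using assms by (simp_all add: aut_one A.int_pow_mult aut_mult)
qed

end

lemma (in group) int_pow_mem_subgroup:
  assumes "subgroup K G" "x \<in> K"
  shows "x [^] (i::int) \<in> K"
  using assms subgroup.mem_carrier[OF assms] by (simp add: subgroup_int_pow_closed)

section \<open>Automorphisms commuting modulo a subgroup\<close>

text \<open>Meant for K the group of elements with bounded conjugates and R a subgroup with finite
  orbit that contains all commutators of K.\<close>

locale commuting_autos = topgroup +
  fixes K R :: "('a \<Rightarrow> 'a) set"
  assumes K: "subgroup K \<A>" and R: "subgroup R \<A>" and RK: "R \<subseteq> K"
    and comm: "\<And>\<phi> \<psi>. \<phi> \<in> K \<Longrightarrow> \<psi> \<in> K \<Longrightarrow> \<phi> \<otimes>\<^bsub>\<A>\<^esub> \<psi> \<otimes>\<^bsub>\<A>\<^esub> inv\<^bsub>\<A>\<^esub> \<phi> \<otimes>\<^bsub>\<A>\<^esub> inv\<^bsub>\<A>\<^esub> \<psi> \<in> R"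
begin

text \<open>On these subgroups K acts as an abelian group: the two orders of composition differ by
  an element of R, which fixes them.\<close>

definition inv_subgroups :: "'a set set" where
  "inv_subgroups = {V \<in> \<B>. \<forall>\<rho>\<in>R. \<rho> ` V = V}"

lemma KA: "\<phi> \<in> K \<Longrightarrow> \<phi> \<in> carrier \<A>"
  by (rule subgroup.mem_carrier[OF K])

lemma inv_subgroups_B: "V \<in> inv_subgroups \<Longrightarrow> V \<in> \<B>" and inv_subgroups_R: "V \<in> inv_subgroups \<Longrightarrow> \<rho> \<in> R \<Longrightarrow> \<rho> ` V = V"
  by (auto simp: inv_subgroups_def)

lemma inv_subgroups_c: "V \<in> inv_subgroups \<Longrightarrow> V \<subseteq> carrier G"
  by (rule B_dest(4)[OF inv_subgroups_B])

lemma comm_image_sub: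
  assumes "V \<subseteq> carrier G" "\<And>\<rho>. \<rho> \<in> R \<Longrightarrow> \<rho> ` V = V" and p: "\<phi> \<in> K" "\<psi> \<in> K"
  shows "\<phi> ` \<psi> ` V = \<psi> ` \<phi> ` V"
proof -
  note c = KA[OF p(1)] KA[OF p(2)]
  let ?\<rho> = "inv\<^bsub>\<A>\<^esub> \<phi> \<otimes>\<^bsub>\<A>\<^esub> inv\<^bsub>\<A>\<^esub> \<psi> \<otimes>\<^bsub>\<A>\<^esub> \<phi> \<otimes>\<^bsub>\<A>\<^esub> \<psi>"
  have "?\<rho> \<in> R"
    using comm[of "inv\<^bsub>\<A>\<^esub> \<phi>" "inv\<^bsub>\<A>\<^esub> \<psi>"] subgroup.m_inv_closed[OF K] p c by simp
  have "\<psi> \<otimes>\<^bsub>\<A>\<^esub> \<phi> \<otimes>\<^bsub>\<A>\<^esub> ?\<rho> = \<phi> \<otimes>\<^bsub>\<A>\<^esub> \<psi>"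
  proof -
    have "\<psi> \<otimes>\<^bsub>\<A>\<^esub> \<phi> \<otimes>\<^bsub>\<A>\<^esub> ?\<rho> = \<psi> \<otimes>\<^bsub>\<A>\<^esub> (\<phi> \<otimes>\<^bsub>\<A>\<^esub> inv\<^bsub>\<A>\<^esub> \<phi>) \<otimes>\<^bsub>\<A>\<^esub> inv\<^bsub>\<A>\<^esub> \<psi> \<otimes>\<^bsub>\<A>\<^esub> \<phi> \<otimes>\<^bsub>\<A>\<^esub> \<psi>"
      using c by (simp only: A.m_assoc A.m_closed A.inv_closed)
    then show ?thesis using c by simp
  qed
  then have "(\<phi> \<otimes>\<^bsub>\<A>\<^esub> \<psi>) ` V = (\<psi> \<otimes>\<^bsub>\<A>\<^esub> \<phi>) ` ?\<rho> ` V"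
    using aut_image_mult[OF assms(1), of "\<psi> \<otimes>\<^bsub>\<A>\<^esub> \<phi>" ?\<rho>] by simp
  also have "\<dots> = (\<psi> \<otimes>\<^bsub>\<A>\<^esub> \<phi>) ` V" using assms(2) \<open>?\<rho> \<in> R\<close> by simp
  finally show ?thesis using aut_image_mult[OF assms(1)] by simp
qed

lemma inv_subgroups_comm: "V \<in> inv_subgroups \<Longrightarrow> \<phi> \<in> K \<Longrightarrow> \<psi> \<in> K \<Longrightarrow> \<phi> ` \<psi> ` V = \<psi> ` \<phi> ` V"
  by (rule comm_image_sub[OF inv_subgroups_c inv_subgroups_R])

lemma inv_subgroups_act: 
  assumes "V \<in> inv_subgroups" "\<phi> \<in> K"
  shows "\<phi> ` V \<in> inv_subgroups"
  using aut_B[OF KA[OF assms(2)] inv_subgroups_B[OF assms(1)]] inv_subgroups_comm[OF assms(1) _ assms(2)] RK inv_subgroups_R[OF assms(1)]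
  by (simp add: inv_subgroups_def subset_iff)

lemma inv_subgroups_Int: "V \<in> inv_subgroups \<Longrightarrow> W \<in> inv_subgroups \<Longrightarrow> V \<inter> W \<in> inv_subgroups"
proof -
  assume V: "V \<in> inv_subgroups" and W: "W \<in> inv_subgroups"
  have "\<rho> ` (V \<inter> W) = V \<inter> W" if r: "\<rho> \<in> R" for \<rho>
  proof -
    have "\<rho> \<in> carrier \<A>" by (rule subgroup.mem_carrier[OF R r])
    then have "\<rho> ` (V \<inter> W) = \<rho> ` V \<inter> \<rho> ` W" by (rule inj_on_image_Int[OF aut_inj _ _, OF _ inv_subgroups_c[OF V] inv_subgroups_c[OF W]])
    then show ?thesis using inv_subgroups_R[OF V r] inv_subgroups_R[OF W r] by simp
  qed
  then show ?thesis using B_Int[OF inv_subgroups_B[OF V] inv_subgroups_B[OF W]] by (simp add: inv_subgroups_def)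
qed

abbreviation powers :: "('a \<Rightarrow> 'a) \<Rightarrow> int \<Rightarrow> 'a \<Rightarrow> 'a" where
  "powers \<phi> \<equiv> (\<lambda>i. \<phi> [^]\<^bsub>\<A>\<^esub> i)"

abbreviation stay_for :: "('a \<Rightarrow> 'a) \<Rightarrow> 'a set \<Rightarrow> int set \<Rightarrow> 'a set" where
  "stay_for \<phi> \<equiv> flow.stay G (powers \<phi>)"

abbreviation homoclinic_for :: "('a \<Rightarrow> 'a) \<Rightarrow> 'a set \<Rightarrow> 'a set" where
  "homoclinic_for \<phi> \<equiv> flow.homoclinic G (powers \<phi>)"

abbreviation straight_for :: "('a \<Rightarrow> 'a) \<Rightarrow> 'a set \<Rightarrow> bool" where
  "straight_for \<phi> \<equiv> flow.straight G (powers \<phi>)"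

lemma flow_powers: "\<phi> \<in> K \<Longrightarrow> flow G T (powers \<phi>)"
  by (rule pow_flow[OF KA])

lemma powK: "\<phi> \<in> K \<Longrightarrow> \<phi> [^]\<^bsub>\<A>\<^esub> (i::int) \<in> K"
  by (rule A.int_pow_mem_subgroup[OF K])

lemma pow_mem_image:
  assumes V: "V \<in> inv_subgroups" and p: "\<phi> \<in> K" "\<psi> \<in> K" and x: "x \<in> carrier G"
  shows "(\<phi> [^]\<^bsub>\<A>\<^esub> (i::int)) (\<psi> x) \<in> \<psi> ` V \<longleftrightarrow> (\<phi> [^]\<^bsub>\<A>\<^esub> i) x \<in> V"
proof -
  let ?g = "\<phi> [^]\<^bsub>\<A>\<^esub> i" and ?h = "\<phi> [^]\<^bsub>\<A>\<^esub> (- i)"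
  interpret flow G T "powers \<phi>" by (rule flow_powers[OF p(1)])
  note c = KA[OF p(2)]
  have px: "\<psi> x \<in> carrier G" by (rule aut_closed[OF c x])
  have "?g (\<psi> x) \<in> \<psi> ` V \<longleftrightarrow> \<psi> x \<in> ?h ` \<psi> ` V"
    using f_image_iff[OF aut_image_subset[OF c inv_subgroups_c[OF V]] px, of "- i"] by simp
  also have "?h ` \<psi> ` V = \<psi> ` ?h ` V" by (rule inv_subgroups_comm[OF V powK[OF p(1)] p(2)])
  also have "\<psi> x \<in> \<psi> ` ?h ` V \<longleftrightarrow> x \<in> ?h ` V"
    by (rule aut_image_mem[OF c aut_image_subset[OF KA[OF powK[OF p(1)]] inv_subgroups_c[OF V]] x])
  also have "x \<in> ?h ` V \<longleftrightarrow> ?g x \<in> V" using f_image_iff[OF inv_subgroups_c[OF V] x, of "- i"] by simp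
  finally show ?thesis .
qed

lemma homoclinic_for_image:
  assumes V: "V \<in> inv_subgroups" and p: "\<phi> \<in> K" "\<psi> \<in> K"
  shows "\<psi> ` homoclinic_for \<phi> V = homoclinic_for \<phi> (\<psi> ` V)"
proof -
  interpret flow G T "powers \<phi>" by (rule flow_powers[OF p(1)])
  note c = KA[OF p(2)]
  have e: "\<psi> x \<in> homoclinic_for \<phi> (\<psi> ` V) \<longleftrightarrow> x \<in> homoclinic_for \<phi> V" if "x \<in> carrier G" for x
    using that aut_closed[OF c that] pow_mem_image[OF V p that] by (simp add: homoclinic_def)
  show ?thesis
  proof (intro subset_antisym subsetI)
    fix y assume "y \<in> \<psi> ` homoclinic_for \<phi> V"
    then obtain x where "x \<in> homoclinic_for \<phi> V" "y = \<psi> x" by blast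
    then show "y \<in> homoclinic_for \<phi> (\<psi> ` V)" using e[of x] homoclinic_carrier[of V] by blast
  next
    fix y assume y: "y \<in> homoclinic_for \<phi> (\<psi> ` V)"
    then have yc: "y \<in> carrier G" using homoclinic_carrier by blast
    let ?x = "(inv\<^bsub>\<A>\<^esub> \<psi>) y"
    have xc: "?x \<in> carrier G" using aut_closed[OF _ yc] c by simp
    have "\<psi> ?x = y" by (rule aut_inv_right[OF c yc])
    then show "y \<in> \<psi> ` homoclinic_for \<phi> V" using e[OF xc] y by (metis imageI)
  qed
qed

lemma inv_subgroups_stay:
  assumes V: "V \<in> inv_subgroups" and p: "\<phi> \<in> K" and I: "finite I" "I \<noteq> {}"
  shows "stay_for \<phi> V I \<in> inv_subgroups"
  using I
proof (induction rule: finite_ne_induct)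
  interpret flow G T "powers \<phi>" by (rule flow_powers[OF p])
  case (singleton i)
  have "stay V {i} = (\<phi> [^]\<^bsub>\<A>\<^esub> (- i)) ` V" using f_image_stay[OF inv_subgroups_c[OF V], of "- i"] by simp
  then show ?case using inv_subgroups_act[OF V powK[OF p]] by simp
next
  interpret flow G T "powers \<phi>" by (rule flow_powers[OF p])
  case (insert i I)
  have "stay V (insert i I) = (\<phi> [^]\<^bsub>\<A>\<^esub> (- i)) ` V \<inter> stay V I"
    using f_image_stay[OF inv_subgroups_c[OF V], of "- i"] by (auto simp: stay_def)
  then show ?case using inv_subgroups_act[OF V powK[OF p]] insert inv_subgroups_Int by simp
qed

lemma inv_subgroups_core:
  assumes V: "V \<in> inv_subgroups" and N: "subgroup N G" "compactin T N" "\<And>\<rho>. \<rho> \<in> R \<Longrightarrow> \<rho> ` N = N"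
  shows "conj_core N V \<in> inv_subgroups"
proof -
  have sub: "\<rho> ` conj_core N V \<subseteq> conj_core N V" if r: "\<rho> \<in> R" for \<rho>
  proof
    have c: "\<rho> \<in> carrier \<A>" by (rule subgroup.mem_carrier[OF R r])
    fix y assume "y \<in> \<rho> ` conj_core N V"
    then obtain x where x: "x \<in> conj_core N V" "y = \<rho> x" by blast
    then have xc: "x \<in> carrier G" by (simp add: conj_core_def)
    have "k \<otimes> \<rho> x \<otimes> inv k \<in> V" if k: "k \<in> N" for k
    proof -
      obtain l where l: "l \<in> N" "k = \<rho> l" using N(3)[OF r] k by blast
      have lc: "l \<in> carrier G" by (rule subgroup.mem_carrier[OF N(1) l(1)])
      have "l \<otimes> x \<otimes> inv l \<in> V" using x l by (simp add: conj_core_def)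
      then have "\<rho> (l \<otimes> x \<otimes> inv l) \<in> V" using inv_subgroups_R[OF V r] by blast
      then show ?thesis unfolding l(2) using lc xc c by (simp add: aut_mult_elt aut_inv_elt)
    qed
    then show "y \<in> conj_core N V" using x xc aut_closed[OF c] by (simp add: conj_core_def)
  qed
  have "\<rho> ` conj_core N V = conj_core N V" if r: "\<rho> \<in> R" for \<rho>
  proof
    have c: "\<rho> \<in> carrier \<A>" by (rule subgroup.mem_carrier[OF R r])
    have cc: "conj_core N V \<subseteq> carrier G" by (auto simp: conj_core_def)
    have "(inv\<^bsub>\<A>\<^esub> \<rho>) ` conj_core N V \<subseteq> conj_core N V" by (rule sub[OF subgroup.m_inv_closed[OF R r]])
    then have "\<rho> ` (inv\<^bsub>\<A>\<^esub> \<rho>) ` conj_core N V \<subseteq> \<rho> ` conj_core N V" by (rule image_mono)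
    then show "conj_core N V \<subseteq> \<rho> ` conj_core N V" using aut_image_inv_right[OF c cc] by simp
  qed (rule sub[OF r])
  then show ?thesis using B_conj_core(1)[OF inv_subgroups_B[OF V] N(1,2)] by (simp add: inv_subgroups_def)
qed

lemma inv_subgroups_mult:
  assumes V: "V \<in> inv_subgroups" and N: "subgroup N G" "compactin T N" "\<And>\<rho>. \<rho> \<in> R \<Longrightarrow> \<rho> ` N = N"
    and n: "\<And>l v. l \<in> N \<Longrightarrow> v \<in> V \<Longrightarrow> l \<otimes> v \<otimes> inv l \<in> V"
  shows "V <#> N \<in> inv_subgroups"
proof -
  note B = B_dest[OF inv_subgroups_B[OF V]]
  have sg: "subgroup (V <#> N) G" by (rule mult_subgroup[OF B(1) N(1) n])
  have Nc: "N \<subseteq> carrier G" by (rule subgroup.subset[OF N(1)])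
  have "openin T (V <#> N)"
  proof -
    \<comment> \<open>Openness is visible in the other order, as a union of left translates of
      V.\<close>
    have "V <#> N = N <#> V"
    proof (intro subset_antisym subsetI)
      fix x assume "x \<in> V <#> N"
      then obtain v l where vl: "v \<in> V" "l \<in> N" "x = v \<otimes> l" by (rule setmultE)
      have c: "v \<in> carrier G" "l \<in> carrier G" using vl B(4) Nc by auto
      have "inv l \<otimes> v \<otimes> inv (inv l) \<in> V" by (rule n[OF subgroup.m_inv_closed[OF N(1) vl(2)] vl(1)])
      then have "l \<otimes> (inv l \<otimes> v \<otimes> inv (inv l)) \<in> N <#> V" by (rule mem_setmult[OF vl(2)])
      moreover have "l \<otimes> (inv l \<otimes> v \<otimes> inv (inv l)) = x" using c vl by (simp add: m_assoc[symmetric])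
      ultimately show "x \<in> N <#> V" by simp
    next
      fix x assume "x \<in> N <#> V"
      then obtain l v where vl: "l \<in> N" "v \<in> V" "x = l \<otimes> v" by (rule setmultE)
      have c: "v \<in> carrier G" "l \<in> carrier G" using vl B(4) Nc by auto
      have "(l \<otimes> v \<otimes> inv l) \<otimes> l \<in> V <#> N" by (rule mem_setmult[OF n[OF vl(1,2)] vl(1)])
      then show "x \<in> V <#> N" using c vl by (simp add: m_assoc)
    qed
    then show ?thesis using open_mult_right[OF B(3) Nc] by simp
  qed
  moreover have "compactin T (V <#> N)" by (rule compact_mult[OF B(2) N(2)])
  moreover have "\<rho> ` (V <#> N) = V <#> N" if r: "\<rho> \<in> R" for \<rho>
  proof -
    have c: "\<rho> \<in> carrier \<A>" by (rule subgroup.mem_carrier[OF R r])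
    have "\<rho> ` (V <#> N) = \<rho> ` V <#> \<rho> ` N"
    proof (intro subset_antisym subsetI)
      fix y assume "y \<in> \<rho> ` (V <#> N)"
      then obtain v l where vl: "v \<in> V" "l \<in> N" "y = \<rho> (v \<otimes> l)" by (auto elim!: setmultE)
      then have "y = \<rho> v \<otimes> \<rho> l" using B(4) Nc c by (simp add: aut_mult_elt subset_iff)
      then show "y \<in> \<rho> ` V <#> \<rho> ` N" using mem_setmult[of "\<rho> v" "\<rho> ` V" "\<rho> l" "\<rho> ` N"] vl by simp
    next
      fix y assume "y \<in> \<rho> ` V <#> \<rho> ` N"
      then obtain v l where vl: "v \<in> V" "l \<in> N" "y = \<rho> v \<otimes> \<rho> l" by (auto elim!: setmultE)
      then have "y = \<rho> (v \<otimes> l)" using B(4) Nc c by (simp add: aut_mult_elt subset_iff)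
      then show "y \<in> \<rho> ` (V <#> N)" using mem_setmult[OF vl(1,2)] by simp
    qed
    then show ?thesis using inv_subgroups_R[OF V r] N(3)[OF r] by simp
  qed
  ultimately show ?thesis using sg by (simp add: inv_subgroups_def cpt_open_subgroups_def)
qed

end

section \<open>Nubs and simultaneous tidying\<close>

locale commuting_autos_ne = commuting_autos +
  assumes ne: "inv_subgroups \<noteq> {}"
begin

text \<open>Only invariant subgroups are intersected: K permutes them, which makes the nub invariant
  under all of K and not merely under \<phi>.\<close>

definition nub :: "('a \<Rightarrow> 'a) \<Rightarrow> 'a set" where
  "nub \<phi> = (\<Inter>V\<in>inv_subgroups. T closure_of homoclinic_for \<phi> V)"

lemma nub_props:
  assumes p: "\<phi> \<in> K"
  shows "subgroup (nub \<phi>) G" "closedin T (nub \<phi>)" "compactin T (nub \<phi>)"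
proof -
  interpret flow G T "powers \<phi>" by (rule flow_powers[OF p])
  show "subgroup (nub \<phi>) G" unfolding nub_def
    by (rule subgroups_Inter) (use ne closure_subgroup[OF homoclinic_subgroup[OF B_dest(1)[OF inv_subgroups_B]]] in auto)
  show cl: "closedin T (nub \<phi>)" unfolding nub_def by (rule closedin_Inter) (use ne in auto)
  obtain V where V: "V \<in> inv_subgroups" using ne by blast
  have "nub \<phi> \<subseteq> T closure_of homoclinic_for \<phi> V" using V by (auto simp: nub_def)
  then show "compactin T (nub \<phi>)" using closed_compactin[OF homoclinic_closure_compact[OF inv_subgroups_B[OF V]] _ cl] by blast
qed

lemma nub_image_sub:
  assumes p: "\<phi> \<in> K" "\<psi> \<in> K"
  shows "\<psi> ` nub \<phi> \<subseteq> nub \<phi>"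
proof -
  interpret flow G T "powers \<phi>" by (rule flow_powers[OF p(1)])
  have "\<psi> ` nub \<phi> \<subseteq> T closure_of homoclinic_for \<phi> V" if V: "V \<in> inv_subgroups" for V
  proof -
    let ?W = "(inv\<^bsub>\<A>\<^esub> \<psi>) ` V"
    have W: "?W \<in> inv_subgroups" by (rule inv_subgroups_act[OF V subgroup.m_inv_closed[OF K p(2)]])
    have "nub \<phi> \<subseteq> T closure_of homoclinic_for \<phi> ?W" using W by (auto simp: nub_def)
    then have "\<psi> ` nub \<phi> \<subseteq> \<psi> ` (T closure_of homoclinic_for \<phi> ?W)" by (rule image_mono)
    also have "\<dots> \<subseteq> T closure_of (\<psi> ` homoclinic_for \<phi> ?W)" by (rule continuous_map_image_closure_subset[OF aut_cont[OF KA[OF p(2)]]])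
    also have "\<psi> ` homoclinic_for \<phi> ?W = homoclinic_for \<phi> V"
      using homoclinic_for_image[OF W p] aut_image_inv_right[OF KA[OF p(2)] inv_subgroups_c[OF V]] by simp
    finally show ?thesis .
  qed
  then show ?thesis by (auto simp: nub_def)
qed

lemma nub_image:
  assumes p: "\<phi> \<in> K" "\<psi> \<in> K"
  shows "\<psi> ` nub \<phi> = nub \<phi>"
proof
  have "(inv\<^bsub>\<A>\<^esub> \<psi>) ` nub \<phi> \<subseteq> nub \<phi>" by (rule nub_image_sub[OF p(1) subgroup.m_inv_closed[OF K p(2)]])
  then have "\<psi> ` (inv\<^bsub>\<A>\<^esub> \<psi>) ` nub \<phi> \<subseteq> \<psi> ` nub \<phi>" by (rule image_mono)
  then show "nub \<phi> \<subseteq> \<psi> ` nub \<phi>"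
    using aut_image_inv_right[OF KA[OF p(2)] subgroup.subset[OF nub_props(1)[OF p(1)]]] by simp
qed (rule nub_image_sub[OF p])

lemma nub_R: "\<phi> \<in> K \<Longrightarrow> \<rho> \<in> R \<Longrightarrow> \<rho> ` nub \<phi> = nub \<phi>"
  using nub_image RK by blast

text \<open>The elements l with \<open>inv l \<otimes> z \<in> V\<close> form the compact set
  \<open>?S\<close>. By \<open>homoclinic_mult\<close> it meets the closure of each homoclinic
  group; these closures are directed downwards, and a common point lies in the nub.\<close>

lemma homoclinic_nub:
  assumes p: "\<phi> \<in> K" and V: "V \<in> inv_subgroups" and z: "z \<in> homoclinic_for \<phi> V"
  shows "\<exists>l\<in>nub \<phi>. inv l \<otimes> z \<in> V"
proof -
  interpret flow G T "powers \<phi>" by (rule flow_powers[OF p])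
  note B = B_dest[OF inv_subgroups_B[OF V]]
  have zc: "z \<in> carrier G" using z homoclinic_carrier by blast
  let ?S = "(\<lambda>v. z \<otimes> inv v) ` V"
  have "continuous_map T T (\<lambda>v. z \<otimes> inv v)" by (rule cont_mult2[OF cont_const[OF zc] cont_inv])
  then have S: "compactin T ?S" by (rule image_compactin[OF B(2)])
  have mem: "l \<in> ?S" if "l \<in> carrier G" "inv l \<otimes> z \<in> V" for l
  proof
    show "l = z \<otimes> inv (inv l \<otimes> z)" using that zc by (simp add: inv_mult_group m_assoc[symmetric])
  qed (rule that(2))
  have "?S \<inter> \<Inter>((\<lambda>W. T closure_of homoclinic_for \<phi> W) ` inv_subgroups) \<noteq> {}"
  proof (rule compact_directed[OF S])
    fix C assume "C \<in> (\<lambda>W. T closure_of homoclinic_for \<phi> W) ` inv_subgroups"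
    then obtain W where W: "W \<in> inv_subgroups" "C = T closure_of homoclinic_for \<phi> W" by blast
    show "closedin T C" using W by simp
    obtain l where l: "l \<in> homoclinic_for \<phi> W" "inv l \<otimes> z \<in> V" using homoclinic_mult[OF inv_subgroups_B[OF V] inv_subgroups_B[OF W(1)]] z by blast
    have lc: "l \<in> carrier G" using l homoclinic_carrier by blast
    have "l \<in> C" using closure_of_subset[of "homoclinic_for \<phi> W" T] homoclinic_carrier l W by auto
    then show "?S \<inter> C \<noteq> {}" using mem[OF lc l(2)] by blast
  next
    fix C D assume "C \<in> (\<lambda>W. T closure_of homoclinic_for \<phi> W) ` inv_subgroups" "D \<in> (\<lambda>W. T closure_of homoclinic_for \<phi> W) ` inv_subgroups"
    then obtain U W where W: "U \<in> inv_subgroups" "W \<in> inv_subgroups" "C = T closure_of homoclinic_for \<phi> U" "D = T closure_of homoclinic_for \<phi> W" by blast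
    have "T closure_of homoclinic_for \<phi> (U \<inter> W) \<subseteq> C \<inter> D"
      unfolding W using closure_of_mono[OF homoclinic_mono[of "U \<inter> W" U]] closure_of_mono[OF homoclinic_mono[of "U \<inter> W" W]] by auto
    then show "\<exists>E\<in>(\<lambda>W. T closure_of homoclinic_for \<phi> W) ` inv_subgroups. E \<subseteq> C \<inter> D" using inv_subgroups_Int[OF W(1,2)] by blast
  qed (use ne in simp)
  then obtain l where l: "l \<in> ?S" "l \<in> nub \<phi>" by (auto simp: nub_def)
  then obtain v where v: "v \<in> V" "l = z \<otimes> inv v" by blast
  then have "inv l \<otimes> z = v" using zc subsetD[OF B(4) v(1)] by (simp add: inv_mult_group m_assoc)
  then have "inv l \<otimes> z \<in> V" using v(1) by simp
  then show ?thesis using l(2) by blast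
qed

text \<open>Every V contains an invariant subgroup normalised by \<open>nub \<psi>\<close>, namely a
  core. Since \<open>nub \<psi>\<close> is K-invariant, the whole \<phi>-orbit of l normalises it,
  so conjugation by l preserves its homoclinic group and the closure.\<close>

lemma nub_normalises:
  assumes p: "\<phi> \<in> K" "\<psi> \<in> K" and l: "l \<in> nub \<psi>" and x: "x \<in> nub \<phi>"
  shows "l \<otimes> x \<otimes> inv l \<in> nub \<phi>"
proof -
  interpret flow G T "powers \<phi>" by (rule flow_powers[OF p(1)])
  note N = nub_props[OF p(2)]
  have lc: "l \<in> carrier G" by (rule subgroup.mem_carrier[OF N(1) l])
  have "l \<otimes> x \<otimes> inv l \<in> T closure_of homoclinic_for \<phi> V" if V: "V \<in> inv_subgroups" for V
  proof -
    let ?W = "conj_core (nub \<psi>) V"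
    have W: "?W \<in> inv_subgroups" by (rule inv_subgroups_core[OF V N(1,3) nub_R[OF p(2)]])
    have "(\<lambda>y. l \<otimes> y \<otimes> inv l) ` homoclinic_for \<phi> ?W \<subseteq> homoclinic_for \<phi> ?W"
    proof clarify
      fix y assume y: "y \<in> homoclinic_for \<phi> ?W"
      obtain n where n: "\<forall>i::int. n \<le> \<bar>i\<bar> \<longrightarrow> (\<phi> [^]\<^bsub>\<A>\<^esub> i) y \<in> ?W"
        using y by (auto simp: homoclinic_def)
      have yc: "y \<in> carrier G" using y homoclinic_carrier by blast
      show "l \<otimes> y \<otimes> inv l \<in> homoclinic_for \<phi> ?W"
      proof (rule homoclinic_I0)
        fix i assume i: "n \<le> \<bar>i\<bar>"
        have "(\<phi> [^]\<^bsub>\<A>\<^esub> i) l \<in> nub \<psi>" using nub_image[OF p(2) powK[OF p(1)]] l by blast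
        from B_conj_core(3)[OF inv_subgroups_B[OF V] N(1,3) this n[rule_format, OF i]]
        show "(\<phi> [^]\<^bsub>\<A>\<^esub> i) (l \<otimes> y \<otimes> inv l) \<in> ?W" using lc yc by (simp add: f_mult f_inv)
      qed (use lc yc in simp)
    qed
    then have "T closure_of ((\<lambda>y. l \<otimes> y \<otimes> inv l) ` homoclinic_for \<phi> ?W) \<subseteq> T closure_of homoclinic_for \<phi> ?W" by (rule closure_of_mono)
    then have s: "(\<lambda>y. l \<otimes> y \<otimes> inv l) ` (T closure_of homoclinic_for \<phi> ?W) \<subseteq> T closure_of homoclinic_for \<phi> ?W"
      by (rule subset_trans[OF continuous_map_image_closure_subset[OF cont_conj[OF lc]]])
    have "x \<in> T closure_of homoclinic_for \<phi> ?W" using x W by (auto simp: nub_def)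
    then have "l \<otimes> x \<otimes> inv l \<in> T closure_of homoclinic_for \<phi> ?W" using s by blast
    then show ?thesis
      using closure_of_mono[OF homoclinic_mono[OF B_conj_core(2)[OF inv_subgroups_B[OF V] N(1,3)]]] by blast
  qed
  then show ?thesis by (simp add: nub_def)
qed

text \<open>Passing to the core for a new nub keeps the earlier normalisations, because conjugation
  by the new nub maps each earlier nub into itself.\<close>

lemma ex_normalised:
  assumes "finite \<Phi>" "\<Phi> \<subseteq> K"
  shows "\<exists>V\<in>inv_subgroups. \<forall>\<phi>\<in>\<Phi>. \<forall>l\<in>nub \<phi>. \<forall>v\<in>V. l \<otimes> v \<otimes> inv l \<in> V"
  using assms
proof (induction \<Phi>)
  case empty
  then show ?case using ne by auto
next
  case (insert \<phi> \<Phi>)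
  then obtain V where V: "V \<in> inv_subgroups" "\<And>\<psi> l v. \<psi> \<in> \<Phi> \<Longrightarrow> l \<in> nub \<psi> \<Longrightarrow> v \<in> V \<Longrightarrow> l \<otimes> v \<otimes> inv l \<in> V" by auto
  have p: "\<phi> \<in> K" using insert by auto
  note N = nub_props[OF p]
  let ?W = "conj_core (nub \<phi>) V"
  have W: "?W \<in> inv_subgroups" by (rule inv_subgroups_core[OF V(1) N(1,3) nub_R[OF p]])
  have "l \<otimes> v \<otimes> inv l \<in> ?W" if h: "\<psi> \<in> insert \<phi> \<Phi>" "l \<in> nub \<psi>" "v \<in> ?W" for \<psi> l v
  proof (cases "\<psi> = \<phi>")
    case True
    then show ?thesis using B_conj_core(3)[OF inv_subgroups_B[OF V(1)] N(1,3)] h by simp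
  next
    case False
    then have ps: "\<psi> \<in> \<Phi>" "\<psi> \<in> K" using h insert by auto
    have c: "l \<in> carrier G" "v \<in> carrier G"
      using subgroup.mem_carrier[OF nub_props(1)[OF ps(2)] h(2)] h(3) by (auto simp: conj_core_def)
    have "k \<otimes> (l \<otimes> v \<otimes> inv l) \<otimes> inv k \<in> V" if k: "k \<in> nub \<phi>" for k
    proof -
      have kc: "k \<in> carrier G" by (rule subgroup.mem_carrier[OF N(1) k])
      let ?l = "k \<otimes> l \<otimes> inv k"
      have "?l \<in> nub \<psi>" by (rule nub_normalises[OF ps(2) p k h(2)])
      moreover have "k \<otimes> v \<otimes> inv k \<in> V" using h(3) k by (simp add: conj_core_def)
      ultimately have "?l \<otimes> (k \<otimes> v \<otimes> inv k) \<otimes> inv ?l \<in> V" using V(2)[OF ps(1)] by blast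
      moreover have "?l \<otimes> (k \<otimes> v \<otimes> inv k) \<otimes> inv ?l
         = k \<otimes> l \<otimes> (inv k \<otimes> k) \<otimes> v \<otimes> (inv k \<otimes> k) \<otimes> inv l \<otimes> inv k"
        using kc c by (simp only: inv_mult_group inv_inv inv_closed m_assoc m_closed)
      moreover have "\<dots> = k \<otimes> (l \<otimes> v \<otimes> inv l) \<otimes> inv k"
        using kc c by (simp add: m_assoc)
      ultimately show ?thesis by simp
    qed
    then show ?thesis using c by (simp add: conj_core_def)
  qed
  then show ?case using W by blast
qed

text \<open>A nub that normalises V can be multiplied into V. Normalisation by the other nubs
  survives, as nubs normalise each other, so they are absorbed one after the other.\<close>

lemma ex_containing:
  assumes "finite \<Phi>" "\<Phi> \<subseteq> K"
  shows "\<exists>V\<in>inv_subgroups. \<forall>\<phi>\<in>\<Phi>. nub \<phi> \<subseteq> V"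
proof -
  have "\<exists>V\<in>inv_subgroups. (\<forall>\<phi>\<in>\<Phi>. \<forall>l\<in>nub \<phi>. \<forall>v\<in>V. l \<otimes> v \<otimes> inv l \<in> V) \<and> (\<forall>\<phi>\<in>\<Psi>. nub \<phi> \<subseteq> V)"
    if "finite \<Psi>" "\<Psi> \<subseteq> \<Phi>" for \<Psi>
    using that
  proof (induction \<Psi>)
    case empty
    then show ?case using ex_normalised[OF assms] by simp
  next
    case (insert \<phi> \<Psi>)
    then obtain V where V: "V \<in> inv_subgroups" "\<And>\<psi> l v. \<psi> \<in> \<Phi> \<Longrightarrow> l \<in> nub \<psi> \<Longrightarrow> v \<in> V \<Longrightarrow> l \<otimes> v \<otimes> inv l \<in> V"
      "\<And>\<psi>. \<psi> \<in> \<Psi> \<Longrightarrow> nub \<psi> \<subseteq> V" by (metis insert_subset)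
    have pf: "\<phi> \<in> \<Phi>" "\<phi> \<in> K" using insert assms by auto
    note N = nub_props[OF pf(2)]
    let ?W = "V <#> nub \<phi>"
    have W: "?W \<in> inv_subgroups" by (rule inv_subgroups_mult[OF V(1) N(1,3) nub_R[OF pf(2)] V(2)[OF pf(1)]])
    have VW: "V \<subseteq> ?W" "nub \<phi> \<subseteq> ?W" using subset_setmult[OF B_dest(1)[OF inv_subgroups_B[OF V(1)]] N(1)] by auto
    have a: "l \<otimes> w \<otimes> inv l \<in> ?W" if h: "\<psi> \<in> \<Phi>" "l \<in> nub \<psi>" "w \<in> ?W" for \<psi> l w
    proof -
      obtain v k where vk: "v \<in> V" "k \<in> nub \<phi>" "w = v \<otimes> k" using h(3) by (rule setmultE)
      have ps: "\<psi> \<in> K" using h assms by auto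
      have c: "v \<in> carrier G" "k \<in> carrier G" "l \<in> carrier G"
        using inv_subgroups_c[OF V(1)] vk subgroup.mem_carrier[OF N(1)] subgroup.mem_carrier[OF nub_props(1)[OF ps]] h by auto
      have "(l \<otimes> v \<otimes> inv l) \<otimes> (l \<otimes> k \<otimes> inv l) \<in> ?W"
        by (rule mem_setmult[OF V(2)[OF h(1,2) vk(1)] nub_normalises[OF pf(2) ps h(2) vk(2)]])
      moreover have "(l \<otimes> v \<otimes> inv l) \<otimes> (l \<otimes> k \<otimes> inv l) = l \<otimes> v \<otimes> (inv l \<otimes> l) \<otimes> k \<otimes> inv l"
        using c by (simp only: inv_closed m_assoc m_closed)
      moreover have "\<dots> = l \<otimes> w \<otimes> inv l" using c vk by (simp add: m_assoc)
      ultimately show ?thesis by simp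
    qed
    have b: "nub \<psi> \<subseteq> ?W" if "\<psi> \<in> insert \<phi> \<Psi>" for \<psi>
    proof (cases "\<psi> = \<phi>")
      case False
      then have "nub \<psi> \<subseteq> V" using that by (intro V(3)) simp
      then show ?thesis using VW(1) by (rule subset_trans)
    qed (use VW(2) in simp)
    show ?case by (rule bexI[OF _ W]) (use a b in simp)
  qed
  from this[OF assms(1) subset_refl] show ?thesis by blast
qed

text \<open>Translates of V under powers of \<phi> have the same indices for \<psi>, because the two
  commute on V; and straightness is stable under intersection.\<close>

lemma straight_for_stay:
  assumes V: "V \<in> inv_subgroups" and p: "\<phi> \<in> K" "\<psi> \<in> K" and s: "straight_for \<psi> V" and I: "finite I" "I \<noteq> {}"
  shows "straight_for \<psi> (stay_for \<phi> V I)"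
proof -
  interpret f: flow G T "powers \<phi>" by (rule flow_powers[OF p(1)])
  interpret g: flow G T "powers \<psi>" by (rule flow_powers[OF p(2)])
  have im: "straight_for \<psi> ((\<phi> [^]\<^bsub>\<A>\<^esub> (i::int)) ` V)" for i
    unfolding g.straight_def
  proof
    fix k :: nat
    have e: "idx G ((\<psi> [^]\<^bsub>\<A>\<^esub> (j::int)) ` (\<phi> [^]\<^bsub>\<A>\<^esub> i) ` V) ((\<phi> [^]\<^bsub>\<A>\<^esub> i) ` V) = idx G ((\<psi> [^]\<^bsub>\<A>\<^esub> j) ` V) V" for j
      using inv_subgroups_comm[OF V powK[OF p(2)] powK[OF p(1)]]
        aut_idx[OF KA[OF powK[OF p(1)]] inv_subgroups_B[OF inv_subgroups_act[OF V powK[OF p(2)]]] inv_subgroups_B[OF V]] by simp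
    show "idx G ((\<psi> [^]\<^bsub>\<A>\<^esub> int k) ` (\<phi> [^]\<^bsub>\<A>\<^esub> i) ` V) ((\<phi> [^]\<^bsub>\<A>\<^esub> i) ` V)
       = idx G ((\<psi> [^]\<^bsub>\<A>\<^esub> (1::int)) ` (\<phi> [^]\<^bsub>\<A>\<^esub> i) ` V) ((\<phi> [^]\<^bsub>\<A>\<^esub> i) ` V) ^ k"
      unfolding e using s unfolding g.straight_def by blast
  qed
  show ?thesis
    using I
  proof (induction rule: finite_ne_induct)
    case (singleton i)
    have "f.stay V {i} = (\<phi> [^]\<^bsub>\<A>\<^esub> (- i)) ` V" using f.f_image_stay[OF inv_subgroups_c[OF V], of "- i"] by simp
    then show ?case using im by simp
  next
    case (insert i I)
    have e: "f.stay V (insert i I) = (\<phi> [^]\<^bsub>\<A>\<^esub> (- i)) ` V \<inter> f.stay V I"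
      using f.f_image_stay[OF inv_subgroups_c[OF V], of "- i"] by (auto simp: f.stay_def)
    show ?case unfolding e
      by (rule g.straight_Int[OF inv_subgroups_B[OF inv_subgroups_act[OF V powK[OF p(1)]]] inv_subgroups_B[OF inv_subgroups_stay[OF V p(1) insert(1,2)]] im])
         (use insert in blast)
  qed
qed

text \<open>For a new \<phi>, intersecting translates makes V tidy above. This preserves
  straightness for the earlier automorphisms and keeps the nubs inside, since they are K-invariant.
  A homoclinic element of the result is then a product of a nub element and an element of the
  result, so the homoclinic group lies inside and no orbit returns.\<close>

theorem ex_straight:
  assumes "finite \<Phi>" "\<Phi> \<subseteq> K"
  shows "\<exists>V\<in>inv_subgroups. \<forall>\<phi>\<in>\<Phi>. straight_for \<phi> V"
proof -
  have "\<exists>V\<in>inv_subgroups. (\<forall>\<phi>\<in>\<Phi>. nub \<phi> \<subseteq> V) \<and> (\<forall>\<phi>\<in>\<Psi>. straight_for \<phi> V)" if "finite \<Psi>" "\<Psi> \<subseteq> \<Phi>" for \<Psi>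
    using that
  proof (induction \<Psi>)
    case empty
    then show ?case using ex_containing[OF assms] by simp
  next
    case (insert \<phi> \<Psi>)
    then obtain V where V: "V \<in> inv_subgroups" "\<And>\<psi>. \<psi> \<in> \<Phi> \<Longrightarrow> nub \<psi> \<subseteq> V" "\<And>\<psi>. \<psi> \<in> \<Psi> \<Longrightarrow> straight_for \<psi> V"
      by (metis insert_subset)
    have pf: "\<phi> \<in> \<Phi>" "\<phi> \<in> K" using insert assms by auto
    interpret f: flow G T "powers \<phi>" by (rule flow_powers[OF pf(2)])
    note B = B_dest[OF inv_subgroups_B[OF V(1)]]
    have "finite_index G (f.stay V {- 1}) V" by (rule B_finite_index[OF f.B_stay[OF inv_subgroups_B[OF V(1)]] inv_subgroups_B[OF V(1)]]) simp_all
    from f.tidy_above_exists[OF B(1,2) B_closed[OF inv_subgroups_B[OF V(1)]] this]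
    obtain n where n: "f.tidy_above (f.stay V {- int n..0})" by blast
    let ?W = "f.stay V {- int n..0}"
    have W: "?W \<in> inv_subgroups" by (rule inv_subgroups_stay[OF V(1) pf(2)]) auto
    note BW = B_dest[OF inv_subgroups_B[OF W]]
    have nW: "nub \<psi> \<subseteq> ?W" if "\<psi> \<in> \<Phi>" for \<psi>
    proof
      fix x assume x: "x \<in> nub \<psi>"
      have ps: "\<psi> \<in> K" using that assms by auto
      have xc: "x \<in> carrier G" by (rule subgroup.mem_carrier[OF nub_props(1)[OF ps] x])
      have "(\<phi> [^]\<^bsub>\<A>\<^esub> i) x \<in> V" for i :: int
        using nub_image[OF ps powK[OF pf(2)]] x V(2)[OF that] by blast
      then show "x \<in> ?W" using xc by (simp add: f.stay_def)
    qed
    have "f.homoclinic ?W \<subseteq> ?W"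
    proof
      fix z assume z: "z \<in> f.homoclinic ?W"
      then have zc: "z \<in> carrier G" using f.homoclinic_carrier by blast
      obtain l where l: "l \<in> nub \<phi>" "inv l \<otimes> z \<in> ?W" using homoclinic_nub[OF pf(2) W z] by blast
      have "l \<in> ?W" using l nW[OF pf(1)] by blast
      from subgroup.m_closed[OF BW(1) this l(2)] show "z \<in> ?W"
        using zc subgroup.mem_carrier[OF nub_props(1)[OF pf(2)] l(1)] by (simp add: m_assoc[symmetric])
    qed
    then have "f.no_return ?W" by (rule f.no_return_I[OF BW(1) n])
    then have "straight_for \<phi> ?W" by (rule f.straight_I[OF inv_subgroups_B[OF W] n])
    moreover have "straight_for \<psi> ?W" if "\<psi> \<in> \<Psi>" for \<psi>
      by (rule straight_for_stay[OF V(1) pf(2) _ V(3)[OF that]]) (use that insert assms in auto)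
    ultimately have st: "\<forall>\<psi>\<in>insert \<phi> \<Psi>. straight_for \<psi> ?W" by simp
    show ?case by (rule bexI[OF _ W], rule conjI, rule ballI, erule nW, rule st)
  qed
  from this[OF assms(1) subset_refl] obtain V where "V \<in> inv_subgroups" "\<forall>\<phi>\<in>\<Phi>. straight_for \<phi> V" by (elim bexE conjE)
  then show ?thesis by (rule bexI[rotated])
qed

end

section \<open>Multiplicative functions up to integer factors\<close>

lemma nat_incseq_subseq:
  fixes w :: "nat \<Rightarrow> nat"
  shows "\<exists>g::nat \<Rightarrow> nat. strict_mono g \<and> (\<forall>m k. m \<le> k \<longrightarrow> w (g m) \<le> w (g k))"
proof -
  obtain g :: "nat \<Rightarrow> nat" where g: "strict_mono g" "monoseq (\<lambda>n. w (g n))" using seq_monosub by blast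
  show ?thesis
  proof (cases "\<forall>m. \<forall>n\<ge>m. w (g m) \<le> w (g n)")
    case True
    then show ?thesis using g(1) by (intro exI[of _ g]) simp
  next
    case False
    then have d: "\<forall>m. \<forall>n\<ge>m. w (g n) \<le> w (g m)" using g(2) unfolding monoseq_def by (elim disjE) simp_all
    obtain k0 where k0: "\<And>k. w (g k0) \<le> w (g k)" using ex_has_least_nat[of "\<lambda>_. True" _ "\<lambda>k. w (g k)"] by auto
    have e: "w (g (k0 + m)) = w (g k0)" for m using d[rule_format, of k0 "k0 + m"] k0[of "k0 + m"] by simp
    have "strict_mono (\<lambda>m. g (k0 + m))" using g(1) by (simp add: strict_mono_def)
    then show ?thesis using e by (intro exI[of _ "\<lambda>m. g (k0 + m)"]) simp
  qed
qed

lemma dickson_subseq: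
  fixes w :: "nat \<Rightarrow> 'i \<Rightarrow> nat"
  assumes "finite I"
  shows "\<exists>r::nat \<Rightarrow> nat. strict_mono r \<and> (\<forall>i\<in>I. \<forall>m k. m \<le> k \<longrightarrow> w (r m) i \<le> w (r k) i)"
  using assms
proof induction
  case empty
  show ?case by (rule exI[of _ "\<lambda>n. n"]) (simp add: strict_mono_def)
next
  case (insert i I)
  then obtain r :: "nat \<Rightarrow> nat" where r: "strict_mono r" "\<And>i m k. i \<in> I \<Longrightarrow> m \<le> k \<Longrightarrow> w (r m) i \<le> w (r k) i" by blast
  obtain g :: "nat \<Rightarrow> nat" where g: "strict_mono g" "\<And>m k. m \<le> k \<Longrightarrow> w (r (g m)) i \<le> w (r (g k)) i"
    using nat_incseq_subseq[of "\<lambda>m. w (r m) i"] by blast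
  have "strict_mono (\<lambda>m. r (g m))" using r(1) g(1) by (simp add: strict_mono_def)
  moreover have "\<forall>j\<in>insert i I. \<forall>m k. m \<le> k \<longrightarrow> w (r (g m)) j \<le> w (r (g k)) j"
    using g r(2) by (auto simp: strict_mono_less_eq)
  ultimately show ?case by (intro exI[of _ "\<lambda>m. r (g m)"]) simp
qed

lemma dickson:
  fixes w :: "'x \<Rightarrow> 'i \<Rightarrow> nat"
  assumes "finite I" "infinite S"
  shows "\<exists>x\<in>S. \<exists>y\<in>S. x \<noteq> y \<and> (\<forall>i\<in>I. w x i \<le> w y i)"
proof -
  obtain h :: "nat \<Rightarrow> 'x" where h: "inj h" "range h \<subseteq> S" using infinite_countable_subset[OF assms(2)] by blast
  obtain r :: "nat \<Rightarrow> nat" where r: "strict_mono r" "\<And>i m k. i \<in> I \<Longrightarrow> m \<le> k \<Longrightarrow> w (h (r m)) i \<le> w (h (r k)) i"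
    using dickson_subseq[OF assms(1), of "\<lambda>n. w (h n)"] by blast
  have "r 0 < r 1" using r(1) by (simp add: strict_mono_def)
  then have "h (r 0) \<noteq> h (r 1)" using h(1) by (metis injD less_irrefl)
  moreover have "\<forall>i\<in>I. w (h (r 0)) i \<le> w (h (r 1)) i" using r(2)[of _ 0 1] by simp
  ultimately show ?thesis using h(2) by blast
qed

section \<open>Vectors and directional derivatives\<close>

definition truncate :: "nat \<Rightarrow> (nat \<Rightarrow> int) \<Rightarrow> nat \<Rightarrow> int" where
  "truncate n v = (\<lambda>i. if i < n then v i else 0)"

definition smul :: "nat \<Rightarrow> (nat \<Rightarrow> int) \<Rightarrow> nat \<Rightarrow> int" where
  "smul k v = (\<lambda>i. int k * v i)"

definition unit_vec :: "nat \<Rightarrow> nat \<Rightarrow> int" where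
  "unit_vec j = (\<lambda>i. if i = j then 1 else 0)"

lemma smul_simps: "smul 0 a = 0" "smul (Suc k) a = a + smul k a" "smul (j + k) a = smul j a + smul k a"
  "smul j (a + b) = smul j a + smul j b" "smul j (smul k a) = smul (j * k) a"
  by (auto simp: smul_def fun_eq_iff algebra_simps)

lemma truncate_add: "truncate n (a + b) = truncate n a + truncate n b" and truncate_truncate [simp]: "truncate n (truncate n a) = truncate n a"
  by (auto simp: truncate_def fun_eq_iff)

lemma mult_right_cancel_real: "x * c = y * c \<Longrightarrow> c \<noteq> 0 \<Longrightarrow> x = (y::real)"
  by simp

text \<open>Vectors of Z^n are functions on nat considered up to \<open>truncate n\<close>. The
  axioms are those of the scale on commuting automorphisms: ln F is subadditive and positively
  homogeneous, and integrality of the quotients will make it piecewise linear. Values are real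
  because derivatives of the scale need not be integers.\<close>

definition quasi_hom :: "nat \<Rightarrow> ((nat \<Rightarrow> int) \<Rightarrow> real) \<Rightarrow> bool" where
  "quasi_hom n F \<longleftrightarrow> (\<forall>a. F a > 0) \<and> (\<forall>a b. \<exists>m::nat. F a * F b = real m * F (a + b)) \<and>
     (\<forall>k a. F (smul k a) = F a ^ k) \<and> (\<forall>a. F (truncate n a) = F a)"

lemma quasi_homD:
  assumes "quasi_hom n F"
  shows "F a > 0" "\<exists>m::nat. m \<ge> 1 \<and> F a * F b = real m * F (a + b)" "F (smul k a) = F a ^ k" "F (truncate n a) = F a"
    "F 0 = 1"
proof -
  show pos: "F a > 0" for a using assms by (simp add: quasi_hom_def)
  have "\<forall>a b. \<exists>m::nat. F a * F b = real m * F (a + b)" using assms unfolding quasi_hom_def by (elim conjE)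
  then obtain m :: nat where m: "F a * F b = real m * F (a + b)" by (elim allE exE)
  have "F a * F b > 0" using pos by simp
  then have "m \<noteq> 0" using m by (intro notI) simp
  then show "\<exists>m::nat. m \<ge> 1 \<and> F a * F b = real m * F (a + b)" using m by (intro exI[of _ m]) simp
  show s: "F (smul k a) = F a ^ k" for k a using assms by (simp add: quasi_hom_def)
  show "F (truncate n a) = F a" using assms by (simp add: quasi_hom_def)
  show "F 0 = 1" using s[of 0 0] by (simp add: smul_simps)
qed

text \<open>ln y is the one-sided directional derivative of ln F at e in the direction a: by
  homogeneity, ln F(a + k e) - k ln F(e) is the difference quotient with step 1/k. Integrality makes
  it constant for large k, so no limit is taken.\<close>

definition dir_deriv :: "(nat \<Rightarrow> int) \<Rightarrow> ((nat \<Rightarrow> int) \<Rightarrow> real) \<Rightarrow> (nat \<Rightarrow> int) \<Rightarrow> real" where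
  "dir_deriv e F a = (SOME y. \<exists>k0. \<forall>k\<ge>k0. F (a + smul k e) = y * F e ^ k)"

text \<open>The quotients \<open>m k\<close> of \<open>F a * F e ^ k\<close> by
  \<open>F (a + smul k e)\<close> are positive integers that do not decrease with k, and
  \<open>F a * F (- a)\<close> bounds them; so they become constant.\<close>

lemma dir_deriv_eventually:
  assumes F: "quasi_hom n F"
  shows "\<exists>k0. \<forall>k\<ge>k0. F (a + smul k e) = dir_deriv e F a * F e ^ k"
    "dir_deriv e F a > 0" "\<exists>m::nat. F a = real m * dir_deriv e F a"
proof -
  note pos = quasi_homD(1)[OF F] and mul = quasi_homD(2)[OF F] and sm = quasi_homD(3)[OF F]
  have "\<exists>m::nat. m \<ge> 1 \<and> F a * F e ^ k = real m * F (a + smul k e)" for k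
    using mul[of a "smul k e"] by (simp add: sm)
  then obtain m :: "nat \<Rightarrow> nat" where m: "\<And>k. m k \<ge> 1" "\<And>k. F a * F e ^ k = real (m k) * F (a + smul k e)" by metis
  have mono: "m k \<le> m (Suc k)" for k
  proof -
    obtain j :: nat where j: "j \<ge> 1" "F (a + smul k e) * F e = real j * F (a + smul k e + e)" using mul[of "a + smul k e" e] by blast
    have ae: "a + smul k e + e = a + smul (Suc k) e" by (simp add: smul_simps algebra_simps)
    have "real (m (Suc k)) * F (a + smul (Suc k) e) = F a * F e ^ Suc k" using m(2)[of "Suc k"] by simp
    also have "\<dots> = (real (m k) * F (a + smul k e)) * F e" using m(2)[of k] by (simp add: mult.commute mult.left_commute)
    also have "\<dots> = real (m k) * real j * F (a + smul (Suc k) e)" using j ae by (simp add: mult.assoc)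
    finally have "real (m (Suc k)) = real (m k) * real j" using pos[of "a + smul (Suc k) e"] by simp
    then have "m (Suc k) = m k * j" by (metis of_nat_eq_iff of_nat_mult)
    then show ?thesis using j(1) by simp
  qed
  have bound: "real (m k) \<le> F a * F (- a)" for k
  proof -
    obtain j :: nat where j: "j \<ge> 1" "F (a + smul k e) * F (- a) = real j * F (a + smul k e + - a)" using mul[of "a + smul k e" "- a"] by blast
    have "1 * F (smul k e) \<le> real j * F (smul k e)"
      by (rule mult_right_mono) (use j(1) pos[of "smul k e"] in simp_all)
    then have "F (a + smul k e) * F (- a) \<ge> F e ^ k" unfolding j(2) by (simp add: sm)
    then have "real (m k) * F e ^ k \<le> real (m k) * F (a + smul k e) * F (- a)"
      by (simp add: mult.assoc mult_left_mono)
    also have "\<dots> = F a * F (- a) * F e ^ k" using m(2)[of k] by simp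
    finally show ?thesis using pos[of e] by simp
  qed
  have "m k \<le> nat \<lceil>F a * F (- a)\<rceil>" for k using bound[of k] by linarith
  then have fin: "finite (range m)" by (intro finite_subset[of "range m" "{..nat \<lceil>F a * F (- a)\<rceil>}"]) auto
  have "Max (range m) \<in> range m" by (rule Max_in[OF fin]) simp
  then obtain k0 where "m k0 = Max (range m)" by (metis rangeE)
  then have k0: "m k \<le> m k0" for k using Max_ge[OF fin] by simp
  have mm: "m k = m k0" if "k \<ge> k0" for k
    using k0[of k] lift_Suc_mono_le[of m k0 k, OF mono that] by simp
  have power_prod: "F (a + smul k e) = F a / real (m k0) * F e ^ k" if "k \<ge> k0" for k
    using m(2)[of k] m(1)[of k0] mm[OF that] by (simp add: field_simps)
  have D: "\<exists>k0. \<forall>k\<ge>k0. F (a + smul k e) = dir_deriv e F a * F e ^ k"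
    unfolding dir_deriv_def by (rule someI[of _ "F a / real (m k0)"]) (use power_prod in blast)
  then obtain k1 where k1: "\<And>k. k \<ge> k1 \<Longrightarrow> F (a + smul k e) = dir_deriv e F a * F e ^ k" by blast
  have "dir_deriv e F a * F e ^ max k0 k1 = F a / real (m k0) * F e ^ max k0 k1"
    using k1[of "max k0 k1"] power_prod[of "max k0 k1"] by simp
  moreover have nz: "F e ^ max k0 k1 \<noteq> 0" using pos[of e] by simp
  ultimately have eq: "dir_deriv e F a = F a / real (m k0)" by (rule mult_right_cancel_real)
  show "\<exists>k0. \<forall>k\<ge>k0. F (a + smul k e) = dir_deriv e F a * F e ^ k" by (rule D)
  show "dir_deriv e F a > 0" using eq pos[of a] m(1)[of k0] by simp
  show "\<exists>m::nat. F a = real m * dir_deriv e F a"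
    by (rule exI[of _ "m k0"]) (use eq m(1)[of k0] in simp)
qed

lemma dir_deriv_eqI:
  assumes F: "quasi_hom n F" and "\<And>k. k \<ge> k0 \<Longrightarrow> F (a + smul k e) = y * F e ^ k"
  shows "dir_deriv e F a = y"
proof -
  obtain k1 where k1: "\<And>k. k \<ge> k1 \<Longrightarrow> F (a + smul k e) = dir_deriv e F a * F e ^ k" using dir_deriv_eventually(1)[OF F] by blast
  have "dir_deriv e F a * F e ^ max k0 k1 = F (a + smul (max k0 k1) e)" by (rule k1[symmetric]) simp
  also have "\<dots> = y * F e ^ max k0 k1" by (rule assms(2)) simp
  finally have "dir_deriv e F a * F e ^ max k0 k1 = y * F e ^ max k0 k1" .
  moreover have nz: "F e ^ max k0 k1 \<noteq> 0" using quasi_homD(1)[OF F, of e] by simp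
  ultimately show ?thesis by (rule mult_right_cancel_real)
qed

lemma dir_deriv_quasi_hom:
  assumes F: "quasi_hom n F"
  shows "quasi_hom n (dir_deriv e F)"
proof -
  note pos = quasi_homD(1)[OF F] and mul = quasi_homD(2)[OF F] and sm = quasi_homD(3)[OF F]
  have "\<exists>m::nat. dir_deriv e F a * dir_deriv e F b = real m * dir_deriv e F (a + b)" for a b
  proof -
    obtain k1 where k1: "\<And>k. k \<ge> k1 \<Longrightarrow> F (a + smul k e) = dir_deriv e F a * F e ^ k" using dir_deriv_eventually(1)[OF F] by blast
    obtain k2 where k2: "\<And>k. k \<ge> k2 \<Longrightarrow> F (b + smul k e) = dir_deriv e F b * F e ^ k" using dir_deriv_eventually(1)[OF F] by blast
    obtain k3 where k3: "\<And>k. k \<ge> k3 \<Longrightarrow> F (a + b + smul k e) = dir_deriv e F (a + b) * F e ^ k" using dir_deriv_eventually(1)[OF F] by blast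
    \<comment> \<open>Large enough for all three eventual formulas; the third is used at k +
      k.\<close>
    define k where "k = k1 + k2 + k3"
    obtain m :: nat where m: "F (a + smul k e) * F (b + smul k e) = real m * F ((a + smul k e) + (b + smul k e))"
      using mul[of "a + smul k e" "b + smul k e"] by blast
    have "(a + smul k e) + (b + smul k e) = a + b + smul (k + k) e" by (simp only: smul_simps ac_simps)
    then have "(dir_deriv e F a * dir_deriv e F b) * F e ^ (k + k) = (real m * dir_deriv e F (a + b)) * F e ^ (k + k)"
      using m k1[of k] k2[of k] k3[of "k + k"] by (simp add: k_def power_add ac_simps)
    moreover have nz: "F e ^ (k + k) \<noteq> 0" using pos[of e] by simp
    ultimately have "dir_deriv e F a * dir_deriv e F b = real m * dir_deriv e F (a + b)"
      by (rule mult_right_cancel_real)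
    then show ?thesis by blast
  qed
  moreover have "dir_deriv e F (smul j a) = dir_deriv e F a ^ j" for j a
  proof (cases "j = 0")
    case True
    have "dir_deriv e F 0 = 1" by (rule dir_deriv_eqI[OF F, of 0]) (simp add: sm)
    then show ?thesis using True by (simp add: smul_simps)
  next
    case False
    obtain k1 where k1: "\<And>k. k \<ge> k1 \<Longrightarrow> F (a + smul k e) = dir_deriv e F a * F e ^ k" using dir_deriv_eventually(1)[OF F] by blast
    obtain k2 where k2: "\<And>k. k \<ge> k2 \<Longrightarrow> F (smul j a + smul k e) = dir_deriv e F (smul j a) * F e ^ k" using dir_deriv_eventually(1)[OF F] by blast
    define k where "k = k1 + k2"
    have "k2 \<le> j * k" using False by (simp add: k_def trans_le_add2 add_mult_distrib2)
    then have "dir_deriv e F (smul j a) * F e ^ (j * k) = F (smul j (a + smul k e))"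
      using k2[of "j * k"] by (simp add: smul_simps)
    also have "\<dots> = dir_deriv e F a ^ j * F e ^ (j * k)"
      using k1[of k] by (simp add: sm k_def power_mult_distrib power_mult[symmetric] mult.commute)
    finally have eq: "dir_deriv e F (smul j a) * F e ^ (j * k) = dir_deriv e F a ^ j * F e ^ (j * k)" .
    have nz: "F e ^ (j * k) \<noteq> 0" using pos[of e] by simp
    show ?thesis by (rule mult_right_cancel_real[OF eq nz])
  qed
  moreover have "dir_deriv e F (truncate n a) = dir_deriv e F a" for a
  proof -
    obtain k1 where k1: "\<And>k. k \<ge> k1 \<Longrightarrow> F (a + smul k e) = dir_deriv e F a * F e ^ k" using dir_deriv_eventually(1)[OF F] by blast
    have "F (truncate n a + smul k e) = F (a + smul k e)" for k
      using quasi_homD(4)[OF F, of "truncate n a + smul k e"] quasi_homD(4)[OF F, of "a + smul k e"] by (simp add: truncate_add)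
    then show ?thesis using k1 by (intro dir_deriv_eqI[OF F, of k1]) simp
  qed
  ultimately show ?thesis using dir_deriv_eventually(2)[OF F] by (simp add: quasi_hom_def)
qed

text \<open>Shifting a by e merely shifts k.\<close>

lemma dir_deriv_along:
  assumes F: "quasi_hom n F"
  shows "dir_deriv e F (a + e) = dir_deriv e F a * dir_deriv e F e" "dir_deriv e F e = F e"
proof -
  have *: "dir_deriv e F (a + e) = dir_deriv e F a * F e" for a
  proof -
    obtain k1 where k1: "\<And>k. k \<ge> k1 \<Longrightarrow> F (a + smul k e) = dir_deriv e F a * F e ^ k" using dir_deriv_eventually(1)[OF F] by blast
    have "F (a + e + smul k e) = dir_deriv e F a * F e * F e ^ k" if "k \<ge> k1" for k
      using k1[of "Suc k"] that by (simp add: smul_simps add.assoc)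
    then show ?thesis by (rule dir_deriv_eqI[OF F])
  qed
  show "dir_deriv e F e = F e" using *[of 0] quasi_homD(5)[OF dir_deriv_quasi_hom[OF F]] by simp
  then show "dir_deriv e F (a + e) = dir_deriv e F a * dir_deriv e F e" using * by simp
qed

text \<open>A direction in which F is already multiplicative stays so, since the factor
  \<open>F c\<close> comes out for every k.\<close>

lemma dir_deriv_preserve:
  assumes F: "quasi_hom n F" and c: "\<And>a. F (a + c) = F a * F c"
  shows "dir_deriv e F (a + c) = dir_deriv e F a * dir_deriv e F c" "dir_deriv e F c = F c"
proof -
  have *: "dir_deriv e F (a + c) = dir_deriv e F a * F c" for a
  proof -
    obtain k1 where k1: "\<And>k. k \<ge> k1 \<Longrightarrow> F (a + smul k e) = dir_deriv e F a * F e ^ k" using dir_deriv_eventually(1)[OF F] by blast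
    have "F (a + c + smul k e) = dir_deriv e F a * F c * F e ^ k" if "k \<ge> k1" for k
    proof -
      have e: "a + c + smul k e = (a + smul k e) + c" by (simp only: ac_simps)
      have "F (a + c + smul k e) = F (a + smul k e) * F c" unfolding e by (rule c)
      then show ?thesis using k1[OF that] by (simp add: mult.commute mult.left_commute)
    qed
    then show ?thesis by (rule dir_deriv_eqI[OF F])
  qed
  show "dir_deriv e F c = F c" using *[of 0] quasi_homD(5)[OF dir_deriv_quasi_hom[OF F]] by simp
  then show "dir_deriv e F (a + c) = dir_deriv e F a * dir_deriv e F c" using * by simp
qed

text \<open>The last clause carries the induction: directions made multiplicative by earlier
  derivatives must remain so, with unchanged value, under the later ones.\<close>

lemma ex_hom_along:
  assumes "quasi_hom n F"
  shows "\<exists>p. quasi_hom n p \<and> (\<forall>a. \<exists>m::nat. F a = real m * p a) \<and> (\<forall>e\<in>set es. \<forall>a. p (a + e) = p a * p e) \<and>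
    (\<forall>c. (\<forall>a. F (a + c) = F a * F c) \<longrightarrow> (\<forall>a. p (a + c) = p a * p c) \<and> p c = F c)"
  using assms
proof (induction es arbitrary: F)
  case Nil
  show ?case by (rule exI[of _ F]) (use Nil in \<open>auto intro: exI[of _ 1]\<close>)
next
  case (Cons e es)
  let ?D = "dir_deriv e F"
  have D: "quasi_hom n ?D" by (rule dir_deriv_quasi_hom[OF Cons.prems])
  obtain p where p: "quasi_hom n p" "\<And>a. \<exists>m::nat. ?D a = real m * p a" "\<And>e a. e \<in> set es \<Longrightarrow> p (a + e) = p a * p e"
    "\<And>c. (\<forall>a. ?D (a + c) = ?D a * ?D c) \<Longrightarrow> (\<forall>a. p (a + c) = p a * p c) \<and> p c = ?D c"
    using Cons.IH[OF D] by blast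
  show ?case
  proof (intro exI[of _ p] conjI allI ballI impI)
    show "quasi_hom n p" by (rule p(1))
    show "\<exists>m::nat. F a = real m * p a" for a
    proof -
      obtain m :: nat where "F a = real m * ?D a" using dir_deriv_eventually(3)[OF Cons.prems] by blast
      moreover obtain k :: nat where "?D a = real k * p a" using p(2) by blast
      ultimately have "F a = real (m * k) * p a" by simp
      then show ?thesis by blast
    qed
    show "p (a + d) = p a * p d" if d: "d \<in> set (e # es)" for d a
    proof (cases "d = e")
      case True
      then show ?thesis using p(4)[of e] dir_deriv_along(1)[OF Cons.prems] by blast
    next
      case False
      then show ?thesis using p(3) d by simp
    qed
    fix c assume c: "\<forall>a. F (a + c) = F a * F c"
    show "p (a + c) = p a * p c" for a using p(4)[of c] dir_deriv_preserve(1)[OF Cons.prems, of c e] c by blast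
    show "p c = F c" using p(4)[of c] dir_deriv_preserve(1)[OF Cons.prems, of c e] dir_deriv_preserve(2)[OF Cons.prems, of c e] c
      by metis
  qed
qed

section \<open>Characters\<close>

definition is_char :: "nat \<Rightarrow> ((nat \<Rightarrow> int) \<Rightarrow> real) \<Rightarrow> bool" where
  "is_char n p \<longleftrightarrow> (\<forall>a. p a > 0) \<and> (\<forall>a b. p (a + b) = p a * p b) \<and> (\<forall>a. p (truncate n a) = p a)"

definition zmul :: "int \<Rightarrow> (nat \<Rightarrow> int) \<Rightarrow> nat \<Rightarrow> int" where
  "zmul z v = (\<lambda>i. z * v i)"

lemma zmul_simps: "zmul 0 v = 0" "zmul (z + 1) v = zmul z v + v" "zmul (z - 1) v = zmul z v - v"
  by (auto simp: zmul_def fun_eq_iff algebra_simps)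

lemma truncate_Suc: "truncate (Suc m) v = truncate m v + zmul (v m) (unit_vec m)"
  by (auto simp: truncate_def unit_vec_def zmul_def fun_eq_iff less_Suc_eq)

lemma truncate_induct:
  assumes "P 0" and step: "\<And>a i. P a \<Longrightarrow> i < n \<Longrightarrow> P (a + unit_vec i) \<and> P (a - unit_vec i)"
  shows "P (truncate n v)"
proof -
  have mult: "P (a + zmul z (unit_vec m))" if a: "P a" and m: "m < n" for a z m
  proof (induction z rule: int_induct[where k = 0])
    case base
    show ?case using a by (simp add: zmul_simps)
  next
    case (step1 z)
    have e: "a + zmul (z + 1) (unit_vec m) = (a + zmul z (unit_vec m)) + unit_vec m" by (simp only: zmul_simps add.assoc)
    show ?case unfolding e using step[OF step1(2) m] by (rule conjunct1)
  next
    case (step2 z)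
    have e: "a + zmul (z - 1) (unit_vec m) = (a + zmul z (unit_vec m)) - unit_vec m"
      by (simp only: zmul_simps add_diff_eq)
    show ?case unfolding e using step[OF step2(2) m] by (rule conjunct2)
  qed
  have "P (truncate m v)" if "m \<le> n" for m using that
  proof (induction m)
    case 0
    have e: "truncate 0 v = 0" by (simp add: truncate_def fun_eq_iff)
    show ?case unfolding e by (rule assms(1))
  next
    case (Suc m)
    then show ?case unfolding truncate_Suc by (intro mult) simp_all
  qed
  then show ?thesis by simp
qed

lemma is_charI:
  assumes pos: "\<And>a. p a > 0" and t: "\<And>a. p (truncate n a) = p a" and p0: "p 0 = 1"
    and u: "\<And>i a. i < n \<Longrightarrow> p (a + unit_vec i) = p a * p (unit_vec i)"
  shows "is_char n p"
proof -
  have u': "p (a - unit_vec i) = p a / p (unit_vec i)" if "i < n" for a i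
    using u[OF that, of "a - unit_vec i"] pos[of "unit_vec i"] by (simp add: field_simps)
  have "p (a + truncate n v) = p a * p (truncate n v)" for a v
  proof (rule truncate_induct[where P = "\<lambda>w. p (a + w) = p a * p w"])
    show "p (a + 0) = p a * p 0" using p0 by simp
    fix w i assume w: "p (a + w) = p a * p w" "i < n"
    have e: "a + (w + unit_vec i) = a + w + unit_vec i" "a + (w - unit_vec i) = a + w - unit_vec i" by simp_all
    show "p (a + (w + unit_vec i)) = p a * p (w + unit_vec i) \<and> p (a + (w - unit_vec i)) = p a * p (w - unit_vec i)"
      unfolding e using w by (simp add: u u')
  qed
  then have "p (a + b) = p a * p b" for a b
    using t[of "a + b"] t[of "a + truncate n b"] t[of b] by (simp add: truncate_add)
  then show ?thesis using pos t by (simp add: is_char_def)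
qed

lemma is_charD:
  assumes "is_char n p"
  shows "p a > 0" "p (a + b) = p a * p b" "p (truncate n a) = p a" "p 0 = 1" "p (a - b) = p a / p b"
proof -
  show pos: "p a > 0" for a using assms by (simp add: is_char_def)
  show add: "p (a + b) = p a * p b" for a b using assms by (simp add: is_char_def)
  show "p (truncate n a) = p a" using assms by (simp add: is_char_def)
  show "p 0 = 1" using add[of 0 0] pos[of 0] by simp
  show "p (a - b) = p a / p b" using add[of "a - b" b] pos[of b] by (simp add: field_simps)
qed

lemma is_char_determined:
  assumes p: "is_char n p" and q: "is_char n q" and e: "\<And>i. i < n \<Longrightarrow> p (unit_vec i) = q (unit_vec i)"
  shows "p = q"
proof
  fix v
  have "p (truncate n v) = q (truncate n v)"
    by (rule truncate_induct[where P = "\<lambda>w. p w = q w"]) (simp_all add: e is_charD[OF p] is_charD[OF q])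
  then show "p v = q v" using is_charD(3)[OF p] is_charD(3)[OF q] by simp
qed

text \<open>Iterating directional derivatives along \<open>b\<close> and the unit vectors linearises \<open>ln F\<close> without
  changing its value at \<open>b\<close>.\<close>

lemma ex_char_touching:
  assumes F: "quasi_hom n F"
  shows "\<exists>p. is_char n p \<and> (\<forall>a. \<exists>m::nat. F a = real m * p a) \<and> p b = F b"
proof -
  let ?D = "dir_deriv b F"
  have D: "quasi_hom n ?D" by (rule dir_deriv_quasi_hom[OF F])
  obtain p where p: "quasi_hom n p" "\<forall>a. \<exists>m::nat. ?D a = real m * p a"
    "\<forall>e\<in>set (map unit_vec [0..<n]). \<forall>a. p (a + e) = p a * p e"
    "\<forall>c. (\<forall>a. ?D (a + c) = ?D a * ?D c) \<longrightarrow> (\<forall>a. p (a + c) = p a * p c) \<and> p c = ?D c"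
    using ex_hom_along[OF D, of "map unit_vec [0..<n]"] by (elim exE conjE)
  have ch: "is_char n p"
    by (rule is_charI) (use quasi_homD[OF p(1)] p(3) in auto)
  have mm: "\<exists>m::nat. F a = real m * p a" for a
  proof -
    obtain m :: nat where "F a = real m * ?D a" using dir_deriv_eventually(3)[OF F] by blast
    moreover obtain k :: nat where "?D a = real k * p a" using p(2) by blast
    ultimately have "F a = real (m * k) * p a" by simp
    then show ?thesis by blast
  qed
  have "\<forall>a. ?D (a + b) = ?D a * ?D b" using dir_deriv_along(1)[OF F] by (rule allI)
  then have "p b = ?D b" by (rule p(4)[THEN spec, of b, THEN mp, THEN conjunct2])
  then have "p b = F b" using dir_deriv_along(2)[OF F] by simp
  then show ?thesis using ch mm by (intro exI[of _ p]) simp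
qed

text \<open>A character is determined by its values on unit vectors, hence by the integers
  \<open>F (unit_vec i) / p (unit_vec i)\<close>. Multiplying by the corresponding positive integer
  at \<open>- unit_vec i\<close> shows that they are at most
  \<open>F (unit_vec i) * F (- unit_vec i)\<close>.\<close>

lemma finite_chars:
  assumes F: "quasi_hom n F"
  shows "finite {p. is_char n p \<and> (\<forall>a. \<exists>m::nat. F a = real m * p a)}" (is "finite ?P")
proof -
  define m where "m p i = nat \<lfloor>F (unit_vec i) / p (unit_vec i)\<rfloor>" for p i
  have m: "F (unit_vec i) = real (m p i) * p (unit_vec i)" "m p i \<ge> 1"
    "real (m p i) \<le> F (unit_vec i) * F (- unit_vec i)" if "p \<in> ?P" for p i
  proof -
    have p: "is_char n p" "\<And>a. \<exists>m::nat. F a = real m * p a" using that by auto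
    obtain k :: nat where k: "F (unit_vec i) = real k * p (unit_vec i)" using p(2) by blast
    then have mk: "m p i = k" using is_charD(1)[OF p(1), of "unit_vec i"] by (simp add: m_def)
    show e: "F (unit_vec i) = real (m p i) * p (unit_vec i)" using k mk by simp
    show "m p i \<ge> 1" using e quasi_homD(1)[OF F, of "unit_vec i"] by (cases "m p i") auto
    obtain j :: nat where j: "F (- unit_vec i) = real j * p (- unit_vec i)" using p(2) by blast
    have "j \<ge> 1" using j quasi_homD(1)[OF F, of "- unit_vec i"] by (cases j) auto
    have "p (unit_vec i) * p (- unit_vec i) = 1"
      using is_charD(2)[OF p(1), of "unit_vec i" "- unit_vec i"] is_charD(4)[OF p(1)] by simp
    then have "F (unit_vec i) * F (- unit_vec i) = real (m p i) * real j"
      unfolding e j by (simp add: mult.assoc mult.left_commute)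
    moreover have "real (m p i) * 1 \<le> real (m p i) * real j" using \<open>j \<ge> 1\<close> by (intro mult_left_mono) simp_all
    ultimately show "real (m p i) \<le> F (unit_vec i) * F (- unit_vec i)" by simp
  qed
  let ?M = "\<lambda>i. {..nat \<lceil>F (unit_vec i) * F (- unit_vec i)\<rceil>}"
  show ?thesis
  proof (rule inj_on_finite[where f = "\<lambda>p. restrict (m p) {..<n}" and B = "PiE {..<n} ?M"])
    show "inj_on (\<lambda>p. restrict (m p) {..<n}) ?P"
    proof (rule inj_onI)
      fix p q assume h: "p \<in> ?P" "q \<in> ?P" "restrict (m p) {..<n} = restrict (m q) {..<n}"
      have "p (unit_vec i) = q (unit_vec i)" if "i < n" for i
      proof -
        have "m p i = m q i" using fun_cong[OF h(3), of i] that by simp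
        then have "p (unit_vec i) * real (m p i) = q (unit_vec i) * real (m p i)"
          using m(1)[OF h(1), of i] m(1)[OF h(2), of i] by (simp only: mult.commute)
        then show ?thesis by (rule mult_right_cancel_real) (use m(2)[OF h(1), of i] in simp)
      qed
      moreover have "is_char n p" "is_char n q" using h(1,2) by blast+
      ultimately show "p = q" by (intro is_char_determined[of n p q])
    qed
    show "(\<lambda>p. restrict (m p) {..<n}) ` ?P \<subseteq> PiE {..<n} ?M"
    proof clarify
      fix p assume p: "is_char n p" "\<forall>a. \<exists>m::nat. F a = real m * p a"
      have "m p i \<le> nat \<lceil>F (unit_vec i) * F (- unit_vec i)\<rceil>" for i
      proof -
        have "real (m p i) \<le> F (unit_vec i) * F (- unit_vec i)" by (rule m(3)) (use p in simp)
        then show ?thesis by linarith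
      qed
      then show "restrict (m p) {..<n} \<in> PiE {..<n} ?M" by (simp add: PiE_iff)
    qed
    show "finite (PiE {..<n} ?M)" by (rule finite_PiE) simp_all
  qed
qed

section \<open>Multiplicative splitting of vectors\<close>

lemma truncate_diff: "truncate n (a - b) = truncate n a - truncate n b"
  by (auto simp: truncate_def fun_eq_iff)

definition vsize :: "nat \<Rightarrow> (nat \<Rightarrow> int) \<Rightarrow> nat" where
  "vsize n v = (\<Sum>i<n. nat \<bar>v i\<bar>)"

lemma vsize_pos: "truncate n v = v \<Longrightarrow> v \<noteq> 0 \<Longrightarrow> vsize n v > 0"
proof -
  assume v: "truncate n v = v" "v \<noteq> 0"
  have "\<exists>i<n. v i \<noteq> 0"
  proof (rule ccontr)
    assume "\<not> (\<exists>i<n. v i \<noteq> 0)"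
    then have "truncate n v = 0" by (simp add: truncate_def fun_eq_iff)
    with v show False by simp
  qed
  then obtain i where "0 < nat \<bar>v i\<bar>" "i \<in> {..<n}" by auto
  then show ?thesis unfolding vsize_def by (intro sum_pos2[of "{..<n}" i]) simp_all
qed

text \<open>The hypothesis, stated with positive and negative parts as naturals to suit Dickson's
  lemma, says that a lies coordinatewise between 0 and b.\<close>

lemma vsize_split:
  assumes "\<And>i. i < n \<Longrightarrow> nat (a i) \<le> nat (b i) \<and> nat (- a i) \<le> nat (- b i)"
  shows "vsize n b = vsize n a + vsize n (b - a)"
proof -
  have "nat \<bar>b i\<bar> = nat \<bar>a i\<bar> + nat \<bar>(b - a) i\<bar>" if "i < n" for i
  proof -
    have "(b - a) i = b i - a i" by simp
    then show ?thesis using assms[OF that] by (cases "0 \<le> b i") (simp_all add: nat_le_iff, linarith+)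
  qed
  then show ?thesis unfolding vsize_def by (simp add: sum.distrib[symmetric])
qed

text \<open>F is the maximum of the characters in P, and \<open>C p\<close> is the cone where p
  attains it. If a precedes b in \<open>C p\<close>, then c = b - a satisfies
  \<open>F b / F a = p c \<le> F c\<close>. Conversely, growth of the ratio \<open>j q\<close> from
  a to b gives \<open>q c \<le> F b / F a\<close> for every q in P, in particular for one attaining
  F at c. So b = a + c splits multiplicatively, and only the minimal vectors of each cone, finitely
  many by Dickson's lemma, have to be kept.\<close>

theorem quasi_hom_finite_basis:
  fixes F :: "(nat \<Rightarrow> int) \<Rightarrow> real"
  assumes F: "quasi_hom n F"
  shows "\<exists>\<Phi>. finite \<Phi> \<and> (\<forall>b\<in>\<Phi>. truncate n b = b) \<and>
    (\<forall>b. truncate n b = b \<longrightarrow> b \<noteq> 0 \<longrightarrow> b \<in> \<Phi> \<or>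
      (\<exists>a c. b = a + c \<and> truncate n a = a \<and> truncate n c = c \<and> vsize n a < vsize n b \<and> vsize n c < vsize n b \<and> F b = F a * F c))"
proof -
  define P where "P = {p. is_char n p \<and> (\<forall>a. \<exists>m::nat. F a = real m * p a)}"
  have finP: "finite P" unfolding P_def by (rule finite_chars[OF F])
  define j where "j p a = nat \<lfloor>F a / p a\<rfloor>" for p a
  have jj: "F a = real (j p a) * p a" "j p a \<ge> 1" if "p \<in> P" for p a
  proof -
    have p: "is_char n p" "\<exists>m::nat. F a = real m * p a" using that by (auto simp: P_def)
    obtain k :: nat where k: "F a = real k * p a" using p(2) by blast
    then have "j p a = k" using is_charD(1)[OF p(1), of a] by (simp add: j_def)
    then show e: "F a = real (j p a) * p a" using k by simp
    then show "j p a \<ge> 1" using quasi_homD(1)[OF F, of a] by (cases "j p a") auto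
  qed
  \<comment> \<open>The ratios \<open>j p\<close> control the characters on the difference; the
    coordinate conditions make the sizes of a and b - a add up to that of b.\<close>
  define le where "le a b \<longleftrightarrow> (\<forall>p\<in>P. j p a \<le> j p b) \<and> (\<forall>i<n. nat (a i) \<le> nat (b i) \<and> nat (- a i) \<le> nat (- b i))"
    for a b
  define C where "C p = {b. truncate n b = b \<and> b \<noteq> 0 \<and> p b = F b}" for p
  define M where "M p = {b \<in> C p. \<not> (\<exists>a\<in>C p. a \<noteq> b \<and> le a b)}" for p
  have finM: "finite (M p)" for p
  proof (rule ccontr)
    assume inf: "infinite (M p)"
    \<comment> \<open>The quantities compared by \<open>le\<close>, as natural coordinates for
      Dickson's lemma: one for each character and two, for the signs, for each entry.\<close>
    let ?I = "Inl ` P \<union> Inr ` ({..<n} \<times> (UNIV::bool set))"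
    let ?w = "\<lambda>b x. case x of Inl q \<Rightarrow> j q b | Inr (i, s) \<Rightarrow> nat (if s then b i else - b i)"
    have "finite ?I" using finP by simp
    then obtain x y where xy: "x \<in> M p" "y \<in> M p" "x \<noteq> y" "\<forall>i\<in>?I. ?w x i \<le> ?w y i"
      using dickson[OF _ inf, of ?I ?w] by blast
    have "le x y" unfolding le_def
    proof (intro conjI ballI allI impI)
      show "j q x \<le> j q y" if "q \<in> P" for q using xy(4)[rule_format, of "Inl q"] that by simp
      show "nat (x i) \<le> nat (y i)" if "i < n" for i using xy(4)[rule_format, of "Inr (i, True)"] that by simp
      show "nat (- x i) \<le> nat (- y i)" if "i < n" for i using xy(4)[rule_format, of "Inr (i, False)"] that by simp
    qed
    then show False using xy by (auto simp: M_def)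
  qed
  have main: "b \<in> (\<Union>p\<in>P. M p) \<or>
      (\<exists>a c. b = a + c \<and> truncate n a = a \<and> truncate n c = c \<and> vsize n a < vsize n b \<and> vsize n c < vsize n b \<and> F b = F a * F c)"
    if b: "truncate n b = b" "b \<noteq> 0" for b
  proof (cases "b \<in> (\<Union>p\<in>P. M p)")
    case False
    obtain p where p: "p \<in> P" "p b = F b" using ex_char_touching[OF F, of b] by (auto simp: P_def)
    have "b \<in> C p" using b p by (simp add: C_def)
    then obtain a where a: "a \<in> C p" "a \<noteq> b" "le a b" using False p(1) by (auto simp: M_def)
    have ta: "truncate n a = a" "a \<noteq> 0" "p a = F a" using a(1) by (auto simp: C_def)
    define c where "c = b - a"
    have bac: "b = a + c" by (simp add: c_def)
    have tc: "truncate n c = c" using ta(1) b(1) by (simp only: c_def truncate_diff)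
    have c0: "c \<noteq> 0" using a(2) by (simp add: c_def)
    have vs: "vsize n b = vsize n a + vsize n c" unfolding c_def
      by (rule vsize_split) (use a(3) in \<open>simp add: le_def\<close>)
    have chp: "is_char n q" if "q \<in> P" for q using that by (simp add: P_def)
    have Fpos: "F x > 0" for x by (rule quasi_homD(1)[OF F])
    have qc: "q c \<le> F b / F a" if q: "q \<in> P" for q
    proof -
      note ch = is_charD[OF chp[OF q]]
      have "j q a \<le> j q b" using a(3) q by (simp add: le_def)
      then have "real (j q a) * (q a * q b) \<le> real (j q b) * (q a * q b)"
        using ch(1)[of a] ch(1)[of b] by (intro mult_right_mono) simp_all
      then have "F a * q b \<le> F b * q a"
        using jj(1)[OF q, of a] jj(1)[OF q, of b] by (simp add: mult.assoc mult.left_commute mult.commute)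
      then show ?thesis unfolding c_def ch(5) using ch(1)[of a] Fpos[of a] by (simp add: field_simps)
    qed
    have "F b / F a = p c" unfolding c_def is_charD(5)[OF chp[OF p(1)]] using p(2) ta(3) by simp
    also have "\<dots> \<le> F c"
    proof -
      have "1 * p c \<le> real (j p c) * p c"
        using jj(2)[OF p(1), of c] is_charD(1)[OF chp[OF p(1)], of c] by (intro mult_right_mono) simp_all
      then show ?thesis using jj(1)[OF p(1), of c] by simp
    qed
    finally have 1: "F b / F a \<le> F c" .
    obtain q where q: "q \<in> P" "q c = F c" using ex_char_touching[OF F, of c] by (auto simp: P_def)
    have 2: "F c \<le> F b / F a" using qc[OF q(1)] q(2) by simp
    have "F b = F a * F c" using 1 2 Fpos[of a] by (simp add: field_simps)
    then show ?thesis
      using bac ta tc vs vsize_pos[OF ta(1,2)] vsize_pos[OF tc c0] by (intro disjI2 exI[of _ a] exI[of _ c]) simp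
  qed simp
  show ?thesis
  proof (intro exI[of _ "\<Union>p\<in>P. M p"] conjI)
    show "finite (\<Union>p\<in>P. M p)" using finP finM by simp
    show "\<forall>b\<in>\<Union>p\<in>P. M p. truncate n b = b" by (auto simp: M_def C_def)
    show "\<forall>b. truncate n b = b \<longrightarrow> b \<noteq> 0 \<longrightarrow> b \<in> (\<Union>p\<in>P. M p) \<or>
      (\<exists>a c. b = a + c \<and> truncate n a = a \<and> truncate n c = c \<and> vsize n a < vsize n b \<and> vsize n c < vsize n b \<and> F b = F a * F c)"
      using main by blast
  qed
qed

section \<open>The scale of commuting automorphisms\<close>

context topgroup
begin

lemma scale_alt: "\<phi> \<in> carrier \<A> \<Longrightarrow> scale G T \<phi> = (LEAST n. \<exists>V\<in>\<B>. n = idx G (\<phi> ` V) V)"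
  unfolding scale_def using sub_index_Int[OF B_dest(1)[OF aut_B] B_dest(1)] by (metis (no_types, opaque_lifting))

lemma scale_le:
  assumes "\<phi> \<in> carrier \<A>" "V \<in> \<B>"
  shows "scale G T \<phi> \<le> idx G (\<phi> ` V) V"
  unfolding scale_alt[OF assms(1)] by (rule Least_le) (use assms(2) in blast)

lemma scale_eqI:
  assumes p: "\<phi> \<in> carrier \<A>" and W: "W \<in> \<B>" and min: "\<And>V. V \<in> \<B> \<Longrightarrow> idx G (\<phi> ` W) W \<le> idx G (\<phi> ` V) V"
  shows "scale G T \<phi> = idx G (\<phi> ` W) W"
  unfolding scale_alt[OF p] by (rule Least_equality) (use W min in auto)

lemma aut_idx_pos: "\<phi> \<in> carrier \<A> \<Longrightarrow> V \<in> \<B> \<Longrightarrow> W \<in> \<B> \<Longrightarrow> 0 < idx G (\<phi> ` V) W"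
  by (rule idx_pos[OF B_finite_index[OF aut_B]]) (use B_dest(5) in blast)+

lemma B_idx_pos: "V \<in> \<B> \<Longrightarrow> W \<in> \<B> \<Longrightarrow> 0 < idx G V W"
  by (rule idx_pos[OF B_finite_index]) (use B_dest(5) in blast)+

lemma B_idx_triangle: "U \<in> \<B> \<Longrightarrow> V \<in> \<B> \<Longrightarrow> W \<in> \<B> \<Longrightarrow> idx G U W \<le> idx G U V * idx G V W"
  by (rule idx_triangle[OF B_dest(1) B_dest(1) B_dest(4) B_finite_index B_finite_index])

lemma B_idx_mult: "U \<in> \<B> \<Longrightarrow> V \<in> \<B> \<Longrightarrow> W \<in> \<B> \<Longrightarrow> W \<subseteq> V \<Longrightarrow> V \<subseteq> U \<Longrightarrow> idx G U W = idx G U V * idx G V W"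
  by (rule idx_mult[OF B_dest(1) B_dest(1) B_dest(1)])

lemma B_idx_Int: "U \<in> \<B> \<Longrightarrow> V \<in> \<B> \<Longrightarrow> idx G U (U \<inter> V) = idx G U V"
  by (rule idx_Int[OF B_dest(1) B_dest(1)])

end

context commuting_autos
begin

lemma scale_straight:
  assumes p: "\<phi> \<in> K" and W: "W \<in> inv_subgroups" "straight_for \<phi> W"
  shows "scale G T \<phi> = idx G (\<phi> ` W) W"
proof -
  interpret flow G T "powers \<phi>" by (rule flow_powers[OF p])
  have e: "\<phi> [^]\<^bsub>\<A>\<^esub> (1::int) = \<phi>" using KA[OF p] by (rule A.int_pow_1)
  show ?thesis
    by (rule scale_eqI[OF KA[OF p] inv_subgroups_B[OF W(1)]])
       (use straight_min[OF inv_subgroups_B[OF W(1)] W(2)] in \<open>simp only: e\<close>)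
qed

end

context commuting_autos_ne
begin

text \<open>Minimisers for both automorphisms exist among the invariant subgroups, so the scale sees
  only the action on these.\<close>

lemma scale_cong:
  assumes p: "\<phi> \<in> K" "\<psi> \<in> K" and e: "\<And>W. W \<in> inv_subgroups \<Longrightarrow> \<phi> ` W = \<psi> ` W"
  shows "scale G T \<phi> = scale G T \<psi>"
proof -
  obtain W where W: "W \<in> inv_subgroups" "\<forall>\<eta>\<in>{\<phi>, \<psi>}. straight_for \<eta> W" using ex_straight[of "{\<phi>, \<psi>}"] p by auto
  then show ?thesis using scale_straight[OF p(1) W(1)] scale_straight[OF p(2) W(1)] e[OF W(1)] by simp
qed

lemma scale_pos: 
  assumes "\<phi> \<in> K"
  shows "0 < scale G T \<phi>"
proof -
  obtain W where W: "W \<in> inv_subgroups" "\<forall>\<eta>\<in>{\<phi>}. straight_for \<eta> W" using ex_straight[of "{\<phi>}"] assms by auto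
  then show ?thesis using scale_straight[OF assms W(1)] aut_idx_pos[OF KA[OF assms] inv_subgroups_B[OF W(1)] inv_subgroups_B[OF W(1)]] by simp
qed

text \<open>W is straight for \<phi> and for its power at once; straightness for \<phi> evaluates
  the index that computes the scale of the power.\<close>

lemma scale_pow:
  assumes p: "\<phi> \<in> K"
  shows "scale G T (\<phi> [^]\<^bsub>\<A>\<^esub> (k::nat)) = scale G T \<phi> ^ k"
proof -
  let ?p = "\<phi> [^]\<^bsub>\<A>\<^esub> (int k)"
  interpret flow G T "powers \<phi>" by (rule flow_powers[OF p])
  obtain W where W: "W \<in> inv_subgroups" "\<forall>\<eta>\<in>{\<phi>, ?p}. straight_for \<eta> W" using ex_straight[of "{\<phi>, ?p}"] p powK[OF p] by auto
  have e: "\<phi> [^]\<^bsub>\<A>\<^esub> (1::int) = \<phi>" using KA[OF p] by (rule A.int_pow_1)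
  have "scale G T ?p = idx G (?p ` W) W" using scale_straight[OF powK[OF p] W(1)] W(2) by simp
  also have "\<dots> = idx G (\<phi> ` W) W ^ k"
  proof -
    have "straight W" using W(2) by simp
    then have "idx G (powers \<phi> (int k) ` W) W = idx G (powers \<phi> 1 ` W) W ^ k" unfolding straight_def by (rule spec)
    then show ?thesis by (simp only: e)
  qed
  also have "\<dots> = scale G T \<phi> ^ k" using scale_straight[OF p W(1)] W(2) by simp
  finally show ?thesis by (simp add: int_pow_int)
qed

lemma straight_for_image:
  assumes V: "V \<in> inv_subgroups" and p: "\<phi> \<in> K" "\<psi> \<in> K" and s: "straight_for \<psi> V"
  shows "straight_for \<psi> (\<phi> ` V)"
proof -
  interpret flow G T "powers \<phi>" by (rule flow_powers[OF p(1)])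
  have e: "\<phi> [^]\<^bsub>\<A>\<^esub> (1::int) = \<phi>" using KA[OF p(1)] by (rule A.int_pow_1)
  have "straight_for \<psi> (stay_for \<phi> V {- 1})" by (rule straight_for_stay[OF V p s]) simp_all
  then show ?thesis using f_image_stay[OF inv_subgroups_c[OF V], of 1] e by simp
qed

text \<open>With W straight for all three automorphisms, A and C are its images under their product
  and under \<psi>. Two index towers from A down to \<open>A \<inter> C \<inter> W\<close> give
  \<open>s(\<phi>) * |A \<inter> C : A \<inter> C \<inter> W| = s(\<phi>\<psi>) * |A \<inter> W : A
  \<inter> C \<inter> W|\<close>. The second factor on the left divides s(\<psi>), because s(\<psi>)
  can also be computed with Y, which is contained in W and has the image \<open>A \<inter> C\<close>
  under \<psi>.\<close>

lemma scale_mult_dvd: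
  assumes p: "\<phi> \<in> K" "\<psi> \<in> K"
  shows "scale G T (\<phi> \<otimes>\<^bsub>\<A>\<^esub> \<psi>) dvd scale G T \<phi> * scale G T \<psi>"
proof -
  let ?pq = "\<phi> \<otimes>\<^bsub>\<A>\<^esub> \<psi>"
  have pq: "?pq \<in> K" by (rule subgroup.m_closed[OF K p])
  obtain W where W: "W \<in> inv_subgroups" "\<forall>\<eta>\<in>{\<phi>, \<psi>, ?pq}. straight_for \<eta> W" using ex_straight[of "{\<phi>, \<psi>, ?pq}"] p pq by auto
  interpret g: flow G T "powers \<psi>" by (rule flow_powers[OF p(2)])
  note B = inv_subgroups_B[OF W(1)]
  define A where "A = \<psi> ` \<phi> ` W"
  define C where "C = \<psi> ` W"
  define Y where "Y = W \<inter> \<phi> ` W"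
  have phiW: "\<phi> ` W \<in> inv_subgroups" by (rule inv_subgroups_act[OF W(1) p(1)])
  have YL: "Y \<in> inv_subgroups" unfolding Y_def by (rule inv_subgroups_Int[OF W(1) phiW])
  have Ae: "A = ?pq ` W" unfolding A_def aut_image_mult[OF inv_subgroups_c[OF W(1)]] by (rule inv_subgroups_comm[OF W(1) p(2,1)])
  have AB: "A \<in> \<B>" unfolding A_def by (rule aut_B[OF KA[OF p(2)] inv_subgroups_B[OF phiW]])
  have CB: "C \<in> \<B>" unfolding C_def by (rule aut_B[OF KA[OF p(2)] B])
  have YB: "Y \<in> \<B>" by (rule inv_subgroups_B[OF YL])
  have gY: "\<psi> ` Y = A \<inter> C" unfolding Y_def A_def C_def
    using inj_on_image_Int[OF aut_inj[OF KA[OF p(2)]] inv_subgroups_c[OF W(1)] inv_subgroups_c[OF phiW]] by (simp only: Int_commute)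
  have ACB: "A \<inter> C \<in> \<B>" by (rule B_Int[OF AB CB])
  have ADB: "A \<inter> W \<in> \<B>" by (rule B_Int[OF AB B])
  have ACDB: "A \<inter> C \<inter> W \<in> \<B>" by (rule B_Int[OF ACB B])
  have sp: "scale G T \<phi> = idx G (\<phi> ` W) W" using scale_straight[OF p(1) W(1)] W(2) by simp
  have spq: "scale G T ?pq = idx G A W" unfolding Ae using scale_straight[OF pq W(1)] W(2) by simp
  have "straight_for \<psi> Y" unfolding Y_def
    by (rule g.straight_Int[OF B inv_subgroups_B[OF phiW] _ straight_for_image[OF W(1) p]]) (use W(2) in simp_all)
  then have sq: "scale G T \<psi> = idx G (A \<inter> C) Y" using scale_straight[OF p(2) YL] gY by simp
  have 1: "idx G A C = scale G T \<phi>" unfolding A_def C_def sp by (rule aut_idx[OF KA[OF p(2)] inv_subgroups_B[OF phiW] B])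
  have 2: "idx G A (A \<inter> C \<inter> W) = scale G T \<phi> * idx G (A \<inter> C) W"
    using B_idx_mult[OF AB ACB ACDB Int_lower1 Int_lower1] B_idx_Int[OF AB CB] B_idx_Int[OF ACB B] 1 by simp
  have sub: "A \<inter> C \<inter> W \<subseteq> A \<inter> W" by auto
  have 3: "idx G A (A \<inter> C \<inter> W) = scale G T ?pq * idx G (A \<inter> W) (A \<inter> C \<inter> W)"
    using B_idx_mult[OF AB ADB ACDB sub Int_lower1] B_idx_Int[OF AB B] spq by simp
  have YD: "Y \<subseteq> W" by (simp add: Y_def)
  have GYB: "(A \<inter> C) \<inter> Y \<in> \<B>" by (rule B_Int[OF ACB YB])
  have "idx G (A \<inter> C) ((A \<inter> C) \<inter> Y) = idx G (A \<inter> C) (A \<inter> C \<inter> W) * idx G (A \<inter> C \<inter> W) ((A \<inter> C) \<inter> Y)"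
    by (rule B_idx_mult[OF ACB ACDB GYB]) (use YD in auto)
  then have 4: "scale G T \<psi> = idx G (A \<inter> C) W * idx G (A \<inter> C \<inter> W) ((A \<inter> C) \<inter> Y)"
    using B_idx_Int[OF ACB YB] B_idx_Int[OF ACB B] sq by simp
  have "scale G T \<phi> * scale G T \<psi> = (scale G T \<phi> * idx G (A \<inter> C) W) * idx G (A \<inter> C \<inter> W) ((A \<inter> C) \<inter> Y)"
    unfolding 4 by (rule mult.assoc[symmetric])
  also have "scale G T \<phi> * idx G (A \<inter> C) W = scale G T ?pq * idx G (A \<inter> W) (A \<inter> C \<inter> W)"
    using 2 3 by (rule trans[OF sym])
  finally show ?thesis unfolding mult.assoc by (metis dvd_triv_left)
qed

end

section \<open>Finitely many generators and a common minimiser\<close>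

locale commuting_autos_fg = commuting_autos_ne +
  fixes n :: nat and t :: "nat \<Rightarrow> 'a \<Rightarrow> 'a"
  assumes tK: "\<And>i. t i \<in> K"
begin

text \<open>Additive in the exponent vector only when applied to invariant subgroups; as
  automorphisms the generators need not commute.\<close>

primrec tau :: "nat \<Rightarrow> (nat \<Rightarrow> int) \<Rightarrow> 'a \<Rightarrow> 'a" where
  "tau 0 v = \<one>\<^bsub>\<A>\<^esub>"
| "tau (Suc m) v = tau m v \<otimes>\<^bsub>\<A>\<^esub> (t m [^]\<^bsub>\<A>\<^esub> v m)"

lemma tauK: "tau m v \<in> K"
  by (induction m) (simp_all add: subgroup.one_closed[OF K] subgroup.m_closed[OF K] powK[OF tK])

lemma tau_add:
  assumes W: "W \<in> inv_subgroups"
  shows "tau m (u + v) ` W = tau m u ` tau m v ` W"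
  using W
proof (induction m arbitrary: W)
  case 0
  then show ?case using aut_image_one[OF inv_subgroups_c] by simp
next
  case (Suc m)
  let ?a = "t m [^]\<^bsub>\<A>\<^esub> u m" and ?b = "t m [^]\<^bsub>\<A>\<^esub> v m"
  have aK: "?a \<in> K" and bK: "?b \<in> K" by (rule powK[OF tK])+
  have c: "?a \<in> carrier \<A>" "?b \<in> carrier \<A>" using KA aK bK by auto
  have bW: "?b ` W \<in> inv_subgroups" by (rule inv_subgroups_act[OF Suc.prems bK])
  have abW: "?a ` ?b ` W \<in> inv_subgroups" by (rule inv_subgroups_act[OF bW aK])
  have "t m [^]\<^bsub>\<A>\<^esub> (u + v) m = ?a \<otimes>\<^bsub>\<A>\<^esub> ?b" using A.int_pow_mult[OF KA[OF tK]] by simp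
  then have "tau (Suc m) (u + v) ` W = tau m (u + v) ` ?a ` ?b ` W"
    using aut_image_mult[OF inv_subgroups_c[OF Suc.prems]] by simp
  also have "\<dots> = tau m u ` tau m v ` ?a ` ?b ` W" by (rule Suc.IH[OF abW])
  also have "tau m v ` ?a ` ?b ` W = ?a ` tau m v ` ?b ` W" by (rule inv_subgroups_comm[OF bW tauK aK])
  also have "tau m u ` ?a ` tau m v ` ?b ` W = tau (Suc m) u ` tau (Suc m) v ` W"
    using aut_image_mult[OF inv_subgroups_c[OF Suc.prems]] aut_image_mult[OF inv_subgroups_c[OF inv_subgroups_act[OF inv_subgroups_act[OF Suc.prems bK] tauK]]] by simp
  finally show ?case .
qed

lemma tau_truncate: "m \<le> n \<Longrightarrow> tau m (truncate n v) = tau m v"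
  by (induction m) (simp_all add: truncate_def)

lemma tau_zero: "tau m 0 = \<one>\<^bsub>\<A>\<^esub>"
  by (induction m) simp_all

lemma tau_unit_vec: "tau m (unit_vec i) = (if i < m then t i else \<one>\<^bsub>\<A>\<^esub>)"
  by (induction m) (auto simp: unit_vec_def KA[OF tK] less_Suc_eq)

lemma tau_smul:
  assumes "W \<in> inv_subgroups"
  shows "tau m (smul k v) ` W = (tau m v [^]\<^bsub>\<A>\<^esub> (k::nat)) ` W"
proof (induction k)
  case 0
  have "smul 0 v = 0" by (rule smul_simps)
  then show ?case by (simp only: tau_zero A.nat_pow_0)
next
  case (Suc k)
  have "tau m (smul (Suc k) v) ` W = tau m v ` tau m (smul k v) ` W"
    unfolding smul_simps by (rule tau_add[OF assms])
  also have "\<dots> = tau m v ` (tau m v [^]\<^bsub>\<A>\<^esub> k) ` W" using Suc by simp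
  also have "\<dots> = (tau m v \<otimes>\<^bsub>\<A>\<^esub> tau m v [^]\<^bsub>\<A>\<^esub> k) ` W" by (rule aut_image_mult[OF inv_subgroups_c[OF assms], symmetric])
  also have "tau m v \<otimes>\<^bsub>\<A>\<^esub> tau m v [^]\<^bsub>\<A>\<^esub> k = tau m v [^]\<^bsub>\<A>\<^esub> Suc k"
    using A.nat_pow_Suc2[OF KA[OF tauK]] by simp
  finally show ?case .
qed

lemma scale_tau_quasi_hom: "quasi_hom n (\<lambda>v. real (scale G T (tau n v)))"
  unfolding quasi_hom_def
proof (intro conjI allI)
  fix a b :: "nat \<Rightarrow> int" and k :: nat
  show "0 < real (scale G T (tau n a))" using scale_pos[OF tauK] by simp
  have "scale G T (tau n (a + b)) = scale G T (tau n a \<otimes>\<^bsub>\<A>\<^esub> tau n b)"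
    by (rule scale_cong[OF tauK subgroup.m_closed[OF K tauK tauK]]) (use tau_add aut_image_mult inv_subgroups_c in simp)
  then have "scale G T (tau n (a + b)) dvd scale G T (tau n a) * scale G T (tau n b)"
    using scale_mult_dvd[OF tauK tauK] by simp
  then obtain m where "scale G T (tau n a) * scale G T (tau n b) = scale G T (tau n (a + b)) * m" by (rule dvdE)
  then have "real (scale G T (tau n a) * scale G T (tau n b)) = real (m * scale G T (tau n (a + b)))"
    by (simp only: mult.commute)
  then show "\<exists>m::nat. real (scale G T (tau n a)) * real (scale G T (tau n b)) = real m * real (scale G T (tau n (a + b)))"
    unfolding of_nat_mult by (rule exI)
  have "(tau n a [^]\<^bsub>\<A>\<^esub> k) \<in> K" using powK[OF tauK, of n a "int k"] by (simp add: int_pow_int)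
  then have "scale G T (tau n (smul k a)) = scale G T (tau n a [^]\<^bsub>\<A>\<^esub> k)"
    by (rule scale_cong[OF tauK]) (rule tau_smul)
  then show "real (scale G T (tau n (smul k a))) = real (scale G T (tau n a)) ^ k"
    using scale_pow[OF tauK, of n a k] by simp
  show "real (scale G T (tau n (truncate n a))) = real (scale G T (tau n a))" by (simp add: tau_truncate)
qed

text \<open>W is made straight for the finitely many basis vectors. If b = a + c with multiplicative
  scales, the triangle inequality through the image of W under \<open>tau n a\<close> bounds the
  index for b by s(c) s(a) = s(b); induction on \<open>vsize\<close> reaches every vector.\<close>

theorem ex_common_minimiser:
  assumes gen: "\<And>\<phi>. \<phi> \<in> K \<Longrightarrow> \<exists>v. \<forall>W\<in>inv_subgroups. \<phi> ` W = tau n v ` W"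
  shows "\<exists>W\<in>inv_subgroups. \<forall>\<phi>\<in>K. idx G (\<phi> ` W) W = scale G T \<phi>"
proof -
  let ?F = "\<lambda>v. real (scale G T (tau n v))"
  obtain \<Phi> where fin: "finite \<Phi>" and basis: "\<forall>b. truncate n b = b \<longrightarrow> b \<noteq> 0 \<longrightarrow> b \<in> \<Phi> \<or>
      (\<exists>a c. b = a + c \<and> truncate n a = a \<and> truncate n c = c \<and> vsize n a < vsize n b \<and> vsize n c < vsize n b \<and> ?F b = ?F a * ?F c)"
    using quasi_hom_finite_basis[OF scale_tau_quasi_hom] by (elim exE conjE)
  obtain W where W: "W \<in> inv_subgroups" "\<forall>\<eta>\<in>tau n ` \<Phi>. straight_for \<eta> W"
    using ex_straight[of "tau n ` \<Phi>"] fin tauK by blast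
  note B = inv_subgroups_B[OF W(1)]
  have tB: "tau n v ` W \<in> \<B>" for v by (rule aut_B[OF KA[OF tauK] B])
  have main: "idx G (tau n b ` W) W \<le> scale G T (tau n b)" if "truncate n b = b" for b
    using that
  proof (induction "vsize n b" arbitrary: b rule: less_induct)
    case less
    show ?case
    proof (cases "b = 0")
      case True
      then have "tau n b ` W = W" using aut_image_one[OF inv_subgroups_c[OF W(1)]] by (simp only: tau_zero)
      then show ?thesis using B_idx_refl[OF B] scale_pos[OF tauK, of n b] by simp
    next
      case False
      show ?thesis
      proof (cases "b \<in> \<Phi>")
        case True
        then show ?thesis using scale_straight[OF tauK W(1)] W(2) by simp
      next
        case nPhi: False
        obtain a c where ac: "b = a + c" "truncate n a = a" "truncate n c = c" "vsize n a < vsize n b" "vsize n c < vsize n b"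
          "?F b = ?F a * ?F c" using basis[THEN spec, of b, THEN mp, THEN mp, OF less.prems False] nPhi by (elim disjE exE conjE) simp_all
        have "tau n b ` W = tau n a ` tau n c ` W" unfolding ac(1) by (rule tau_add[OF W(1)])
        then have "idx G (tau n b ` W) W \<le> idx G (tau n a ` tau n c ` W) (tau n a ` W) * idx G (tau n a ` W) W"
          using B_idx_triangle[OF tB[of b] tB[of a] B] by simp
        also have "idx G (tau n a ` tau n c ` W) (tau n a ` W) = idx G (tau n c ` W) W"
          by (rule aut_idx[OF KA[OF tauK] tB B])
        also have "idx G (tau n c ` W) W * idx G (tau n a ` W) W \<le> scale G T (tau n c) * scale G T (tau n a)"
          by (intro mult_le_mono less.hyps ac)
        also have "\<dots> = scale G T (tau n b)"
        proof -
          have "real (scale G T (tau n b)) = real (scale G T (tau n c) * scale G T (tau n a))" using ac(6) by simp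
          then show ?thesis by (simp only: of_nat_eq_iff)
        qed
        finally show ?thesis .
      qed
    qed
  qed
  have "idx G (\<phi> ` W) W = scale G T \<phi>" if p: "\<phi> \<in> K" for \<phi>
  proof -
    obtain v where v: "\<forall>W\<in>inv_subgroups. \<phi> ` W = tau n v ` W" using gen[OF p] by blast
    have "scale G T \<phi> = scale G T (tau n v)" by (rule scale_cong[OF p tauK]) (use v in blast)
    moreover have "idx G (\<phi> ` W) W = idx G (tau n (truncate n v) ` W) W" using v W(1) tau_truncate[of n v] by simp
    moreover have "idx G (tau n (truncate n v) ` W) W \<le> scale G T (tau n (truncate n v))" by (rule main) simp
    ultimately have "idx G (\<phi> ` W) W \<le> scale G T \<phi>" using tau_truncate[of n v] by simp
    then show ?thesis using scale_le[OF KA[OF p] B] by simp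
  qed
  then show ?thesis using W(1) by blast
qed

end

section \<open>Actions with bounded displacement\<close>

text \<open>Abstracts the elements with bounded conjugates acting on their orbit of O: b is the base
  point, r the step width of chains, finiteness of balls comes from properness, and
  \<open>displacement\<close> is boundedness of conjugates read on the orbit.\<close>

locale bounded_displacement_action = group P for P (structure) +
  fixes act :: "'a \<Rightarrow> 'x \<Rightarrow> 'x" and pts :: "'x set" and d :: "'x \<Rightarrow> 'x \<Rightarrow> real" and b :: 'x and r :: real
  assumes act_closed: "g \<in> carrier P \<Longrightarrow> x \<in> pts \<Longrightarrow> act g x \<in> pts"
    and act_mult: "g \<in> carrier P \<Longrightarrow> h \<in> carrier P \<Longrightarrow> x \<in> pts \<Longrightarrow> act (g \<otimes> h) x = act g (act h x)"
    and act_one: "x \<in> pts \<Longrightarrow> act \<one> x = x"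
    and b_pts: "b \<in> pts"
    and transitive: "x \<in> pts \<Longrightarrow> \<exists>g\<in>carrier P. x = act g b"
    and d_refl: "x \<in> pts \<Longrightarrow> d x x = 0"
    and d_sym: "x \<in> pts \<Longrightarrow> y \<in> pts \<Longrightarrow> d x y = d y x"
    and d_tri: "x \<in> pts \<Longrightarrow> y \<in> pts \<Longrightarrow> z \<in> pts \<Longrightarrow> d x z \<le> d x y + d y z"
    and d_act: "g \<in> carrier P \<Longrightarrow> x \<in> pts \<Longrightarrow> y \<in> pts \<Longrightarrow> d (act g x) (act g y) = d x y"
    and balls: "finite {x \<in> pts. d b x \<le> c}"
    and displacement: "g \<in> carrier P \<Longrightarrow> \<exists>c. \<forall>x\<in>pts. d (act g x) x \<le> c"
    and chain: "x \<in> pts \<Longrightarrow> \<exists>xs. xs \<noteq> [] \<and> hd xs = b \<and> last xs = x \<and> set xs \<subseteq> pts \<and>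
        (\<forall>i. Suc i < length xs \<longrightarrow> d (xs ! i) (xs ! Suc i) \<le> r)"
begin

lemma inv_cancel: "x \<in> carrier P \<Longrightarrow> y \<in> carrier P \<Longrightarrow> inv x \<otimes> (x \<otimes> y) = y"
  "x \<in> carrier P \<Longrightarrow> y \<in> carrier P \<Longrightarrow> x \<otimes> (inv x \<otimes> y) = y"
  by (simp_all add: m_assoc[symmetric])

definition conj_closed :: "'a set \<Rightarrow> bool" where
  "conj_closed C \<longleftrightarrow> C \<subseteq> carrier P \<and> (\<forall>c\<in>C. \<forall>g\<in>carrier P. g \<otimes> c \<otimes> inv g \<in> C)"

lemma conj_closedD:
  assumes "conj_closed C"
  shows "c \<in> C \<Longrightarrow> c \<in> carrier P" "c \<in> C \<Longrightarrow> g \<in> carrier P \<Longrightarrow> g \<otimes> c \<otimes> inv g \<in> C"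
    "c \<in> C \<Longrightarrow> g \<in> carrier P \<Longrightarrow> inv g \<otimes> c \<otimes> g \<in> C"
proof -
  show 1: "c \<in> C \<Longrightarrow> c \<in> carrier P" using assms by (auto simp: conj_closed_def)
  show 2: "c \<in> C \<Longrightarrow> g \<in> carrier P \<Longrightarrow> g \<otimes> c \<otimes> inv g \<in> C" for g using assms by (simp add: conj_closed_def)
  show "c \<in> C \<Longrightarrow> g \<in> carrier P \<Longrightarrow> inv g \<otimes> c \<otimes> g \<in> C" using 2[of "inv g"] by simp
qed

text \<open>Products of n factors are recorded by their effect on b, so that the factor next to b
  can be exchanged for any other with the same effect.\<close>

primrec reach :: "'a set \<Rightarrow> nat \<Rightarrow> 'x set" where
  "reach C 0 = {b}"
| "reach C (Suc n) = {act c x | c x. c \<in> C \<and> x \<in> reach C n}"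

lemma reach_pts: "C \<subseteq> carrier P \<Longrightarrow> reach C n \<subseteq> pts"
  by (induction n) (auto simp: b_pts intro!: act_closed)

lemma reach_SucI: "c \<in> C \<Longrightarrow> x \<in> reach C n \<Longrightarrow> act c x \<in> reach C (Suc n)"
  by auto

lemma act_swap:
  assumes "g \<in> carrier P" "h \<in> carrier P" "x \<in> pts"
  shows "act g (act h x) = act h (act (inv h \<otimes> g \<otimes> h) x)"
  using assms by (simp add: act_mult[symmetric] m_assoc inv_cancel)

text \<open>The factor acting directly on b may be taken from B; moving it to the front only
  conjugates the factors it passes, and these stay in C.\<close>

lemma reach_Suc_subset:
  assumes C: "conj_closed C" and B: "B \<subseteq> C" and rep: "\<And>c. c \<in> C \<Longrightarrow> \<exists>e\<in>B. act c b = act e b"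
  shows "z \<in> reach C (Suc n) \<Longrightarrow> \<exists>e\<in>B. \<exists>x\<in>reach C n. z = act e x"
proof (induction n arbitrary: z)
  case 0
  then show ?case using rep by auto
next
  case (Suc n)
  obtain c x where c: "c \<in> C" "x \<in> reach C (Suc n)" "z = act c x" using Suc.prems by auto
  obtain e y where e: "e \<in> B" "y \<in> reach C n" "x = act e y" using Suc.IH[OF c(2)] by auto
  have eC: "e \<in> C" "e \<in> carrier P" using e B conj_closedD(1)[OF C] by auto
  have y: "y \<in> pts" using e(2) reach_pts[of C n] C by (auto simp: conj_closed_def)
  have "z = act e (act (inv e \<otimes> c \<otimes> e) y)" unfolding c e using act_swap[OF conj_closedD(1)[OF C c(1)] eC(2) y] .
  moreover have "act (inv e \<otimes> c \<otimes> e) y \<in> reach C (Suc n)"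
    by (rule reach_SucI[OF conj_closedD(3)[OF C c(1) eC(2)] e(2)])
  ultimately show ?case using e(1) by blast
qed

text \<open>The collecting process: factors equal to a given element can be moved to the front, which only
  conjugates the remaining ones, so that after sorting only the powers of finitely many elements matter.\<close>

lemma collecting:
  assumes C: "conj_closed C" and B: "finite B" "B \<subseteq> C" and rep: "\<And>c. c \<in> C \<Longrightarrow> \<exists>e\<in>B. act c b = act e b"
    and g: "g \<in> carrier P" and bd: "\<And>e k x. e \<in> B \<Longrightarrow> x \<in> pts \<Longrightarrow> d (act (e [^] (k::nat)) x) (act (g [^] k) x) \<le> \<beta> e"
    and U: "finite U" "U \<subseteq> B"
    and z: "z \<in> reach C n" and avoid: "\<forall>m. n = Suc m \<longrightarrow> (\<forall>e\<in>B - U. z \<notin> act e ` reach C m)"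
  shows "d z (act (g [^] n) b) \<le> sum \<beta> U"
  using U z avoid
proof (induction U arbitrary: z n rule: finite_induct)
  case empty
  show ?case
  proof (cases n)
    case 0
    then show ?thesis using empty by (simp add: act_one b_pts d_refl)
  next
    case (Suc m)
    then show ?thesis using empty reach_Suc_subset[OF C B(2) rep, of z m] by auto
  qed
next
  case (insert e U)
  have eB: "e \<in> B" and UB: "U \<subseteq> B" using insert.prems by auto
  have eC: "e \<in> C" "e \<in> carrier P" using eB B conj_closedD(1)[OF C] by auto
  have Csub: "C \<subseteq> carrier P" using C by (simp add: conj_closed_def)
  \<comment> \<open>Strip e from the front as long as possible. What remains starts with no element
    of B outside U and is left to the outer induction.\<close>
  have "\<exists>k m y. n = k + m \<and> z = act (e [^] k) y \<and> y \<in> reach C m \<and>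
      (\<forall>l. m = Suc l \<longrightarrow> (\<forall>e\<in>B - U. y \<notin> act e ` reach C l))"
    using insert.prems(2,3)
  proof (induction n arbitrary: z)
    case 0
    then show ?case by (intro exI[of _ 0] exI[of _ z]) (simp add: act_one b_pts)
  next
    case (Suc n)
    have zp: "z \<in> pts" using Suc.prems(1) reach_pts[OF Csub, of "Suc n"] by blast
    show ?case
    proof (cases "z \<in> act e ` reach C n")
      case False
      then show ?thesis using Suc.prems zp
        by (intro exI[of _ 0] exI[of _ "Suc n"] exI[of _ z]) (auto simp: act_one)
    next
      case True
      then obtain y where y: "y \<in> reach C n" "z = act e y" by blast
      \<comment> \<open>If y could start with such an f, so could z: moving e past f only conjugates
        e.\<close>
      have "\<forall>m. n = Suc m \<longrightarrow> (\<forall>f\<in>B - insert e U. y \<notin> act f ` reach C m)"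
      proof (intro allI impI ballI notI)
        fix m f assume nm: "n = Suc m" and f: "f \<in> B - insert e U" and yf: "y \<in> act f ` reach C m"
        obtain x where x: "x \<in> reach C m" "y = act f x" using yf by blast
        have fC: "f \<in> carrier P" using f B conj_closedD(1)[OF C] by auto
        have xp: "x \<in> pts" using x(1) reach_pts[OF Csub, of m] by blast
        have "z = act f (act (inv f \<otimes> e \<otimes> f) x)" unfolding y(2) x(2) by (rule act_swap[OF eC(2) fC xp])
        moreover have "act (inv f \<otimes> e \<otimes> f) x \<in> reach C n"
          unfolding nm by (rule reach_SucI[OF conj_closedD(3)[OF C eC(1) fC] x(1)])
        ultimately show False using Suc.prems(2) f by blast
      qed
      from Suc.IH[OF y(1) this] obtain k m x where x: "n = k + m" "y = act (e [^] k) x" "x \<in> reach C m"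
        "\<forall>l. m = Suc l \<longrightarrow> (\<forall>e\<in>B - U. x \<notin> act e ` reach C l)" by (elim exE conjE)
      have xp: "x \<in> pts" using x(3) reach_pts[OF Csub, of m] by blast
      have "z = act (e [^] Suc k) x"
        using y(2) x(2) act_mult[OF eC(2) nat_pow_closed[OF eC(2)] xp] nat_pow_Suc2[OF eC(2)] by simp
      then show ?thesis using x(1,3,4) by (intro exI[of _ "Suc k"] exI[of _ m] exI[of _ x]) simp
    qed
  qed
  then obtain k m y where y: "n = k + m" "z = act (e [^] k) y" "y \<in> reach C m"
    "\<forall>l. m = Suc l \<longrightarrow> (\<forall>e\<in>B - U. y \<notin> act e ` reach C l)" by (elim exE conjE)
  have yp: "y \<in> pts" using y(3) reach_pts[OF Csub, of m] by blast
  note gk = nat_pow_closed[OF g, of k] and gm = nat_pow_closed[OF g, of m] and ek = nat_pow_closed[OF eC(2), of k]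
  have gn: "act (g [^] n) b = act (g [^] k) (act (g [^] m) b)"
    unfolding y(1) nat_pow_mult[OF g, symmetric] by (rule act_mult[OF gk gm b_pts])
  have "d z (act (g [^] n) b) \<le> d (act (e [^] k) y) (act (g [^] k) y) + d (act (g [^] k) y) (act (g [^] k) (act (g [^] m) b))"
    unfolding y(2) gn by (intro d_tri act_closed ek gk gm yp b_pts)
  also have "d (act (g [^] k) y) (act (g [^] k) (act (g [^] m) b)) = d y (act (g [^] m) b)"
    by (rule d_act[OF gk yp act_closed[OF gm b_pts]])
  also have "\<dots> \<le> sum \<beta> U" by (rule insert.IH[OF UB y(3,4)])
  also have "d (act (e [^] k) y) (act (g [^] k) y) \<le> \<beta> e" by (rule bd[OF eB yp])
  finally show ?case using insert.hyps by simp
qed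

text \<open>Used with C the conjugacy class of g, and with g = \<one> for commutators, whose powers
  have bounded displacement.\<close>

lemma reach_bounded:
  assumes C: "conj_closed C" and fin: "finite ((\<lambda>c. act c b) ` C)" and g: "g \<in> carrier P"
    and bd: "\<And>c. c \<in> C \<Longrightarrow> \<exists>\<beta>. \<forall>x\<in>pts. \<forall>k::nat. d (act (c [^] k) x) (act (g [^] k) x) \<le> \<beta>"
  shows "\<exists>\<kappa>. \<forall>n. \<forall>z\<in>reach C n. d z (act (g [^] n) b) \<le> \<kappa>"
proof -
  obtain B where B: "B \<subseteq> C" "finite B" "(\<lambda>c. act c b) ` C = (\<lambda>c. act c b) ` B"
    using finite_subset_image[OF fin subset_refl] by blast
  have rep: "\<exists>e\<in>B. act c b = act e b" if "c \<in> C" for c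
  proof -
    have "act c b \<in> (\<lambda>c. act c b) ` B" using that B(3) by blast
    then show ?thesis by blast
  qed
  have "\<exists>\<beta>. \<forall>e\<in>C. \<forall>x\<in>pts. \<forall>k::nat. d (act (e [^] k) x) (act (g [^] k) x) \<le> \<beta> e"
    by (intro bchoice ballI bd)
  then obtain \<beta> where \<beta>: "\<forall>e\<in>C. \<forall>x\<in>pts. \<forall>k::nat. d (act (e [^] k) x) (act (g [^] k) x) \<le> \<beta> e" by (rule exE)
  have "d z (act (g [^] n) b) \<le> sum \<beta> B" if "z \<in> reach C n" for n z
    by (rule collecting[OF C B(2,1) rep g _ B(2) subset_refl that]) (use \<beta> B(1) in auto)
  then show ?thesis by blast
qed

section \<open>Conjugacy classes and words in them\<close>

definition conj_class :: "'a \<Rightarrow> 'a set" where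
  "conj_class g = (\<lambda>h. h \<otimes> g \<otimes> inv h) ` carrier P"

lemma conj_class_closed:
  assumes "g \<in> carrier P" shows "conj_closed (conj_class g)"
  unfolding conj_closed_def conj_class_def
proof (intro conjI subsetI ballI)
  fix x assume "x \<in> (\<lambda>h. h \<otimes> g \<otimes> inv h) ` carrier P"
  then show "x \<in> carrier P" using assms by auto
next
  fix c h assume "c \<in> (\<lambda>h. h \<otimes> g \<otimes> inv h) ` carrier P" and h: "h \<in> carrier P"
  then obtain k where k: "k \<in> carrier P" "c = k \<otimes> g \<otimes> inv k" by blast
  have "h \<otimes> c \<otimes> inv h = (h \<otimes> k) \<otimes> g \<otimes> inv (h \<otimes> k)" using k h assms by (simp add: m_assoc inv_mult_group)
  then show "h \<otimes> c \<otimes> inv h \<in> (\<lambda>h. h \<otimes> g \<otimes> inv h) ` carrier P" using h k(1) by blast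
qed

lemma conj_class_self: "g \<in> carrier P \<Longrightarrow> g \<in> conj_class g"
  unfolding conj_class_def by (rule image_eqI[of _ _ \<one>]) auto

lemma act_inv: 
  assumes "g \<in> carrier P" "x \<in> pts" shows "act (inv g) (act g x) = x" "act g (act (inv g) x) = x"
  using assms by (simp_all add: act_mult[symmetric] act_one)

lemma conj_class_disp:
  assumes g: "g \<in> carrier P" and bd: "\<forall>x\<in>pts. d (act g x) x \<le> c" and h: "h \<in> conj_class g" and x: "x \<in> pts"
  shows "d (act h x) x \<le> c" "d (act (inv h) x) x \<le> c"
proof -
  obtain k where k: "k \<in> carrier P" "h = k \<otimes> g \<otimes> inv k" using h unfolding conj_class_def by blast
  have *: "d (act h x) x \<le> c" if x: "x \<in> pts" for x
  proof -
    let ?y = "act (inv k) x"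
    have y: "?y \<in> pts" using k x by (simp add: act_closed)
    have "act h x = act k (act g ?y)" unfolding k(2) using k g x y by (simp add: act_mult)
    moreover have "x = act k ?y" using act_inv(2)[OF k(1) x] by simp
    ultimately have "d (act h x) x = d (act k (act g ?y)) (act k ?y)" by simp
    also have "\<dots> = d (act g ?y) ?y" by (rule d_act[OF k(1) act_closed[OF g y] y])
    finally show ?thesis using bd y by simp
  qed
  show "d (act h x) x \<le> c" by (rule *[OF x])
  have hc: "h \<in> carrier P" using k g by simp
  let ?y = "act (inv h) x"
  have y: "?y \<in> pts" using hc x by (simp add: act_closed)
  have "d (act h ?y) ?y \<le> c" by (rule *[OF y])
  then show "d ?y x \<le> c" using act_inv(2)[OF hc x] d_sym[OF x y] by simp
qed

lemma finite_orbit_if_bounded: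
  assumes "C \<subseteq> carrier P" "\<And>g. g \<in> C \<Longrightarrow> d (act g b) b \<le> c"
  shows "finite ((\<lambda>g. act g b) ` C)"
proof (rule finite_subset[OF _ balls[of c]])
  show "(\<lambda>g. act g b) ` C \<subseteq> {x \<in> pts. d b x \<le> c}"
  proof (rule image_subsetI)
    fix g assume "g \<in> C"
    then show "act g b \<in> {x \<in> pts. d b x \<le> c}"
      using assms act_closed[of g b] d_sym[OF b_pts, of "act g b"] b_pts by auto
  qed
qed

lemma conj_pow:
  assumes "h \<in> carrier P" "g \<in> carrier P"
  shows "(h \<otimes> g \<otimes> inv h) [^] (k::nat) = h \<otimes> g [^] k \<otimes> inv h"
proof (induction k)
  case (Suc k)
  then show ?case using assms by (simp add: m_assoc inv_cancel)
qed (use assms in simp)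

text \<open>\<open>h [^] k\<close> is \<open>g [^] k\<close> conjugated by the same p for every k,
  so the bounded displacement of p, used twice, gives a bound independent of k.\<close>

lemma conj_class_pow_close:
  assumes g: "g \<in> carrier P" and h: "h \<in> conj_class g"
  shows "\<exists>\<beta>. \<forall>x\<in>pts. \<forall>k::nat. d (act (h [^] k) x) (act (g [^] k) x) \<le> \<beta>"
proof -
  obtain p where p: "p \<in> carrier P" "h = p \<otimes> g \<otimes> inv p" using h unfolding conj_class_def by blast
  obtain c where c: "\<forall>x\<in>pts. d (act p x) x \<le> c" using displacement[OF p(1)] by (rule exE)
  have "d (act (h [^] k) x) (act (g [^] k) x) \<le> c + c" if x: "x \<in> pts" for x and k :: nat
  proof -
    note gk = nat_pow_closed[OF g, of k]
    let ?y = "act (inv p) x"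
    have y: "?y \<in> pts" using p x by (simp add: act_closed)
    have x': "act p ?y = x" by (rule act_inv(2)[OF p(1) x])
    have "act (h [^] k) x = act p (act (g [^] k) ?y)"
      unfolding p(2) conj_pow[OF p(1) g] using p(1) gk x y by (simp add: act_mult)
    then have "d (act (h [^] k) x) (act (g [^] k) x) \<le> d (act p (act (g [^] k) ?y)) (act (g [^] k) ?y) + d (act (g [^] k) ?y) (act (g [^] k) x)"
      using d_tri[OF act_closed[OF p(1) act_closed[OF gk y]] act_closed[OF gk y] act_closed[OF gk x]] by simp
    also have "d (act (g [^] k) ?y) (act (g [^] k) x) = d x ?y"
      using d_act[OF gk y x] d_sym[OF x y] by simp
    also have "d x ?y \<le> c" using c[THEN bspec, OF y] unfolding x' .
    also have "d (act p (act (g [^] k) ?y)) (act (g [^] k) ?y) \<le> c" using c act_closed[OF gk y] by blast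
    finally show ?thesis by simp
  qed
  then show ?thesis by blast
qed

lemma conj_class_finite: 
  assumes g: "g \<in> carrier P" shows "finite ((\<lambda>c. act c b) ` conj_class g)"
proof -
  obtain c where c: "\<forall>x\<in>pts. d (act g x) x \<le> c" using displacement[OF g] by (rule exE)
  have s: "conj_class g \<subseteq> carrier P" using conj_class_closed[OF g] by (simp add: conj_closed_def)
  show ?thesis by (rule finite_orbit_if_bounded[OF s conj_class_disp(1)[OF g c _ b_pts]])
qed

primrec words :: "'a set \<Rightarrow> nat \<Rightarrow> 'a set" where
  "words C 0 = {\<one>}"
| "words C (Suc n) = {c \<otimes> w | c w. c \<in> C \<and> w \<in> words C n}"

lemma words_carrier: "C \<subseteq> carrier P \<Longrightarrow> words C n \<subseteq> carrier P"
  by (induction n) auto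

lemma words_reach: "C \<subseteq> carrier P \<Longrightarrow> w \<in> words C n \<Longrightarrow> act w b \<in> reach C n"
proof (induction n arbitrary: w)
  case 0
  then show ?case by (simp add: act_one b_pts)
next
  case (Suc n)
  obtain c v where c: "c \<in> C" "v \<in> words C n" "w = c \<otimes> v" using Suc.prems by auto
  have "act w b = act c (act v b)" unfolding c(3)
    by (rule act_mult) (use c Suc.prems(1) words_carrier[of C n] b_pts in auto)
  then show ?case using reach_SucI[OF c(1) Suc.IH[OF Suc.prems(1) c(2)]] by simp
qed

lemma words_conj:
  assumes C: "conj_closed C" and g: "g \<in> carrier P"
  shows "w \<in> words C n \<Longrightarrow> inv g \<otimes> w \<otimes> g \<in> words C n"
proof (induction n arbitrary: w)
  case 0
  then show ?case using g by simp
next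
  case (Suc n)
  have s: "C \<subseteq> carrier P" using C by (simp add: conj_closed_def)
  obtain c v where c: "c \<in> C" "v \<in> words C n" "w = c \<otimes> v" using Suc.prems by auto
  have cv: "c \<in> carrier P" "v \<in> carrier P" using c s words_carrier[OF s, of n] by auto
  have "inv g \<otimes> w \<otimes> g = (inv g \<otimes> c \<otimes> g) \<otimes> (inv g \<otimes> v \<otimes> g)"
    unfolding c(3) using cv g by (simp add: m_assoc inv_cancel)
  then show ?case using conj_closedD(3)[OF C c(1) g] Suc.IH[OF c(2)] by auto
qed

lemma words_pow: "C \<subseteq> carrier P \<Longrightarrow> c \<in> C \<Longrightarrow> c [^] n \<in> words C n"
proof (induction n)
  case (Suc n)
  have "c [^] Suc n = c \<otimes> c [^] n" by (rule nat_pow_Suc2) (use Suc.prems in blast)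
  then show ?case using Suc by auto
qed simp

text \<open>Writing x as the image of b under p and conjugating by p moves the comparison to the
  base point, where w and \<open>g [^] n\<close> both become words of length n; this doubles the
  constant.\<close>

lemma words_close:
  assumes g: "g \<in> carrier P"
  shows "\<exists>\<kappa>. \<forall>n. \<forall>w\<in>words (conj_class g) n. \<forall>x\<in>pts. d (act w x) (act (g [^] n) x) \<le> \<kappa>"
proof -
  let ?C = "conj_class g"
  note C = conj_class_closed[OF g]
  have s: "?C \<subseteq> carrier P" using C by (simp add: conj_closed_def)
  obtain \<kappa> where "\<forall>n. \<forall>z\<in>reach ?C n. d z (act (g [^] n) b) \<le> \<kappa>"
    using reach_bounded[OF C conj_class_finite[OF g] g conj_class_pow_close[OF g]] by (rule exE)
  then have k: "d z (act (g [^] n) b) \<le> \<kappa>" if "z \<in> reach ?C n" for n z using that by simp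
  have "d (act w x) (act (g [^] n) x) \<le> \<kappa> + \<kappa>" if w: "w \<in> words ?C n" and x: "x \<in> pts" for n w x
  proof -
    obtain p where p: "p \<in> carrier P" "x = act p b" using transitive[OF x] by blast
    have wc: "w \<in> carrier P" using w words_carrier[OF s, of n] by blast
    define w' where "w' = inv p \<otimes> w \<otimes> p"
    define v' where "v' = inv p \<otimes> g [^] n \<otimes> p"
    note gn = nat_pow_closed[OF g, of n]
    have w': "w' \<in> words ?C n" "w' \<in> carrier P" unfolding w'_def using words_conj[OF C p(1) w] wc p(1) by auto
    have v': "v' \<in> words ?C n" "v' \<in> carrier P" unfolding v'_def
      using words_conj[OF C p(1) words_pow[OF s conj_class_self[OF g]]] gn p(1) by auto
    note bd = k[OF words_reach[OF s w'(1)]] k[OF words_reach[OF s v'(1)]]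
    have b': "act w' b \<in> pts" "act v' b \<in> pts" "act (g [^] n) b \<in> pts" using w' v' gn b_pts by (auto intro!: act_closed)
    have 1: "act w x = act p (act w' b)" unfolding p(2) w'_def by (rule act_swap[OF wc p(1) b_pts])
    have 2: "act (g [^] n) x = act p (act v' b)" unfolding p(2) v'_def by (rule act_swap[OF gn p(1) b_pts])
    have "d (act w x) (act (g [^] n) x) = d (act w' b) (act v' b)" unfolding 1 2 by (rule d_act[OF p(1) b'(1,2)])
    also have "\<dots> \<le> d (act w' b) (act (g [^] n) b) + d (act (g [^] n) b) (act v' b)" by (rule d_tri[OF b'(1,3,2)])
    finally show ?thesis using bd d_sym[OF b'(2,3)] by simp
  qed
  then show ?thesis by blast
qed

end

section \<open>Commutators and an abelian quotient\<close>

context bounded_displacement_action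
begin

definition commutator :: "'a \<Rightarrow> 'a \<Rightarrow> 'a" where
  "commutator g h = g \<otimes> h \<otimes> inv g \<otimes> inv h"

lemma commutator_closed: "g \<in> carrier P \<Longrightarrow> h \<in> carrier P \<Longrightarrow> commutator g h \<in> carrier P"
  by (simp add: commutator_def)

text \<open>A commutator is a conjugate of h times \<open>inv h\<close>; collecting the n inverses
  on the right only conjugates the other factors within the class of h.\<close>

lemma commutator_pow:
  assumes g: "g \<in> carrier P" and h: "h \<in> carrier P"
  shows "\<exists>w\<in>words (conj_class h) n. commutator g h [^] n = w \<otimes> inv (h [^] n)"
proof (induction n)
  case 0
  then show ?case by simp
next
  case (Suc n)
  then obtain w where w: "w \<in> words (conj_class h) n" "commutator g h [^] n = w \<otimes> inv (h [^] n)" by blast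
  note C = conj_class_closed[OF h]
  have s: "conj_class h \<subseteq> carrier P" using C by (simp add: conj_closed_def)
  have wc: "w \<in> carrier P" using w(1) words_carrier[OF s, of n] by blast
  have "commutator g h [^] Suc n = commutator g h \<otimes> (commutator g h [^] n)" by (rule nat_pow_Suc2[OF commutator_closed[OF g h]])
  also have "\<dots> = ((g \<otimes> h \<otimes> inv g) \<otimes> (inv h \<otimes> w \<otimes> h)) \<otimes> inv (h [^] Suc n)"
    unfolding w(2) unfolding commutator_def using g h wc by (simp add: m_assoc inv_mult_group inv_cancel)
  finally have "commutator g h [^] Suc n = ((g \<otimes> h \<otimes> inv g) \<otimes> (inv h \<otimes> w \<otimes> h)) \<otimes> inv (h [^] Suc n)" .
  moreover have "g \<otimes> h \<otimes> inv g \<in> conj_class h" using g unfolding conj_class_def by (rule imageI)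
  ultimately show ?case using words_conj[OF C h w(1)] unfolding words.simps by blast
qed

text \<open>The n conjugates of h move points like \<open>h [^] n\<close> up to an error independent
  of n and g, and the trailing inverse compensates that power.\<close>

lemma commutator_pow_bounded:
  assumes h: "h \<in> carrier P"
  shows "\<exists>\<kappa>. \<forall>g\<in>carrier P. \<forall>x\<in>pts. \<forall>n::nat. d (act (commutator g h [^] n) x) x \<le> \<kappa>"
proof -
  obtain \<kappa> where k: "\<forall>n. \<forall>w\<in>words (conj_class h) n. \<forall>x\<in>pts. d (act w x) (act (h [^] n) x) \<le> \<kappa>"
    using words_close[OF h] by (rule exE)
  have s: "conj_class h \<subseteq> carrier P" using conj_class_closed[OF h] by (simp add: conj_closed_def)
  have "d (act (commutator g h [^] n) x) x \<le> \<kappa>" if g: "g \<in> carrier P" and x: "x \<in> pts" for g x and n :: nat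
  proof -
    obtain w where w: "w \<in> words (conj_class h) n" "commutator g h [^] n = w \<otimes> inv (h [^] n)"
      using commutator_pow[OF g h] by blast
    have wc: "w \<in> carrier P" using w(1) words_carrier[OF s, of n] by blast
    have hn: "h [^] n \<in> carrier P" using h by simp
    have y: "act (inv (h [^] n)) x \<in> pts" by (rule act_closed[OF inv_closed[OF hn] x])
    have "d (act w (act (inv (h [^] n)) x)) (act (h [^] n) (act (inv (h [^] n)) x)) \<le> \<kappa>" using k w(1) y by blast
    then show ?thesis unfolding w(2) using act_mult[OF wc inv_closed[OF hn] x] act_inv(2)[OF hn x] by simp
  qed
  then show ?thesis by blast
qed

definition commutators :: "'a set \<Rightarrow> 'a set" where
  "commutators S = {commutator g c | g c t. g \<in> carrier P \<and> t \<in> S \<and> c \<in> conj_class t}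
         \<union> {inv (commutator g c) | g c t. g \<in> carrier P \<and> t \<in> S \<and> c \<in> conj_class t}"

lemma commutator_conj:
  assumes "g \<in> carrier P" "h \<in> carrier P" "k \<in> carrier P"
  shows "k \<otimes> commutator g h \<otimes> inv k = commutator (k \<otimes> g \<otimes> inv k) (k \<otimes> h \<otimes> inv k)"
  using assms by (simp add: commutator_def m_assoc inv_mult_group inv_cancel)

lemma conj_inv: "g \<in> carrier P \<Longrightarrow> k \<in> carrier P \<Longrightarrow> k \<otimes> inv g \<otimes> inv k = inv (k \<otimes> g \<otimes> inv k)"
  by (simp add: m_assoc inv_mult_group)

lemma conj_class_carrier: "g \<in> carrier P \<Longrightarrow> conj_class g \<subseteq> carrier P"
  using conj_class_closed[of g] by (simp add: conj_closed_def)

lemma commutators_cases: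
  assumes S: "S \<subseteq> carrier P" and e: "e \<in> commutators S"
  obtains g t c where "g \<in> carrier P" "t \<in> S" "c \<in> conj_class t" "c \<in> carrier P" "e = commutator g c \<or> e = inv (commutator g c)"
proof -
  have "\<exists>g t c. g \<in> carrier P \<and> t \<in> S \<and> c \<in> conj_class t \<and> (e = commutator g c \<or> e = inv (commutator g c))"
    using e unfolding commutators_def by blast
  then obtain g t c where *: "g \<in> carrier P" "t \<in> S" "c \<in> conj_class t" "e = commutator g c \<or> e = inv (commutator g c)" by (elim exE conjE)
  then have "c \<in> carrier P" using conj_class_carrier[of t] S by blast
  with * show thesis by (intro that)
qed

lemma commutators_I: "g \<in> carrier P \<Longrightarrow> t \<in> S \<Longrightarrow> c \<in> conj_class t \<Longrightarrow> e = commutator g c \<or> e = inv (commutator g c) \<Longrightarrow> e \<in> commutators S"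
  unfolding commutators_def by blast

lemma commutators_carrier: "S \<subseteq> carrier P \<Longrightarrow> commutators S \<subseteq> carrier P"
  by (rule subsetI) (metis commutators_cases commutator_closed inv_closed)

lemma commutators_conj_closed:
  assumes S: "S \<subseteq> carrier P"
  shows "conj_closed (commutators S)"
  unfolding conj_closed_def
proof (intro conjI ballI commutators_carrier[OF S])
  fix e k assume e: "e \<in> commutators S" and k: "k \<in> carrier P"
  obtain g t c where c: "g \<in> carrier P" "t \<in> S" "c \<in> conj_class t" "c \<in> carrier P" "e = commutator g c \<or> e = inv (commutator g c)"
    using commutators_cases[OF S e] .
  have t: "t \<in> carrier P" using c(2) S by blast
  have "k \<otimes> e \<otimes> inv k = commutator (k \<otimes> g \<otimes> inv k) (k \<otimes> c \<otimes> inv k) \<or> k \<otimes> e \<otimes> inv k = inv (commutator (k \<otimes> g \<otimes> inv k) (k \<otimes> c \<otimes> inv k))"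
    using c(5) conj_inv[OF commutator_closed[OF c(1,4)] k] commutator_conj[OF c(1,4) k] by auto
  then show "k \<otimes> e \<otimes> inv k \<in> commutators S"
    by (rule commutators_I[rotated 3]) (use c(1,2) k conj_closedD(2)[OF conj_class_closed[OF t] c(3) k] in auto)
qed

lemma inv_pow_disp:
  assumes g: "g \<in> carrier P" and x: "x \<in> pts"
  shows "d (act (inv g [^] (n::nat)) x) x = d (act (g [^] n) x) x"
proof -
  have gn: "g [^] n \<in> carrier P" "inv (g [^] n) \<in> carrier P" using g by simp_all
  have "d (act (inv (g [^] n)) x) x = d (act (g [^] n) (act (inv (g [^] n)) x)) (act (g [^] n) x)"
    by (rule d_act[OF gn(1) act_closed[OF gn(2) x] x, symmetric])
  also have "\<dots> = d (act (g [^] n) x) x" using act_inv(2)[OF gn(1) x] d_sym[OF x act_closed[OF gn(1) x]] by simp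
  finally show ?thesis using g by (simp add: nat_pow_inv)
qed

lemma commutators_pow_bounded:
  assumes S: "S \<subseteq> carrier P" and e: "e \<in> commutators S"
  shows "\<exists>\<beta>. \<forall>x\<in>pts. \<forall>n::nat. d (act (e [^] n) x) (act (\<one> [^] n) x) \<le> \<beta>"
proof -
  obtain g t c where c: "g \<in> carrier P" "t \<in> S" "c \<in> conj_class t" "c \<in> carrier P" "e = commutator g c \<or> e = inv (commutator g c)"
    using commutators_cases[OF S e] .
  obtain \<kappa> where k: "\<forall>g\<in>carrier P. \<forall>x\<in>pts. \<forall>n::nat. d (act (commutator g c [^] n) x) x \<le> \<kappa>"
    using commutator_pow_bounded[OF c(4)] by (rule exE)
  have "d (act (e [^] n) x) (act (\<one> [^] n) x) \<le> \<kappa>" if x: "x \<in> pts" for x and n :: nat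
    using c(5) k c(1) x inv_pow_disp[OF commutator_closed[OF c(1,4)] x, of n] by (auto simp: act_one)
  then show ?thesis by blast
qed

text \<open>\<open>commutator g c\<close> is a conjugate of t times the inverse of another one, so
  its displacement is at most twice the bound for t, whatever g and c are.\<close>

lemma commutators_finite:
  assumes S: "finite S" "S \<subseteq> carrier P"
  shows "finite ((\<lambda>g. act g b) ` commutators S)"
proof -
  have "\<exists>c. \<forall>t\<in>S. \<forall>x\<in>pts. d (act t x) x \<le> c t"
    by (intro bchoice ballI displacement) (use S(2) in blast)
  then obtain D where D: "\<forall>t\<in>S. \<forall>x\<in>pts. d (act t x) x \<le> D t" by (rule exE)
  have D0: "0 \<le> D t" if "t \<in> S" for t
  proof -
    have t: "t \<in> carrier P" using that S(2) by blast
    have p: "act t b \<in> pts" by (rule act_closed[OF t b_pts])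
    have "0 \<le> d (act t b) b + d b (act t b)" using d_tri[OF p b_pts p] d_refl[OF p] by simp
    then show ?thesis using D[THEN bspec, OF that, THEN bspec, OF b_pts] d_sym[OF p b_pts] by simp
  qed
  have "d (act e b) b \<le> 2 * sum D S" if e: "e \<in> commutators S" for e
  proof -
    obtain g t c where c: "g \<in> carrier P" "t \<in> S" "c \<in> conj_class t" "c \<in> carrier P" "e = commutator g c \<or> e = inv (commutator g c)"
      using commutators_cases[OF S(2) e] .
    have t: "t \<in> carrier P" using c(2) S(2) by blast
    have Dt: "\<forall>x\<in>pts. d (act t x) x \<le> D t" using D c(2) by blast
    let ?c' = "g \<otimes> c \<otimes> inv g"
    have c': "?c' \<in> conj_class t" by (rule conj_closedD(2)[OF conj_class_closed[OF t] c(3,1)])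
    have c'c: "?c' \<in> carrier P" using c by simp
    have y: "act (inv c) b \<in> pts" by (rule act_closed[OF inv_closed[OF c(4)] b_pts])
    have "act (commutator g c) b = act ?c' (act (inv c) b)"
      unfolding commutator_def by (rule act_mult[OF c'c inv_closed[OF c(4)] b_pts])
    then have "d (act (commutator g c) b) b \<le> d (act ?c' (act (inv c) b)) (act (inv c) b) + d (act (inv c) b) b"
      using d_tri[OF act_closed[OF c'c y] y b_pts] by simp
    also have "\<dots> \<le> D t + D t"
      by (intro add_mono conj_class_disp(1)[OF t Dt c' y] conj_class_disp(2)[OF t Dt c(3) b_pts])
    finally have "d (act (commutator g c) b) b \<le> 2 * D t" by simp
    moreover have "d (act (inv (commutator g c)) b) b = d (act (commutator g c) b) b"
      using inv_pow_disp[OF commutator_closed[OF c(1,4)] b_pts, of 1] commutator_closed[OF c(1,4)] by simp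
    moreover have "D t \<le> sum D S" by (rule member_le_sum[OF c(2) D0 S(1)]) simp
    ultimately show ?thesis using c(5) by auto
  qed
  then show ?thesis by (rule finite_orbit_if_bounded[OF commutators_carrier[OF S(2)]])
qed

lemma words_append:
  assumes C: "C \<subseteq> carrier P"
  shows "u \<in> words C n \<Longrightarrow> v \<in> words C m \<Longrightarrow> u \<otimes> v \<in> words C (n + m)"
proof (induction n arbitrary: u)
  case 0
  then show ?case using words_carrier[OF C, of m] by auto
next
  case (Suc n)
  obtain c w where c: "c \<in> C" "w \<in> words C n" "u = c \<otimes> w" using Suc.prems by auto
  have "u \<otimes> v = c \<otimes> (w \<otimes> v)" unfolding c(3)
    by (rule m_assoc) (use c Suc.prems words_carrier[OF C, of n] words_carrier[OF C, of m] C in auto)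
  then show ?case using c(1) Suc.IH[OF c(2) Suc.prems(2)] by auto
qed

lemma commutators_inv: "S \<subseteq> carrier P \<Longrightarrow> e \<in> commutators S \<Longrightarrow> inv e \<in> commutators S"
  by (elim commutators_cases, assumption) (rule commutators_I, auto simp: commutator_closed)

lemma commutators_words_1: 
  assumes S: "S \<subseteq> carrier P" and e: "e \<in> commutators S" 
  shows "e \<in> words (commutators S) 1"
proof -
  have "e \<in> carrier P" using e commutators_carrier[OF S] by blast
  then show ?thesis using words_pow[OF commutators_carrier[OF S] e, of 1] by (simp only: nat_pow_eone)
qed

lemma generate_words:
  assumes S: "S \<subseteq> carrier P" and g: "g \<in> generate P (commutators S)"
  shows "\<exists>n. g \<in> words (commutators S) n"
  using g
proof (induction rule: generate.induct)
  case one
  show ?case by (rule exI[of _ 0]) simp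
next
  case (incl h)
  from commutators_words_1[OF S incl] show ?case by (rule exI)
next
  case (inv h)
  have "inv h \<in> commutators S" by (rule commutators_inv[OF S]) fact
  from commutators_words_1[OF S this] show ?case by (rule exI)
next
  case (eng h1 h2)
  then obtain n m where "h1 \<in> words (commutators S) n" "h2 \<in> words (commutators S) m" by (elim exE)
  from words_append[OF commutators_carrier[OF S] this] show ?case by (rule exI)
qed

text \<open>Collecting with g = \<one> bounds the displacement of b under arbitrarily long products
  of commutators, and balls are finite.\<close>

lemma generate_commutators_finite:
  assumes S: "finite S" "S \<subseteq> carrier P"
  shows "finite ((\<lambda>g. act g b) ` generate P (commutators S))"
proof -
  note C = commutators_carrier[OF S(2)]
  obtain \<kappa> where k: "\<forall>n. \<forall>z\<in>reach (commutators S) n. d z (act (\<one> [^] n) b) \<le> \<kappa>"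
    using reach_bounded[OF commutators_conj_closed[OF S(2)] commutators_finite[OF S] one_closed commutators_pow_bounded[OF S(2)]] by (rule exE)
  show ?thesis
  proof (rule finite_orbit_if_bounded[of _ \<kappa>])
    show "generate P (commutators S) \<subseteq> carrier P" by (rule generate_incl[OF C])
    fix g assume "g \<in> generate P (commutators S)"
    then obtain n where "g \<in> words (commutators S) n" using generate_words[OF S(2)] by blast
    then have "act g b \<in> reach (commutators S) n" by (rule words_reach[OF C])
    then have "d (act g b) (act (\<one> [^] n) b) \<le> \<kappa>" using k by blast
    then show "d (act g b) b \<le> \<kappa>" by (simp add: act_one b_pts)
  qed
qed

text \<open>Walk along a chain from b to x. If z moves b to the current point, the next point is the
  image under z of some y within r of b, and S supplies t moving b to y; then
  \<open>z \<otimes> t\<close> reaches it.\<close>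

lemma orbit_covered:
  assumes S: "S \<subseteq> carrier P" "\<And>x. x \<in> pts \<Longrightarrow> d b x \<le> r \<Longrightarrow> \<exists>t\<in>S. act t b = x"
    and D: "D \<subseteq> carrier P" "\<one> \<in> D" "\<And>z t. z \<in> D \<Longrightarrow> t \<in> S \<Longrightarrow> z \<otimes> t \<in> D" and x: "x \<in> pts"
  shows "\<exists>z\<in>D. act z b = x"
proof -
  obtain xs where xs: "xs \<noteq> []" "hd xs = b" "last xs = x" "set xs \<subseteq> pts"
    "\<forall>i. Suc i < length xs \<longrightarrow> d (xs ! i) (xs ! Suc i) \<le> r" using chain[OF x] by (elim exE conjE)
  have "i < length xs \<Longrightarrow> \<exists>z\<in>D. act z b = xs ! i" for i
  proof (induction i)
    case 0
    then show ?case using D(2) act_one[OF b_pts] xs(1,2) hd_conv_nth[OF xs(1)] by (intro bexI[of _ \<one>]) auto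
  next
    case (Suc i)
    then obtain z where z: "z \<in> D" "act z b = xs ! i" by auto
    have zc: "z \<in> carrier P" using z(1) D(1) by blast
    define y where "y = xs ! Suc i"
    have y: "y \<in> pts" unfolding y_def using nth_mem[OF Suc.prems] xs(4) by blast
    have y': "act (inv z) y \<in> pts" by (rule act_closed[OF inv_closed[OF zc] y])
    have "d b (act (inv z) y) = d (act z b) (act z (act (inv z) y))" by (rule d_act[OF zc b_pts y', symmetric])
    also have "\<dots> = d (xs ! i) (xs ! Suc i)" unfolding z(2) act_inv(2)[OF zc y] unfolding y_def ..
    also have "\<dots> \<le> r" using xs(5)[THEN spec, THEN mp, OF Suc.prems] .
    finally have le: "d b (act (inv z) y) \<le> r" .
    obtain t where t: "t \<in> S" "act t b = act (inv z) y" using S(2)[OF y' le] by (elim bexE)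
    have "act (z \<otimes> t) b = act z (act t b)" by (rule act_mult[OF zc _ b_pts]) (use t S in blast)
    also have "\<dots> = y" unfolding t(2) by (rule act_inv(2)[OF zc y])
    finally show ?case unfolding y_def[symmetric] by (rule bexI[of _ "z \<otimes> t"]) (rule D(3)[OF z(1) t(1)])
  qed
  from this[of "length xs - 1"] show ?thesis using xs(1,3) by (simp add: last_conv_nth)
qed

lemma commutator_mult_left:
  assumes "x \<in> carrier P" "y \<in> carrier P" "h \<in> carrier P"
  shows "commutator (x \<otimes> y) h = (x \<otimes> commutator y h \<otimes> inv x) \<otimes> commutator x h"
  using assms by (simp add: commutator_def m_assoc inv_mult_group inv_cancel)

lemma commutator_mult_right:
  assumes "x \<in> carrier P" "y \<in> carrier P" "h \<in> carrier P"
  shows "commutator h (x \<otimes> y) = commutator h x \<otimes> (x \<otimes> commutator h y \<otimes> inv x)"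
  using assms by (simp add: commutator_def m_assoc inv_mult_group inv_cancel)

lemma inv_commutator: "x \<in> carrier P \<Longrightarrow> y \<in> carrier P \<Longrightarrow> inv (commutator x y) = commutator y x"
  by (simp add: commutator_def m_assoc inv_mult_group)

text \<open>M is the normal subgroup generated by commutators with S, and R consists of the elements
  acting on b like an element of M; in particular R contains the stabiliser of b. The set Z of
  elements central modulo M is closed under right multiplication by S and so covers the orbit. Every
  g is therefore an element of Z times one of the stabiliser, and commutators fall into R.
  Generation is phrased as closure of a set D so that D can later be defined through its
  action.\<close>

theorem ex_finite_orbit_normal_subgroup:
  "\<exists>S R. finite S \<and> S \<subseteq> carrier P \<and> subgroup R P \<and> finite ((\<lambda>g. act g b) ` R) \<and>
     (\<forall>g\<in>carrier P. \<forall>h\<in>carrier P. g \<otimes> h \<otimes> inv g \<otimes> inv h \<in> R) \<and>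
     (\<forall>D. D \<subseteq> carrier P \<longrightarrow> \<one> \<in> D \<longrightarrow> (\<forall>z\<in>D. \<forall>t\<in>S. z \<otimes> t \<in> D) \<longrightarrow> (\<forall>g\<in>carrier P. \<exists>z\<in>D. inv z \<otimes> g \<in> R))"
proof -
  have "\<forall>x\<in>{x \<in> pts. d b x \<le> r}. \<exists>t. t \<in> carrier P \<and> act t b = x" using transitive by blast
  then obtain rep where rep: "\<forall>x\<in>{x \<in> pts. d b x \<le> r}. rep x \<in> carrier P \<and> act (rep x) b = x"
    by (rule bchoice[THEN exE])
  define S where "S = rep ` {x \<in> pts. d b x \<le> r}"
  have S: "finite S" "S \<subseteq> carrier P" "\<And>x. x \<in> pts \<Longrightarrow> d b x \<le> r \<Longrightarrow> \<exists>t\<in>S. act t b = x"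
    unfolding S_def using balls rep by auto
  define M where "M = generate P (commutators S)"
  have Mn: "M \<lhd> P" unfolding M_def
    by (rule normal_generateI[OF commutators_carrier[OF S(2)]]) (rule conj_closedD(2)[OF commutators_conj_closed[OF S(2)]])
  have M: "subgroup M P" by (rule normal_imp_subgroup[OF Mn])
  have Mc: "m \<in> carrier P" if "m \<in> M" for m by (rule subgroup.mem_carrier[OF M that])
  have Mconj: "g \<otimes> m \<otimes> inv g \<in> M" if "g \<in> carrier P" "m \<in> M" for g m
    using normal.inv_op_closed2[OF Mn that] .
  have Mconj': "inv g \<otimes> m \<otimes> g \<in> M" if "g \<in> carrier P" "m \<in> M" for g m
    using normal.inv_op_closed1[OF Mn that] .
  have Mfin: "finite ((\<lambda>g. act g b) ` M)" unfolding M_def by (rule generate_commutators_finite[OF S(1,2)])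
  define R where "R = {g \<in> carrier P. \<exists>m\<in>M. act g b = act m b}"
  have Rc: "R \<subseteq> carrier P" by (auto simp: R_def)
  have RI: "g \<in> R" if "g \<in> carrier P" "m \<in> M" "act g b = act m b" for g m using that unfolding R_def by blast
  have MR: "m \<in> R" if "m \<in> M" for m by (rule RI[OF Mc[OF that] that refl])
  have SR: "s \<in> R" if "s \<in> carrier P" "act s b = b" for s
    by (rule RI[OF that(1) subgroup.one_closed[OF M]]) (simp add: that act_one b_pts)
  have R: "subgroup R P"
  proof (rule subgroupI[OF Rc])
    show "R \<noteq> {}" using MR[OF subgroup.one_closed[OF M]] by blast
  next
    fix g assume "g \<in> R"
    then obtain m where g: "g \<in> carrier P" and m: "m \<in> M" "act g b = act m b" unfolding R_def by blast
    let ?m = "inv g \<otimes> m \<otimes> g"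
    have mM: "?m \<in> M" by (rule Mconj'[OF g m(1)])
    have "act ?m (act (inv g) b) = act (inv g) (act m b)"
      using g Mc[OF m(1)] b_pts by (simp add: act_mult[symmetric] m_assoc)
    also have "\<dots> = b" unfolding m(2)[symmetric] by (rule act_inv(1)[OF g b_pts])
    finally have "act (inv ?m) b = act (inv g) b"
      using act_inv(1)[OF Mc[OF mM] act_closed[OF inv_closed[OF g] b_pts]] by simp
    then show "inv g \<in> R" by (intro RI[OF inv_closed[OF g] subgroup.m_inv_closed[OF M mM]]) (rule sym)
  next
    fix g h assume "g \<in> R" "h \<in> R"
    then obtain m m' where g: "g \<in> carrier P" "h \<in> carrier P" and m: "m \<in> M" "act g b = act m b" "m' \<in> M" "act h b = act m' b"
      unfolding R_def by blast
    have "act (g \<otimes> h) b = act g (act m' b)" using g b_pts m(4) by (simp add: act_mult)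
    also have "\<dots> = act (g \<otimes> m' \<otimes> inv g) (act g b)"
      using g(1) Mc[OF m(3)] b_pts by (simp add: act_mult[symmetric] m_assoc)
    also have "\<dots> = act ((g \<otimes> m' \<otimes> inv g) \<otimes> m) b"
      unfolding m(2) by (rule act_mult[symmetric]) (use g Mc m b_pts in auto)
    finally show "g \<otimes> h \<in> R"
      by (intro RI[OF m_closed[OF g] subgroup.m_closed[OF M Mconj[OF g(1) m(3)] m(1)]])
  qed
  have cover: "\<exists>z\<in>D. inv z \<otimes> g \<in> R \<and> act (inv z \<otimes> g) b = b"
    if D: "D \<subseteq> carrier P" "\<one> \<in> D" "\<forall>z\<in>D. \<forall>t\<in>S. z \<otimes> t \<in> D" and g: "g \<in> carrier P" for D g
  proof -
    obtain z where z: "z \<in> D" "act z b = act g b"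
      using orbit_covered[OF S(2,3) D(1,2) _ act_closed[OF g b_pts]] D(3) by blast
    have zc: "z \<in> carrier P" using z(1) D(1) by blast
    have "act (inv z \<otimes> g) b = b" using act_mult[OF inv_closed[OF zc] g b_pts] z(2) act_inv(1)[OF zc b_pts] by simp
    then show ?thesis using z(1) SR[of "inv z \<otimes> g"] zc g by auto
  qed
  define Z where "Z = {z \<in> carrier P. \<forall>h\<in>carrier P. commutator h z \<in> M}"
  have Zc: "Z \<subseteq> carrier P" by (auto simp: Z_def)
  have Zcover: "\<exists>z\<in>Z. inv z \<otimes> g \<in> R \<and> act (inv z \<otimes> g) b = b" if g: "g \<in> carrier P" for g
  proof (rule cover[OF Zc _ _ g])
    show "\<one> \<in> Z" unfolding Z_def using subgroup.one_closed[OF M] by (simp add: commutator_def)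
    show "\<forall>z\<in>Z. \<forall>t\<in>S. z \<otimes> t \<in> Z"
    proof (intro ballI)
      fix z t assume z: "z \<in> Z" and t: "t \<in> S"
      have zc: "z \<in> carrier P" using z Zc by blast
      have tc: "t \<in> carrier P" using t S by blast
      have "commutator h (z \<otimes> t) \<in> M" if h: "h \<in> carrier P" for h
      proof -
        have "commutator h t \<in> M" unfolding M_def
          by (rule generate.incl) (rule commutators_I[OF h t conj_class_self[OF tc]], simp)
        moreover have "commutator h z \<in> M" using z h unfolding Z_def by blast
        ultimately show ?thesis unfolding commutator_mult_right[OF zc tc h]
          by (intro subgroup.m_closed[OF M] Mconj[OF zc])
      qed
      then show "z \<otimes> t \<in> Z" unfolding Z_def using zc tc by simp
    qed
  qed
  have dec: "\<exists>z\<in>Z. \<exists>s\<in>R. g = z \<otimes> s \<and> act s b = b" if g: "g \<in> carrier P" for g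
  proof -
    obtain z where z: "z \<in> Z" "inv z \<otimes> g \<in> R" "act (inv z \<otimes> g) b = b" using Zcover[OF g] by blast
    then have "g = z \<otimes> (inv z \<otimes> g)" using Zc g by (simp add: inv_cancel subset_iff)
    then show ?thesis using z by blast
  qed
  have ZM: "commutator h z \<in> R" "commutator z h \<in> R" if "z \<in> Z" "h \<in> carrier P" for z h
  proof -
    have m: "commutator h z \<in> M" using that unfolding Z_def by blast
    show "commutator h z \<in> R" by (rule MR[OF m])
    have "inv (commutator h z) = commutator z h" by (rule inv_commutator) (use that Zc in auto)
    then show "commutator z h \<in> R" using subgroup.m_inv_closed[OF R MR[OF m]] by simp
  qed
  have Rconj: "g \<otimes> x \<otimes> inv g \<in> R" if g: "g \<in> carrier P" and x: "x \<in> R" for g x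
  proof -
    obtain z s where z: "z \<in> Z" "s \<in> R" "g = z \<otimes> s" using dec[OF g] by blast
    have zc: "z \<in> carrier P" using z(1) Zc by blast
    have sc: "s \<in> carrier P" "x \<in> carrier P" using z(2) x Rc by auto
    \<comment> \<open>Conjugation by s stays in the subgroup R, and conjugation by z, which is
      central modulo M, only multiplies by a commutator.\<close>
    let ?y = "s \<otimes> x \<otimes> inv s"
    have y: "?y \<in> R" by (intro subgroup.m_closed[OF R] subgroup.m_inv_closed[OF R] z x)
    have "g \<otimes> x \<otimes> inv g = commutator z ?y \<otimes> ?y"
      unfolding z(3) commutator_def using zc sc by (simp add: m_assoc inv_mult_group inv_cancel)
    then show ?thesis using subgroup.m_closed[OF R ZM(2)[OF z(1)] y, of ?y] sc by simp
  qed
  have comm: "commutator g h \<in> R" if gh: "g \<in> carrier P" "h \<in> carrier P" for g h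
  proof -
    obtain z s where z: "z \<in> Z" "s \<in> R" "g = z \<otimes> s" using dec[OF gh(1)] by blast
    obtain z' s' where z': "z' \<in> Z" "s' \<in> R" "h = z' \<otimes> s'" using dec[OF gh(2)] by blast
    have c: "z \<in> carrier P" "s \<in> carrier P" "z' \<in> carrier P" "s' \<in> carrier P" using z z' Zc Rc by auto
    have "commutator s s' \<in> R" unfolding commutator_def by (intro subgroup.m_closed[OF R] subgroup.m_inv_closed[OF R] z z')
    then have "commutator s h \<in> R" unfolding z'(3) commutator_mult_right[OF c(3,4,2)]
      by (intro subgroup.m_closed[OF R] Rconj[OF c(3)] ZM(1)[OF z'(1) c(2)])
    then show ?thesis unfolding z(3) commutator_mult_left[OF c(1,2) gh(2)]
      by (intro subgroup.m_closed[OF R] Rconj[OF c(1)] ZM(2)[OF z(1) gh(2)])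
  qed
  have Rfin: "finite ((\<lambda>g. act g b) ` R)"
    by (rule finite_subset[OF _ Mfin]) (auto simp: R_def)
  show ?thesis
  proof (intro exI conjI)
    show "finite S" "S \<subseteq> carrier P" "subgroup R P" "finite ((\<lambda>g. act g b) ` R)" by (fact S R Rfin)+
    show "\<forall>g\<in>carrier P. \<forall>h\<in>carrier P. g \<otimes> h \<otimes> inv g \<otimes> inv h \<in> R" using comm unfolding commutator_def by blast
    show "\<forall>D. D \<subseteq> carrier P \<longrightarrow> \<one> \<in> D \<longrightarrow> (\<forall>z\<in>D. \<forall>t\<in>S. z \<otimes> t \<in> D) \<longrightarrow> (\<forall>g\<in>carrier P. \<exists>z\<in>D. inv z \<otimes> g \<in> R)"
      using cover by meson
  qed
qed

end

section \<open>The orbit metric\<close>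

lemma cos_dist_commute: "cos_dist G V W = cos_dist G W V"
  by (simp add: cos_dist_def mult.commute)

lemma cos_dist_nonneg: "0 \<le> cos_dist G V W"
proof -
  have "0 \<le> ln (real n)" for n by (cases n) auto
  then show ?thesis by (simp only: cos_dist_def)
qed

context topgroup
begin

lemma cos_dist_alt:
  assumes "V \<in> \<B>" "W \<in> \<B>"
  shows "cos_dist G V W = ln (idx G V W) + ln (idx G W V)"
  unfolding cos_dist_def sub_index_Int[OF B_dest(1)[OF assms(1)] B_dest(1)[OF assms(2)]]
    sub_index_Int[OF B_dest(1)[OF assms(2)] B_dest(1)[OF assms(1)]]
  using B_idx_pos[OF assms] B_idx_pos[OF assms(2,1)] by (simp add: ln_mult)

lemma cos_dist_refl: "V \<in> \<B> \<Longrightarrow> cos_dist G V V = 0"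
  by (simp add: cos_dist_alt B_idx_refl)

lemma cos_dist_triangle:
  assumes "U \<in> \<B>" "V \<in> \<B>" "W \<in> \<B>"
  shows "cos_dist G U W \<le> cos_dist G U V + cos_dist G V W"
proof -
  have *: "ln (real (idx G U W)) \<le> ln (real (idx G U V)) + ln (real (idx G V W))"
    if a: "U \<in> \<B>" "V \<in> \<B>" "W \<in> \<B>" for U V W
  proof -
    note p = B_idx_pos[OF a(1,3)] B_idx_pos[OF a(1,2)] B_idx_pos[OF a(2,3)]
    have "real (idx G U W) \<le> real (idx G U V) * real (idx G V W)"
      using B_idx_triangle[OF a] by (metis of_nat_le_iff of_nat_mult)
    then have "ln (real (idx G U W)) \<le> ln (real (idx G U V) * real (idx G V W))" using p by simp
    then show ?thesis using p by (simp add: ln_mult)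
  qed
  show ?thesis using *[OF assms] *[OF assms(3,2,1)] assms by (simp add: cos_dist_alt)
qed

lemma aut_cos_dist: "\<phi> \<in> carrier \<A> \<Longrightarrow> V \<in> \<B> \<Longrightarrow> W \<in> \<B> \<Longrightarrow> cos_dist G (\<phi> ` V) (\<phi> ` W) = cos_dist G V W"
  by (simp add: cos_dist_alt aut_B aut_idx)

text \<open>The exponential of the distance is a product of two positive integers; below 2 both are
  1, which gives mutual inclusion.\<close>

lemma cos_dist_less_imp_eq:
  assumes "V \<in> \<B>" "W \<in> \<B>" "cos_dist G V W < ln 2"
  shows "V = W"
proof -
  note p = B_idx_pos[OF assms(1,2)] B_idx_pos[OF assms(2,1)]
  have "ln (real (idx G V W)) + ln (real (idx G W V)) < ln 2" using assms by (simp add: cos_dist_alt)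
  then have "ln (real (idx G V W * idx G W V)) < ln 2" using p by (simp add: ln_mult)
  then have "real (idx G V W * idx G W V) < 2" using p by (subst (asm) ln_less_cancel_iff) auto
  then have "idx G V W * idx G W V < 2" by linarith
  then have "idx G V W * idx G W V = 1" using p by (metis One_nat_def less_2_cases nat_0_less_mult_iff less_irrefl)
  then show ?thesis using idx_eq_1[OF B_dest(1) B_dest(1)] assms(1,2) by (intro subset_antisym) auto
qed

text \<open>Balls of radius ln 2 are singletons, so a compact set, being covered by finitely many of
  them, is finite.\<close>

lemma proper_imp_finite_ball:
  assumes M: "M \<subseteq> \<B>" and p: "proper_metric M (cos_dist G)" and V: "V \<in> M"
  shows "finite {W \<in> M. cos_dist G V W \<le> c}"
proof -
  have eq0: "x \<in> M \<Longrightarrow> y \<in> M \<Longrightarrow> cos_dist G x y < ln 2 \<Longrightarrow> x = y" for x y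
    by (rule cos_dist_less_imp_eq) (use M in auto)
  interpret m: Metric_space M "cos_dist G"
  proof
    fix x y z
    show "0 \<le> cos_dist G x y" by (rule cos_dist_nonneg)
    show "cos_dist G x y = cos_dist G y x" by (rule cos_dist_commute)
    show "cos_dist G x y = 0 \<longleftrightarrow> x = y" if "x \<in> M" "y \<in> M"
      using eq0[OF that] cos_dist_refl[of x] that M by auto
    show "cos_dist G x z \<le> cos_dist G x y + cos_dist G y z" if "x \<in> M" "y \<in> M" "z \<in> M"
      by (rule cos_dist_triangle) (use that M in auto)
  qed
  let ?A = "{W \<in> M. cos_dist G V W \<le> c}"
  have ball: "m.mball x (ln 2) \<subseteq> {x}" for x unfolding m.mball_def using eq0 by auto
  have "closedin m.mtopology ?A"
    unfolding m.closedin_metric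
  proof (intro conjI allI impI)
    fix x assume "x \<in> M - ?A"
    then have "disjnt ?A (m.mball x (ln 2))" using ball[of x] unfolding disjnt_def by blast
    then show "\<exists>r>0. disjnt ?A (m.mball x r)" by (intro exI[of _ "ln 2"]) simp
  qed auto
  moreover have "m.mbounded ?A" unfolding m.mbounded_def m.mcball_def using V by blast
  ultimately have "compactin m.mtopology ?A" using p unfolding proper_metric_def by blast
  moreover have "openin m.mtopology u" if "u \<in> (\<lambda>x. m.mball x (ln 2)) ` ?A" for u
    using that by auto
  moreover have "?A \<subseteq> \<Union> ((\<lambda>x. m.mball x (ln 2)) ` ?A)"
  proof
    fix x assume x: "x \<in> ?A"
    then have "x \<in> m.mball x (ln 2)" by simp
    then show "x \<in> \<Union> ((\<lambda>x. m.mball x (ln 2)) ` ?A)" using x by blast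
  qed
  ultimately obtain \<F> where F: "finite \<F>" "\<F> \<subseteq> (\<lambda>x. m.mball x (ln 2)) ` ?A" "?A \<subseteq> \<Union>\<F>"
    unfolding compactin_def by meson
  obtain B where B: "finite B" "\<F> = (\<lambda>x. m.mball x (ln 2)) ` B" using finite_subset_image[OF F(1,2)] by metis
  have "?A \<subseteq> B" using F(3) ball unfolding B(2) by blast
  then show ?thesis by (rule finite_subset[OF _ B(1)])
qed

text \<open>Applying the inverse of \<psi> turns the displacement by \<phi> of the image of V under
  \<psi> into the distance of V from its image under a conjugate of \<phi>. So bounded conjugates
  mean bounded displacement on the orbit.\<close>

lemma FCd_iff:
  assumes H: "subgroup H \<A>" and V: "V \<in> \<B>" and p: "\<phi> \<in> H"
  shows "\<phi> \<in> FCd G T H \<longleftrightarrow> (\<exists>c. \<forall>\<psi>\<in>H. cos_dist G (\<phi> ` \<psi> ` V) (\<psi> ` V) \<le> c)"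
proof
  note HA = subgroup.mem_carrier[OF H]
  note Hi = subgroup.m_inv_closed[OF H]
  define cj where "cj \<psi> = \<psi> \<otimes>\<^bsub>\<A>\<^esub> \<phi> \<otimes>\<^bsub>\<A>\<^esub> inv\<^bsub>\<A>\<^esub> \<psi>" for \<psi>
  have cjA: "cj \<psi> \<in> carrier \<A>" if "\<psi> \<in> H" for \<psi> unfolding cj_def using HA[OF that] HA[OF p] by simp
  have cji: "cos_dist G (cj (inv\<^bsub>\<A>\<^esub> \<psi>) ` U) U = cos_dist G (\<phi> ` \<psi> ` U) (\<psi> ` U)"
    if q: "\<psi> \<in> H" and U: "U \<in> \<B>" for \<psi> U
  proof -
    have "cj (inv\<^bsub>\<A>\<^esub> \<psi>) ` U = (inv\<^bsub>\<A>\<^esub> \<psi>) ` \<phi> ` \<psi> ` U"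
      unfolding cj_def using HA[OF q] aut_image_mult[OF B_dest(4)[OF U]] by (simp add: aut_image_mult aut_image_subset B_dest(4) U)
    then have "cos_dist G (cj (inv\<^bsub>\<A>\<^esub> \<psi>) ` U) U = cos_dist G ((inv\<^bsub>\<A>\<^esub> \<psi>) ` \<phi> ` \<psi> ` U) ((inv\<^bsub>\<A>\<^esub> \<psi>) ` \<psi> ` U)"
      using aut_image_inv_left[OF HA[OF q] B_dest(4)[OF U]] by simp
    also have "\<dots> = cos_dist G (\<phi> ` \<psi> ` U) (\<psi> ` U)"
      by (intro aut_cos_dist HA Hi q aut_B p U)
    finally show ?thesis .
  qed
  {
    assume "\<phi> \<in> FCd G T H"
    then have "bounded_auts G T (cj ` H)" unfolding FCd_def cj_def by simp
    then obtain U c where U: "U \<in> \<B>" and c: "\<forall>a\<in>cj ` H. \<forall>b\<in>cj ` H. cos_dist G (a ` U) (b ` U) \<le> c"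
      unfolding bounded_auts_def by blast
    let ?i = "inv\<^bsub>\<A>\<^esub> \<phi>"
    \<comment> \<open>Passing from V to the given U and back costs two distances;
      \<open>cj \<phi>\<close> serves as a fixed conjugate with which the others are
      compared.\<close>
    let ?c = "cos_dist G V U + c + cos_dist G (cj \<phi> ` U) U + cos_dist G U V"
    have "cos_dist G (\<phi> ` \<psi> ` V) (\<psi> ` V) \<le> ?c" if q: "\<psi> \<in> H" for \<psi>
    proof -
      let ?a = "cj (inv\<^bsub>\<A>\<^esub> \<psi>)"
      have a: "?a \<in> carrier \<A>" by (rule cjA[OF Hi[OF q]])
      have b: "cj \<phi> \<in> carrier \<A>" by (rule cjA[OF p])
      have "cos_dist G (?a ` V) V \<le> cos_dist G (?a ` V) (?a ` U) + cos_dist G (?a ` U) V"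
        by (intro cos_dist_triangle aut_B a U V)
      also have "cos_dist G (?a ` U) V \<le> cos_dist G (?a ` U) (cj \<phi> ` U) + cos_dist G (cj \<phi> ` U) V"
        by (intro cos_dist_triangle aut_B a b U V)
      also have "cos_dist G (cj \<phi> ` U) V \<le> cos_dist G (cj \<phi> ` U) U + cos_dist G U V"
        by (intro cos_dist_triangle aut_B a b U V)
      also have "cos_dist G (?a ` V) (?a ` U) = cos_dist G V U" by (rule aut_cos_dist[OF a V U])
      also have "cos_dist G (?a ` U) (cj \<phi> ` U) \<le> c" using c Hi[OF q] p by blast
      finally show ?thesis unfolding cji[OF q V] by simp
    qed
    then show "\<exists>c. \<forall>\<psi>\<in>H. cos_dist G (\<phi> ` \<psi> ` V) (\<psi> ` V) \<le> c" by blast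
  next
    assume "\<exists>c. \<forall>\<psi>\<in>H. cos_dist G (\<phi> ` \<psi> ` V) (\<psi> ` V) \<le> c"
    then obtain c where c: "\<forall>\<psi>\<in>H. cos_dist G (\<phi> ` \<psi> ` V) (\<psi> ` V) \<le> c" by (rule exE)
    have 1: "cos_dist G (cj \<psi> ` V) V \<le> c" if q: "\<psi> \<in> H" for \<psi>
      using cji[OF Hi[OF q] V] c Hi[OF q] HA[OF q] by simp
    have "cos_dist G (cj x ` V) (cj y ` V) \<le> c + c" if xy: "x \<in> H" "y \<in> H" for x y
    proof -
      have "cos_dist G (cj x ` V) (cj y ` V) \<le> cos_dist G (cj x ` V) V + cos_dist G V (cj y ` V)"
        by (intro cos_dist_triangle aut_B cjA xy V)
      also have "\<dots> \<le> c + c" using 1[OF xy(1)] 1[OF xy(2)] cos_dist_commute[of G V] by simp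
      finally show ?thesis .
    qed
    then have "bounded_auts G T (cj ` H)" unfolding bounded_auts_def using V by blast
    then show "\<phi> \<in> FCd G T H" using p unfolding FCd_def cj_def by simp
  }
qed

lemma FCd_subset: "FCd G T H \<subseteq> H"
  by (auto simp: FCd_def)

lemma FCd_subgroup:
  assumes H: "subgroup H \<A>" and V: "V \<in> \<B>"
  shows "subgroup (FCd G T H) \<A>"
proof (rule A.subgroupI)
  note HA = subgroup.mem_carrier[OF H]
  note iff = FCd_iff[OF H V]
  have qV: "\<psi> ` V \<in> \<B>" if "\<psi> \<in> H" for \<psi> by (rule aut_B[OF HA[OF that] V])
  note pc = B_dest(4)[OF qV]
  show "FCd G T H \<subseteq> carrier \<A>" using FCd_subset HA by blast
  have "\<one>\<^bsub>\<A>\<^esub> \<in> FCd G T H" unfolding iff[OF subgroup.one_closed[OF H]]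
    by (intro exI[of _ 0] ballI) (simp add: aut_image_one pc cos_dist_refl qV)
  then show "FCd G T H \<noteq> {}" by blast
  fix \<phi> assume f: "\<phi> \<in> FCd G T H"
  have p: "\<phi> \<in> H" using f FCd_subset by blast
  obtain c where c: "\<forall>\<psi>\<in>H. cos_dist G (\<phi> ` \<psi> ` V) (\<psi> ` V) \<le> c" using f unfolding iff[OF p] by (rule exE)
  have pi: "inv\<^bsub>\<A>\<^esub> \<phi> \<in> H" by (rule subgroup.m_inv_closed[OF H p])
  show "inv\<^bsub>\<A>\<^esub> \<phi> \<in> FCd G T H" unfolding iff[OF pi]
  proof (intro exI[of _ c] ballI)
    fix \<psi> assume q: "\<psi> \<in> H"
    have "cos_dist G ((inv\<^bsub>\<A>\<^esub> \<phi>) ` \<psi> ` V) (\<psi> ` V) = cos_dist G (\<phi> ` (inv\<^bsub>\<A>\<^esub> \<phi>) ` \<psi> ` V) (\<phi> ` \<psi> ` V)"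
      by (intro aut_cos_dist[symmetric] HA p aut_B pi qV q)
    also have "\<dots> = cos_dist G (\<phi> ` \<psi> ` V) (\<psi> ` V)"
      unfolding aut_image_inv_right[OF HA[OF p] pc[OF q]] by (rule cos_dist_commute)
    also have "\<dots> \<le> c" using c q by blast
    finally show "cos_dist G ((inv\<^bsub>\<A>\<^esub> \<phi>) ` \<psi> ` V) (\<psi> ` V) \<le> c" .
  qed
  fix \<phi>' assume f': "\<phi>' \<in> FCd G T H"
  have p': "\<phi>' \<in> H" using f' FCd_subset by blast
  obtain c' where c': "\<forall>\<psi>\<in>H. cos_dist G (\<phi>' ` \<psi> ` V) (\<psi> ` V) \<le> c'" using f' unfolding iff[OF p'] by (rule exE)
  have pp: "\<phi> \<otimes>\<^bsub>\<A>\<^esub> \<phi>' \<in> H" by (rule subgroup.m_closed[OF H p p'])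
  show "\<phi> \<otimes>\<^bsub>\<A>\<^esub> \<phi>' \<in> FCd G T H" unfolding iff[OF pp]
  proof (intro exI[of _ "c + c'"] ballI)
    fix \<psi> assume q: "\<psi> \<in> H"
    have pq: "\<phi>' \<otimes>\<^bsub>\<A>\<^esub> \<psi> \<in> H" by (rule subgroup.m_closed[OF H p' q])
    have e: "\<phi>' ` \<psi> ` V = (\<phi>' \<otimes>\<^bsub>\<A>\<^esub> \<psi>) ` V" by (rule aut_image_mult[OF B_dest(4)[OF V], symmetric])
    have "cos_dist G (\<phi> ` \<phi>' ` \<psi> ` V) (\<psi> ` V) \<le> cos_dist G (\<phi> ` \<phi>' ` \<psi> ` V) (\<phi>' ` \<psi> ` V) + cos_dist G (\<phi>' ` \<psi> ` V) (\<psi> ` V)"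
      by (intro cos_dist_triangle aut_B HA p p' q V)
    also have "cos_dist G (\<phi> ` \<phi>' ` \<psi> ` V) (\<phi>' ` \<psi> ` V) \<le> c" unfolding e using c pq by blast
    also have "cos_dist G (\<phi>' ` \<psi> ` V) (\<psi> ` V) \<le> c'" using c' q by blast
    finally show "cos_dist G ((\<phi> \<otimes>\<^bsub>\<A>\<^esub> \<phi>') ` \<psi> ` V) (\<psi> ` V) \<le> c + c'" unfolding aut_image_mult[OF pc[OF q]] by simp
  qed
qed

end

section \<open>Finitely generated torsion-free abelian groups\<close>

context comm_group
begin

definition power_prod :: "'i set \<Rightarrow> ('i \<Rightarrow> 'a) \<Rightarrow> ('i \<Rightarrow> int) \<Rightarrow> 'a" where
  "power_prod I g v = finprod G (\<lambda>i. g i [^] v i) I"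

definition generating :: "'i set \<Rightarrow> ('i \<Rightarrow> 'a) \<Rightarrow> bool" where
  "generating I g \<longleftrightarrow> finite I \<and> g \<in> I \<rightarrow> carrier G \<and> (\<forall>x\<in>carrier G. \<exists>v. x = power_prod I g v)"

lemma power_prod_closed: "g \<in> I \<rightarrow> carrier G \<Longrightarrow> power_prod I g v \<in> carrier G"
  unfolding power_prod_def by (rule finprod_closed) auto

lemma power_prod_cong: "g \<in> I \<rightarrow> carrier G \<Longrightarrow> (\<And>i. i \<in> I \<Longrightarrow> u i = v i) \<Longrightarrow> power_prod I g u = power_prod I g v"
  unfolding power_prod_def by (rule finprod_cong') auto

lemma power_prod_add:
  assumes "g \<in> I \<rightarrow> carrier G"
  shows "power_prod I g (\<lambda>i. u i + v i) = power_prod I g u \<otimes> power_prod I g v"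
proof -
  have "power_prod I g (\<lambda>i. u i + v i) = finprod G (\<lambda>i. g i [^] u i \<otimes> g i [^] v i) I"
    unfolding power_prod_def by (rule finprod_cong') (use assms in \<open>auto simp: int_pow_mult Pi_iff\<close>)
  also have "\<dots> = power_prod I g u \<otimes> power_prod I g v"
    unfolding power_prod_def by (rule finprod_multf) (use assms in auto)
  finally show ?thesis .
qed

lemma power_prod_insert:
  assumes "finite I" "i \<notin> I" "g \<in> insert i I \<rightarrow> carrier G"
  shows "power_prod (insert i I) g v = g i [^] v i \<otimes> power_prod I g v"
  unfolding power_prod_def by (rule finprod_insert[OF assms(1,2)]) (use assms(3) in auto)

text \<open>The modified generator contributes an extra \<open>g i [^] (e * v j)\<close>, which the
  lowered exponent at i cancels.\<close>

lemma power_prod_elementary: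
  assumes I: "finite I" "g \<in> I \<rightarrow> carrier G" and ij: "i \<in> I" "j \<in> I" "i \<noteq> j"
  shows "power_prod I (g(j := g j \<otimes> g i [^] (e::int))) (v(i := v i - e * v j)) = power_prod I g v"
proof -
  define J where "J = I - {i, j}"
  have J: "I = insert i (insert j J)" "finite J" "i \<notin> insert j J" "j \<notin> J" using I ij by (auto simp: J_def)
  let ?g = "g(j := g j \<otimes> g i [^] e)" and ?v = "v(i := v i - e * v j)"
  have c: "g i \<in> carrier G" "g j \<in> carrier G" using I ij by auto
  have gI: "g \<in> insert i (insert j J) \<rightarrow> carrier G" using I(2) unfolding J(1) .
  have gJ: "g \<in> insert j J \<rightarrow> carrier G" "g \<in> J \<rightarrow> carrier G" using gI by auto
  have gI': "?g \<in> insert i (insert j J) \<rightarrow> carrier G" using gI by auto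
  have gJ': "?g \<in> insert j J \<rightarrow> carrier G" using gI' by auto
  have "power_prod J ?g ?v = power_prod J g v" unfolding power_prod_def by (rule finprod_cong') (use J gJ in auto)
  then have "power_prod I ?g ?v = g i [^] (v i - e * v j) \<otimes> ((g j \<otimes> g i [^] e) [^] v j \<otimes> power_prod J g v)"
    unfolding J(1) using power_prod_insert[OF _ J(3) gI', of ?v] power_prod_insert[OF J(2,4) gJ', of ?v] J ij by simp
  also have "(g j \<otimes> g i [^] e) [^] v j = g j [^] v j \<otimes> g i [^] (e * v j)"
    using c by (simp add: int_pow_distrib int_pow_pow)
  also have "g i [^] (v i - e * v j) \<otimes> (g j [^] v j \<otimes> g i [^] (e * v j) \<otimes> power_prod J g v)
      = (g i [^] (v i - e * v j) \<otimes> g i [^] (e * v j)) \<otimes> (g j [^] v j \<otimes> power_prod J g v)"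
    using c power_prod_closed[OF gJ(2), of v] by (simp add: m_ac)
  also have "g i [^] (v i - e * v j) \<otimes> g i [^] (e * v j) = g i [^] v i"
    using c by (simp add: int_pow_mult[symmetric])
  also have "g i [^] v i \<otimes> (g j [^] v j \<otimes> power_prod J g v) = power_prod I g v"
    unfolding J(1) using power_prod_insert[OF _ J(3) gI, of v] power_prod_insert[OF J(2,4) gJ(1), of v] J by simp
  finally show ?thesis .
qed

lemma generating_elementary:
  assumes "generating I g" and ij: "i \<in> I" "j \<in> I" "i \<noteq> j"
  shows "generating I (g(j := g j \<otimes> g i [^] (e::int)))"
proof -
  have I: "finite I" "g \<in> I \<rightarrow> carrier G" and s: "\<And>x. x \<in> carrier G \<Longrightarrow> \<exists>v. x = power_prod I g v"
    using assms(1) by (auto simp: generating_def)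
  show ?thesis unfolding generating_def
  proof (intro conjI ballI I(1))
    show "g(j := g j \<otimes> g i [^] e) \<in> I \<rightarrow> carrier G" using I(2) ij by (simp add: Pi_iff)
    fix x assume "x \<in> carrier G"
    from s[OF this] obtain v where v: "x = power_prod I g v" by (rule exE)
    show "\<exists>v. x = power_prod I (g(j := g j \<otimes> g i [^] e)) v" unfolding v by (rule exI, rule power_prod_elementary[OF I ij, symmetric])
  qed
qed

lemma generating_remove:
  assumes "generating I g" "i \<in> I" "g i = \<one>"
  shows "generating (I - {i}) g"
proof -
  have I: "finite I" "g \<in> I \<rightarrow> carrier G" and s: "\<And>x. x \<in> carrier G \<Longrightarrow> \<exists>v. x = power_prod I g v"
    using assms(1) by (auto simp: generating_def)
  have ins: "insert i (I - {i}) = I" using assms(2) by blast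
  have gI: "g \<in> I - {i} \<rightarrow> carrier G" using I(2) by auto
  have "power_prod I g v = power_prod (I - {i}) g v" for v
    using power_prod_insert[of "I - {i}" i g v] I ins power_prod_closed[OF gI, of v] assms(3) by simp
  then show ?thesis using s I gI unfolding generating_def by simp
qed

lemma torsion_free_int_pow:
  assumes tf: "\<forall>x\<in>carrier G. \<forall>k::nat. 0 < k \<longrightarrow> x [^] k = \<one> \<longrightarrow> x = \<one>"
    and x: "x \<in> carrier G" "x [^] (z::int) = \<one>" "z \<noteq> 0"
  shows "x = \<one>"
proof (cases "0 \<le> z")
  case True
  then have "x [^] nat z = \<one>" using x(2) by (metis int_nat_eq int_pow_int)
  then show ?thesis using tf[THEN bspec, OF x(1), THEN spec, of "nat z"] True x(3) by simp
next
  case False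
  then have "x [^] nat (- z) = \<one>"
    using x int_pow_neg[OF x(1), of z] by (metis int_nat_eq int_pow_int inv_one neg_0_le_iff_le linear)
  then show ?thesis using tf[THEN bspec, OF x(1), THEN spec, of "nat (- z)"] False by simp
qed

text \<open>Nielsen moves shorten a relation between the generators by the Euclidean algorithm, until it kills a
  generator.\<close>

lemma minimal_generating_independent:
  fixes I :: "'i set"
  assumes tf: "\<forall>x\<in>carrier G. \<forall>k::nat. 0 < k \<longrightarrow> x [^] k = \<one> \<longrightarrow> x = \<one>"
    and min: "\<forall>(J :: 'i set) h. generating J h \<longrightarrow> card I \<le> card J"
    and g: "generating I g" and rel: "power_prod I g v = \<one>" and k: "k \<in> I"
  shows "v k = 0"
  using g rel k
proof (induction "\<Sum>i\<in>I. nat \<bar>v i\<bar>" arbitrary: g v k rule: less_induct)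
  case less
  have I: "finite I" "g \<in> I \<rightarrow> carrier G" using less.prems(1) by (auto simp: generating_def)
  have step: False if ij: "i \<in> I" "j \<in> I" "i \<noteq> j" "\<bar>v j\<bar> \<le> \<bar>v i\<bar>" "v j \<noteq> 0" for i j
  proof -
    \<comment> \<open>\<open>e * v j\<close> has the sign of \<open>v i\<close>, so subtracting it
      makes \<open>\<bar>v i\<bar>\<close> smaller. The entry \<open>v j\<close> is unchanged and
      nonzero, against the induction hypothesis for the shorter relation.\<close>
    define e where "e = sgn (v i) * sgn (v j)"
    let ?g = "g(j := g j \<otimes> g i [^] e)" and ?v = "v(i := v i - e * v j)"
    have lt: "\<bar>v i - e * v j\<bar> < \<bar>v i\<bar>"
      using ij(4,5) unfolding e_def by (auto simp: sgn_if)
    have "(\<Sum>k\<in>I. nat \<bar>?v k\<bar>) < (\<Sum>k\<in>I. nat \<bar>v k\<bar>)"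
      by (rule sum_strict_mono_ex1[OF I(1)]) (use lt ij(1) in auto)
    moreover have "power_prod I ?g ?v = \<one>" unfolding power_prod_elementary[OF I ij(1-3)] by (rule less.prems(2))
    ultimately have "?v j = 0" by (intro less.hyps[OF _ generating_elementary[OF less.prems(1) ij(1-3)] _ ij(2)])
    then show False using ij by simp
  qed
  show "v k = 0"
  proof (rule ccontr)
    assume nz: "v k \<noteq> 0"
    \<comment> \<open>Of two nonzero entries the one of larger absolute value could be shortened by
      \<open>step\<close>; so \<open>v k\<close> is the only nonzero one.\<close>
    have "v j = 0" if "j \<in> I - {k}" for j
    proof (rule ccontr)
      assume "v j \<noteq> 0"
      then show False using step[of j k] step[of k j] that less.prems(3) nz by (cases "\<bar>v j\<bar> \<le> \<bar>v k\<bar>") auto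
    qed
    then have "power_prod (I - {k}) g v = finprod G (\<lambda>i. \<one>) (I - {k})" unfolding power_prod_def by (intro finprod_cong') auto
    then have "power_prod (I - {k}) g v = \<one>" by simp
    moreover have "power_prod I g v = g k [^] v k \<otimes> power_prod (I - {k}) g v"
      using power_prod_insert[of "I - {k}" k g v] I less.prems(3) by (simp add: insert_absorb)
    moreover have gk: "g k \<in> carrier G" using I less.prems(3) by auto
    ultimately have "g k [^] v k = \<one>" using less.prems(2) by simp
    then have "g k = \<one>" by (rule torsion_free_int_pow[OF tf gk _ nz])
    then have "generating (I - {k}) g" by (rule generating_remove[OF less.prems(1,3)])
    then have "card I \<le> card (I - {k})" by (rule min[rule_format])
    moreover have "card (I - {k}) < card I" by (rule psubset_card_mono[OF I(1)]) (use less.prems(3) in blast)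
    ultimately show False by simp
  qed
qed

text \<open>A generating family with the fewest members has only the trivial relation, so evaluation
  of exponent vectors is injective.\<close>

lemma torsion_free_iso_free:
  assumes tf: "\<forall>x\<in>carrier G. \<forall>k::nat. 0 < k \<longrightarrow> x [^] k = \<one> \<longrightarrow> x = \<one>"
    and ex: "generating (I0 :: 'i set) g0"
  shows "\<exists>S::'i set. finite S \<and> G \<cong> free_Abelian_group S"
proof -
  let ?P = "\<lambda>(I :: 'i set, g). generating I g"
  obtain Ig where Ig: "?P Ig" and least: "\<And>Jh. ?P Jh \<Longrightarrow> card (fst Ig) \<le> card (fst Jh)"
    using arg_min_natI[of ?P "(I0, g0)" "\<lambda>Jh. card (fst Jh)"] arg_min_nat_le[of ?P _ "\<lambda>Jh. card (fst Jh)"] ex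
    by (metis case_prod_conv)
  obtain I g where e: "Ig = (I, g)" by (cases Ig)
  have gI: "generating I g" using Ig e by simp
  have min: "\<forall>J h. generating (J :: 'i set) h \<longrightarrow> card I \<le> card J" using least e by force
  have I: "finite I" "g \<in> I \<rightarrow> carrier G" and s: "\<And>x. x \<in> carrier G \<Longrightarrow> \<exists>v. x = power_prod I g v"
    using gI by (auto simp: generating_def)
  let ?h = "\<lambda>c. power_prod I g (Poly_Mapping.lookup c)"
  have hom: "?h \<in> hom (free_Abelian_group I) G"
    by (rule homI) (simp_all add: power_prod_closed[OF I(2)] power_prod_add[OF I(2)] plus_poly_mapping.rep_eq)
  interpret h: group_hom "free_Abelian_group I" G ?h
    by (intro group_hom.intro group_hom_axioms.intro hom group_free_Abelian_group is_group)
  have "inj_on ?h (carrier (free_Abelian_group I))"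
    unfolding h.inj_on_one_iff
  proof (intro allI impI)
    fix c assume c: "c \<in> carrier (free_Abelian_group I)" and "?h c = \<one>"
    then have "Poly_Mapping.lookup c k = 0" if "k \<in> I" for k
      using minimal_generating_independent[OF tf min gI _ that] by blast
    then show "c = \<one>\<^bsub>free_Abelian_group I\<^esub>"
      using c by (intro poly_mapping_eqI) (auto simp: in_keys_iff subset_iff)
  qed
  moreover have "?h ` carrier (free_Abelian_group I) = carrier G"
  proof
    show "?h ` carrier (free_Abelian_group I) \<subseteq> carrier G" using power_prod_closed[OF I(2)] by blast
    show "carrier G \<subseteq> ?h ` carrier (free_Abelian_group I)"
    proof
      fix x assume "x \<in> carrier G"
      then obtain v where v: "x = power_prod I g v" using s by blast
      let ?f = "\<lambda>i. if i \<in> I then v i else 0"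
      have fin: "finite {i. ?f i \<noteq> 0}" by (rule finite_subset[OF _ I(1)]) auto
      define c where "c = Abs_poly_mapping ?f"
      have lk: "Poly_Mapping.lookup c = ?f" unfolding c_def by (rule lookup_Abs_poly_mapping) (rule fin)
      have "?h c = x" unfolding v lk by (rule power_prod_cong[OF I(2)]) simp
      moreover have "c \<in> carrier (free_Abelian_group I)" by (auto simp: in_keys_iff lk split: if_splits)
      ultimately show "x \<in> ?h ` carrier (free_Abelian_group I)" by blast
    qed
  qed
  ultimately have "?h \<in> iso (free_Abelian_group I) G" using hom by (auto simp: iso_def bij_betw_def)
  then have "free_Abelian_group I \<cong> G" by (rule is_isoI)
  then have "G \<cong> free_Abelian_group I" by (rule group.iso_sym[OF group_free_Abelian_group])
  then show ?thesis using I(1) by blast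
qed

end

section \<open>Flat groups\<close>

context group
begin

lemma finite_rcosets_iff:
  assumes H: "subgroup H G" and F: "subgroup F G" "F \<subseteq> H"
  shows "finite (rcosets\<^bsub>G\<lparr>carrier := H\<rparr>\<^esub> F) \<longleftrightarrow> (\<exists>J. finite J \<and> J \<subseteq> H \<and> (\<forall>h\<in>H. \<exists>f\<in>F. \<exists>j\<in>J. h = f \<otimes> j))"
proof
  interpret P: group "G\<lparr>carrier := H\<rparr>" by (rule subgroup.subgroup_is_group[OF H is_group])
  have FP: "subgroup F (G\<lparr>carrier := H\<rparr>)" by (rule subgroup_incl[OF F(1) H F(2)])
  let ?c = "\<lambda>h. F #>\<^bsub>G\<lparr>carrier := H\<rparr>\<^esub> h"
  have rc: "rcosets\<^bsub>G\<lparr>carrier := H\<rparr>\<^esub> F = ?c ` H" unfolding RCOSETS_def by auto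
  {
    assume "finite (rcosets\<^bsub>G\<lparr>carrier := H\<rparr>\<^esub> F)"
    then have fin: "finite (?c ` H)" unfolding rc .
    obtain J where J: "J \<subseteq> H" "finite J" "?c ` H = ?c ` J" using finite_subset_image[OF fin subset_refl] by metis
    have "\<exists>f\<in>F. \<exists>j\<in>J. h = f \<otimes> j" if h: "h \<in> H" for h
    proof -
      have "?c h \<in> ?c ` J" using J(3) h by blast
      then obtain j where j: "j \<in> J" "?c h = ?c j" by (rule imageE)
      have "h \<in> ?c h" by (rule P.rcos_self[OF _ FP]) (simp add: h)
      then have "h \<in> ?c j" unfolding j(2) .
      then show ?thesis using j(1) unfolding r_coset_def by auto
    qed
    then show "\<exists>J. finite J \<and> J \<subseteq> H \<and> (\<forall>h\<in>H. \<exists>f\<in>F. \<exists>j\<in>J. h = f \<otimes> j)" using J by blast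
  next
    assume "\<exists>J. finite J \<and> J \<subseteq> H \<and> (\<forall>h\<in>H. \<exists>f\<in>F. \<exists>j\<in>J. h = f \<otimes> j)"
    then obtain J where J: "finite J" "J \<subseteq> H" "\<forall>h\<in>H. \<exists>f\<in>F. \<exists>j\<in>J. h = f \<otimes> j" by (elim exE conjE)
    have "?c ` H \<subseteq> ?c ` J"
    proof (rule image_subsetI)
      fix h assume "h \<in> H"
      then obtain f j where fj: "f \<in> F" "j \<in> J" "h = f \<otimes> j" using J(3) by blast
      have "h \<in> ?c j" using fj unfolding r_coset_def by auto
      then have "?c j = ?c h" by (rule P.repr_independence[OF _ _ FP]) (use fj J in auto)
      then show "?c h \<in> ?c ` J" using fj(2) by auto
    qed
    then show "finite (rcosets\<^bsub>G\<lparr>carrier := H\<rparr>\<^esub> F)" unfolding rc by (rule finite_subset) (use J in auto)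
  }
qed

end

section \<open>Abelian quotients and the scale-one subgroup\<close>

context normal
begin

lemma FactGroup_group_hom: "group_hom G (G Mod H) (\<lambda>a. H #> a)"
  by (intro group_hom.intro group_hom_axioms.intro r_coset_hom_Mod factorgroup_is_group is_group)

lemma rcos_eq_one_iff: "x \<in> carrier G \<Longrightarrow> H #> x = \<one>\<^bsub>G Mod H\<^esub> \<longleftrightarrow> x \<in> H"
  using coset_join1[OF _ _ subgroup_axioms, of x] coset_join2[OF _ subgroup_axioms, of x] by (auto simp: FactGroup_def)

lemma rcos_eqI:
  assumes "x \<in> carrier G" "y \<in> carrier G" "x \<otimes> inv y \<in> H"
  shows "H #> x = H #> y"
proof -
  have "x \<in> H #> y" unfolding r_coset_def
    using assms by (auto intro!: bexI[of _ "x \<otimes> inv y"] simp: m_assoc)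
  from repr_independence[OF this assms(2) subgroup_axioms] show ?thesis by simp
qed

lemma FactGroup_comm_group:
  assumes c: "\<And>x y. x \<in> carrier G \<Longrightarrow> y \<in> carrier G \<Longrightarrow> x \<otimes> y \<otimes> inv x \<otimes> inv y \<in> H"
  shows "comm_group (G Mod H)"
proof -
  interpret Q: group "G Mod H" by (rule factorgroup_is_group)
  show ?thesis
  proof (rule Q.group_comm_groupI)
    fix U V assume "U \<in> carrier (G Mod H)" "V \<in> carrier (G Mod H)"
    then obtain x y where xy: "x \<in> carrier G" "y \<in> carrier G" "U = H #> x" "V = H #> y"
      unfolding carrier_FactGroup by blast
    have "(x \<otimes> y) \<otimes> inv (y \<otimes> x) \<in> H" using c[OF xy(1,2)] xy(1,2) by (simp add: m_assoc inv_mult_group)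
    then have "H #> (x \<otimes> y) = H #> (y \<otimes> x)" by (intro rcos_eqI m_closed xy)
    then show "U \<otimes>\<^bsub>G Mod H\<^esub> V = V \<otimes>\<^bsub>G Mod H\<^esub> U" using rcos_sum xy by simp
  qed
qed

lemma FactGroup_commute_imp:
  assumes Q: "comm_group (G Mod H)" and x: "x \<in> carrier G" "y \<in> carrier G"
  shows "x \<otimes> y \<otimes> inv x \<otimes> inv y \<in> H"
proof -
  interpret Q: comm_group "G Mod H" by (rule Q)
  interpret h: group_hom G "G Mod H" "\<lambda>a. H #> a" by (rule FactGroup_group_hom)
  have "H #> (x \<otimes> y \<otimes> inv (y \<otimes> x)) = \<one>\<^bsub>G Mod H\<^esub>"
    using Q.m_comm[OF h.hom_closed[OF x(1)] h.hom_closed[OF x(2)]] h.hom_mult x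
    by (metis Q.r_inv h.hom_closed h.hom_inv inv_closed m_closed)
  moreover have "x \<otimes> y \<otimes> inv (y \<otimes> x) \<in> carrier G" using x by simp
  ultimately have "x \<otimes> y \<otimes> inv (y \<otimes> x) \<in> H" by (rule iffD1[OF rcos_eq_one_iff, rotated])
  then show ?thesis using x by (simp add: m_assoc inv_mult_group)
qed

end

context topgroup
begin

lemma scale_conj:
  assumes p: "\<phi> \<in> carrier \<A>" "\<psi> \<in> carrier \<A>"
  shows "scale G T (\<psi> \<otimes>\<^bsub>\<A>\<^esub> \<phi> \<otimes>\<^bsub>\<A>\<^esub> inv\<^bsub>\<A>\<^esub> \<psi>) = scale G T \<phi>"
proof -
  let ?c = "\<psi> \<otimes>\<^bsub>\<A>\<^esub> \<phi> \<otimes>\<^bsub>\<A>\<^esub> inv\<^bsub>\<A>\<^esub> \<psi>"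
  have c: "?c \<in> carrier \<A>" using p by simp
  have e: "idx G (?c ` \<psi> ` V) (\<psi> ` V) = idx G (\<phi> ` V) V" if V: "V \<in> \<B>" for V
  proof -
    have "?c ` \<psi> ` V = (?c \<otimes>\<^bsub>\<A>\<^esub> \<psi>) ` V" by (rule aut_image_mult[OF B_dest(4)[OF V], symmetric])
    also have "?c \<otimes>\<^bsub>\<A>\<^esub> \<psi> = \<psi> \<otimes>\<^bsub>\<A>\<^esub> \<phi>" using p by (simp add: A.m_assoc)
    also have "(\<psi> \<otimes>\<^bsub>\<A>\<^esub> \<phi>) ` V = \<psi> ` \<phi> ` V" by (rule aut_image_mult[OF B_dest(4)[OF V]])
    finally show ?thesis using aut_idx[OF p(2) aut_B[OF p(1) V] V] by simp
  qed
  have "(\<exists>V\<in>\<B>. n = idx G (?c ` V) V) \<longleftrightarrow> (\<exists>V\<in>\<B>. n = idx G (\<phi> ` V) V)" for n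
  proof
    assume "\<exists>V\<in>\<B>. n = idx G (?c ` V) V"
    then obtain V where V: "V \<in> \<B>" "n = idx G (?c ` V) V" by blast
    let ?U = "(inv\<^bsub>\<A>\<^esub> \<psi>) ` V"
    have U: "?U \<in> \<B>" by (rule aut_B[OF A.inv_closed[OF p(2)] V(1)])
    show "\<exists>V\<in>\<B>. n = idx G (\<phi> ` V) V"
      using e[OF U] V(2) unfolding aut_image_inv_right[OF p(2) B_dest(4)[OF V(1)]] by (intro bexI[OF _ U]) simp
  next
    assume "\<exists>V\<in>\<B>. n = idx G (\<phi> ` V) V"
    then obtain V where V: "V \<in> \<B>" "n = idx G (\<phi> ` V) V" by blast
    show "\<exists>V\<in>\<B>. n = idx G (?c ` V) V"
      using e[OF V(1)] V(2) by (intro bexI[OF _ aut_B[OF p(2) V(1)]]) simp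
  qed
  then show ?thesis unfolding scale_alt[OF c] scale_alt[OF p(1)] by simp
qed

lemma idx_eq_1_iff:
  assumes "V \<in> \<B>" "W \<in> \<B>"
  shows "idx G V W = 1 \<longleftrightarrow> V \<subseteq> W"
proof
  assume "V \<subseteq> W"
  then have "V \<inter> W = V" by blast
  then show "idx G V W = 1" using B_idx_Int[OF assms] B_idx_refl[OF assms(1)] by simp
qed (rule idx_eq_1[OF B_dest(1)[OF assms(1)] B_dest(1)[OF assms(2)]])

text \<open>At a common minimiser scale 1 is index 1, that is inclusion; the inclusions for \<phi>
  and for its inverse together say that W is fixed.\<close>

lemma K_one_eq_stabiliser:
  assumes K: "subgroup K \<A>" and W: "W \<in> \<B>" and m: "\<forall>\<phi>\<in>K. idx G (\<phi> ` W) W = scale G T \<phi>"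
  shows "K_one G T K = {\<phi> \<in> K. \<phi> ` W = W}"
proof -
  have "scale G T \<phi> = 1 \<and> scale G T (inv\<^bsub>\<A>\<^esub> \<phi>) = 1 \<longleftrightarrow> \<phi> ` W = W" if p: "\<phi> \<in> K" for \<phi>
  proof -
    have pA: "\<phi> \<in> carrier \<A>" by (rule subgroup.mem_carrier[OF K p])
    note i = subgroup.m_inv_closed[OF K p]
    have 1: "scale G T \<phi> = 1 \<longleftrightarrow> \<phi> ` W \<subseteq> W"
      using m[THEN bspec, OF p] idx_eq_1_iff[OF aut_B[OF pA W] W] by simp
    have "scale G T (inv\<^bsub>\<A>\<^esub> \<phi>) = idx G (\<phi> ` (inv\<^bsub>\<A>\<^esub> \<phi>) ` W) (\<phi> ` W)"
      using m[THEN bspec, OF i] aut_idx[OF pA aut_B[OF A.inv_closed[OF pA] W] W] by simp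
    then have "scale G T (inv\<^bsub>\<A>\<^esub> \<phi>) = 1 \<longleftrightarrow> W \<subseteq> \<phi> ` W"
      unfolding aut_image_inv_right[OF pA B_dest(4)[OF W]] using idx_eq_1_iff[OF W aut_B[OF pA W]] by simp
    then show ?thesis using 1 by blast
  qed
  then show ?thesis unfolding K_one_def by blast
qed

lemma K_one_normal:
  assumes K: "subgroup K \<A>" and W: "W \<in> \<B>" and m: "\<forall>\<phi>\<in>K. idx G (\<phi> ` W) W = scale G T \<phi>"
  shows "K_one G T K \<lhd> \<A>\<lparr>carrier := K\<rparr>"
proof -
  interpret P: group "\<A>\<lparr>carrier := K\<rparr>" by (rule subgroup.subgroup_is_group[OF K A.is_group])
  note KA = subgroup.mem_carrier[OF K]
  note e = K_one_eq_stabiliser[OF K W m]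
  note Wc = B_dest(4)[OF W]
  have inv: "inv\<^bsub>\<A>\<lparr>carrier := K\<rparr>\<^esub> \<phi> = inv\<^bsub>\<A>\<^esub> \<phi>" if "\<phi> \<in> K" for \<phi>
    by (rule A.m_inv_consistent[OF K that])
  show ?thesis
    unfolding P.normal_inv_iff
  proof (intro conjI ballI)
    have "subgroup {\<phi> \<in> K. \<phi> ` W = W} (\<A>\<lparr>carrier := K\<rparr>)"
    proof (rule P.subgroupI)
      show "{\<phi> \<in> K. \<phi> ` W = W} \<noteq> {}" using subgroup.one_closed[OF K] aut_image_one[OF Wc] by blast
      fix \<phi> assume p: "\<phi> \<in> {\<phi> \<in> K. \<phi> ` W = W}"
      then have "(inv\<^bsub>\<A>\<^esub> \<phi>) ` W = W" using aut_image_inv_left[OF KA Wc, of \<phi>] by simp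
      then show "inv\<^bsub>\<A>\<lparr>carrier := K\<rparr>\<^esub> \<phi> \<in> {\<phi> \<in> K. \<phi> ` W = W}"
        using p inv subgroup.m_inv_closed[OF K] by simp
      fix \<psi> assume q: "\<psi> \<in> {\<phi> \<in> K. \<phi> ` W = W}"
      show "\<phi> \<otimes>\<^bsub>\<A>\<lparr>carrier := K\<rparr>\<^esub> \<psi> \<in> {\<phi> \<in> K. \<phi> ` W = W}"
        using p q subgroup.m_closed[OF K] aut_image_mult[OF Wc] by simp
    qed auto
    then show "subgroup (K_one G T K) (\<A>\<lparr>carrier := K\<rparr>)" unfolding e .
    fix \<psi> \<phi> assume q: "\<psi> \<in> carrier (\<A>\<lparr>carrier := K\<rparr>)" and p: "\<phi> \<in> K_one G T K"
    have qK: "\<psi> \<in> K" using q by simp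
    have pK: "\<phi> \<in> K" "scale G T \<phi> = 1" "scale G T (inv\<^bsub>\<A>\<^esub> \<phi>) = 1" using p by (auto simp: K_one_def)
    let ?c = "\<psi> \<otimes>\<^bsub>\<A>\<^esub> \<phi> \<otimes>\<^bsub>\<A>\<^esub> inv\<^bsub>\<A>\<^esub> \<psi>"
    have "inv\<^bsub>\<A>\<^esub> ?c = \<psi> \<otimes>\<^bsub>\<A>\<^esub> inv\<^bsub>\<A>\<^esub> \<phi> \<otimes>\<^bsub>\<A>\<^esub> inv\<^bsub>\<A>\<^esub> \<psi>"
      using KA[OF qK] KA[OF pK(1)] by (simp add: A.m_assoc A.inv_mult_group)
    moreover have "?c \<in> K" by (intro subgroup.m_closed[OF K] subgroup.m_inv_closed[OF K] qK pK)
    ultimately have "?c \<in> K_one G T K"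
      using scale_conj[OF KA[OF pK(1)] KA[OF qK]] scale_conj[OF A.inv_closed[OF KA[OF pK(1)]] KA[OF qK]] pK
      by (simp add: K_one_def)
    then show "\<psi> \<otimes>\<^bsub>\<A>\<lparr>carrier := K\<rparr>\<^esub> \<phi> \<otimes>\<^bsub>\<A>\<lparr>carrier := K\<rparr>\<^esub> inv\<^bsub>\<A>\<lparr>carrier := K\<rparr>\<^esub> \<psi> \<in> K_one G T K"
      using inv[OF qK] by simp
  qed
qed

end

context commuting_autos_fg
begin

text \<open>The quotient by the stabiliser of a common minimiser is abelian because R lies in the
  stabiliser, finitely generated by the classes of the \<open>t i\<close>, and torsion-free because
  the scale of a power is the power of the scale.\<close>

theorem flat_finite_rank_K:
  assumes gen: "\<And>\<phi>. \<phi> \<in> K \<Longrightarrow> \<exists>v. \<forall>W\<in>inv_subgroups. \<phi> ` W = tau n v ` W"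
  shows "flat_finite_rank G T K"
proof -
  obtain W where W: "W \<in> inv_subgroups" and m: "\<forall>\<phi>\<in>K. idx G (\<phi> ` W) W = scale G T \<phi>"
    using ex_common_minimiser[OF gen] by (rule bexE)
  note WB = inv_subgroups_B[OF W]
  note Wc = inv_subgroups_c[OF W]
  have "sub_index G (\<phi> ` W) (\<phi> ` W \<inter> W) = scale G T \<phi>" if "\<phi> \<in> K" for \<phi>
    using sub_index_Int[OF B_dest(1)[OF aut_B[OF KA[OF that] WB]] B_dest(1)[OF WB]] m[THEN bspec, OF that] by simp
  then have flatK: "flat G T K" unfolding flat_def using K WB by blast
  let ?P = "\<A>\<lparr>carrier := K\<rparr>" and ?N = "K_one G T K"
  note e = K_one_eq_stabiliser[OF K WB m]
  interpret N: normal ?N ?P by (rule K_one_normal[OF K WB m])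
  interpret h: group_hom ?P "?P Mod ?N" "\<lambda>a. ?N #>\<^bsub>?P\<^esub> a" by (rule N.FactGroup_group_hom)
  have inv: "inv\<^bsub>?P\<^esub> \<phi> = inv\<^bsub>\<A>\<^esub> \<phi>" if "\<phi> \<in> K" for \<phi> by (rule A.m_inv_consistent[OF K that])
  have RN: "R \<subseteq> ?N" unfolding e using RK inv_subgroups_R[OF W] by blast
  interpret Q: comm_group "?P Mod ?N"
    by (rule N.FactGroup_comm_group) (use comm RN inv in auto)
  have tf: "\<forall>x\<in>carrier (?P Mod ?N). \<forall>k::nat. 0 < k \<longrightarrow> x [^]\<^bsub>?P Mod ?N\<^esub> k = \<one>\<^bsub>?P Mod ?N\<^esub> \<longrightarrow> x = \<one>\<^bsub>?P Mod ?N\<^esub>"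
  proof (intro ballI allI impI)
    fix x and k :: nat assume x: "x \<in> carrier (?P Mod ?N)" and k: "0 < k" "x [^]\<^bsub>?P Mod ?N\<^esub> k = \<one>\<^bsub>?P Mod ?N\<^esub>"
    obtain \<phi> where p: "\<phi> \<in> K" "x = ?N #>\<^bsub>?P\<^esub> \<phi>" using x unfolding carrier_FactGroup by auto
    have pk: "\<phi> [^]\<^bsub>?P\<^esub> k = \<phi> [^]\<^bsub>\<A>\<^esub> k" by (rule A.nat_pow_consistent[symmetric])
    have pP: "\<phi> \<in> carrier ?P" using p by simp
    have kP: "\<phi> [^]\<^bsub>?P\<^esub> k \<in> carrier ?P" by (rule N.nat_pow_closed[OF pP])
    have "?N #>\<^bsub>?P\<^esub> (\<phi> [^]\<^bsub>?P\<^esub> k) = \<one>\<^bsub>?P Mod ?N\<^esub>"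
      unfolding h.hom_nat_pow[OF pP] p(2)[symmetric] by (rule k(2))
    then have "\<phi> [^]\<^bsub>?P\<^esub> k \<in> ?N" by (rule iffD1[OF N.rcos_eq_one_iff[OF kP]])
    then have s: "scale G T (\<phi> [^]\<^bsub>\<A>\<^esub> k) = 1" "scale G T (inv\<^bsub>\<A>\<^esub> (\<phi> [^]\<^bsub>\<A>\<^esub> k)) = 1"
      unfolding pk K_one_def by auto
    note i = subgroup.m_inv_closed[OF K p(1)]
    have "scale G T \<phi> ^ k = 1" using scale_pow[OF p(1), of k] s(1) by simp
    moreover have "scale G T (inv\<^bsub>\<A>\<^esub> \<phi>) ^ k = 1"
      using scale_pow[OF i, of k] s(2) A.nat_pow_inv[OF KA[OF p(1)]] by simp
    ultimately have "\<phi> \<in> ?N" using p(1) k(1) by (simp add: K_one_def)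
    then show "x = \<one>\<^bsub>?P Mod ?N\<^esub>" unfolding p(2) by (rule iffD2[OF N.rcos_eq_one_iff[OF pP]])
  qed
  have tP: "t i \<in> carrier ?P" for i using tK by simp
  have power_prod: "?N #>\<^bsub>?P\<^esub> tau k v = Q.power_prod {..<k} (\<lambda>i. ?N #>\<^bsub>?P\<^esub> t i) v" for k v
  proof (induction k)
    case 0
    then show ?case using h.hom_one by (simp add: Q.power_prod_def)
  next
    case (Suc k)
    have c: "(\<lambda>i. ?N #>\<^bsub>?P\<^esub> t i) \<in> insert k {..<k} \<rightarrow> carrier (?P Mod ?N)" using h.hom_closed[OF tP] by auto
    have c': "(\<lambda>i. ?N #>\<^bsub>?P\<^esub> t i) \<in> {..<k} \<rightarrow> carrier (?P Mod ?N)" using h.hom_closed[OF tP] by auto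
    have nk: "k \<notin> {..<k}" by simp
    have p: "t k [^]\<^bsub>\<A>\<^esub> v k = t k [^]\<^bsub>?P\<^esub> v k" by (rule A.int_pow_consistent[OF K tK])
    have tauP: "tau k v \<in> carrier ?P" using tauK by simp
    have "?N #>\<^bsub>?P\<^esub> tau (Suc k) v = (?N #>\<^bsub>?P\<^esub> tau k v) \<otimes>\<^bsub>?P Mod ?N\<^esub> (?N #>\<^bsub>?P\<^esub> (t k [^]\<^bsub>?P\<^esub> v k))"
      using h.hom_mult[OF tauP N.int_pow_closed[OF tP, of k "v k"]] p by simp
    also have "\<dots> = Q.power_prod {..<k} (\<lambda>i. ?N #>\<^bsub>?P\<^esub> t i) v \<otimes>\<^bsub>?P Mod ?N\<^esub> ((?N #>\<^bsub>?P\<^esub> t k) [^]\<^bsub>?P Mod ?N\<^esub> v k)"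
      unfolding Suc h.hom_int_pow[OF tP] ..
    also have "\<dots> = Q.power_prod (insert k {..<k}) (\<lambda>i. ?N #>\<^bsub>?P\<^esub> t i) v"
      unfolding Q.power_prod_insert[OF finite_lessThan nk c]
      by (rule Q.m_comm[OF Q.power_prod_closed[OF c'] group.int_pow_closed[OF N.factorgroup_is_group h.hom_closed[OF tP]]])
    finally show ?case by (simp add: lessThan_Suc)
  qed
  have "Q.generating {..<n} (\<lambda>i. ?N #>\<^bsub>?P\<^esub> t i)"
    unfolding Q.generating_def
  proof (intro conjI ballI)
    show "(\<lambda>i. ?N #>\<^bsub>?P\<^esub> t i) \<in> {..<n} \<rightarrow> carrier (?P Mod ?N)" using h.hom_closed[OF tP] by auto
    fix x assume "x \<in> carrier (?P Mod ?N)"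
    then obtain \<phi> where p: "\<phi> \<in> K" "x = ?N #>\<^bsub>?P\<^esub> \<phi>" unfolding carrier_FactGroup by auto
    obtain v where v: "\<forall>W\<in>inv_subgroups. \<phi> ` W = tau n v ` W" using gen[OF p(1)] by (rule exE)
    let ?i = "inv\<^bsub>\<A>\<^esub> (tau n v)"
    have i: "?i \<in> K" by (rule subgroup.m_inv_closed[OF K tauK])
    have iW: "?i ` W \<in> inv_subgroups" by (rule inv_subgroups_act[OF W i])
    have "(\<phi> \<otimes>\<^bsub>\<A>\<^esub> ?i) ` W = \<phi> ` ?i ` W" by (rule aut_image_mult[OF Wc])
    also have "\<dots> = tau n v ` ?i ` W" by (rule v[THEN bspec, OF iW])
    also have "\<dots> = W" by (rule aut_image_inv_right[OF KA[OF tauK] Wc])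
    finally have "\<phi> \<otimes>\<^bsub>\<A>\<^esub> ?i \<in> ?N" unfolding e using subgroup.m_closed[OF K p(1) i] by simp
    then have "x = ?N #>\<^bsub>?P\<^esub> tau n v" unfolding p(2)
      by (intro N.rcos_eqI) (use p(1) tauK inv[OF tauK] in auto)
    then have "x = Q.power_prod {..<n} (\<lambda>i. ?N #>\<^bsub>?P\<^esub> t i) v" unfolding power_prod .
    then show "\<exists>v. x = Q.power_prod {..<n} (\<lambda>i. ?N #>\<^bsub>?P\<^esub> t i) v" by (rule exI[where x = v])
  qed (rule finite_lessThan)
  from Q.torsion_free_iso_free[OF tf this] show ?thesis unfolding flat_finite_rank_def using flatK by blast
qed

end

section \<open>The two implications\<close>

context topgroup
begin

lemma B_Inter:
  assumes "finite S" "S \<noteq> {}" "S \<subseteq> \<B>"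
  shows "\<Inter>S \<in> \<B>"
  using assms by (induction rule: finite_ne_induct) (auto intro: B_Int)

lemma coset_reps_dist:
  assumes H: "subgroup H \<A>" and V: "V \<in> \<B>" and J: "finite J" "J \<subseteq> H"
  shows "\<exists>D\<ge>0. \<forall>j\<in>J. cos_dist G (j ` V) V \<le> D"
proof (intro exI conjI ballI)
  show "0 \<le> (\<Sum>j\<in>J. cos_dist G (j ` V) V)" by (intro sum_nonneg cos_dist_nonneg)
  show "cos_dist G (j ` V) V \<le> (\<Sum>j\<in>J. cos_dist G (j ` V) V)" if "j \<in> J" for j
    by (rule member_le_sum[OF that cos_dist_nonneg J(1)])
qed

lemma orbit_B: "subgroup H \<A> \<Longrightarrow> V \<in> \<B> \<Longrightarrow> orbit_sp H V \<subseteq> \<B>"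
  unfolding orbit_sp_def using aut_B[OF subgroup.mem_carrier[of H \<A>]] by blast

text \<open>Chains in the larger orbit are projected to the orbit of F: finitely many coset
  representatives move V by at most D, so every point is within D of that orbit. Points already in
  it are kept, so that the end points survive, and steps lengthen by at most 2 D.\<close>

lemma coarsely_connected_finite_index:
  assumes H: "subgroup H \<A>" and F: "subgroup F \<A>" "F \<subseteq> H" and V: "V \<in> \<B>"
    and fin: "finite (rcosets\<^bsub>\<A>\<lparr>carrier := H\<rparr>\<^esub> F)" and cc: "coarsely_connected (orbit_sp H V) (cos_dist G)"
  shows "coarsely_connected (orbit_sp F V) (cos_dist G)"
proof -
  obtain J where J: "finite J" "J \<subseteq> H" "\<forall>h\<in>H. \<exists>f\<in>F. \<exists>j\<in>J. h = f \<otimes>\<^bsub>\<A>\<^esub> j"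
    using iffD1[OF A.finite_rcosets_iff[OF H F] fin] by (elim exE conjE)
  obtain D where D: "0 \<le> D" "\<forall>j\<in>J. cos_dist G (j ` V) V \<le> D" using coset_reps_dist[OF H V J(1,2)] by (elim exE conjE)
  note HA = subgroup.mem_carrier[OF H]
  have FH: "orbit_sp F V \<subseteq> orbit_sp H V" unfolding orbit_sp_def using F(2) by blast
  note HB = orbit_B[OF H V]
  have "\<exists>y. y \<in> orbit_sp F V \<and> cos_dist G x y \<le> D \<and> (x \<in> orbit_sp F V \<longrightarrow> y = x)" if x: "x \<in> orbit_sp H V" for x
  proof (cases "x \<in> orbit_sp F V")
    case True
    then have "x \<in> \<B>" using x HB by blast
    then show ?thesis using True D(1) by (intro exI[of _ x]) (simp add: cos_dist_refl)
  next
    case False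
    obtain h where h: "h \<in> H" "x = h ` V" using x unfolding orbit_sp_def by blast
    obtain f j where fj: "f \<in> F" "j \<in> J" "h = f \<otimes>\<^bsub>\<A>\<^esub> j" using J(3) h(1) by blast
    have jH: "j \<in> carrier \<A>" and fH: "f \<in> carrier \<A>" using fj J(2) F(2) HA by auto
    have "x = f ` j ` V" unfolding h(2) fj(3) by (rule aut_image_mult[OF B_dest(4)[OF V]])
    then have "cos_dist G x (f ` V) = cos_dist G (j ` V) V"
      using aut_cos_dist[OF fH aut_B[OF jH V] V] by simp
    moreover have "f ` V \<in> orbit_sp F V" unfolding orbit_sp_def using fj(1) by blast
    ultimately show ?thesis using D(2)[THEN bspec, OF fj(2)] False by auto
  qed
  then have "\<forall>x\<in>orbit_sp H V. \<exists>y. y \<in> orbit_sp F V \<and> cos_dist G x y \<le> D \<and> (x \<in> orbit_sp F V \<longrightarrow> y = x)" by blast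
  from bchoice[OF this] obtain p where
    p: "\<forall>x\<in>orbit_sp H V. p x \<in> orbit_sp F V \<and> cos_dist G x (p x) \<le> D \<and> (x \<in> orbit_sp F V \<longrightarrow> p x = x)" by (rule exE)
  obtain e where e: "0 < e" "\<forall>x\<in>orbit_sp H V. \<forall>y\<in>orbit_sp H V. \<exists>xs. xs \<noteq> [] \<and> hd xs = x \<and> last xs = y \<and>
      set xs \<subseteq> orbit_sp H V \<and> (\<forall>i. Suc i < length xs \<longrightarrow> cos_dist G (xs ! i) (xs ! Suc i) \<le> e)"
    using cc unfolding coarsely_connected_def by (elim exE conjE)
  show ?thesis
    unfolding coarsely_connected_def
  proof (intro exI[of _ "D + e + D"] conjI ballI)
    show "0 < D + e + D" using D(1) e(1) by simp
    fix x y assume xy: "x \<in> orbit_sp F V" "y \<in> orbit_sp F V"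
    then have xyH: "x \<in> orbit_sp H V" "y \<in> orbit_sp H V" using FH by auto
    from e(2)[THEN bspec, OF xyH(1), THEN bspec, OF xyH(2)]
    obtain xs where xs: "xs \<noteq> []" "hd xs = x" "last xs = y" "set xs \<subseteq> orbit_sp H V"
      "\<forall>i. Suc i < length xs \<longrightarrow> cos_dist G (xs ! i) (xs ! Suc i) \<le> e" by (elim exE conjE)
    have mem: "xs ! i \<in> orbit_sp H V" if "i < length xs" for i by (rule subsetD[OF xs(4) nth_mem[OF that]])
    have "cos_dist G (p (xs ! i)) (p (xs ! Suc i)) \<le> D + e + D" if i: "Suc i < length xs" for i
    proof -
      have m: "xs ! i \<in> orbit_sp H V" "xs ! Suc i \<in> orbit_sp H V" using mem i by auto
      have pm: "p (xs ! i) \<in> orbit_sp F V" "p (xs ! Suc i) \<in> orbit_sp F V" using p m by auto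
      have B: "xs ! i \<in> \<B>" "xs ! Suc i \<in> \<B>" "p (xs ! i) \<in> \<B>" "p (xs ! Suc i) \<in> \<B>"
        using m pm FH HB by auto
      have "cos_dist G (p (xs ! i)) (p (xs ! Suc i)) \<le> cos_dist G (p (xs ! i)) (xs ! i) + cos_dist G (xs ! i) (p (xs ! Suc i))"
        by (rule cos_dist_triangle[OF B(3,1,4)])
      also have "cos_dist G (xs ! i) (p (xs ! Suc i)) \<le> cos_dist G (xs ! i) (xs ! Suc i) + cos_dist G (xs ! Suc i) (p (xs ! Suc i))"
        by (rule cos_dist_triangle[OF B(1,2,4)])
      also have "cos_dist G (p (xs ! i)) (xs ! i) \<le> D" using p m(1) by (subst cos_dist_commute) blast
      also have "cos_dist G (xs ! Suc i) (p (xs ! Suc i)) \<le> D" using p m(2) by blast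
      also have "cos_dist G (xs ! i) (xs ! Suc i) \<le> e" by (rule xs(5)[THEN spec, THEN mp, OF i])
      finally show ?thesis by simp
    qed
    then show "\<exists>xs. xs \<noteq> [] \<and> hd xs = x \<and> last xs = y \<and> set xs \<subseteq> orbit_sp F V \<and>
      (\<forall>i. Suc i < length xs \<longrightarrow> cos_dist G (xs ! i) (xs ! Suc i) \<le> D + e + D)"
      using xs(1-4) p xy xyH by (intro exI[of _ "map p xs"]) (auto simp: hd_map last_map)
  qed
qed

lemma FCd_bounded_displacement_action:
  assumes H: "subgroup H \<A>" and V: "V \<in> \<B>" and pr: "proper_metric (orbit_sp H V) (cos_dist G)"
    and F: "F = FCd G T H" and r: "\<forall>x\<in>orbit_sp F V. \<forall>y\<in>orbit_sp F V. \<exists>xs. xs \<noteq> [] \<and> hd xs = x \<and> last xs = y \<and>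
      set xs \<subseteq> orbit_sp F V \<and> (\<forall>i. Suc i < length xs \<longrightarrow> cos_dist G (xs ! i) (xs ! Suc i) \<le> r)"
  shows "bounded_displacement_action (\<A>\<lparr>carrier := F\<rparr>) (`) (orbit_sp F V) (cos_dist G) V r"
proof -
  have Fs: "subgroup F \<A>" unfolding F by (rule FCd_subgroup[OF H V])
  have FH: "F \<subseteq> H" unfolding F by (rule FCd_subset)
  interpret P: group "\<A>\<lparr>carrier := F\<rparr>" by (rule subgroup.subgroup_is_group[OF Fs A.is_group])
  note FA = subgroup.mem_carrier[OF Fs]
  have B: "x \<in> \<B>" if "x \<in> orbit_sp F V" for x using orbit_B[OF Fs V] that by blast
  have one: "V \<in> orbit_sp F V" unfolding orbit_sp_def
    using aut_image_one[OF B_dest(4)[OF V]] subgroup.one_closed[OF Fs] by force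
  have sub: "orbit_sp F V \<subseteq> orbit_sp H V" unfolding orbit_sp_def using FH by blast
  show ?thesis
  proof
    fix g x assume g: "g \<in> carrier (\<A>\<lparr>carrier := F\<rparr>)" and x: "x \<in> orbit_sp F V"
    obtain f where f: "f \<in> F" "x = f ` V" using x unfolding orbit_sp_def by blast
    have "g ` x = (g \<otimes>\<^bsub>\<A>\<^esub> f) ` V" unfolding f(2) by (rule aut_image_mult[OF B_dest(4)[OF V], symmetric])
    then show "g ` x \<in> orbit_sp F V" unfolding orbit_sp_def using subgroup.m_closed[OF Fs _ f(1), of g] g by auto
  next
    fix g h x assume x: "x \<in> orbit_sp F V"
    show "(g \<otimes>\<^bsub>\<A>\<lparr>carrier := F\<rparr>\<^esub> h) ` x = g ` h ` x" using aut_image_mult[OF B_dest(4)[OF B[OF x]]] by simp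
  next
    fix x assume x: "x \<in> orbit_sp F V"
    show "\<one>\<^bsub>\<A>\<lparr>carrier := F\<rparr>\<^esub> ` x = x" using aut_image_one[OF B_dest(4)[OF B[OF x]]] by simp
    show "\<exists>g\<in>carrier (\<A>\<lparr>carrier := F\<rparr>). x = g ` V" using x unfolding orbit_sp_def by auto
    show "cos_dist G x x = 0" by (rule cos_dist_refl[OF B[OF x]])
    show "\<exists>xs. xs \<noteq> [] \<and> hd xs = V \<and> last xs = x \<and> set xs \<subseteq> orbit_sp F V \<and>
      (\<forall>i. Suc i < length xs \<longrightarrow> cos_dist G (xs ! i) (xs ! Suc i) \<le> r)" by (rule r[THEN bspec, OF one, THEN bspec, OF x])
    fix y assume y: "y \<in> orbit_sp F V"
    show "cos_dist G x y = cos_dist G y x" by (rule cos_dist_commute)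
    show "cos_dist G (g ` x) (g ` y) = cos_dist G x y" if "g \<in> carrier (\<A>\<lparr>carrier := F\<rparr>)" for g
      using aut_cos_dist[OF _ B[OF x] B[OF y], of g] that FA by simp
    fix z assume z: "z \<in> orbit_sp F V"
    show "cos_dist G x z \<le> cos_dist G x y + cos_dist G y z" by (rule cos_dist_triangle[OF B[OF x] B[OF y] B[OF z]])
  next
    show "V \<in> orbit_sp F V" by (rule one)
    fix c
    show "finite {x \<in> orbit_sp F V. cos_dist G V x \<le> c}"
      by (rule finite_subset[OF _ proper_imp_finite_ball[OF orbit_B[OF H V] pr, of V c]]) (use sub one in auto)
  next
    fix g assume "g \<in> carrier (\<A>\<lparr>carrier := F\<rparr>)"
    then have g: "g \<in> FCd G T H" "g \<in> H" using F FH by auto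
    then obtain c where c: "\<forall>\<psi>\<in>H. cos_dist G (g ` \<psi> ` V) (\<psi> ` V) \<le> c" using FCd_iff[OF H V] by blast
    show "\<exists>c. \<forall>x\<in>orbit_sp F V. cos_dist G (g ` x) x \<le> c"
    proof (intro exI[of _ c] ballI)
      fix x assume "x \<in> orbit_sp F V"
      then obtain f where "f \<in> F" "x = f ` V" unfolding orbit_sp_def by blast
      then show "cos_dist G (g ` x) x \<le> c" using c FH by blast
    qed
  qed
qed

theorem finite_index_imp_flat:
  assumes H: "subgroup H \<A>" and V: "V \<in> \<B>" and pr: "proper_metric (orbit_sp H V) (cos_dist G)"
    and cc: "coarsely_connected (orbit_sp H V) (cos_dist G)"
    and fin: "finite (rcosets\<^bsub>\<A>\<lparr>carrier := H\<rparr>\<^esub> (FCd G T H))"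
  shows "flat_finite_rank G T (FCd G T H)"
proof -
  define F where "F = FCd G T H"
  have Fs: "subgroup F \<A>" unfolding F_def by (rule FCd_subgroup[OF H V])
  have FH: "F \<subseteq> H" unfolding F_def by (rule FCd_subset)
  note FA = subgroup.mem_carrier[OF Fs]
  note Vc = B_dest(4)[OF V]
  have "coarsely_connected (orbit_sp F V) (cos_dist G)"
    by (rule coarsely_connected_finite_index[OF H Fs FH V fin[folded F_def] cc])
  then obtain r where r: "\<forall>x\<in>orbit_sp F V. \<forall>y\<in>orbit_sp F V. \<exists>xs. xs \<noteq> [] \<and> hd xs = x \<and> last xs = y \<and>
      set xs \<subseteq> orbit_sp F V \<and> (\<forall>i. Suc i < length xs \<longrightarrow> cos_dist G (xs ! i) (xs ! Suc i) \<le> r)"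
    unfolding coarsely_connected_def by blast
  let ?P = "\<A>\<lparr>carrier := F\<rparr>"
  interpret bd: bounded_displacement_action ?P "(`)" "orbit_sp F V" "cos_dist G" V r
    by (rule FCd_bounded_displacement_action[OF H V pr F_def r])
  obtain S R where S: "finite S" "S \<subseteq> carrier ?P" and RP: "subgroup R ?P" and Rfin: "finite ((\<lambda>g. g ` V) ` R)"
    and comm: "\<forall>g\<in>carrier ?P. \<forall>h\<in>carrier ?P. g \<otimes>\<^bsub>?P\<^esub> h \<otimes>\<^bsub>?P\<^esub> inv\<^bsub>?P\<^esub> g \<otimes>\<^bsub>?P\<^esub> inv\<^bsub>?P\<^esub> h \<in> R"
    and cover: "\<forall>D. D \<subseteq> carrier ?P \<longrightarrow> \<one>\<^bsub>?P\<^esub> \<in> D \<longrightarrow> (\<forall>z\<in>D. \<forall>t\<in>S. z \<otimes>\<^bsub>?P\<^esub> t \<in> D) \<longrightarrow>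
      (\<forall>g\<in>carrier ?P. \<exists>z\<in>D. inv\<^bsub>?P\<^esub> z \<otimes>\<^bsub>?P\<^esub> g \<in> R)"
    using bd.ex_finite_orbit_normal_subgroup by (elim exE conjE)
  have inv: "inv\<^bsub>?P\<^esub> \<phi> = inv\<^bsub>\<A>\<^esub> \<phi>" if "\<phi> \<in> F" for \<phi> by (rule A.m_inv_consistent[OF Fs that])
  have RF: "R \<subseteq> F" using subgroup.subset[OF RP] by simp
  have R: "subgroup R \<A>" by (rule A.incl_subgroup[OF Fs RP])
  note RA = subgroup.mem_carrier[OF R]
  obtain ts where ts: "set ts = S" using finite_list[OF S(1)] by blast
  define n where "n = length ts"
  \<comment> \<open>The default value puts \<open>t i\<close> into F for every i;
    \<open>tau n\<close> uses only i < n.\<close>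
  define t where "t i = (if i < n then ts ! i else \<one>\<^bsub>\<A>\<^esub>)" for i
  have tF: "t i \<in> F" for i unfolding t_def n_def using ts S(2) nth_mem[of i ts] subgroup.one_closed[OF Fs] by auto
  interpret ca: commuting_autos G T F R
  proof (intro commuting_autos.intro commuting_autos_axioms.intro topgroup_axioms)
    show "subgroup F \<A>" "subgroup R \<A>" "R \<subseteq> F" by (fact Fs R RF)+
    show "\<phi> \<otimes>\<^bsub>\<A>\<^esub> \<psi> \<otimes>\<^bsub>\<A>\<^esub> inv\<^bsub>\<A>\<^esub> \<phi> \<otimes>\<^bsub>\<A>\<^esub> inv\<^bsub>\<A>\<^esub> \<psi> \<in> R" if "\<phi> \<in> F" "\<psi> \<in> F" for \<phi> \<psi>
      using comm that inv by simp
  qed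
  \<comment> \<open>The R-orbit of V is finite, so the intersection is open; R permutes the
    intersected sets and fixes V0.\<close>
  define V0 where "V0 = \<Inter>((\<lambda>g. g ` V) ` R)"
  have one: "\<one>\<^bsub>\<A>\<^esub> \<in> R" by (rule subgroup.one_closed[OF R])
  have "V0 \<in> \<B>" unfolding V0_def by (rule B_Inter[OF Rfin]) (use one aut_B[OF RA V] in auto)
  moreover have "\<sigma> ` V0 = V0" if s: "\<sigma> \<in> R" for \<sigma>
  proof -
    have "\<sigma> ` V0 = (\<Inter>g\<in>R. \<sigma> ` g ` V)" unfolding V0_def
      by (rule image_INT[OF aut_inj[OF RA[OF s]] _ one]) (use aut_image_subset[OF RA Vc] in blast)
    also have "(\<lambda>g. \<sigma> ` g ` V) ` R = (\<lambda>g. g ` V) ` R"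
    proof (intro subset_antisym image_subsetI)
      fix g assume g: "g \<in> R"
      have "\<sigma> ` g ` V = (\<sigma> \<otimes>\<^bsub>\<A>\<^esub> g) ` V" by (rule aut_image_mult[OF Vc, symmetric])
      then show "\<sigma> ` g ` V \<in> (\<lambda>g. g ` V) ` R" using subgroup.m_closed[OF R s g] by blast
      let ?h = "inv\<^bsub>\<A>\<^esub> \<sigma> \<otimes>\<^bsub>\<A>\<^esub> g"
      have h: "?h \<in> R" by (rule subgroup.m_closed[OF R subgroup.m_inv_closed[OF R s] g])
      have "g ` V = \<sigma> ` ?h ` V"
        unfolding aut_image_mult[OF Vc] by (rule aut_image_inv_right[OF RA[OF s] aut_image_subset[OF RA[OF g] Vc], symmetric])
      then show "g ` V \<in> (\<lambda>g. \<sigma> ` g ` V) ` R" using h by blast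
    qed
    finally show ?thesis unfolding V0_def .
  qed
  ultimately have V0: "V0 \<in> ca.inv_subgroups" unfolding ca.inv_subgroups_def by blast
  interpret ca: commuting_autos_fg G T F R n t
    by unfold_locales (use V0 tF in auto)
  \<comment> \<open>Elements that act on the invariant subgroups like some exponent vector. Being
    closed under right multiplication by S, they meet every coset of R, and R fixes the invariant
    subgroups.\<close>
  define D where "D = {g \<in> F. \<exists>v. \<forall>W\<in>ca.inv_subgroups. g ` W = ca.tau n v ` W}"
  have "\<one>\<^bsub>\<A>\<^esub> \<in> D" unfolding D_def using subgroup.one_closed[OF Fs] ca.tau_zero by (auto intro!: exI[of _ 0])
  moreover have "z \<otimes>\<^bsub>\<A>\<^esub> s \<in> D" if z: "z \<in> D" and s: "s \<in> S" for z s
  proof -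
    obtain i where i: "i < n" "s = t i" using s unfolding ts[symmetric] in_set_conv_nth n_def t_def by auto
    obtain v where v: "z \<in> F" "\<forall>W\<in>ca.inv_subgroups. z ` W = ca.tau n v ` W" using z unfolding D_def by blast
    have "(z \<otimes>\<^bsub>\<A>\<^esub> s) ` W = ca.tau n (v + unit_vec i) ` W" if W: "W \<in> ca.inv_subgroups" for W
    proof -
      have "(z \<otimes>\<^bsub>\<A>\<^esub> s) ` W = z ` t i ` W" unfolding i(2) by (rule aut_image_mult[OF ca.inv_subgroups_c[OF W]])
      also have "\<dots> = ca.tau n v ` t i ` W" by (rule v(2)[THEN bspec, OF ca.inv_subgroups_act[OF W tF]])
      also have "t i ` W = ca.tau n (unit_vec i) ` W" using ca.tau_unit_vec[of n i] i(1) by simp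
      finally show ?thesis unfolding ca.tau_add[OF W] .
    qed
    then show ?thesis unfolding D_def using subgroup.m_closed[OF Fs v(1) tF[of i]] i(2) by blast
  qed
  moreover have "D \<subseteq> F" unfolding D_def by blast
  ultimately have cov: "\<exists>z\<in>D. inv\<^bsub>?P\<^esub> z \<otimes>\<^bsub>?P\<^esub> g \<in> R" if "g \<in> F" for g
    using cover[THEN spec, of D] that by simp
  have "\<exists>v. \<forall>W\<in>ca.inv_subgroups. \<phi> ` W = ca.tau n v ` W" if p: "\<phi> \<in> F" for \<phi>
  proof -
    obtain z where z: "z \<in> D" "inv\<^bsub>?P\<^esub> z \<otimes>\<^bsub>?P\<^esub> \<phi> \<in> R" using cov[OF p] by blast
    obtain v where v: "z \<in> F" "\<forall>W\<in>ca.inv_subgroups. z ` W = ca.tau n v ` W" using z(1) unfolding D_def by blast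
    have zR: "inv\<^bsub>\<A>\<^esub> z \<otimes>\<^bsub>\<A>\<^esub> \<phi> \<in> R" using z(2) inv[OF v(1)] by simp
    have "\<phi> ` W = ca.tau n v ` W" if W: "W \<in> ca.inv_subgroups" for W
    proof -
      have "\<phi> ` W = z ` (inv\<^bsub>\<A>\<^esub> z \<otimes>\<^bsub>\<A>\<^esub> \<phi>) ` W"
        unfolding aut_image_mult[OF ca.inv_subgroups_c[OF W]]
        by (rule aut_image_inv_right[OF FA[OF v(1)] aut_image_subset[OF FA[OF p] ca.inv_subgroups_c[OF W]], symmetric])
      also have "\<dots> = z ` W" unfolding ca.inv_subgroups_R[OF W zR] ..
      also have "\<dots> = ca.tau n v ` W" by (rule v(2)[THEN bspec, OF W])
      finally show ?thesis .
    qed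
    then show ?thesis by blast
  qed
  then show ?thesis unfolding F_def[symmetric] by (rule ca.flat_finite_rank_K)
qed

text \<open>As the quotient of K is abelian, conjugation by f in K changes \<phi> only by an element
  fixing the minimiser W, so all these conjugates of \<phi> move W alike. Writing an element of H as
  a product of f and one of finitely many j adds at most twice the displacement of W by j. Hence
  every element of K has bounded conjugates.\<close>

theorem virtually_flat_imp_finite_index:
  assumes H: "subgroup H \<A>" and vf: "virtually_flat_finite_rank G T H"
  shows "finite (rcosets\<^bsub>\<A>\<lparr>carrier := H\<rparr>\<^esub> (FCd G T H))"
proof -
  obtain K where K: "K \<subseteq> H" "subgroup K \<A>" "finite (rcosets\<^bsub>\<A>\<lparr>carrier := H\<rparr>\<^esub> K)" "flat_finite_rank G T K"
    using vf unfolding virtually_flat_finite_rank_def by (elim exE conjE)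
  obtain W S where W: "W \<in> \<B>" and m0: "\<forall>\<phi>\<in>K. sub_index G (\<phi> ` W) (\<phi> ` W \<inter> W) = scale G T \<phi>"
    and isom: "(\<A>\<lparr>carrier := K\<rparr> Mod K_one G T K) \<cong> free_Abelian_group (S :: nat set)"
    using K(4) unfolding flat_finite_rank_def flat_def by (elim exE conjE bexE)
  note KA = subgroup.mem_carrier[OF K(2)]
  note HA = subgroup.mem_carrier[OF H]
  note Wc = B_dest(4)[OF W]
  have m: "\<forall>\<phi>\<in>K. idx G (\<phi> ` W) W = scale G T \<phi>"
  proof
    fix \<phi> assume p: "\<phi> \<in> K"
    show "idx G (\<phi> ` W) W = scale G T \<phi>"
      using m0[THEN bspec, OF p] sub_index_Int[OF B_dest(1)[OF aut_B[OF KA[OF p] W]] B_dest(1)[OF W]] by simp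
  qed
  let ?P = "\<A>\<lparr>carrier := K\<rparr>" and ?N = "K_one G T K"
  note e = K_one_eq_stabiliser[OF K(2) W m]
  interpret N: normal ?N ?P by (rule K_one_normal[OF K(2) W m])
  have Q: "comm_group (?P Mod ?N)"
  proof -
    have "free_Abelian_group S \<cong> (?P Mod ?N)" using group.iso_sym[OF N.factorgroup_is_group isom] .
    then obtain h where h: "h \<in> iso (free_Abelian_group S) (?P Mod ?N)" unfolding is_iso_def by blast
    show ?thesis
      by (rule comm_group.iso_imp_comm_group[OF abelian_free_Abelian_group])
         (use is_isoI[OF h] N.factorgroup_is_group group.is_monoid in auto)
  qed
  have inv: "inv\<^bsub>?P\<^esub> \<phi> = inv\<^bsub>\<A>\<^esub> \<phi>" if "\<phi> \<in> K" for \<phi> by (rule A.m_inv_consistent[OF K(2) that])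
  have fix_conj: "(inv\<^bsub>\<A>\<^esub> f) ` \<phi> ` f ` W = \<phi> ` W" if p: "\<phi> \<in> K" and f: "f \<in> K" for \<phi> f
  proof -
    let ?c = "inv\<^bsub>\<A>\<^esub> \<phi> \<otimes>\<^bsub>\<A>\<^esub> inv\<^bsub>\<A>\<^esub> f \<otimes>\<^bsub>\<A>\<^esub> \<phi> \<otimes>\<^bsub>\<A>\<^esub> f"
    have i: "inv\<^bsub>\<A>\<^esub> \<phi> \<in> K" "inv\<^bsub>\<A>\<^esub> f \<in> K" using subgroup.m_inv_closed[OF K(2)] p f by auto
    have "?c \<in> ?N"
      using N.FactGroup_commute_imp[OF Q, of "inv\<^bsub>\<A>\<^esub> \<phi>" "inv\<^bsub>\<A>\<^esub> f"] i inv KA[OF p] KA[OF f] by simp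
    then have c: "?c ` W = W" unfolding e by simp
    have cA: "?c \<in> carrier \<A>" using KA[OF p] KA[OF f] by simp
    have "(inv\<^bsub>\<A>\<^esub> f) ` \<phi> ` f ` W = (inv\<^bsub>\<A>\<^esub> f \<otimes>\<^bsub>\<A>\<^esub> (\<phi> \<otimes>\<^bsub>\<A>\<^esub> f)) ` W"
      by (simp add: aut_image_mult Wc)
    also have "inv\<^bsub>\<A>\<^esub> f \<otimes>\<^bsub>\<A>\<^esub> (\<phi> \<otimes>\<^bsub>\<A>\<^esub> f) = \<phi> \<otimes>\<^bsub>\<A>\<^esub> ?c"
      using KA[OF p] KA[OF f] by (simp add: A.m_assoc[symmetric])
    also have "(\<phi> \<otimes>\<^bsub>\<A>\<^esub> ?c) ` W = \<phi> ` ?c ` W" by (rule aut_image_mult[OF Wc])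
    finally show ?thesis unfolding c .
  qed
  obtain J where J: "finite J" "J \<subseteq> H" "\<forall>h\<in>H. \<exists>f\<in>K. \<exists>j\<in>J. h = f \<otimes>\<^bsub>\<A>\<^esub> j"
    using iffD1[OF A.finite_rcosets_iff[OF H K(2,1)] K(3)] by (elim exE conjE)
  obtain D where D: "0 \<le> D" "\<forall>j\<in>J. cos_dist G (j ` W) W \<le> D" using coset_reps_dist[OF H W J(1,2)] by (elim exE conjE)
  have KF: "K \<subseteq> FCd G T H"
  proof
    fix \<phi> assume p: "\<phi> \<in> K"
    have pA: "\<phi> \<in> carrier \<A>" by (rule KA[OF p])
    have "cos_dist G (\<phi> ` \<psi> ` W) (\<psi> ` W) \<le> D + cos_dist G (\<phi> ` W) W + D" if q: "\<psi> \<in> H" for \<psi>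
    proof -
      obtain f j where fj: "f \<in> K" "j \<in> J" "\<psi> = f \<otimes>\<^bsub>\<A>\<^esub> j" using J(3) q by blast
      have fA: "f \<in> carrier \<A>" by (rule KA[OF fj(1)])
      have jA: "j \<in> carrier \<A>" using fj(2) J(2) HA by blast
      let ?c = "inv\<^bsub>\<A>\<^esub> f \<otimes>\<^bsub>\<A>\<^esub> \<phi> \<otimes>\<^bsub>\<A>\<^esub> f"
      have cA: "?c \<in> carrier \<A>" using pA fA by simp
      have ci: "?c ` U = (inv\<^bsub>\<A>\<^esub> f) ` \<phi> ` f ` U" if "U \<in> \<B>" for U
        by (simp add: aut_image_mult B_dest(4)[OF that] aut_image_subset fA)
      have jB: "j ` W \<in> \<B>" by (rule aut_B[OF jA W])
      have psi: "\<psi> ` W = f ` j ` W" unfolding fj(3) by (rule aut_image_mult[OF Wc])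
      have "cos_dist G (\<phi> ` \<psi> ` W) (\<psi> ` W) = cos_dist G ((inv\<^bsub>\<A>\<^esub> f) ` \<phi> ` f ` j ` W) ((inv\<^bsub>\<A>\<^esub> f) ` f ` j ` W)"
        unfolding psi by (intro aut_cos_dist[symmetric] A.inv_closed fA aut_B pA jA W)
      also have "\<dots> = cos_dist G (?c ` j ` W) (j ` W)"
        unfolding ci[OF jB] aut_image_inv_left[OF fA B_dest(4)[OF jB]] ..
      also have "\<dots> \<le> cos_dist G (?c ` j ` W) (?c ` W) + cos_dist G (?c ` W) (j ` W)"
        by (intro cos_dist_triangle aut_B cA jA W)
      also have "cos_dist G (?c ` j ` W) (?c ` W) = cos_dist G (j ` W) W" by (rule aut_cos_dist[OF cA jB W])
      also have "?c ` W = \<phi> ` W" unfolding ci[OF W] by (rule fix_conj[OF p fj(1)])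
      also have "cos_dist G (\<phi> ` W) (j ` W) \<le> cos_dist G (\<phi> ` W) W + cos_dist G W (j ` W)"
        by (intro cos_dist_triangle aut_B pA jA W)
      finally show ?thesis using D(2)[THEN bspec, OF fj(2)] cos_dist_commute[of G W "j ` W"] by simp
    qed
    then show "\<phi> \<in> FCd G T H" using FCd_iff[OF H W, of \<phi>] p K(1) by blast
  qed
  then have "\<forall>h\<in>H. \<exists>f\<in>FCd G T H. \<exists>j\<in>J. h = f \<otimes>\<^bsub>\<A>\<^esub> j" using J(3) by blast
  then show ?thesis using J(1,2) A.finite_rcosets_iff[OF H FCd_subgroup[OF H W] FCd_subset] by blast
qed

end

theorem theorem7:
  fixes G :: "('a, 'b) monoid_scheme" and T :: "'a topology" and H :: "('a \<Rightarrow> 'a) set"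
    and O\<^sub>0 :: "'a set"
  assumes "tdlc_group G T"
    and "subgroup H (aut_group G T)"
    and "O\<^sub>0 \<in> cpt_open_subgroups G T"
    and "proper_metric (orbit_sp H O\<^sub>0) (cos_dist G)"
    and "coarsely_connected (orbit_sp H O\<^sub>0) (cos_dist G)"
  shows "virtually_flat_finite_rank G T H \<longleftrightarrow>
         finite (rcosets\<^bsub>(aut_group G T)\<lparr>carrier := H\<rparr>\<^esub> (FCd G T H))"
proof
  have tg: "topological_group G T" using assms(1) by (simp add: tdlc_group_def)
  interpret topgroup G T
    using tg unfolding topgroup_def topgroup_axioms_def topological_group_def by blast
  show "finite (rcosets\<^bsub>(aut_group G T)\<lparr>carrier := H\<rparr>\<^esub> (FCd G T H))" if "virtually_flat_finite_rank G T H"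
    by (rule virtually_flat_imp_finite_index[OF assms(2) that])
  \<comment> \<open>The subgroup of finite index is the group of elements with bounded conjugates
    itself.\<close>
  show "virtually_flat_finite_rank G T H" if "finite (rcosets\<^bsub>(aut_group G T)\<lparr>carrier := H\<rparr>\<^esub> (FCd G T H))"
    unfolding virtually_flat_finite_rank_def
    using FCd_subset FCd_subgroup[OF assms(2,3)] that finite_index_imp_flat[OF assms(2-5) that] by blast
qed

end
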